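(* There exist universal constants $C>0$ and $\delta>0$ such that the following holds. Suppose that $V$ satisfies Hypothesis A (with constants $a,b$) and that $W=g^2\omega^{-1}v^2$ satisfies Hypothesis C (both stated in the context). There exists a constant $C_V>0$, depending on $V$, such that, if the decompositions $V=V_1+V_2$ and $W=W_1+W_2$ in Hypotheses A and C can be chosen such that $$\|W_1\|_{L^1}+C_V\|W_2\|_{L^{3,\infty}}\le\delta(\mu_{V_1}-\mu_V)$$ and $$C\|W_2\|_{L^{3,\infty}}\le\tfrac12(1-a),$$ then the Klein--Gordon--Schrödinger energy functional $\mathcal{E}$ has a minimizer over $\mathcal{U}\times\mathcal{Z}_\omega$.
   Context: Weak Lebesgue space: $L^{3,\infty}=L^{3,\infty}(\mathbb{R}^3)$ is the set of measurable $f$ with $\|f\|_{L^{3,\infty}}=\sup_{t>0}t\,\lambda(\{|f|>t\})^{1/3}<\infty$, $\lambda$ being Lebesgue measure. Particle. $V:\mathbb{R}^3\to\mathbb{R}$ is a measurable potential, $V_+=\max(V,0)$, $V_-=\max(-V,0)$. $H_V=-\Delta+V$ on $L^2(\mathbb{R}^3)$ is defined through its quadratic form, and $\mu_V=\inf\sigma(H_V)$ (similarly $H_U,\mu_U$ for other potentials $U$). Hypothesis A on $V$: there are $0\le a<1$ and $b\in\mathbb{R}$ with $V_-\le -a\Delta+b$ as quadratic forms on $H^1(\mathbb{R}^3)$, and $V=V_1+V_2$ with (i) $V_1\in L^1_{\mathrm{loc}}(\mathbb{R}^3;\mathbb{R}^+)$; (ii) $V_2\in L^{3/2}_{\mathrm{loc}}(\mathbb{R}^3;\mathbb{R})$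 and $\lim_{|x|\to\infty}V_2(x)=0$; (iii) $\mu_V<\mu_{V_1}$. Under Hypothesis A, $H_V$ is a semibounded self-adjoint operator with form domain $\mathcal{Q}_V=\{u\in H^1(\mathbb{R}^3): \int V_+|u|^2<\infty\}$. Set $\mathcal{U}=\{u\in\mathcal{Q}_V:\|u\|_{L^2}=1\}$. Field. $\omega:\mathbb{R}^3\to[0,\infty)$ is measurable with $\omega>0$ almost everywhere, $v:\mathbb{R}^3\to\mathbb{R}$ is measurable, $g\in\mathbb{R}$, and $W=g^2\omega^{-1}v^2$. $\mathcal{Z}_\omega=\{f:\mathbb{R}^3\to\mathbb{C}\text{ measurable}:\omega^{1/2}f\in L^2(\mathbb{R}^3)\}$. Hypothesis C on $W$: $W=W_1+W_2$ with $W_1\in L^1(\mathbb{R}^3)$ and $W_2\in L^{3,\infty}(\mathbb{R}^3)$. Energy. For $(u,f)\in\mathcal{U}\times\mathcal{Z}_\omega$, $$\mathcal{E}(u,f)=\int|\nabla u|^2dx+\int V|u|^2dx+\int\omega|f|^2dk+2g\,\mathrm{Re}\int_{\mathbb{R}^6}e^{ik\cdot x}v(k)f(k)|u(x)|^2dx\,dk,$$ where the last integral is understood as $\int v(k)f(k)\big(\int e^{ik\cdot x}|u(x)|^2dx\big)dk$. Constants: "universal" means independent of $V,\omega,v,g$ and of the decompositions; $C_V$ depends on $V$ (including the constants $a,b$ of Hypothesis A) but not on $\omega,v,g$. *)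

theory Defs
  imports "HOL-Analysis.Analysis"
begin

type_synonym R3 = "real ^ 3"


section \<open>Function spaces\<close>

text \<open>
  Elements of the function spaces are represented by functions defined everywhere and measurable
  with respect to the (complete) Lebesgue measure. Equality in the spaces is equality almost
  everywhere, so representatives are not unique.
\<close>

definition L2 :: "(R3 \<Rightarrow> 'b::euclidean_space) set" where
  "L2 = {f \<in> borel_measurable lebesgue. integrable lebesgue (\<lambda>x. (norm (f x))\<^sup>2)}"

definition L2_norm :: "(R3 \<Rightarrow> 'b::euclidean_space) \<Rightarrow> real" where
  "L2_norm f = sqrt (\<integral>x. (norm (f x))\<^sup>2 \<partial>lebesgue)"

definition L1_norm :: "(R3 \<Rightarrow> real) \<Rightarrow> real" where
  "L1_norm f = (\<integral>x. \<bar>f x\<bar> \<partial>lebesgue)"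

definition Lp_loc :: "real \<Rightarrow> (R3 \<Rightarrow> real) set" where
  "Lp_loc p = {f \<in> borel_measurable lebesgue.
     \<forall>K. compact K \<longrightarrow> set_integrable lebesgue K (\<lambda>x. \<bar>f x\<bar> powr p)}"

text \<open>
  The finiteness conditions are spelled out because \<^const>\<open>measure\<close> is 0 on sets of
  infinite measure, and the real supremum is meaningful only for bounded sets.
\<close>

definition L3_weak :: "(R3 \<Rightarrow> real) set" where
  "L3_weak = {f \<in> borel_measurable lebesgue.
     (\<forall>t>0. emeasure lebesgue {x. \<bar>f x\<bar> > t} < \<infinity>) \<and>
     bdd_above ((\<lambda>t. t * root 3 (measure lebesgue {x. \<bar>f x\<bar> > t})) ` {0<..})}"

definition L3_weak_norm :: "(R3 \<Rightarrow> real) \<Rightarrow> real" where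
  "L3_weak_norm f = (SUP t\<in>{0<..}. t * root 3 (measure lebesgue {x. \<bar>f x\<bar> > t}))"


section \<open>The Sobolev space \<open>H\<^sup>1\<close>\<close>

definition partial :: "3 \<Rightarrow> (R3 \<Rightarrow> real) \<Rightarrow> R3 \<Rightarrow> real" where
  "partial i \<phi> x = frechet_derivative \<phi> (at x) (axis i 1)"

text \<open>Differentiability gives the continuity of all derivatives of lower order.\<close>

primrec times_differentiable :: "nat \<Rightarrow> (R3 \<Rightarrow> real) \<Rightarrow> bool" where
  "times_differentiable 0 \<phi> \<longleftrightarrow> True"
| "times_differentiable (Suc n) \<phi> \<longleftrightarrow>
     (\<forall>x. \<phi> differentiable at x) \<and> (\<forall>i. times_differentiable n (partial i \<phi>))"

definition test_functions :: "(R3 \<Rightarrow> real) set" where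
  "test_functions = {\<phi>. (\<forall>n. times_differentiable n \<phi>) \<and> compact (closure {x. \<phi> x \<noteq> 0})}"

definition has_weak_gradient :: "(R3 \<Rightarrow> complex) \<Rightarrow> (R3 \<Rightarrow> complex ^ 3) \<Rightarrow> bool" where
  "has_weak_gradient u G \<longleftrightarrow>
     (\<forall>\<phi>\<in>test_functions. \<forall>i.
        (\<integral>x. u x * complex_of_real (partial i \<phi> x) \<partial>lebesgue) =
        - (\<integral>x. G x $ i * complex_of_real (\<phi> x) \<partial>lebesgue))"

definition H1 :: "(R3 \<Rightarrow> complex) set" where
  "H1 = {u \<in> L2. \<exists>G\<in>L2. has_weak_gradient u G}"

text \<open>The weak gradient is unique only up to null sets; a representative is chosen.\<close>

definition weak_grad :: "(R3 \<Rightarrow> complex) \<Rightarrow> R3 \<Rightarrow> complex ^ 3" where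
  "weak_grad u = (SOME G. G \<in> L2 \<and> has_weak_gradient u G)"


section \<open>Schroedinger operators\<close>

definition pos_part :: "(R3 \<Rightarrow> real) \<Rightarrow> R3 \<Rightarrow> real" where
  "pos_part V x = max (V x) 0"

definition neg_part :: "(R3 \<Rightarrow> real) \<Rightarrow> R3 \<Rightarrow> real" where
  "neg_part V x = max (- V x) 0"

definition form_domain :: "(R3 \<Rightarrow> real) \<Rightarrow> (R3 \<Rightarrow> complex) set" where
  "form_domain V = {u \<in> H1. integrable lebesgue (\<lambda>x. pos_part V x * (norm (u x))\<^sup>2)}"

definition schroedinger_form ::
  "(R3 \<Rightarrow> real) \<Rightarrow> (R3 \<Rightarrow> complex) \<Rightarrow> (R3 \<Rightarrow> complex) \<Rightarrow> complex" where
  "schroedinger_form V u \<phi> =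
     (\<integral>x. (\<Sum>i\<in>UNIV. weak_grad u x $ i * cnj (weak_grad \<phi> x $ i)) \<partial>lebesgue) +
     (\<integral>x. complex_of_real (V x) * u x * cnj (\<phi> x) \<partial>lebesgue)"

text \<open>
  The graph of \<open>H\<^sub>V = -\<Delta> + V\<close>, the operator associated with the quadratic form: \<open>u\<close> is in the
  operator domain and \<open>H\<^sub>V u = h\<close>. The relation is invariant under changing \<open>u\<close> and \<open>h\<close> on null
  sets.
\<close>

definition schroedinger_op ::
  "(R3 \<Rightarrow> real) \<Rightarrow> (R3 \<Rightarrow> complex) \<Rightarrow> (R3 \<Rightarrow> complex) \<Rightarrow> bool" where
  "schroedinger_op V u h \<longleftrightarrow>
     u \<in> form_domain V \<and> h \<in> L2 \<and>
     (\<forall>\<phi>\<in>form_domain V. schroedinger_form V u \<phi> = (\<integral>x. h x * cnj (\<phi> x) \<partial>lebesgue))"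

text \<open>
  \<open>z\<close> is in the resolvent set iff \<open>H\<^sub>V - z\<close> is a bijection from the operator domain onto \<open>L\<^sup>2\<close>
  with bounded inverse. The equation \<open>(H\<^sub>V - z) u = w\<close> is written as \<open>H\<^sub>V u = w + z u\<close>; by
  linearity the norm estimate includes uniqueness of \<open>u\<close> (almost everywhere).
\<close>

definition resolvent_set :: "(R3 \<Rightarrow> real) \<Rightarrow> complex set" where
  "resolvent_set V = {z. \<exists>K. \<forall>w\<in>L2.
     (\<exists>u. schroedinger_op V u (\<lambda>x. w x + z * u x)) \<and>
     (\<forall>u. schroedinger_op V u (\<lambda>x. w x + z * u x) \<longrightarrow> L2_norm u \<le> K * L2_norm w)}"

definition spectrum :: "(R3 \<Rightarrow> real) \<Rightarrow> complex set" where
  "spectrum V = - resolvent_set V"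

definition \<mu> :: "(R3 \<Rightarrow> real) \<Rightarrow> real" where
  "\<mu> V = Inf {s. complex_of_real s \<in> spectrum V}"


section \<open>The hypotheses on the potential and on the field\<close>

definition form_bounded :: "(R3 \<Rightarrow> real) \<Rightarrow> real \<Rightarrow> real \<Rightarrow> bool" where
  "form_bounded V a b \<longleftrightarrow>
     (\<forall>u\<in>H1. integrable lebesgue (\<lambda>x. neg_part V x * (norm (u x))\<^sup>2) \<and>
        (\<integral>x. neg_part V x * (norm (u x))\<^sup>2 \<partial>lebesgue)
          \<le> a * (\<integral>x. (norm (weak_grad u x))\<^sup>2 \<partial>lebesgue) + b * (\<integral>x. (norm (u x))\<^sup>2 \<partial>lebesgue))"

definition decomposition_A :: "(R3 \<Rightarrow> real) \<Rightarrow> (R3 \<Rightarrow> real) \<Rightarrow> (R3 \<Rightarrow> real) \<Rightarrow> bool" where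
  "decomposition_A V V\<^sub>1 V\<^sub>2 \<longleftrightarrow>
     (AE x in lebesgue. V x = V\<^sub>1 x + V\<^sub>2 x) \<and>
     V\<^sub>1 \<in> Lp_loc 1 \<and> (\<forall>x. 0 \<le> V\<^sub>1 x) \<and>
     V\<^sub>2 \<in> Lp_loc (3/2) \<and> (V\<^sub>2 \<longlongrightarrow> 0) at_infinity \<and>
     \<mu> V < \<mu> V\<^sub>1"

definition hypothesis_A :: "(R3 \<Rightarrow> real) \<Rightarrow> real \<Rightarrow> real \<Rightarrow> bool" where
  "hypothesis_A V a b \<longleftrightarrow>
     V \<in> borel_measurable lebesgue \<and> 0 \<le> a \<and> a < 1 \<and> form_bounded V a b \<and>
     (\<exists>V\<^sub>1 V\<^sub>2. decomposition_A V V\<^sub>1 V\<^sub>2)"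

definition field_data :: "(R3 \<Rightarrow> real) \<Rightarrow> (R3 \<Rightarrow> real) \<Rightarrow> bool" where
  "field_data \<omega> v \<longleftrightarrow>
     \<omega> \<in> borel_measurable lebesgue \<and> (\<forall>k. 0 \<le> \<omega> k) \<and> (AE k in lebesgue. 0 < \<omega> k) \<and>
     v \<in> borel_measurable lebesgue"

definition field_W :: "(R3 \<Rightarrow> real) \<Rightarrow> (R3 \<Rightarrow> real) \<Rightarrow> real \<Rightarrow> R3 \<Rightarrow> real" where
  "field_W \<omega> v g k = g\<^sup>2 * inverse (\<omega> k) * (v k)\<^sup>2"

definition decomposition_C :: "(R3 \<Rightarrow> real) \<Rightarrow> (R3 \<Rightarrow> real) \<Rightarrow> (R3 \<Rightarrow> real) \<Rightarrow> bool" where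
  "decomposition_C W W\<^sub>1 W\<^sub>2 \<longleftrightarrow>
     (AE k in lebesgue. W k = W\<^sub>1 k + W\<^sub>2 k) \<and> integrable lebesgue W\<^sub>1 \<and> W\<^sub>2 \<in> L3_weak"

definition hypothesis_C :: "(R3 \<Rightarrow> real) \<Rightarrow> bool" where
  "hypothesis_C W \<longleftrightarrow> (\<exists>W\<^sub>1 W\<^sub>2. decomposition_C W W\<^sub>1 W\<^sub>2)"


section \<open>The Klein--Gordon--Schroedinger energy\<close>

definition particle_states :: "(R3 \<Rightarrow> real) \<Rightarrow> (R3 \<Rightarrow> complex) set" where
  "particle_states V = {u \<in> form_domain V. L2_norm u = 1}"

definition field_states :: "(R3 \<Rightarrow> real) \<Rightarrow> (R3 \<Rightarrow> complex) set" where
  "field_states \<omega> =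
     {f \<in> borel_measurable lebesgue. (\<lambda>k. complex_of_real (sqrt (\<omega> k)) * f k) \<in> L2}"

text \<open>
  On the states above and under the hypotheses, every integral converges absolutely, except that
  for \<open>g = 0\<close> the coupling integral may diverge; it then has the factor 0.
\<close>

definition energy ::
  "(R3 \<Rightarrow> real) \<Rightarrow> (R3 \<Rightarrow> real) \<Rightarrow> (R3 \<Rightarrow> real) \<Rightarrow> real \<Rightarrow> (R3 \<Rightarrow> complex) \<Rightarrow> (R3 \<Rightarrow> complex) \<Rightarrow> real"
  where
  "energy V \<omega> v g u f =
     (\<integral>x. (norm (weak_grad u x))\<^sup>2 \<partial>lebesgue) +
     (\<integral>x. V x * (norm (u x))\<^sup>2 \<partial>lebesgue) +
     (\<integral>k. \<omega> k * (norm (f k))\<^sup>2 \<partial>lebesgue) +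
     2 * g * Re (\<integral>k. complex_of_real (v k) * f k *
       (\<integral>x. exp (\<i> * complex_of_real (k \<bullet> x)) * complex_of_real ((norm (u x))\<^sup>2) \<partial>lebesgue)
       \<partial>lebesgue)"

definition is_minimizer ::
  "(R3 \<Rightarrow> real) \<Rightarrow> (R3 \<Rightarrow> real) \<Rightarrow> (R3 \<Rightarrow> real) \<Rightarrow> real \<Rightarrow> (R3 \<Rightarrow> complex) \<Rightarrow> (R3 \<Rightarrow> complex) \<Rightarrow> bool"
  where
  "is_minimizer V \<omega> v g u f \<longleftrightarrow>
     u \<in> particle_states V \<and> f \<in> field_states \<omega> \<and>
     (\<forall>u'\<in>particle_states V. \<forall>f'\<in>field_states \<omega>.
        energy V \<omega> v g u f \<le> energy V \<omega> v g u' f')"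

end

theory Submission
  imports Defs "HOL-Probability.Probability" "HOL-Computational_Algebra.Polynomial"
    "HOL-Real_Asymp.Real_Asymp" "HOL-Library.Diagonal_Subsequence"
begin

text \<open>
  Completing the square in the field leaves the functional \<open>q(u) - \<integral> W \<bar>\<rho>\<^sub>u\<bar>\<^sup>2\<close>, where \<open>q\<close> is the form of
  \<open>H\<^sub>V\<close> and \<open>\<rho>\<^sub>u\<close> the Fourier transform of \<open>\<bar>u\<bar>\<^sup>2\<close>. Truncating \<open>u\<close> at a suitable level bounds the
  integral of \<open>\<bar>\<rho>\<^sub>u\<bar>\<^sup>2\<close> over a set of measure \<open>\<tau>\<close> by a multiple of \<open>\<tau>\<close> to the power 1/5; the layer
  cake formula then controls the coupling with a weak \<open>L\<^sup>3\<close> weight by \<open>\<parallel>u\<parallel>\<^sup>2 \<parallel>\<nabla>u\<parallel>\<^sup>2\<close>. So the functional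
  is coercive in \<open>H\<^sup>1\<close> and the coupling is continuous under \<open>L\<^sup>2\<close> convergence of \<open>H\<^sup>1\<close>-bounded
  sequences. Localization splits a near minimizer into a part in a ball and a part of mass \<open>m\<close> far
  out. There \<open>V\<close> is close to \<open>V\<^sub>1\<close>, so the far part costs at least about \<open>m\<close> times the
  gap between the bottoms of the two spectra, while the coupling it contributes is at most a small
  multiple of the same quantity. Hence minimizing sequences are tight and converge in \<open>L\<^sup>2\<close>, and the
  limit is a minimizer because \<open>q\<close> is lower semicontinuous.
\<close>


section \<open>The space \<open>L\<^sup>2\<close>\<close>

text \<open>The spectrum is defined through the resolvent set, so \<open>\<mu>\<close> has to be
  identified with the infimum of the form before a variational argument can start. One convexity
  argument, that near minimizers of a coercive form are Cauchy in the form norm, serves for this and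
  again for lower semicontinuity. Likewise all information from H1 comes from one estimate:
  translating \<open>u\<close> by \<open>y\<close> changes it in L2 by at most |y| times the norm of
  its gradient. Averaged over cubes it gives both the compactness and the bound for the mass above a
  level, which plays the part of a Sobolev inequality. The obstacle is the cross term between the
  near and the far part of a state: for the weak L^3 weight it is bounded by the gradient norm of
  the far part times the root of its mass. A fraction of the form is therefore reserved for the far
  gradient, and this is the origin of the term 4 (mu_V + b)/(1 - a) in C_V; its other terms bound
  the gradients of near minimizers. C_V is fixed before the decompositions are known, so it may
  contain mu_V, a and b, but not the bottom of the spectrum for V1.\<close>

lemma AE_lebesgue_iff: "(AE x in lebesgue. P x) \<longleftrightarrow> (AE x in lborel. P x)"
  by (rule AE_completion_iff)

lemma borel_measurable_lebesgueI: "f \<in> borel_measurable borel \<Longrightarrow> f \<in> borel_measurable lebesgue"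
  by (simp add: measurable_completion)

text \<open>Translations and Fubini arguments are carried out with Borel functions and
  \<open>lborel\<close>, where composition with (x, y) -> x + y stays measurable. This lemma lets
  each class of functions equal almost everywhere be represented by a Borel function.\<close>

lemma ex_borel_representative:
  fixes f :: "R3 \<Rightarrow> 'b::euclidean_space"
  assumes "f \<in> borel_measurable lebesgue"
  shows "\<exists>f'\<in>borel_measurable borel. AE x in lebesgue. f x = f' x"
proof -
  have "\<exists>g. g \<in> borel_measurable lborel \<and> (AE x in lborel. f x \<bullet> b = g x)" for b
    using completion_ex_borel_measurable_real[of "\<lambda>x. f x \<bullet> b" lborel] assms by auto
  then obtain g where g: "\<And>b. g b \<in> borel_measurable lborel"
    "\<And>b. AE x in lborel. f x \<bullet> b = g b x" by metis
  define f' where "f' x = (\<Sum>b\<in>Basis. g b x *\<^sub>R b)" for x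
  have "AE x in lborel. \<forall>b\<in>Basis. f x \<bullet> b = g b x"
    using g(2) by (intro AE_finite_allI) auto
  then have "AE x in lborel. f x = f' x"
  proof eventually_elim
    case (elim x)
    have "f' x = (\<Sum>b\<in>Basis. (f x \<bullet> b) *\<^sub>R b)" unfolding f'_def using elim by (intro sum.cong) auto
    then show ?case by (simp add: euclidean_representation)
  qed
  moreover have "f' \<in> borel_measurable borel"
    using g(1) unfolding f'_def[abs_def] by simp
  ultimately show ?thesis by (auto simp: AE_lebesgue_iff)
qed

definition sqn :: "(R3 \<Rightarrow> 'b::euclidean_space) \<Rightarrow> real" where
  "sqn f = (\<integral>x. (norm (f x))\<^sup>2 \<partial>lebesgue)"

text \<open>For complex values this is the real part of the Hermitian product. The imaginary part is
  recovered later by replacing \<open>g\<close> by \<open>\<i> * g\<close>.\<close>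

definition ip :: "(R3 \<Rightarrow> 'b::euclidean_space) \<Rightarrow> (R3 \<Rightarrow> 'b) \<Rightarrow> real" where
  "ip f g = (\<integral>x. f x \<bullet> g x \<partial>lebesgue)"

lemma L2_norm_sqrt: "L2_norm f = sqrt (sqn f)"
  by (simp add: L2_norm_def sqn_def)

lemma sqn_nonneg [simp]: "0 \<le> sqn f"
  unfolding sqn_def by (rule integral_nonneg_AE) simp

lemma L2D:
  assumes "f \<in> L2"
  shows "f \<in> borel_measurable lebesgue" "integrable lebesgue (\<lambda>x. (norm (f x))\<^sup>2)"
  using assms by (auto simp: L2_def)

lemma L2I_bound:
  fixes f :: "R3 \<Rightarrow> 'b::euclidean_space"
  assumes "f \<in> borel_measurable lebesgue" "integrable lebesgue g"
    "AE x in lebesgue. (norm (f x))\<^sup>2 \<le> g x"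
  shows "f \<in> L2"
proof -
  have "integrable lebesgue (\<lambda>x. (norm (f x))\<^sup>2)"
    by (rule Bochner_Integration.integrable_bound[OF assms(2)])
      (use assms in \<open>auto elim!: eventually_mono\<close>)
  then show ?thesis using assms by (simp add: L2_def)
qed

lemma L2_dominated:
  fixes f :: "R3 \<Rightarrow> 'b::euclidean_space" and g :: "R3 \<Rightarrow> 'c::euclidean_space"
  assumes "g \<in> L2" "f \<in> borel_measurable lebesgue" "AE x in lebesgue. norm (f x) \<le> c * norm (g x)"
  shows "f \<in> L2"
proof (rule L2I_bound)
  show "integrable lebesgue (\<lambda>x. c\<^sup>2 * (norm (g x))\<^sup>2)" using L2D(2)[OF assms(1)] by simp
  show "AE x in lebesgue. (norm (f x))\<^sup>2 \<le> c\<^sup>2 * (norm (g x))\<^sup>2"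
    using assms(3) proof eventually_elim
    case (elim x)
    have "(norm (f x))\<^sup>2 \<le> (c * norm (g x))\<^sup>2" using elim by (intro power_mono) auto
    then show ?case by (simp add: power_mult_distrib)
  qed
qed (use assms in auto)

lemma sqn_mono:
  fixes f :: "R3 \<Rightarrow> 'b::euclidean_space" and g :: "R3 \<Rightarrow> 'c::euclidean_space"
  assumes "g \<in> L2" "f \<in> borel_measurable lebesgue" "AE x in lebesgue. norm (f x) \<le> norm (g x)"
  shows "sqn f \<le> sqn g"
  unfolding sqn_def
  by (rule integral_mono_AE) (use L2D[OF assms(1)] L2D[OF L2_dominated[OF assms(1,2), of 1]] assms(3) in
      \<open>auto elim!: eventually_mono intro: power_mono\<close>)

lemma sqn_cong_AE:
  fixes f g :: "R3 \<Rightarrow> 'b::euclidean_space"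
  assumes "f \<in> borel_measurable lebesgue" "g \<in> borel_measurable lebesgue" "AE x in lebesgue. f x = g x"
  shows "sqn f = sqn g"
  unfolding sqn_def by (rule integral_cong_AE) (use assms in auto)

lemma L2_cong_AE:
  fixes f g :: "R3 \<Rightarrow> 'b::euclidean_space"
  assumes "f \<in> L2" "g \<in> borel_measurable lebesgue" "AE x in lebesgue. f x = g x"
  shows "g \<in> L2"
  by (rule L2_dominated[OF assms(1,2), of 1]) (use assms(3) in auto)

lemma L2_zero [simp]: "(\<lambda>x. 0) \<in> L2"
  by (simp add: L2_def)

lemma L2_scaleR: "f \<in> L2 \<Longrightarrow> (\<lambda>x. c *\<^sub>R f x) \<in> L2"
  by (rule L2_dominated[where c = "\<bar>c\<bar>"]) (auto dest: L2D)

lemma L2_cmult: "f \<in> L2 \<Longrightarrow> (\<lambda>x. c * f x :: complex) \<in> L2"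
  by (rule L2_dominated[where c = "norm c"]) (auto dest: L2D simp: norm_mult)

lemma L2_add:
  fixes f g :: "R3 \<Rightarrow> 'b::euclidean_space"
  assumes "f \<in> L2" "g \<in> L2" shows "(\<lambda>x. f x + g x) \<in> L2"
proof (rule L2I_bound)
  show "integrable lebesgue (\<lambda>x. 2 * (norm (f x))\<^sup>2 + 2 * (norm (g x))\<^sup>2)"
    using assms[THEN L2D(2)] by simp
  have "(norm (a + b))\<^sup>2 \<le> 2 * (norm a)\<^sup>2 + 2 * (norm b)\<^sup>2" for a b :: 'b
  proof -
    have "(norm (a + b))\<^sup>2 \<le> (norm a + norm b)\<^sup>2" by (intro power_mono norm_triangle_ineq) simp
    also have "\<dots> \<le> 2 * (norm a)\<^sup>2 + 2 * (norm b)\<^sup>2"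
      using sum_squares_bound[of "norm a" "norm b"] by (simp add: power2_sum)
    finally show ?thesis .
  qed
  then show "AE x in lebesgue. (norm (f x + g x))\<^sup>2 \<le> 2 * (norm (f x))\<^sup>2 + 2 * (norm (g x))\<^sup>2" by simp
qed (use assms[THEN L2D(1)] in measurable)

lemma L2_uminus: "f \<in> L2 \<Longrightarrow> (\<lambda>x. - f x) \<in> L2"
  using L2_scaleR[of f "-1"] by simp

lemma L2_diff: "f \<in> L2 \<Longrightarrow> g \<in> L2 \<Longrightarrow> (\<lambda>x. f x - g x) \<in> L2"
  using L2_add[of f "\<lambda>x. - g x"] L2_uminus[of g] by simp

lemma L2_integrable_bilinear:
  fixes f :: "R3 \<Rightarrow> 'b::euclidean_space" and g :: "R3 \<Rightarrow> 'c::euclidean_space"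
    and h :: "R3 \<Rightarrow> 'd::euclidean_space"
  assumes "f \<in> L2" "g \<in> L2" "h \<in> borel_measurable lebesgue"
    "AE x in lebesgue. norm (h x) \<le> norm (f x) * norm (g x)"
  shows "integrable lebesgue h"
proof (rule Bochner_Integration.integrable_bound)
  show "integrable lebesgue (\<lambda>x. (norm (f x))\<^sup>2 + (norm (g x))\<^sup>2)"
    using L2D(2)[OF assms(1)] L2D(2)[OF assms(2)] by simp
  show "AE x in lebesgue. norm (h x) \<le> norm ((norm (f x))\<^sup>2 + (norm (g x))\<^sup>2)"
    using assms(4)
  proof eventually_elim
    case (elim x)
    have "norm (f x) * norm (g x) \<le> (norm (f x))\<^sup>2 + (norm (g x))\<^sup>2"
      using sum_squares_bound[of "norm (f x)" "norm (g x)"]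
        mult_nonneg_nonneg[OF norm_ge_zero[of "f x"] norm_ge_zero[of "g x"]] by linarith
    then show ?case using elim by simp
  qed
qed (use assms in auto)

lemma L2_integrable_inner: "f \<in> L2 \<Longrightarrow> g \<in> L2 \<Longrightarrow> integrable lebesgue (\<lambda>x. f x \<bullet> g x)"
  by (rule L2_integrable_bilinear[of f g])
    (auto simp: Cauchy_Schwarz_ineq2 intro: borel_measurable_inner L2D(1))

lemma L2_integrable_mult:
  fixes f g :: "R3 \<Rightarrow> complex"
  shows "f \<in> L2 \<Longrightarrow> g \<in> L2 \<Longrightarrow> integrable lebesgue (\<lambda>x. f x * g x)"
  by (rule L2_integrable_bilinear[of f g]) (auto intro!: borel_measurable_times dest!: L2D(1) simp: norm_mult)

lemma L2_cnj: "f \<in> L2 \<Longrightarrow> (\<lambda>x. cnj (f x)) \<in> L2"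
  by (rule L2_dominated[where c = 1]) (auto dest: L2D intro: borel_measurable_continuous_on[OF continuous_on_cnj])

lemma sqn_add:
  assumes "f \<in> L2" "g \<in> L2"
  shows "sqn (\<lambda>x. f x + g x) = sqn f + 2 * ip f g + sqn g"
proof -
  have "sqn (\<lambda>x. f x + g x) = (\<integral>x. (norm (f x))\<^sup>2 + 2 * (f x \<bullet> g x) + (norm (g x))\<^sup>2 \<partial>lebesgue)"
    unfolding sqn_def by (rule Bochner_Integration.integral_cong)
      (auto simp: power2_norm_eq_inner inner_add inner_commute)
  then show ?thesis
    using assms L2_integrable_inner[OF assms] L2D(2)[OF assms(1)] L2D(2)[OF assms(2)]
    by (simp add: sqn_def ip_def)
qed

lemma ip_scaleR: "ip (\<lambda>x. c *\<^sub>R f x) g = c * ip f g" "ip f (\<lambda>x. c *\<^sub>R g x) = c * ip f g"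
  by (simp_all add: ip_def)

lemma ip_uminus: "ip f (\<lambda>x. - g x) = - ip f g"
  by (simp add: ip_def)

lemma ip_commute: "ip f g = ip g f" by (simp add: ip_def inner_commute)

lemma ip_add:
  assumes "f \<in> L2" "g \<in> L2" "h \<in> L2"
  shows "ip f (\<lambda>x. g x + h x) = ip f g + ip f h"
  using L2_integrable_inner[OF assms(1,2)] L2_integrable_inner[OF assms(1,3)]
  by (simp add: ip_def inner_add_right)

lemma sqn_scaleR: "sqn (\<lambda>x. c *\<^sub>R f x) = c\<^sup>2 * sqn f"
  by (simp add: sqn_def power_mult_distrib)

lemma sqn_uminus: "sqn (\<lambda>x. - f x) = sqn f"
  by (simp add: sqn_def)

lemma sqn_minus_commute: "sqn (\<lambda>x. f x - g x) = sqn (\<lambda>x. g x - f x)"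
  by (simp add: sqn_def norm_minus_commute)

lemma sqn_diff:
  assumes "f \<in> L2" "g \<in> L2"
  shows "sqn (\<lambda>x. f x - g x) = sqn f - 2 * ip f g + sqn g"
  using sqn_add[OF assms(1) L2_uminus[OF assms(2)]] by (simp add: sqn_uminus ip_uminus)

lemma sqn_parallelogram:
  assumes "f \<in> L2" "g \<in> L2"
  shows "sqn (\<lambda>x. f x + g x) + sqn (\<lambda>x. f x - g x) = 2 * sqn f + 2 * sqn g"
  using assms by (simp add: sqn_add sqn_diff)

text \<open>Used for the Cauchy-Schwarz inequalities of \<open>ip\<close> and of the forms. With
  \<open>a = 0\<close> it says that \<open>b\<close> vanishes, which turns minimality along a line
  into the Euler-Lagrange equation.\<close>

lemma discriminant_le:
  fixes a b c :: real
  assumes "\<And>t. 0 \<le> a + 2 * t * b + t\<^sup>2 * c" "0 \<le> a" "0 \<le> c"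
  shows "b\<^sup>2 \<le> a * c"
proof (cases "c = 0")
  case True
  have "b = 0"
  proof (rule ccontr)
    assume "b \<noteq> 0"
    then have "2 * (- (a + 1) / (2 * b)) * b = - (a + 1)" by (simp add: field_simps)
    then show False using assms(1)[of "- (a + 1) / (2 * b)"] True by simp
  qed
  then show ?thesis using True by simp
next
  case False
  have "0 \<le> a + 2 * (- b / c) * b + (- b / c)\<^sup>2 * c" by (rule assms)
  also have "\<dots> = a - b\<^sup>2 / c" using False by (simp add: field_simps power2_eq_square)
  finally show ?thesis using False assms(3) by (simp add: field_simps)
qed

lemma ip_Cauchy_Schwarz:
  assumes "f \<in> L2" "g \<in> L2"
  shows "(ip f g)\<^sup>2 \<le> sqn f * sqn g"
proof (rule discriminant_le)
  fix t :: real
  show "0 \<le> sqn f + 2 * t * ip f g + t\<^sup>2 * sqn g"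
    using sqn_add[OF assms(1) L2_scaleR[OF assms(2), of t]] sqn_nonneg[of "\<lambda>x. f x + t *\<^sub>R g x"]
    by (simp add: ip_scaleR sqn_scaleR)
qed simp_all

lemma ip_le: "f \<in> L2 \<Longrightarrow> g \<in> L2 \<Longrightarrow> \<bar>ip f g\<bar> \<le> L2_norm f * L2_norm g"
  unfolding L2_norm_sqrt real_sqrt_mult[symmetric] using ip_Cauchy_Schwarz
  by (metis real_sqrt_abs real_sqrt_le_iff)

lemma L2_norm_nonneg [simp]: "0 \<le> L2_norm f" by (simp add: L2_norm_sqrt)

lemma L2_norm_power2: "(L2_norm f)\<^sup>2 = sqn f" by (simp add: L2_norm_sqrt)

lemma L2_norm_triangle:
  assumes "f \<in> L2" "g \<in> L2"
  shows "L2_norm (\<lambda>x. f x + g x) \<le> L2_norm f + L2_norm g"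
proof (rule power2_le_imp_le)
  show "(L2_norm (\<lambda>x. f x + g x))\<^sup>2 \<le> (L2_norm f + L2_norm g)\<^sup>2"
    using ip_le[OF assms] by (simp add: L2_norm_power2 sqn_add[OF assms] power2_sum)
qed simp

lemma L2_norm_minus_commute: "L2_norm (\<lambda>x. f x - g x) = L2_norm (\<lambda>x. g x - f x)"
  by (simp add: L2_norm_sqrt sqn_minus_commute[of f g])

lemma L2_norm_rev_triangle:
  assumes "f \<in> L2" "g \<in> L2"
  shows "\<bar>L2_norm f - L2_norm g\<bar> \<le> L2_norm (\<lambda>x. f x - g x)"
  using L2_norm_triangle[OF L2_diff[OF assms] assms(2)]
    L2_norm_triangle[OF L2_diff[OF assms(2) assms(1)] assms(1)]
  by (simp add: L2_norm_minus_commute[of f g])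

lemma sqn_zero_AE:
  assumes "f \<in> L2" "sqn f = 0" shows "AE x in lebesgue. f x = 0"
  using integral_nonneg_eq_0_iff_AE[OF L2D(2)[OF assms(1)]] assms(2) by (simp add: sqn_def)

section \<open>Convergence in \<open>L2\<close> and completeness\<close>

lemma L2_subseq_AE:
  fixes f :: "nat \<Rightarrow> R3 \<Rightarrow> 'b::euclidean_space"
  assumes f: "\<And>n. f n \<in> L2" and g: "g \<in> L2" and lim: "(\<lambda>n. sqn (\<lambda>x. f n x - g x)) \<longlonglongrightarrow> 0"
  shows "\<exists>r::nat\<Rightarrow>nat. strict_mono r \<and> (AE x in lebesgue. (\<lambda>n. f (r n) x) \<longlonglongrightarrow> g x)"
proof -
  have "\<exists>r::nat\<Rightarrow>nat. strict_mono r \<and> (AE x in lebesgue. (\<lambda>n. (norm (f (r n) x - g x))\<^sup>2) \<longlonglongrightarrow> 0)"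
    by (rule tendsto_L1_AE_subseq) (use f g lim L2D(2)[OF L2_diff[OF f g]] in \<open>auto simp: sqn_def\<close>)
  then obtain r :: "nat \<Rightarrow> nat" where r: "strict_mono r" "AE x in lebesgue. (\<lambda>n. (norm (f (r n) x - g x))\<^sup>2) \<longlonglongrightarrow> 0"
    by blast
  from r(2) have "AE x in lebesgue. (\<lambda>n. f (r n) x) \<longlonglongrightarrow> g x"
  proof eventually_elim
    case (elim x)
    from tendsto_real_sqrt[OF elim] have "(\<lambda>n. norm (f (r n) x - g x)) \<longlonglongrightarrow> 0" by simp
    then show ?case using LIM_zero_iff tendsto_norm_zero_iff by blast
  qed
  with r(1) show ?thesis by blast
qed

lemma L2_fatou:
  fixes f :: "nat \<Rightarrow> R3 \<Rightarrow> 'b::euclidean_space"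
  assumes f: "\<And>n. f n \<in> L2" and g: "g \<in> borel_measurable lebesgue"
    and lim: "AE x in lebesgue. (\<lambda>n. f n x) \<longlonglongrightarrow> g x" and B: "\<And>n. n \<ge> N \<Longrightarrow> sqn (f n) \<le> B"
  shows "g \<in> L2" "sqn g \<le> B"
proof -
  have B0: "0 \<le> B" using B[of N] sqn_nonneg[of "f N"] by (simp del: sqn_nonneg)
  have [measurable]: "f n \<in> borel_measurable lebesgue" for n using f by (auto dest: L2D)
  note g[measurable]
  have nf: "(\<integral>\<^sup>+x. ennreal ((norm (f n x))\<^sup>2) \<partial>lebesgue) = ennreal (sqn (f n))" for n
    unfolding sqn_def by (rule nn_integral_eq_integral) (use f L2D(2) in auto)
  have "(\<integral>\<^sup>+x. ennreal ((norm (g x))\<^sup>2) \<partial>lebesgue) = (\<integral>\<^sup>+x. liminf (\<lambda>n. ennreal ((norm (f n x))\<^sup>2)) \<partial>lebesgue)"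
  proof (rule nn_integral_cong_AE)
    show "AE x in lebesgue. ennreal ((norm (g x))\<^sup>2) = liminf (\<lambda>n. ennreal ((norm (f n x))\<^sup>2))"
      using lim
    proof eventually_elim
      case (elim x)
      have "(\<lambda>n. ennreal ((norm (f n x))\<^sup>2)) \<longlonglongrightarrow> ennreal ((norm (g x))\<^sup>2)"
        by (intro tendsto_ennrealI tendsto_intros elim)
      then show ?case using lim_imp_Liminf[OF trivial_limit_sequentially] by metis
    qed
  qed
  also have "\<dots> \<le> liminf (\<lambda>n. \<integral>\<^sup>+x. ennreal ((norm (f n x))\<^sup>2) \<partial>lebesgue)"
    by (rule nn_integral_liminf) measurable
  also have "\<dots> \<le> liminf (\<lambda>n. ennreal B)"
    by (rule Liminf_mono) (auto simp: nf eventually_sequentially intro!: ennreal_leI B exI[of _ N])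
  also have "\<dots> = ennreal B" by (simp add: Liminf_const)
  finally have *: "(\<integral>\<^sup>+x. ennreal ((norm (g x))\<^sup>2) \<partial>lebesgue) \<le> ennreal B" .
  then have int: "integrable lebesgue (\<lambda>x. (norm (g x))\<^sup>2)"
    by (intro integrableI_bounded) (auto simp: top.extremum_strict less_top[symmetric] top_unique)
  then show "g \<in> L2" by (simp add: L2_def g)
  have "ennreal (sqn g) \<le> ennreal B"
    unfolding sqn_def using * nn_integral_eq_integral[OF int] by simp
  then show "sqn g \<le> B" using B0 by (simp add: ennreal_le_iff)
qed

text \<open>Applied with \<open>f\<close> an almost everywhere convergent subsequence of
  \<open>h\<close>. Fatou's lemma in the index of \<open>f\<close> passes from the Cauchy estimate
  to an estimate against the limit \<open>g\<close>, uniformly in the index of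
  \<open>h\<close>.\<close>

lemma L2_fatou_subseq:
  fixes f :: "nat \<Rightarrow> R3 \<Rightarrow> 'b::euclidean_space"
  assumes f: "\<And>n. f n \<in> L2" and ae: "AE x in lebesgue. (\<lambda>n. f n x) \<longlonglongrightarrow> g x"
    and g: "g \<in> borel_measurable lebesgue"
    and C: "\<And>e. e > 0 \<Longrightarrow> \<exists>N. \<forall>m\<ge>N. \<forall>n\<ge>N. sqn (\<lambda>x. h m x - f n x) \<le> e"
    and h: "\<And>n. h n \<in> L2"
  shows "g \<in> L2" "(\<lambda>n. sqn (\<lambda>x. h n x - g x)) \<longlonglongrightarrow> 0"
proof -
  have *: "\<exists>N. \<forall>m\<ge>N. (\<lambda>x. h m x - g x) \<in> L2 \<and> sqn (\<lambda>x. h m x - g x) \<le> e" if e: "e > 0" for e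
  proof -
    obtain N where N: "\<And>m n. m \<ge> N \<Longrightarrow> n \<ge> N \<Longrightarrow> sqn (\<lambda>x. h m x - f n x) \<le> e" using C[OF e] by blast
    have "(\<lambda>x. h m x - g x) \<in> L2 \<and> sqn (\<lambda>x. h m x - g x) \<le> e" if "m \<ge> N" for m
    proof -
      have 1: "(\<lambda>x. h m x - f n x) \<in> L2" for n using f h by (intro L2_diff)
      have 2: "(\<lambda>x. h m x - g x) \<in> borel_measurable lebesgue"
        using L2D(1)[OF h] g by (intro borel_measurable_diff)
      have 3: "AE x in lebesgue. (\<lambda>n. h m x - f n x) \<longlonglongrightarrow> h m x - g x"
        using ae by eventually_elim (intro tendsto_intros)
      have 4: "sqn (\<lambda>x. h m x - f n x) \<le> e" if "n \<ge> N" for n using N \<open>m \<ge> N\<close> that by blast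
      show ?thesis using L2_fatou[OF 1 2 3 4] by blast
    qed
    then show ?thesis by blast
  qed
  obtain N where "(\<lambda>x. h N x - g x) \<in> L2" using *[of 1] by auto
  then have "(\<lambda>x. h N x - (h N x - g x)) \<in> L2" using h L2_diff by blast
  then show "g \<in> L2" by simp
  show "(\<lambda>n. sqn (\<lambda>x. h n x - g x)) \<longlonglongrightarrow> 0"
  proof (rule LIMSEQ_I)
    fix r :: real assume "r > 0"
    then obtain N where "\<forall>m\<ge>N. sqn (\<lambda>x. h m x - g x) \<le> r/2" using *[of "r/2"] by auto
    then show "\<exists>no. \<forall>n\<ge>no. norm (sqn (\<lambda>x. h n x - g x) - 0) < r"
      using \<open>r > 0\<close> by (intro exI[of _ N]) (auto simp: abs_of_nonneg intro: le_less_trans)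
  qed
qed

theorem L2_complete:
  fixes f :: "nat \<Rightarrow> R3 \<Rightarrow> 'b::euclidean_space"
  assumes f: "\<And>n. f n \<in> L2"
    and C: "\<And>e. e > 0 \<Longrightarrow> \<exists>N. \<forall>m\<ge>N. \<forall>n\<ge>N. sqn (\<lambda>x. f m x - f n x) \<le> e"
  shows "\<exists>g\<in>L2. (\<lambda>n. sqn (\<lambda>x. f n x - g x)) \<longlonglongrightarrow> 0"
proof -
  have [measurable]: "f n \<in> borel_measurable lebesgue" for n using f by (auto dest: L2D)
  have "\<exists>N. \<forall>m\<ge>N. \<forall>n\<ge>N. sqn (\<lambda>x. f m x - f n x) \<le> (1/4)^j" for j :: nat
    using C[of "(1/4)^j"] by simp
  then obtain N where N: "\<And>j m n. m \<ge> N j \<Longrightarrow> n \<ge> N j \<Longrightarrow> sqn (\<lambda>x. f m x - f n x) \<le> (1/4)^j"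
    by metis
  \<comment> \<open>Strictly increasing because of the summand \<open>j\<close>, and at least
    \<open>N j\<close>, so consecutive members differ by at most (1/4)^j in square norm.\<close>
  define r where "r j = j + (\<Sum>i\<le>j. N i)" for j
  have r: "strict_mono r" by (auto simp: strict_mono_Suc_iff r_def)
  have rN: "N j \<le> r k" if "j \<le> k" for j k
  proof -
    have "N j \<le> (\<Sum>i\<le>k. N i)" using that by (intro member_le_sum) auto
    then show ?thesis by (simp add: r_def)
  qed
  define g where "g j x = f (r (Suc j)) x - f (r j) x" for j x
  have gL2: "g j \<in> L2" for j unfolding g_def[abs_def] using f by (auto intro: L2_diff)
  have gs: "sqn (g j) \<le> (1/4)^j" for j unfolding g_def[abs_def] by (intro N rN) auto
  have [measurable]: "g j \<in> borel_measurable lebesgue" for j using gL2 by (auto dest: L2D)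
  \<comment> \<open>The weight 2^j still leaves a summable series of integrals. Finiteness of the
    weighted sum at \<open>x\<close> bounds |g_j| by a constant times 2^(-j/2), hence the
    telescoping series converges absolutely at \<open>x\<close>.\<close>
  have "(\<integral>\<^sup>+x. (\<Sum>j. ennreal (2^j * (norm (g j x))\<^sup>2)) \<partial>lebesgue) = (\<Sum>j. \<integral>\<^sup>+x. ennreal (2^j * (norm (g j x))\<^sup>2) \<partial>lebesgue)"
    by (rule nn_integral_suminf) measurable
  also have "\<dots> = (\<Sum>j. ennreal (2^j * sqn (g j)))"
  proof -
    have "(\<integral>\<^sup>+x. ennreal (2^j * (norm (g j x))\<^sup>2) \<partial>lebesgue) = ennreal (2^j * sqn (g j))" for j
      using nn_integral_eq_integral[of lebesgue "\<lambda>x. 2^j * (norm (g j x))\<^sup>2"] L2D(2)[OF gL2[of j]]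
      by (simp add: sqn_def)
    then show ?thesis by simp
  qed
  also have "\<dots> \<le> (\<Sum>j. ennreal ((1/2)^j))"
  proof (intro suminf_le)
    fix j show "ennreal (2^j * sqn (g j)) \<le> ennreal ((1/2)^j)"
    proof (rule ennreal_leI)
      have "2^j * sqn (g j) \<le> 2^j * (1/4)^j" using gs by (intro mult_left_mono) auto
      also have "\<dots> = (1/2)^j" by (simp add: power_mult_distrib[symmetric])
      finally show "2^j * sqn (g j) \<le> (1/2)^j" .
    qed
  qed auto
  also have "\<dots> = ennreal (\<Sum>j. (1/2)^j)" by (rule suminf_ennreal2) (auto intro: summable_geometric)
  also have "\<dots> < \<infinity>" by simp
  finally have "AE x in lebesgue. (\<Sum>j. ennreal (2^j * (norm (g j x))\<^sup>2)) \<noteq> \<infinity>"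
    by (intro nn_integral_noteq_infinite) auto
  then have conv: "AE x in lebesgue. convergent (\<lambda>j. f (r j) x)"
  proof eventually_elim
    case (elim x)
    then have "summable (\<lambda>j. 2^j * (norm (g j x))\<^sup>2)"
      by (intro summable_suminf_not_top) (auto simp: top.not_eq_extremum)
    then have "(\<lambda>j. 2^j * (norm (g j x))\<^sup>2) \<longlonglongrightarrow> 0" by (rule summable_LIMSEQ_zero)
    then have "Bseq (\<lambda>j. 2^j * (norm (g j x))\<^sup>2)"
      by (intro convergent_imp_Bseq) (rule convergentI)
    then obtain K where K: "\<And>j. norm (2^j * (norm (g j x))\<^sup>2) \<le> K" by (auto simp: Bseq_def)
    have le: "norm (g j x) \<le> sqrt K * (sqrt (1/2))^j" for j
    proof -
      have "(norm (g j x))\<^sup>2 \<le> K * (1/2)^j" using K[of j] by (simp add: field_simps power_one_over)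
      then have "sqrt ((norm (g j x))\<^sup>2) \<le> sqrt (K * (1/2)^j)" by (rule real_sqrt_le_mono)
      then show ?thesis by (simp add: real_sqrt_mult real_sqrt_power)
    qed
    have "summable (\<lambda>j. sqrt K * (sqrt (1/2))^j)"
      by (intro summable_mult summable_geometric) (auto simp: real_sqrt_divide)
    then have "summable (\<lambda>j. g j x)" by (rule summable_comparison_test'[where N = 0]) (rule le)
    then have "convergent (\<lambda>n. \<Sum>j<n. g j x)" by (simp add: summable_iff_convergent)
    moreover have "(\<Sum>j<n. g j x) = f (r n) x - f (r 0) x" for n
      unfolding g_def by (rule sum_lessThan_telescope)
    ultimately have "convergent (\<lambda>n. f (r n) x - f (r 0) x + f (r 0) x)"
      by (intro convergent_add) (auto simp: convergent_const)
    then show ?case by simp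
  qed
  define G where "G x = lim (\<lambda>j. f (r j) x)" for x
  have [measurable]: "G \<in> borel_measurable lebesgue" unfolding G_def[abs_def] by measurable
  have lim: "AE x in lebesgue. (\<lambda>j. f (r j) x) \<longlonglongrightarrow> G x"
    using conv by eventually_elim (simp add: G_def convergent_LIMSEQ_iff[symmetric])
  have C': "\<exists>N. \<forall>m\<ge>N. \<forall>n\<ge>N. sqn (\<lambda>x. f m x - f (r n) x) \<le> e" if "e > 0" for e
    using C[OF that] r by (meson seq_suble order_trans)
  have "G \<in> L2" "(\<lambda>n. sqn (\<lambda>x. f n x - G x)) \<longlonglongrightarrow> 0"
    by (rule L2_fatou_subseq[where f = "\<lambda>n. f (r n)" and h = f]; use f lim C' in \<open>auto\<close>)+
  then show ?thesis by blast
qed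


section \<open>Smooth functions and test functions\<close>

lemma partial_eqI: "(f has_derivative f') (at x) \<Longrightarrow> partial i f x = f' (axis i 1)"
  unfolding partial_def by (metis frechet_derivative_at)

lemma partial_const [simp]: "partial i (\<lambda>x. c) = (\<lambda>x. 0)"
  by (rule ext) (auto intro!: partial_eqI)

lemma partial_nth: "partial i (\<lambda>x. x $ j) = (\<lambda>x. if i = j then 1 else 0)"
proof
  fix x :: R3
  have "((\<lambda>x. x $ j) has_derivative (\<lambda>x. x $ j)) (at x)"
    by (intro bounded_linear_imp_has_derivative bounded_linear_vec_nth)
  from partial_eqI[OF this, of i] show "partial i (\<lambda>x. x $ j) x = (if i = j then 1 else 0)"
    by (simp add: axis_def eq_commute)
qed

lemma partial_add:
  assumes "f differentiable at x" "g differentiable at x"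
  shows "partial i (\<lambda>x. f x + g x) x = partial i f x + partial i g x"
  unfolding partial_def using assms
  by (subst frechet_derivative_at[symmetric, OF has_derivative_add[OF
          frechet_derivative_works[THEN iffD1] frechet_derivative_works[THEN iffD1]]]) auto

lemma partial_mult:
  assumes "f differentiable at x" "g differentiable at x"
  shows "partial i (\<lambda>x. f x * g x) x = f x * partial i g x + partial i f x * g x"
  unfolding partial_def using assms
  by (subst frechet_derivative_at[symmetric, OF has_derivative_mult[OF
          frechet_derivative_works[THEN iffD1] frechet_derivative_works[THEN iffD1]]]) auto

lemma partial_compose:
  assumes "s differentiable at x" "(h has_real_derivative D) (at (s x))"
  shows "partial i (\<lambda>x. h (s x)) x = D * partial i s x"
    and "(\<lambda>x. h (s x)) differentiable at x"
proof -
  have "((\<lambda>x. h (s x)) has_derivative (\<lambda>y. D * frechet_derivative s (at x) y)) (at x)"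
    by (rule has_derivative_compose[where f = s and g = h, OF _ assms(2)[unfolded has_field_derivative_def]])
      (use assms(1) frechet_derivative_works in blast)
  then show "partial i (\<lambda>x. h (s x)) x = D * partial i s x" "(\<lambda>x. h (s x)) differentiable at x"
    by (auto simp: partial_def[of i s] differentiable_def dest: partial_eqI)
qed

lemma partial_translate:
  assumes "\<And>x. f differentiable at x"
  shows "partial i (\<lambda>x. f (x - y)) = (\<lambda>x. partial i f (x - y))" "(\<lambda>x. f (x - y)) differentiable at x"
proof -
  have "((\<lambda>x. f (x - y)) has_derivative frechet_derivative f (at (x - y))) (at x)" for x
  proof -
    have "((\<lambda>x. x - y) has_derivative (\<lambda>h. h)) (at x)" by (auto intro!: derivative_eq_intros)
    from has_derivative_compose[OF this, of f] show ?thesis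
      using assms frechet_derivative_works by blast
  qed
  then show "partial i (\<lambda>x. f (x - y)) = (\<lambda>x. partial i f (x - y))" "(\<lambda>x. f (x - y)) differentiable at x"
    by (auto simp: partial_def[of i f] differentiable_def dest: partial_eqI)
qed

lemma times_differentiable_Suc_D: "times_differentiable (Suc n) f \<Longrightarrow> times_differentiable n f"
  by (induction n arbitrary: f) auto

lemma times_differentiable_const: "times_differentiable n (\<lambda>x. c)"
  by (induction n arbitrary: c) auto

lemma times_differentiable_nth: "times_differentiable n (\<lambda>x. x $ j)"
proof (cases n)
  case (Suc m)
  have "(\<lambda>x. x $ j) differentiable at x" for x :: R3
    by (intro bounded_linear_imp_differentiable bounded_linear_vec_nth)
  then show ?thesis using Suc by (simp add: partial_nth times_differentiable_const)
qed simp

lemma times_differentiable_add: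
  "times_differentiable n f \<Longrightarrow> times_differentiable n g \<Longrightarrow> times_differentiable n (\<lambda>x. f x + g x)"
proof (induction n arbitrary: f g)
  case (Suc n)
  then have "partial i (\<lambda>x. f x + g x) = (\<lambda>x. partial i f x + partial i g x)" for i
    by (intro ext partial_add) auto
  then show ?case using Suc by auto
qed simp

lemma times_differentiable_mult:
  "times_differentiable n f \<Longrightarrow> times_differentiable n g \<Longrightarrow> times_differentiable n (\<lambda>x. f x * g x)"
proof (induction n arbitrary: f g)
  case (Suc n)
  have f: "times_differentiable n f" "times_differentiable n g"
    using Suc.prems times_differentiable_Suc_D by blast+
  have eq: "partial i (\<lambda>x. f x * g x) = (\<lambda>x. f x * partial i g x + partial i f x * g x)" for i
    using Suc.prems by (intro ext partial_mult) auto
  have "times_differentiable n (\<lambda>x. f x * partial i g x + partial i f x * g x)" for i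
    using Suc.prems by (intro times_differentiable_add Suc.IH[OF f(1)] Suc.IH[OF _ f(2)]) auto
  then show ?case using Suc.prems by (auto simp: eq)
qed simp

lemma times_differentiable_prod:
  "finite I \<Longrightarrow> (\<And>i. i \<in> I \<Longrightarrow> times_differentiable n (f i)) \<Longrightarrow> times_differentiable n (\<lambda>x. \<Prod>i\<in>I. f i x)"
  by (induction I rule: finite_induct) (auto simp: times_differentiable_const intro: times_differentiable_mult)

lemma times_differentiable_sum:
  "finite I \<Longrightarrow> (\<And>i. i \<in> I \<Longrightarrow> times_differentiable n (f i)) \<Longrightarrow> times_differentiable n (\<lambda>x. \<Sum>i\<in>I. f i x)"
  by (induction I rule: finite_induct) (auto simp: times_differentiable_const intro: times_differentiable_add)

lemma times_differentiable_translate: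
  "times_differentiable n f \<Longrightarrow> times_differentiable n (\<lambda>x. f (x - y))"
proof (induction n arbitrary: f)
  case (Suc n)
  then show ?case using partial_translate[of f] by simp
qed simp

text \<open>For such a family, compositions with its members can be differentiated any number of
  times by induction on the order, without a formula for the higher derivatives.\<close>

definition deriv_closed :: "(real \<Rightarrow> real) set \<Rightarrow> bool" where
  "deriv_closed F \<longleftrightarrow> (\<forall>h\<in>F. \<exists>h'\<in>F. \<forall>t. (h has_real_derivative h' t) (at t))"

lemma times_differentiable_compose:
  assumes "deriv_closed F"
  shows "h \<in> F \<Longrightarrow> times_differentiable n s \<Longrightarrow> times_differentiable n (\<lambda>x. h (s x))"
proof (induction n arbitrary: h)
  case (Suc n)
  obtain h' where h': "h' \<in> F" "\<And>t. (h has_real_derivative h' t) (at t)"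
    using assms Suc.prems(1) unfolding deriv_closed_def by blast
  have s: "s differentiable at x" for x using Suc.prems by simp
  have "partial i (\<lambda>x. h (s x)) = (\<lambda>x. h' (s x) * partial i s x)" for i
    using partial_compose(1)[OF s h'(2)] by blast
  moreover have "times_differentiable n (\<lambda>x. h' (s x) * partial i s x)" for i
    using Suc.prems(2) by (intro times_differentiable_mult[OF Suc.IH[OF h'(1) times_differentiable_Suc_D]]) auto
  ultimately show ?case using partial_compose(2)[OF s h'(2)] by simp
qed simp

text \<open>
  \<open>flat 1\<close> is the usual smooth function vanishing on a half line; the polynomial factor makes the
  family closed under differentiation.
\<close>

definition flat :: "real poly \<Rightarrow> real \<Rightarrow> real" where
  "flat p t = (if t > 0 then poly p (1/t) * exp (- (1/t)) else 0)"

lemma tendsto_poly_exp: "((\<lambda>s. poly p s * exp (- s)) \<longlongrightarrow> (0::real)) at_top"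
proof -
  have "((\<lambda>s. \<Sum>i\<le>degree p. coeff p i * (s ^ i / exp s)) \<longlongrightarrow> (\<Sum>i\<le>degree p. coeff p i * 0)) at_top"
    by (intro tendsto_intros tendsto_power_div_exp_0)
  moreover have "(\<Sum>i\<le>degree p. coeff p i * (s ^ i / exp s)) = poly p s * exp (- s)" for s
    unfolding poly_altdef sum_distrib_right by (rule sum.cong) (auto simp: exp_minus field_simps)
  ultimately show ?thesis by simp
qed

text \<open>With s = 1/t one has d/dt = - s^2 d/ds, so p(s) exp(-s) is mapped to s^2 (p(s) - p'(s))
  exp(-s).\<close>

lemma flat_deriv: "(flat p has_real_derivative flat (monom 1 2 * (p - pderiv p)) t) (at t)"
proof -
  consider "t > 0" | "t < 0" | "t = 0" by linarith
  then show ?thesis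
  proof cases
    case 1
    have d1: "((\<lambda>t. 1/t) has_real_derivative - (1/t\<^sup>2)) (at t)"
      using 1 by (auto intro!: derivative_eq_intros simp: power2_eq_square)
    have d2: "((\<lambda>t. exp (- (1/t))) has_real_derivative exp (- (1/t)) * - (- (1/t\<^sup>2))) (at t)"
      by (rule DERIV_chain2[OF DERIV_exp DERIV_minus[OF d1]])
    have "((\<lambda>t. poly p (1/t) * exp (- (1/t))) has_real_derivative
        poly (pderiv p) (1/t) * - (1/t\<^sup>2) * exp (- (1/t)) + exp (- (1/t)) * - (- (1/t\<^sup>2)) * poly p (1/t)) (at t)"
      by (rule DERIV_mult[OF DERIV_chain2[OF poly_DERIV d1] d2])
    moreover have "poly (pderiv p) (1/t) * - (1/t\<^sup>2) * exp (- (1/t)) + exp (- (1/t)) * - (- (1/t\<^sup>2)) * poly p (1/t)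
       = flat (monom 1 2 * (p - pderiv p)) t"
      using 1 by (simp add: flat_def poly_monom power_one_over algebra_simps)
    ultimately have "((\<lambda>t. poly p (1/t) * exp (- (1/t))) has_real_derivative flat (monom 1 2 * (p - pderiv p)) t) (at t)"
      by simp
    then show ?thesis
      by (rule DERIV_cong_ev[OF refl _ refl, THEN iffD1, rotated])
        (use 1 in \<open>auto simp: flat_def intro!: eventually_mono[OF eventually_nhds_in_open[of "{0<..}"]]\<close>)
  next
    case 2
    have "((\<lambda>t. 0) has_real_derivative flat (monom 1 2 * (p - pderiv p)) t) (at t)"
      using 2 by (simp add: flat_def)
    then show ?thesis
      by (rule DERIV_cong_ev[OF refl _ refl, THEN iffD1, rotated])
        (use 2 in \<open>auto simp: flat_def intro!: eventually_mono[OF eventually_nhds_in_open[of "{..<0}"]]\<close>)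
  next
    case 3
    have "((\<lambda>h. flat p h / h) \<longlongrightarrow> 0) (at 0)"
    proof (rule filterlim_split_at)
      show "((\<lambda>h. flat p h / h) \<longlongrightarrow> 0) (at_left 0)"
        by (rule tendsto_eventually) (auto simp: eventually_at_filter flat_def)
      \<comment> \<open>Division by \<open>h\<close> multiplies the polynomial by its variable s =
        1/h, so the difference quotient at 0 is again a polynomial in s times exp(-s).\<close>
      have "((\<lambda>h. poly (pCons 0 p) (inverse h) * exp (- inverse h)) \<longlongrightarrow> 0) (at_right (0::real))"
        using filterlim_compose[OF tendsto_poly_exp filterlim_inverse_at_top_right] .
      then show "((\<lambda>h. flat p h / h) \<longlongrightarrow> 0) (at_right 0)"
        by (rule Lim_transform_eventually)
          (auto simp: eventually_at_filter flat_def field_simps)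
    qed
    then show ?thesis using 3 by (simp add: DERIV_def flat_def)
  qed
qed

lemma deriv_closed_flat: "deriv_closed (range flat)"
  unfolding deriv_closed_def using flat_deriv by blast

lemma deriv_closed_trig: "deriv_closed {sin, cos, \<lambda>t. - sin t, \<lambda>t. - cos t}"
proof -
  have "(sin has_real_derivative cos t) (at t)" "(cos has_real_derivative - sin t) (at t)"
    "((\<lambda>t. - sin t) has_real_derivative - cos t) (at t)"
    "((\<lambda>t. - cos t) has_real_derivative sin t) (at t)" for t
    by (auto intro!: derivative_eq_intros)
  note d = this
  have "(\<exists>h'\<in>{sin, cos, \<lambda>t. - sin t, \<lambda>t. - cos t}. \<forall>t. (h has_real_derivative h' t) (at t))"
    if "h \<in> {sin, cos, \<lambda>t. - sin t, \<lambda>t. - cos t}" for h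
  proof -
    consider "h = sin" | "h = cos" | "h = (\<lambda>t. - sin t)" | "h = (\<lambda>t. - cos t)" using \<open>h \<in> _\<close> by blast
    then show ?thesis
    proof cases
      case 1 then show ?thesis using d(1) by (intro bexI[of _ cos]) auto
    next
      case 2 then show ?thesis using d(2) by (intro bexI[of _ "\<lambda>t. - sin t"]) auto
    next
      case 3 then show ?thesis using d(3) by (intro bexI[of _ "\<lambda>t. - cos t"]) auto
    next
      case 4 then show ?thesis using d(4) by (intro bexI[of _ sin]) auto
    qed
  qed
  then show ?thesis unfolding deriv_closed_def by blast
qed

definition smooth :: "(R3 \<Rightarrow> real) \<Rightarrow> bool" where
  "smooth \<phi> \<longleftrightarrow> (\<forall>n. times_differentiable n \<phi>)"

lemma smooth_const: "smooth (\<lambda>x. c)"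
  and smooth_nth: "smooth (\<lambda>x. x $ j)"
  and smooth_add: "smooth f \<Longrightarrow> smooth g \<Longrightarrow> smooth (\<lambda>x. f x + g x)"
  and smooth_mult: "smooth f \<Longrightarrow> smooth g \<Longrightarrow> smooth (\<lambda>x. f x * g x)"
  and smooth_prod: "finite I \<Longrightarrow> (\<And>i. i \<in> I \<Longrightarrow> smooth (F i)) \<Longrightarrow> smooth (\<lambda>x. \<Prod>i\<in>I. F i x)"
  and smooth_sum: "finite I \<Longrightarrow> (\<And>i. i \<in> I \<Longrightarrow> smooth (F i)) \<Longrightarrow> smooth (\<lambda>x. \<Sum>i\<in>I. F i x)"
  and smooth_translate: "smooth f \<Longrightarrow> smooth (\<lambda>x. f (x - y))"
  and smooth_flat: "smooth f \<Longrightarrow> smooth (\<lambda>x. flat p (f x))"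
  and smooth_sin: "smooth f \<Longrightarrow> smooth (\<lambda>x. sin (f x))"
  and smooth_cos: "smooth f \<Longrightarrow> smooth (\<lambda>x. cos (f x))"
  unfolding smooth_def
  using times_differentiable_const times_differentiable_nth times_differentiable_add
    times_differentiable_mult times_differentiable_translate
    times_differentiable_compose[OF deriv_closed_flat] times_differentiable_compose[OF deriv_closed_trig]
  by (auto intro: times_differentiable_prod times_differentiable_sum)

lemma smooth_diff: "smooth f \<Longrightarrow> smooth g \<Longrightarrow> smooth (\<lambda>x. f x - g x)"
  using smooth_add[of f "\<lambda>x. (-1) * g x"] smooth_mult[OF smooth_const[of "-1"], of g] by simp

lemma smooth_partial: "smooth f \<Longrightarrow> smooth (partial i f)"
  unfolding smooth_def by (metis times_differentiable.simps(2))

lemma smooth_differentiable: "smooth f \<Longrightarrow> f differentiable at x"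
  unfolding smooth_def by (metis times_differentiable.simps(2))

lemma smooth_continuous_on: "smooth f \<Longrightarrow> continuous_on A f"
  by (meson smooth_differentiable differentiable_imp_continuous_within continuous_at_imp_continuous_on)

lemma smooth_measurable: "smooth f \<Longrightarrow> f \<in> borel_measurable borel"
  by (rule borel_measurable_continuous_onI) (rule smooth_continuous_on)

lemma test_function_iff: "\<phi> \<in> test_functions \<longleftrightarrow> smooth \<phi> \<and> bounded {x. \<phi> x \<noteq> 0}"
  by (auto simp: test_functions_def smooth_def compact_closure)

lemma test_function_bounded:
  assumes "\<phi> \<in> test_functions"
  obtains B where "\<And>x. \<bar>\<phi> x\<bar> \<le> B" "0 \<le> B"
proof -
  let ?K = "closure {x. \<phi> x \<noteq> 0}"
  have "compact ?K" using assms by (simp add: test_functions_def)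
  moreover have "continuous_on ?K \<phi>" using assms by (auto simp: test_function_iff intro: smooth_continuous_on)
  ultimately have "bounded (\<phi> ` ?K)" by (intro compact_imp_bounded compact_continuous_image)
  then obtain B where B: "\<And>x. x \<in> ?K \<Longrightarrow> \<bar>\<phi> x\<bar> \<le> B" by (auto simp: bounded_iff)
  have "\<bar>\<phi> x\<bar> \<le> max B 0" for x
    using B[of x] closure_subset[of "{x. \<phi> x \<noteq> 0}"] by (cases "\<phi> x = 0") (auto simp: max_def)
  then show ?thesis using that[of "max B 0"] by auto
qed

lemma test_function_support:
  assumes "\<phi> \<in> test_functions"
  obtains R where "\<And>x. norm x > R \<Longrightarrow> \<phi> x = 0" "R > 0"
proof -
  obtain R where "R > 0" "\<forall>x\<in>{x. \<phi> x \<noteq> 0}. norm x \<le> R"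
    using assms by (auto simp: test_function_iff bounded_pos)
  then show thesis using that[of R] by force
qed

lemma test_function_mult:
  "smooth f \<Longrightarrow> \<phi> \<in> test_functions \<Longrightarrow> (\<lambda>x. f x * \<phi> x) \<in> test_functions"
  unfolding test_function_iff by (auto intro: smooth_mult elim!: bounded_subset)

lemma test_function_partial:
  assumes "\<phi> \<in> test_functions" shows "partial i \<phi> \<in> test_functions"
proof -
  obtain R where R: "\<And>x. norm x > R \<Longrightarrow> \<phi> x = 0" using test_function_support[OF assms] by blast
  have "partial i \<phi> x = 0" if "norm x > R" for x
  proof -
    have "((\<lambda>x. 0) has_derivative (\<lambda>h. 0)) (at x)" by simp
    moreover have "open {x::R3. R < norm x}" by (intro open_Collect_less continuous_intros)
    ultimately have "(\<phi> has_derivative (\<lambda>h. 0)) (at x)"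
      by (rule has_derivative_transform_within_open[where s = "{x. R < norm x}"]) (use R that in auto)
    then show ?thesis by (simp add: partial_eqI)
  qed
  then have "bounded {x. partial i \<phi> x \<noteq> 0}" unfolding bounded_iff by (metis mem_Collect_eq not_le)
  then show ?thesis using assms by (simp add: test_function_iff smooth_partial)
qed

lemma test_function_translate:
  assumes "\<phi> \<in> test_functions" shows "(\<lambda>x. \<phi> (x - y)) \<in> test_functions"
proof -
  have "{x. \<phi> (x - y) \<noteq> 0} = (\<lambda>x. y + x) ` {x. \<phi> x \<noteq> 0}"
    by (auto simp: image_iff) (metis add_diff_cancel_left' diff_add_cancel add.commute)
  then show ?thesis using assms by (auto simp: test_function_iff smooth_translate intro: bounded_translation)
qed

text \<open>As \<open>n\<close> grows this tends pointwise to the indicator of the open box, staying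
  between 0 and 1 and vanishing outside. Dominated convergence thus carries identities from test
  functions over to boxes.\<close>

definition box_bump :: "nat \<Rightarrow> R3 \<Rightarrow> R3 \<Rightarrow> R3 \<Rightarrow> real" where
  "box_bump n a b x = (\<Prod>i\<in>UNIV. flat 1 (real n * (x $ i - a $ i)) * flat 1 (real n * (b $ i - x $ i)))"

lemma flat_1: "flat 1 t = (if t > 0 then exp (- (1/t)) else 0)"
  by (simp add: flat_def)

lemma flat_1_bounds: "0 \<le> flat 1 t" "flat 1 t \<le> 1"
  by (auto simp: flat_1)

lemma box_bump_bounds: "0 \<le> box_bump n a b x" "box_bump n a b x \<le> 1"
  unfolding box_bump_def by (auto intro!: prod_nonneg prod_le_1 mult_nonneg_nonneg mult_le_one simp: flat_1_bounds)

lemma box_bump_outside: "x \<notin> box a b \<Longrightarrow> box_bump n a b x = 0"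
proof -
  assume "x \<notin> box a b"
  then obtain i where "x $ i \<le> a $ i \<or> b $ i \<le> x $ i" by (auto simp: mem_box_cart not_less)
  then have "flat 1 (real n * (x $ i - a $ i)) * flat 1 (real n * (b $ i - x $ i)) = 0"
    by (auto simp: flat_1 zero_less_mult_iff)
  then show ?thesis unfolding box_bump_def by (intro prod_zero) auto
qed

lemma box_bump_tendsto: "(\<lambda>n. box_bump n a b x) \<longlonglongrightarrow> indicator (box a b) x"
proof (cases "x \<in> box a b")
  case True
  have lim: "(\<lambda>n. flat 1 (real n * c)) \<longlonglongrightarrow> 1" if "c > 0" for c
  proof -
    have "(\<lambda>n. exp (- (1 / (real n * c)))) \<longlonglongrightarrow> exp (- 0)"
      using that by (intro tendsto_intros) real_asymp
    then have "(\<lambda>n. exp (- (1 / (real n * c)))) \<longlonglongrightarrow> 1" by simp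
    then show ?thesis
      by (rule Lim_transform_eventually)
        (use that in \<open>auto simp: flat_1 intro!: eventually_sequentiallyI[of 1]\<close>)
  qed
  have "(\<lambda>n. box_bump n a b x) \<longlonglongrightarrow> (\<Prod>i\<in>(UNIV::3 set). 1 * 1)"
    unfolding box_bump_def using True by (intro tendsto_prod tendsto_mult lim) (auto simp: mem_box_cart)
  then show ?thesis using True by simp
next
  case False
  then show ?thesis by (simp add: box_bump_outside)
qed

lemma box_bump_test: "box_bump n a b \<in> test_functions"
proof -
  have "bounded {x. box_bump n a b x \<noteq> 0}"
    by (rule bounded_subset[OF bounded_box[of a b]]) (use box_bump_outside in blast)
  moreover have "smooth (\<lambda>x. flat 1 (real n * (x $ i - a $ i)) * flat 1 (real n * (b $ i - x $ i)))" for i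
  proof -
    have "smooth (\<lambda>x. real n * (x $ i - a $ i))" "smooth (\<lambda>x. real n * (b $ i - x $ i))"
      by (intro smooth_mult smooth_diff smooth_const smooth_nth)+
    then show ?thesis by (intro smooth_mult[OF smooth_flat smooth_flat])
  qed
  then have "smooth (box_bump n a b)" unfolding box_bump_def by (intro smooth_prod) auto
  ultimately show ?thesis by (simp add: test_function_iff)
qed


section \<open>Weak gradients\<close>

lemma box_subset_cball_cart: "\<exists>R. box a b \<subseteq> cball (0::R3) R"
proof -
  obtain R where "\<forall>x\<in>box a b. norm x \<le> R" using bounded_box[of a b] by (auto simp: bounded_iff)
  then show ?thesis by (intro exI[of _ R]) auto
qed

text \<open>Bumps converge to indicators of boxes, so the integral of \<open>g\<close> over every
  box vanishes. On a large box the densities given by the positive and the negative part of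
  \<open>g\<close> are then finite measures that agree on boxes, hence equal, because boxes are
  closed under intersection and generate the Borel sets.\<close>

lemma AE_zero_of_test_functions_real:
  fixes g :: "R3 \<Rightarrow> real"
  assumes [measurable]: "g \<in> borel_measurable borel"
    and int: "\<And>R. integrable lborel (\<lambda>x. indicator (cball 0 R) x * g x)"
    and zero: "\<And>\<phi>. \<phi> \<in> test_functions \<Longrightarrow> (\<integral>x. \<phi> x * g x \<partial>lborel) = 0"
  shows "AE x in lborel. g x = 0"
proof -
  have box0: "(\<integral>x. indicator (box a b) x * g x \<partial>lborel) = 0" for a b
  proof -
    obtain R where R: "box a b \<subseteq> cball 0 R" using box_subset_cball_cart by blast
    have m[measurable]: "box_bump n a b \<in> borel_measurable borel" for n
      using box_bump_test test_function_iff smooth_measurable by blast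
    have "(\<lambda>n. \<integral>x. box_bump n a b x * g x \<partial>lborel) \<longlonglongrightarrow> (\<integral>x. indicator (box a b) x * g x \<partial>lborel)"
    proof (rule integral_dominated_convergence)
      show "integrable lborel (\<lambda>x. norm (indicator (cball 0 R) x * g x))" using int by (rule integrable_norm)
      show "AE x in lborel. (\<lambda>n. box_bump n a b x * g x) \<longlonglongrightarrow> indicator (box a b) x * g x"
        by (intro AE_I2 tendsto_intros box_bump_tendsto)
      show "AE x in lborel. norm (box_bump n a b x * g x) \<le> norm (indicator (cball 0 R) x * g x)" for n
      proof (rule AE_I2)
        fix x
        show "norm (box_bump n a b x * g x) \<le> norm (indicator (cball 0 R) x * g x)"
        proof (cases "x \<in> box a b")
          case True
          then have "x \<in> cball 0 R" using R by blast
          then show ?thesis using box_bump_bounds[of n a b x] by (simp add: abs_mult mult_left_le_one_le)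
        qed (simp add: box_bump_outside)
      qed
    qed measurable
    moreover have "(\<integral>x. box_bump n a b x * g x \<partial>lborel) = 0" for n
      by (rule zero) (rule box_bump_test)
    ultimately show ?thesis by (simp add: LIMSEQ_const_iff)
  qed
  have AEN: "AE x in lborel. indicator (box (- (real N *\<^sub>R One)) (real N *\<^sub>R One)) x * g x = 0" for N
  proof -
    let ?K = "box (- (real N *\<^sub>R One)) (real N *\<^sub>R One) :: R3 set"
    define h where "h x = indicator ?K x * g x" for x
    have hm[measurable]: "h \<in> borel_measurable borel" unfolding h_def[abs_def] by measurable
    obtain R where R: "?K \<subseteq> cball 0 R" using box_subset_cball_cart by blast
    have hint: "integrable lborel h"
      by (rule Bochner_Integration.integrable_bound[OF int[of R]])
        (use R in \<open>auto simp: h_def indicator_def intro!: AE_I2\<close>)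
    have em: "emeasure (density lborel (\<lambda>x. ennreal (max (s * h x) 0))) X
       = ennreal (\<integral>x. max (s * h x) 0 * indicator X x \<partial>lborel)" if [measurable]: "X \<in> sets borel" for X s
    proof -
      have i: "integrable lborel (\<lambda>x. max (s * h x) 0 * indicator X x)"
        by (rule Bochner_Integration.integrable_bound[of lborel "\<lambda>x. s * h x"])
          (use hint in \<open>auto simp: indicator_def\<close>)
      have "emeasure (density lborel (\<lambda>x. ennreal (max (s * h x) 0))) X
        = (\<integral>\<^sup>+x. ennreal (max (s * h x) 0) * indicator X x \<partial>lborel)"
        by (rule emeasure_density) auto
      also have "\<dots> = (\<integral>\<^sup>+x. ennreal (max (s * h x) 0 * indicator X x) \<partial>lborel)"
        by (rule nn_integral_cong) (auto simp: indicator_def)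
      also have "\<dots> = ennreal (\<integral>x. max (s * h x) 0 * indicator X x \<partial>lborel)"
        by (rule nn_integral_eq_integral[OF i]) (auto simp: indicator_def)
      finally show ?thesis .
    qed
    have i: "integrable lborel (\<lambda>x. max (s * h x) 0 * indicator X x)" if [measurable]: "X \<in> sets borel" for X s
        by (rule Bochner_Integration.integrable_bound[of lborel "\<lambda>x. s * h x"])
          (use hint in \<open>auto simp: indicator_def\<close>)
    let ?E = "range (\<lambda>(a, b). box a b::R3 set)"
    let ?A = "\<lambda>n::nat. box (- (real n *\<^sub>R One)) (real n *\<^sub>R One) :: R3 set"
    have "density lborel (\<lambda>x. ennreal (max (1 * h x) 0)) = density lborel (\<lambda>x. ennreal (max ((-1) * h x) 0))"
    proof (rule measure_eqI_generator_eq)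
      show "Int_stable ?E" by (auto simp: Int_stable_def box_Int_box)
      show "?E \<subseteq> Pow UNIV" "sets (density lborel (\<lambda>x. ennreal (max (1 * h x) 0))) = sigma_sets UNIV ?E"
        "sets (density lborel (\<lambda>x. ennreal (max ((-1) * h x) 0))) = sigma_sets UNIV ?E"
        by (simp_all add: borel_eq_box)
      show "range ?A \<subseteq> ?E" "(\<Union>i. ?A i) = UNIV" unfolding UN_box_eq_UNIV by auto
      show "emeasure (density lborel (\<lambda>x. ennreal (max (1 * h x) 0))) (?A i) \<noteq> \<infinity>" for i
        by (subst em) auto
      fix X assume "X \<in> ?E"
      then obtain a b where X: "X = box a b" by auto
      have Xb: "X \<in> sets borel" unfolding X by simp
      obtain c d where cd: "?K \<inter> box a b = box c d" using box_Int_box by blast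
      have "(\<integral>x. max (1 * h x) 0 * indicator X x \<partial>lborel) - (\<integral>x. max ((-1) * h x) 0 * indicator X x \<partial>lborel)
        = (\<integral>x. max (1 * h x) 0 * indicator X x - max ((-1) * h x) 0 * indicator X x \<partial>lborel)"
        by (rule Bochner_Integration.integral_diff[symmetric]) (intro i Xb)+
      also have "\<dots> = (\<integral>x. indicator (box c d) x * g x \<partial>lborel)"
        by (rule Bochner_Integration.integral_cong)
          (auto simp: X h_def cd[symmetric] indicator_def max_def)
      also have "\<dots> = 0" by (rule box0)
      finally show "emeasure (density lborel (\<lambda>x. ennreal (max (1 * h x) 0))) X =
         emeasure (density lborel (\<lambda>x. ennreal (max ((-1) * h x) 0))) X"
        by (simp only: em[OF Xb]) simp
    qed
    then have "AE x in lborel. ennreal (max (1 * h x) 0) = ennreal (max ((-1) * h x) 0)"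
      by (intro sigma_finite_measure.density_unique[OF sigma_finite_lborel]) auto
    then have "AE x in lborel. h x = 0"
      by eventually_elim (auto simp: max_def split: if_splits)
    then show ?thesis by (simp add: h_def)
  qed
  have "AE x in lborel. \<forall>N::nat. indicator (box (- (real N *\<^sub>R One)) (real N *\<^sub>R One)) x * g x = 0"
    unfolding AE_all_countable using AEN by blast
  then show ?thesis
  proof eventually_elim
    case (elim x)
    obtain N :: nat where "x \<in> box (- (real N *\<^sub>R One)) (real N *\<^sub>R One)"
      using UN_box_eq_UNIV by blast
    then show ?case using elim[rule_format, of N] by simp
  qed
qed

lemma sets_lebesgue_cball: "cball (a::R3) r \<in> sets lebesgue"
  by simp

lemma borel_measurable_cball_scaleR:
  fixes f :: "R3 \<Rightarrow> 'b::euclidean_space"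
  assumes "f \<in> borel_measurable lebesgue"
  shows "(\<lambda>x. indicator (cball a r) x *\<^sub>R f x) \<in> borel_measurable lebesgue"
  using borel_measurable_indicator[OF sets_lebesgue_cball] assms by (rule borel_measurable_scaleR)

definition loc_integrable :: "(R3 \<Rightarrow> 'b::euclidean_space) \<Rightarrow> bool" where
  "loc_integrable f \<longleftrightarrow> f \<in> borel_measurable lebesgue \<and> (\<forall>R. integrable lebesgue (\<lambda>x. indicator (cball 0 R) x *\<^sub>R f x))"

lemma indicator_finite_L2:
  assumes "A \<in> sets lebesgue" "emeasure lebesgue A < \<infinity>"
  shows "(indicator A :: R3 \<Rightarrow> real) \<in> L2"
proof -
  have "(\<lambda>x. (norm (indicator A x :: real))\<^sup>2) = indicator A" by (auto simp: indicator_def)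
  then show ?thesis using assms by (simp add: L2_def integrable_indicator_iff)
qed

lemma emeasure_lebesgue_cball: "emeasure lebesgue (cball (0::R3) R) < \<infinity>"
  using emeasure_lborel_cball_finite[of "0::R3" R] by simp

lemma L2_loc_integrable:
  fixes f :: "R3 \<Rightarrow> 'b::euclidean_space"
  assumes "f \<in> L2" shows "loc_integrable f"
  unfolding loc_integrable_def
proof (intro conjI allI)
  fix R
  have "(indicator (cball 0 R) :: R3 \<Rightarrow> real) \<in> L2"
    by (rule indicator_finite_L2[OF _ emeasure_lebesgue_cball]) simp
  from this assms show "integrable lebesgue (\<lambda>x. indicator (cball 0 R) x *\<^sub>R f x)"
    by (rule L2_integrable_bilinear) (use borel_measurable_cball_scaleR[OF L2D(1)[OF assms]] in auto)
qed (use assms L2D in auto)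

lemma test_measurable: "\<phi> \<in> test_functions \<Longrightarrow> \<phi> \<in> borel_measurable borel"
  by (simp add: test_function_iff smooth_measurable)

lemma loc_integrable_test:
  fixes f :: "R3 \<Rightarrow> 'b::euclidean_space"
  assumes "loc_integrable f" "\<phi> \<in> test_functions"
  shows "integrable lebesgue (\<lambda>x. \<phi> x *\<^sub>R f x)"
proof -
  obtain R where R: "\<And>x. norm x > R \<Longrightarrow> \<phi> x = 0" using test_function_support[OF assms(2)] by blast
  obtain B where B: "\<And>x. \<bar>\<phi> x\<bar> \<le> B" "0 \<le> B" using test_function_bounded[OF assms(2)] by blast
  have [measurable]: "f \<in> borel_measurable lebesgue" "\<phi> \<in> borel_measurable lebesgue"
    using assms borel_measurable_lebesgueI[OF test_measurable] by (auto simp: loc_integrable_def)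
  show ?thesis
  proof (rule Bochner_Integration.integrable_bound)
    show "integrable lebesgue (\<lambda>x. B *\<^sub>R (indicator (cball 0 R) x *\<^sub>R f x))"
      using assms(1) by (auto simp: loc_integrable_def simp del: scaleR_scaleR)
    show "AE x in lebesgue. norm (\<phi> x *\<^sub>R f x) \<le> norm (B *\<^sub>R (indicator (cball 0 R) x *\<^sub>R f x))"
      using B R by (intro AE_I2) (auto simp: indicator_def intro: mult_right_mono)
  qed measurable
qed

theorem AE_zero_of_test_functions:
  fixes f :: "R3 \<Rightarrow> 'b::euclidean_space"
  assumes f: "loc_integrable f"
    and zero: "\<And>\<phi>. \<phi> \<in> test_functions \<Longrightarrow> (\<integral>x. \<phi> x *\<^sub>R f x \<partial>lebesgue) = 0"
  shows "AE x in lebesgue. f x = 0"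
proof -
  have fm[measurable]: "f \<in> borel_measurable lebesgue" using f by (simp add: loc_integrable_def)
  have "AE x in lebesgue. f x \<bullet> b = 0" for b
  proof -
    have "(\<lambda>x. f x \<bullet> b) \<in> borel_measurable lebesgue" by measurable
    then obtain g where g[measurable]: "g \<in> borel_measurable borel" and ae: "AE x in lebesgue. f x \<bullet> b = g x"
      using completion_ex_borel_measurable_real[of "\<lambda>x. f x \<bullet> b" lborel] by (auto simp: AE_lebesgue_iff)
    have gm[measurable]: "g \<in> borel_measurable lebesgue" using g by (rule borel_measurable_lebesgueI)
    have "AE x in lborel. g x = 0"
    proof (rule AE_zero_of_test_functions_real)
      fix R
      have "integrable lebesgue (\<lambda>x. (indicator (cball 0 R) x *\<^sub>R f x) \<bullet> b)"
        using f by (intro integrable_inner_left) (auto simp: loc_integrable_def)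
      moreover have "AE x in lebesgue. (indicator (cball 0 R) x *\<^sub>R f x) \<bullet> b = indicator (cball 0 R) x * g x"
        using ae by eventually_elim simp
      moreover have "(\<lambda>x. indicator (cball 0 R) x * g x) \<in> borel_measurable lebesgue"
        using borel_measurable_cball_scaleR[OF gm] by simp
      ultimately have "integrable lebesgue (\<lambda>x. indicator (cball 0 R) x * g x)"
        by (blast intro: integrable_cong_AE_imp)
      then show "integrable lborel (\<lambda>x. indicator (cball 0 R) x * g x)"
        by (subst (asm) integrable_completion) (auto intro!: borel_measurable_times borel_measurable_indicator g)
    next
      fix \<phi> :: "R3 \<Rightarrow> real" assume \<phi>: "\<phi> \<in> test_functions"
      have [measurable]: "\<phi> \<in> borel_measurable borel" "\<phi> \<in> borel_measurable lebesgue"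
        using \<phi> test_measurable borel_measurable_lebesgueI by blast+
      have "(\<integral>x. \<phi> x * g x \<partial>lborel) = (\<integral>x. \<phi> x * g x \<partial>lebesgue)"
        by (rule integral_completion[symmetric]) measurable
      also have "\<dots> = (\<integral>x. (\<phi> x *\<^sub>R f x) \<bullet> b \<partial>lebesgue)"
        by (rule integral_cong_AE) (use ae in \<open>auto elim!: eventually_mono\<close>)
      also have "\<dots> = (\<integral>x. \<phi> x *\<^sub>R f x \<partial>lebesgue) \<bullet> b"
        by (rule integral_inner_left) (rule loc_integrable_test[OF f \<phi>])
      finally show "(\<integral>x. \<phi> x * g x \<partial>lborel) = 0" using zero[OF \<phi>] by simp
    qed measurable
    then show ?thesis using ae by (auto simp: AE_lebesgue_iff)
  qed
  then have "AE x in lebesgue. \<forall>b\<in>Basis. f x \<bullet> b = 0" by (intro AE_finite_allI) auto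
  then show ?thesis by eventually_elim (simp add: euclidean_all_zero_iff)
qed

section \<open>Calculus of weak gradients\<close>

lemma borel_measurable_vec_nth:
  fixes f :: "'a \<Rightarrow> complex ^ 3"
  shows "f \<in> borel_measurable M \<Longrightarrow> (\<lambda>x. f x $ i) \<in> borel_measurable M"
  by (rule borel_measurable_continuous_on[OF linear_continuous_on[OF bounded_linear_vec_nth]])

lemma borel_measurable_vec_lambda:
  fixes g :: "3 \<Rightarrow> 'a \<Rightarrow> complex"
  assumes "\<And>i. g i \<in> borel_measurable M"
  shows "(\<lambda>x. \<chi> i. g i x) \<in> borel_measurable M"
proof (subst borel_measurable_euclidean_space, intro ballI)
  fix b :: "complex ^ 3" assume "b \<in> Basis"
  then obtain i c where b: "b = axis i c" by (auto simp: Basis_vec_def)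
  show "(\<lambda>x. (\<chi> i. g i x) \<bullet> b) \<in> borel_measurable M"
    unfolding b inner_axis using assms[of i] by simp
qed

lemma norm_vec_power2: "(norm (v :: complex ^ 3))\<^sup>2 = (\<Sum>i\<in>UNIV. (norm (v $ i))\<^sup>2)"
  by (simp add: power2_norm_eq_inner inner_vec_def)

lemma L2_vec_nth: "(G :: R3 \<Rightarrow> complex ^ 3) \<in> L2 \<Longrightarrow> (\<lambda>x. G x $ i) \<in> L2"
  by (rule L2_dominated[where c = 1]) (use borel_measurable_vec_nth[OF L2D(1)] in \<open>auto simp: Finite_Cartesian_Product.norm_nth_le\<close>)

lemma L2_vec_lambda:
  fixes g :: "3 \<Rightarrow> R3 \<Rightarrow> complex"
  assumes "\<And>i. g i \<in> L2" shows "(\<lambda>x. \<chi> i. g i x) \<in> L2"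
proof (rule L2I_bound)
  show "integrable lebesgue (\<lambda>x. \<Sum>i\<in>UNIV. (norm (g i x))\<^sup>2)"
    using L2D(2)[OF assms] by (intro Bochner_Integration.integrable_sum)
qed (use L2D(1)[OF assms] in \<open>auto intro: borel_measurable_vec_lambda simp: norm_vec_power2\<close>)

lemma L2_mult_integral_bound:
  fixes f g :: "R3 \<Rightarrow> complex"
  assumes "f \<in> L2" "g \<in> L2"
  shows "norm (\<integral>x. f x * g x \<partial>lebesgue) \<le> L2_norm f * L2_norm g"
proof -
  have n: "(\<lambda>x. norm (f x)) \<in> L2" "(\<lambda>x. norm (g x)) \<in> L2"
    using assms by (auto simp: L2_def)
  have "norm (\<integral>x. f x * g x \<partial>lebesgue) \<le> (\<integral>x. norm (f x * g x) \<partial>lebesgue)"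
    by (rule integral_norm_bound)
  also have "\<dots> = ip (\<lambda>x. norm (f x)) (\<lambda>x. norm (g x))" by (simp add: ip_def norm_mult)
  also have "\<dots> \<le> L2_norm (\<lambda>x. norm (f x)) * L2_norm (\<lambda>x. norm (g x))" using ip_le[OF n] by linarith
  finally show ?thesis by (simp add: L2_norm_def)
qed

lemma test_function_L2:
  assumes "\<phi> \<in> test_functions" shows "(\<lambda>x. complex_of_real (\<phi> x)) \<in> L2"
proof -
  obtain R where R: "\<And>x. norm x > R \<Longrightarrow> \<phi> x = 0" using test_function_support[OF assms] by blast
  obtain B where B: "\<And>x. \<bar>\<phi> x\<bar> \<le> B" "0 \<le> B" using test_function_bounded[OF assms] by blast
  have [measurable]: "\<phi> \<in> borel_measurable lebesgue"
    using assms borel_measurable_lebesgueI[OF test_measurable] by auto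
  have "(indicator (cball 0 R) :: R3 \<Rightarrow> real) \<in> L2"
    by (rule indicator_finite_L2[OF _ emeasure_lebesgue_cball]) simp
  then show ?thesis
    by (rule L2_dominated[where c = B]) (use B R in \<open>auto simp: indicator_def\<close>)
qed

text \<open>A relation instead of the chosen representative \<open>weak_grad\<close>, so that
  explicit gradients can be handed around. Membership in \<open>L2\<close> ensures that the
  integrals in \<open>has_weak_gradient\<close> converge and are not default values.\<close>

definition wgrad :: "(R3 \<Rightarrow> complex) \<Rightarrow> (R3 \<Rightarrow> complex ^ 3) \<Rightarrow> bool" where
  "wgrad u G \<longleftrightarrow> u \<in> L2 \<and> G \<in> L2 \<and> has_weak_gradient u G"

lemma wgradD:
  assumes "wgrad u G" shows "u \<in> L2" "G \<in> L2"
    "\<phi> \<in> test_functions \<Longrightarrow> (\<integral>x. u x * complex_of_real (partial i \<phi> x) \<partial>lebesgue) =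
        - (\<integral>x. G x $ i * complex_of_real (\<phi> x) \<partial>lebesgue)"
  using assms by (auto simp: wgrad_def has_weak_gradient_def)

lemma wgrad_unique:
  assumes "wgrad u G" "wgrad u G'" shows "AE x in lebesgue. G x = G' x"
proof -
  have "AE x in lebesgue. G x $ i - G' x $ i = 0" for i
  proof (rule AE_zero_of_test_functions)
    have L: "(\<lambda>x. G x $ i) \<in> L2" "(\<lambda>x. G' x $ i) \<in> L2" using assms by (auto dest!: wgradD(2) intro: L2_vec_nth)
    then show "loc_integrable (\<lambda>x. G x $ i - G' x $ i)" by (intro L2_loc_integrable L2_diff)
    fix \<phi> :: "R3 \<Rightarrow> real" assume \<phi>: "\<phi> \<in> test_functions"
    have "(\<integral>x. \<phi> x *\<^sub>R (G x $ i - G' x $ i) \<partial>lebesgue) =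
      (\<integral>x. G x $ i * complex_of_real (\<phi> x) - G' x $ i * complex_of_real (\<phi> x) \<partial>lebesgue)"
      by (rule Bochner_Integration.integral_cong) (auto simp: scaleR_conv_of_real algebra_simps)
    also have "\<dots> = 0"
      using L[THEN L2_integrable_mult, OF test_function_L2[OF \<phi>]] wgradD(3)[OF assms(1) \<phi>, of i] wgradD(3)[OF assms(2) \<phi>, of i]
      by simp
    finally show "(\<integral>x. \<phi> x *\<^sub>R (G x $ i - G' x $ i) \<partial>lebesgue) = 0" .
  qed
  then have "AE x in lebesgue. \<forall>i\<in>UNIV. G x $ i - G' x $ i = 0" by (intro AE_finite_allI) auto
  then show ?thesis by eventually_elim (simp add: vec_eq_iff)
qed

lemma wgrad_weak_grad: "u \<in> H1 \<Longrightarrow> wgrad u (weak_grad u)"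
proof -
  assume u: "u \<in> H1"
  then have "\<exists>G. G \<in> L2 \<and> has_weak_gradient u G" by (auto simp: H1_def)
  from someI_ex[OF this] show ?thesis using u unfolding wgrad_def weak_grad_def H1_def by blast
qed

lemma wgrad_H1: "wgrad u G \<Longrightarrow> u \<in> H1"
  unfolding H1_def wgrad_def by auto

lemma wgrad_AE: "wgrad u G \<Longrightarrow> AE x in lebesgue. weak_grad u x = G x"
  using wgrad_unique wgrad_weak_grad wgrad_H1 by blast

lemma wgrad_sqn: "wgrad u G \<Longrightarrow> sqn (weak_grad u) = sqn G"
  using wgrad_AE wgradD(2) wgrad_weak_grad wgrad_H1 by (intro sqn_cong_AE) (blast dest: L2D)+

lemma wgrad_cong_AE:
  assumes "wgrad u G" "u' \<in> borel_measurable lebesgue" "G' \<in> borel_measurable lebesgue"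
    and ae: "AE x in lebesgue. u x = u' x" "AE x in lebesgue. G x = G' x"
  shows "wgrad u' G'"
  unfolding wgrad_def has_weak_gradient_def
proof (intro conjI ballI allI)
  show u': "u' \<in> L2" and G': "G' \<in> L2" using L2_cong_AE wgradD[OF assms(1)] assms by blast+
  fix \<phi> i assume \<phi>: "\<phi> \<in> test_functions"
  have [measurable]: "\<phi> \<in> borel_measurable lebesgue" "partial i \<phi> \<in> borel_measurable lebesgue"
    "u \<in> borel_measurable lebesgue" "(\<lambda>x. G x $ i) \<in> borel_measurable lebesgue" "(\<lambda>x. G' x $ i) \<in> borel_measurable lebesgue"
    using \<phi> borel_measurable_lebesgueI[OF test_measurable] test_function_partial wgradD[OF assms(1)] assms
    by (auto dest: L2D intro: borel_measurable_vec_nth)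
  note assms(2)[measurable]
  have "(\<integral>x. u' x * complex_of_real (partial i \<phi> x) \<partial>lebesgue) = (\<integral>x. u x * complex_of_real (partial i \<phi> x) \<partial>lebesgue)"
    by (rule integral_cong_AE) (use ae(1) in \<open>auto elim!: eventually_mono\<close>)
  also have "\<dots> = - (\<integral>x. G x $ i * complex_of_real (\<phi> x) \<partial>lebesgue)" by (rule wgradD(3)[OF assms(1) \<phi>])
  also have "(\<integral>x. G x $ i * complex_of_real (\<phi> x) \<partial>lebesgue) = (\<integral>x. G' x $ i * complex_of_real (\<phi> x) \<partial>lebesgue)"
    by (rule integral_cong_AE) (use ae(2) in \<open>auto elim!: eventually_mono\<close>)
  finally show "(\<integral>x. u' x * complex_of_real (partial i \<phi> x) \<partial>lebesgue) = - (\<integral>x. G' x $ i * complex_of_real (\<phi> x) \<partial>lebesgue)" .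
qed

lemma wgrad_add:
  assumes "wgrad u G" "wgrad v F" shows "wgrad (\<lambda>x. u x + v x) (\<lambda>x. G x + F x)"
  unfolding wgrad_def has_weak_gradient_def
proof (intro conjI ballI allI)
  fix \<phi> i assume \<phi>: "\<phi> \<in> test_functions"
  note L = wgradD(1,2)[OF assms(1)] wgradD(1,2)[OF assms(2)]
  note I = L2_integrable_mult[OF L(1) test_function_L2[OF test_function_partial[OF \<phi>]]]
    L2_integrable_mult[OF L(3) test_function_L2[OF test_function_partial[OF \<phi>]]]
    L2_integrable_mult[OF L2_vec_nth[OF L(2)] test_function_L2[OF \<phi>]]
    L2_integrable_mult[OF L2_vec_nth[OF L(4)] test_function_L2[OF \<phi>]]
  show "(\<integral>x. (u x + v x) * complex_of_real (partial i \<phi> x) \<partial>lebesgue) = - (\<integral>x. (G x + F x) $ i * complex_of_real (\<phi> x) \<partial>lebesgue)"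
    using I wgradD(3)[OF assms(1) \<phi>] wgradD(3)[OF assms(2) \<phi>] by (simp add: distrib_right)
qed (use assms in \<open>auto intro: L2_add dest: wgradD\<close>)

lemma L2_vec_scale: "G \<in> L2 \<Longrightarrow> (\<lambda>x. c *s (G x :: complex ^ 3)) \<in> L2"
proof -
  assume G: "G \<in> L2"
  have "(\<lambda>x. \<chi> i. c * G x $ i) \<in> L2" by (intro L2_vec_lambda L2_cmult L2_vec_nth G)
  then show ?thesis by (simp add: vector_scalar_mult_def)
qed

lemma wgrad_cmult:
  assumes "wgrad u G" shows "wgrad (\<lambda>x. c * u x) (\<lambda>x. c *s G x)"
  unfolding wgrad_def has_weak_gradient_def
proof (intro conjI ballI allI)
  fix \<phi> i assume \<phi>: "\<phi> \<in> test_functions"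
  show "(\<integral>x. c * u x * complex_of_real (partial i \<phi> x) \<partial>lebesgue) = - (\<integral>x. (c *s G x) $ i * complex_of_real (\<phi> x) \<partial>lebesgue)"
    using wgradD(3)[OF assms \<phi>, of i] by (simp add: mult.assoc)
qed (use assms in \<open>auto intro: L2_cmult L2_vec_scale dest: wgradD\<close>)

lemma wgrad_diff:
  assumes "wgrad u G" "wgrad v F" shows "wgrad (\<lambda>x. u x - v x) (\<lambda>x. G x - F x)"
  using wgrad_add[OF assms(1) wgrad_cmult[OF assms(2), of "-1"]] by simp

text \<open>The gradient is a closed operator: tested with a fixed function, both sides of its
  defining identity are continuous in \<open>L2\<close>.\<close>

lemma wgrad_limit:
  assumes w: "\<And>n. wgrad (u n) (G n)" and "u' \<in> L2" "G' \<in> L2"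
    and lim: "(\<lambda>n. sqn (\<lambda>x. u n x - u' x)) \<longlonglongrightarrow> 0" "(\<lambda>n. sqn (\<lambda>x. G n x - G' x)) \<longlonglongrightarrow> 0"
  shows "wgrad u' G'"
  unfolding wgrad_def has_weak_gradient_def
proof (intro conjI ballI allI)
  fix \<phi> i assume \<phi>: "\<phi> \<in> test_functions"
  have conv: "(\<lambda>n. \<integral>x. f n x * complex_of_real (\<psi> x) \<partial>lebesgue) \<longlonglongrightarrow> (\<integral>x. f' x * complex_of_real (\<psi> x) \<partial>lebesgue)"
    if f: "\<And>n. f n \<in> L2" "f' \<in> L2" "(\<lambda>n. sqn (\<lambda>x. f n x - f' x)) \<longlonglongrightarrow> 0" and \<psi>: "\<psi> \<in> test_functions" for f f' and \<psi> :: "R3 \<Rightarrow> real"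
  proof (rule LIM_zero_cancel, rule Lim_null_comparison)
    show "(\<lambda>n. L2_norm (\<lambda>x. f n x - f' x) * L2_norm (\<lambda>x. complex_of_real (\<psi> x))) \<longlonglongrightarrow> 0"
      using tendsto_mult_right[OF tendsto_real_sqrt[OF f(3)]] by (simp add: L2_norm_sqrt tendsto_mult_left_zero)
    show "\<forall>\<^sub>F n in sequentially. norm ((\<integral>x. f n x * complex_of_real (\<psi> x) \<partial>lebesgue) - (\<integral>x. f' x * complex_of_real (\<psi> x) \<partial>lebesgue))
      \<le> L2_norm (\<lambda>x. f n x - f' x) * L2_norm (\<lambda>x. complex_of_real (\<psi> x))"
    proof (intro always_eventually allI)
      fix n
      have "(\<integral>x. f n x * complex_of_real (\<psi> x) \<partial>lebesgue) - (\<integral>x. f' x * complex_of_real (\<psi> x) \<partial>lebesgue)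
        = (\<integral>x. (f n x - f' x) * complex_of_real (\<psi> x) \<partial>lebesgue)"
        using L2_integrable_mult[OF f(1) test_function_L2[OF \<psi>]] L2_integrable_mult[OF f(2) test_function_L2[OF \<psi>]]
        by (simp add: left_diff_distrib)
      then show "norm ((\<integral>x. f n x * complex_of_real (\<psi> x) \<partial>lebesgue) - (\<integral>x. f' x * complex_of_real (\<psi> x) \<partial>lebesgue))
      \<le> L2_norm (\<lambda>x. f n x - f' x) * L2_norm (\<lambda>x. complex_of_real (\<psi> x))"
        using L2_mult_integral_bound[OF L2_diff[OF f(1)[of n] f(2)] test_function_L2[OF \<psi>]] by simp
    qed
  qed
  have Gi: "(\<lambda>n. sqn (\<lambda>x. G n x $ i - G' x $ i)) \<longlonglongrightarrow> 0"
  proof (rule tendsto_sandwich[OF _ _ tendsto_const lim(2)])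
    have "sqn (\<lambda>x. G n x $ i - G' x $ i) \<le> sqn (\<lambda>x. G n x - G' x)" for n
    proof -
      have L: "(\<lambda>x. G n x - G' x) \<in> L2" using wgradD(2)[OF w] assms(3) by (intro L2_diff)
      have "AE x in lebesgue. norm ((G n x - G' x) $ i) \<le> norm (G n x - G' x)"
        by (intro AE_I2 Finite_Cartesian_Product.norm_nth_le)
      then show ?thesis
        using sqn_mono[OF L L2D(1)[OF L2_vec_nth[OF L]], of i] by simp
    qed
    then show "\<forall>\<^sub>F n in sequentially. sqn (\<lambda>x. G n x $ i - G' x $ i) \<le> sqn (\<lambda>x. G n x - G' x)" by simp
  qed simp
  have 1: "(\<lambda>n. \<integral>x. u n x * complex_of_real (partial i \<phi> x) \<partial>lebesgue) \<longlonglongrightarrow> (\<integral>x. u' x * complex_of_real (partial i \<phi> x) \<partial>lebesgue)"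
    by (rule conv) (use w assms lim \<phi> in \<open>auto dest: wgradD intro: test_function_partial\<close>)
  have 2: "(\<lambda>n. - (\<integral>x. G n x $ i * complex_of_real (\<phi> x) \<partial>lebesgue)) \<longlonglongrightarrow> - (\<integral>x. G' x $ i * complex_of_real (\<phi> x) \<partial>lebesgue)"
    by (rule tendsto_minus, rule conv) (use w assms Gi \<phi> in \<open>auto dest: wgradD intro: L2_vec_nth\<close>)
  show "(\<integral>x. u' x * complex_of_real (partial i \<phi> x) \<partial>lebesgue) = - (\<integral>x. G' x $ i * complex_of_real (\<phi> x) \<partial>lebesgue)"
    by (rule LIMSEQ_unique[OF 1]) (use 2 wgradD(3)[OF w \<phi>] in simp)
qed fact+

text \<open>The gradient of \<open>u\<close> is tested with the product of \<theta> and \<phi>; the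
  classical product rule for this test function becomes the weak one for the product of \<theta> and
  \<open>u\<close>.\<close>

lemma wgrad_smooth_mult:
  assumes w: "wgrad u G" and \<theta>: "smooth \<theta>" and B: "\<And>x. \<bar>\<theta> x\<bar> \<le> B" "\<And>i x. \<bar>partial i \<theta> x\<bar> \<le> B"
  shows "wgrad (\<lambda>x. complex_of_real (\<theta> x) * u x) (\<lambda>x. \<chi> i. complex_of_real (\<theta> x) * G x $ i + complex_of_real (partial i \<theta> x) * u x)"
proof -
  have bm: "(\<lambda>x. complex_of_real (h x) * f x) \<in> L2" if "f \<in> L2" "smooth h" "\<And>x. \<bar>h x\<bar> \<le> B" for f h
  proof (rule L2_dominated[OF that(1), where c = B])
    have [measurable]: "f \<in> borel_measurable lebesgue" "h \<in> borel_measurable lebesgue"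
      using that L2D borel_measurable_lebesgueI[OF smooth_measurable] by auto
    show "(\<lambda>x. complex_of_real (h x) * f x) \<in> borel_measurable lebesgue" by measurable
    show "AE x in lebesgue. norm (complex_of_real (h x) * f x) \<le> B * norm (f x)"
      using that(3) by (intro AE_I2) (auto simp: norm_mult intro: mult_right_mono)
  qed
  have B1: "\<bar>\<theta> x\<bar> \<le> B" "\<bar>partial i \<theta> x\<bar> \<le> B" for i x using B by auto
  note L = bm[OF wgradD(1)[OF w] \<theta> B1(1)] bm[OF L2_vec_nth[OF wgradD(2)[OF w]] \<theta> B1(1)]
    bm[OF wgradD(1)[OF w] smooth_partial[OF \<theta>] B1(2)]
  show ?thesis
    unfolding wgrad_def has_weak_gradient_def
  proof (intro conjI ballI allI L2_vec_lambda L2_add L)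
    fix \<phi> i assume \<phi>: "\<phi> \<in> test_functions"
    have p: "partial i (\<lambda>x. \<theta> x * \<phi> x) x = \<theta> x * partial i \<phi> x + partial i \<theta> x * \<phi> x" for x
      by (rule partial_mult) (use \<theta> \<phi> smooth_differentiable in \<open>auto simp: test_function_iff\<close>)
    note P = test_function_L2[OF test_function_partial[OF \<phi>]]
    have "(\<integral>x. u x * complex_of_real (partial i (\<lambda>x. \<theta> x * \<phi> x) x) \<partial>lebesgue) =
      (\<integral>x. complex_of_real (\<theta> x) * u x * complex_of_real (partial i \<phi> x)
        + complex_of_real (partial i \<theta> x) * u x * complex_of_real (\<phi> x) \<partial>lebesgue)"
      by (rule Bochner_Integration.integral_cong) (simp_all only: p, simp add: algebra_simps)
    also have "\<dots> = (\<integral>x. complex_of_real (\<theta> x) * u x * complex_of_real (partial i \<phi> x) \<partial>lebesgue)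
      + (\<integral>x. complex_of_real (partial i \<theta> x) * u x * complex_of_real (\<phi> x) \<partial>lebesgue)"
      by (rule Bochner_Integration.integral_add[OF L2_integrable_mult[OF L(1) P]
          L2_integrable_mult[OF L(3) test_function_L2[OF \<phi>]]])
    finally have 1: "(\<integral>x. complex_of_real (\<theta> x) * u x * complex_of_real (partial i \<phi> x) \<partial>lebesgue) =
       - (\<integral>x. G x $ i * complex_of_real (\<theta> x * \<phi> x) \<partial>lebesgue)
       - (\<integral>x. complex_of_real (partial i \<theta> x) * u x * complex_of_real (\<phi> x) \<partial>lebesgue)"
      using wgradD(3)[OF w test_function_mult[OF \<theta> \<phi>], of i] by simp
    have "(\<integral>x. (\<chi> i. complex_of_real (\<theta> x) * G x $ i + complex_of_real (partial i \<theta> x) * u x) $ i * complex_of_real (\<phi> x) \<partial>lebesgue)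
      = (\<integral>x. complex_of_real (\<theta> x) * G x $ i * complex_of_real (\<phi> x)
           + complex_of_real (partial i \<theta> x) * u x * complex_of_real (\<phi> x) \<partial>lebesgue)"
      by (rule Bochner_Integration.integral_cong) (auto simp: algebra_simps)
    also have "\<dots> = (\<integral>x. complex_of_real (\<theta> x) * G x $ i * complex_of_real (\<phi> x) \<partial>lebesgue)
           + (\<integral>x. complex_of_real (partial i \<theta> x) * u x * complex_of_real (\<phi> x) \<partial>lebesgue)"
      by (rule Bochner_Integration.integral_add[OF L2_integrable_mult[OF L(2) test_function_L2[OF \<phi>]]
            L2_integrable_mult[OF L(3) test_function_L2[OF \<phi>]]])
    also have "(\<integral>x. complex_of_real (\<theta> x) * G x $ i * complex_of_real (\<phi> x) \<partial>lebesgue) =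
        (\<integral>x. G x $ i * complex_of_real (\<theta> x * \<phi> x) \<partial>lebesgue)"
      by (rule Bochner_Integration.integral_cong) (auto simp: algebra_simps)
    finally show "(\<integral>x. complex_of_real (\<theta> x) * u x * complex_of_real (partial i \<phi> x) \<partial>lebesgue) =
      - (\<integral>x. (\<chi> i. complex_of_real (\<theta> x) * G x $ i + complex_of_real (partial i \<theta> x) * u x) $ i * complex_of_real (\<phi> x) \<partial>lebesgue)"
      using 1 by simp
  qed
qed


section \<open>Translations\<close>

lemma integral_lborel_translate:
  fixes f :: "'a::euclidean_space \<Rightarrow> 'b::{banach, second_countable_topology}"
  assumes [measurable]: "f \<in> borel_measurable borel"
  shows "(\<integral>x. f (x + c) \<partial>lborel) = (\<integral>x. f x \<partial>lborel)"
proof -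
  have "(\<integral>x. f x \<partial>lborel) = (\<integral>x. f x \<partial>(distr lborel borel ((+) c)))" by (simp only: lborel_distr_plus)
  also have "\<dots> = (\<integral>x. f (c + x) \<partial>lborel)" by (rule integral_distr) auto
  finally show ?thesis by (simp add: add.commute)
qed

lemma nn_integral_lborel_translate:
  fixes f :: "'a::euclidean_space \<Rightarrow> ennreal"
  assumes [measurable]: "f \<in> borel_measurable borel"
  shows "(\<integral>\<^sup>+x. f (x + c) \<partial>lborel) = (\<integral>\<^sup>+x. f x \<partial>lborel)"
proof -
  have "(\<integral>\<^sup>+x. f x \<partial>lborel) = (\<integral>\<^sup>+x. f x \<partial>(distr lborel borel ((+) c)))" by (simp only: lborel_distr_plus)
  also have "\<dots> = (\<integral>\<^sup>+x. f (c + x) \<partial>lborel)" by (rule nn_integral_distr) auto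
  finally show ?thesis by (simp add: add.commute)
qed

lemma integrable_lborel_pairI:
  fixes f :: "'a::euclidean_space \<times> 'c::euclidean_space \<Rightarrow> 'b::{banach, second_countable_topology}"
  assumes [measurable]: "f \<in> borel_measurable (lborel \<Otimes>\<^sub>M lborel)"
    and fin: "(\<integral>\<^sup>+x. \<integral>\<^sup>+t. ennreal (norm (f (x, t))) \<partial>lborel \<partial>lborel) < \<infinity>"
  shows "integrable (lborel \<Otimes>\<^sub>M lborel) f"
proof (rule integrableI_bounded)
  have "(\<integral>\<^sup>+p. ennreal (norm (f p)) \<partial>(lborel \<Otimes>\<^sub>M lborel)) = (\<integral>\<^sup>+x. \<integral>\<^sup>+t. ennreal (norm (f (x, t))) \<partial>lborel \<partial>lborel)"
    by (rule lborel.nn_integral_fst[symmetric]) measurable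
  then show "(\<integral>\<^sup>+p. ennreal (norm (f p)) \<partial>(lborel \<Otimes>\<^sub>M lborel)) < \<infinity>" using fin by simp
qed fact

lemma sqn_lborel: "f \<in> borel_measurable borel \<Longrightarrow> sqn f = (\<integral>x. (norm (f x))\<^sup>2 \<partial>lborel)"
  unfolding sqn_def by (rule integral_completion) simp

lemma L2_nn_integral:
  fixes f :: "R3 \<Rightarrow> 'b::euclidean_space"
  assumes "f \<in> L2" "f \<in> borel_measurable borel"
  shows "(\<integral>\<^sup>+x. ennreal ((norm (f x))\<^sup>2) \<partial>lborel) = ennreal (sqn f)"
proof -
  have "integrable lborel (\<lambda>x. (norm (f x))\<^sup>2)"
    using L2D(2)[OF assms(1)] assms(2) by (subst (asm) integrable_completion) auto
  then show ?thesis unfolding sqn_lborel[OF assms(2)] by (rule nn_integral_eq_integral) simp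
qed

lemma L2I_nn_integral:
  fixes f :: "R3 \<Rightarrow> 'b::euclidean_space"
  assumes m[measurable]: "f \<in> borel_measurable borel" and b: "(\<integral>\<^sup>+x. ennreal ((norm (f x))\<^sup>2) \<partial>lborel) \<le> ennreal B" "0 \<le> B"
  shows "f \<in> L2" "sqn f \<le> B"
proof -
  have "integrable lborel (\<lambda>x. (norm (f x))\<^sup>2)"
    using b by (intro integrableI_bounded) (auto simp: top.extremum_strict less_top[symmetric] top_unique)
  then have "integrable lebesgue (\<lambda>x. (norm (f x))\<^sup>2)" by (subst integrable_completion) auto
  then show "f \<in> L2" using borel_measurable_lebesgueI[OF m] by (simp add: L2_def)
  from L2_nn_integral[OF this m] b show "sqn f \<le> B" by (simp add: ennreal_le_iff)
qed

text \<open>Stated for extended nonnegative integrals, so that it applies to sections of a function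
  of two variables before these are known to be square integrable.\<close>

lemma norm_set_integral_power2_le:
  fixes f :: "'a::euclidean_space \<Rightarrow> 'b::euclidean_space"
  assumes [measurable]: "f \<in> borel_measurable borel" "A \<in> sets borel"
    and A: "emeasure lborel A = ennreal m" "0 < m"
  shows "ennreal ((norm (\<integral>t. indicator A t *\<^sub>R f t \<partial>lborel))\<^sup>2)
     \<le> ennreal m * (\<integral>\<^sup>+t. indicator A t * ennreal ((norm (f t))\<^sup>2) \<partial>lborel)"
proof (cases "(\<integral>\<^sup>+t. indicator A t * ennreal ((norm (f t))\<^sup>2) \<partial>lborel) = \<infinity>")
  case False
  have eq: "(\<integral>\<^sup>+t. indicator A t * ennreal ((norm (f t))\<^sup>2) \<partial>lborel) =
     (\<integral>\<^sup>+t. ennreal (indicator A t * (norm (f t))\<^sup>2) \<partial>lborel)"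
    by (rule nn_integral_cong) (auto simp: indicator_def)
  have i2: "integrable lborel (\<lambda>t. indicator A t * (norm (f t))\<^sup>2)"
    using False unfolding eq by (intro integrableI_bounded) (auto simp: less_top[symmetric])
  have i0: "integrable lborel (\<lambda>t. indicator A t :: real)" using A by (simp add: integrable_indicator_iff)
  have i0': "(\<integral>t. indicator A t \<partial>lborel) = m" using A by (simp add: measure_def)
  have i1: "integrable lborel (\<lambda>t. indicator A t * norm (f t))"
  proof (rule Bochner_Integration.integrable_bound)
    show "integrable lborel (\<lambda>t. indicator A t + indicator A t * (norm (f t))\<^sup>2)"
      using i0 i2 by (rule Bochner_Integration.integrable_add)
    have "x \<le> 1 + x\<^sup>2" for x :: real using sum_squares_bound[of 1 x] by (simp add: power2_eq_square) (smt (verit) zero_le_square)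
    then show "AE t in lborel. norm (indicator A t * norm (f t)) \<le> norm (indicator A t + indicator A t * (norm (f t))\<^sup>2)"
      by (intro AE_I2) (auto simp: indicator_def)
  qed measurable
  define c where "c = (\<integral>t. indicator A t * norm (f t) \<partial>lborel)"
  \<comment> \<open>Cauchy-Schwarz as the nonnegativity of a variance: \<open>c / m\<close> is the
    mean of |f| over \<open>A\<close>.\<close>
  have "0 \<le> (\<integral>t. indicator A t * (norm (f t) - c / m)\<^sup>2 \<partial>lborel)" by (rule integral_nonneg_AE) auto
  also have "\<dots> = (\<integral>t. indicator A t * (norm (f t))\<^sup>2 - 2 * (c / m) * (indicator A t * norm (f t)) + (c / m)\<^sup>2 * indicator A t \<partial>lborel)"
    by (rule Bochner_Integration.integral_cong) (auto simp: power2_diff algebra_simps)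
  also have "\<dots> = (\<integral>t. indicator A t * (norm (f t))\<^sup>2 \<partial>lborel) - 2 * (c / m) * c + (c / m)\<^sup>2 * m"
    using i0 i1 i2 i0' by (simp add: c_def)
  also have "2 * (c / m) * c = 2 * (c\<^sup>2 / m)" by (simp add: power2_eq_square)
  also have "(c / m)\<^sup>2 * m = c\<^sup>2 / m" using A by (simp add: power2_eq_square)
  finally have le: "c\<^sup>2 \<le> m * (\<integral>t. indicator A t * (norm (f t))\<^sup>2 \<partial>lborel)"
    using A(2) by (simp add: field_simps)
  have "norm (\<integral>t. indicator A t *\<^sub>R f t \<partial>lborel) \<le> (\<integral>t. norm (indicator A t *\<^sub>R f t) \<partial>lborel)"
    by (rule integral_norm_bound)
  also have "\<dots> = c" unfolding c_def by (rule Bochner_Integration.integral_cong) auto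
  finally have "(norm (\<integral>t. indicator A t *\<^sub>R f t \<partial>lborel))\<^sup>2 \<le> c\<^sup>2" by (intro power_mono) auto
  with le have "(norm (\<integral>t. indicator A t *\<^sub>R f t \<partial>lborel))\<^sup>2 \<le> m * (\<integral>t. indicator A t * (norm (f t))\<^sup>2 \<partial>lborel)" by simp
  then show ?thesis unfolding eq using nn_integral_eq_integral[OF i2] A(2) by (simp add: ennreal_leI flip: ennreal_mult')
qed (use A(2) in \<open>simp add: ennreal_mult_top\<close>)

lemma integral_unit_interval_power2:
  fixes f :: "real \<Rightarrow> 'b::euclidean_space"
  assumes "f \<in> borel_measurable borel"
  shows "ennreal ((norm (\<integral>t. indicator {0..1} t *\<^sub>R f t \<partial>lborel))\<^sup>2)
     \<le> (\<integral>\<^sup>+t. indicator {0..1} t * ennreal ((norm (f t))\<^sup>2) \<partial>lborel)"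
  using norm_set_integral_power2_le[of f "{0..1}" 1] assms by simp

section \<open>Increments along a segment\<close>

lemma smooth_line_deriv:
  assumes "smooth \<phi>"
  shows "((\<lambda>s. \<phi> (x + s *\<^sub>R y)) has_real_derivative (\<Sum>i\<in>UNIV. y $ i * partial i \<phi> (x + s *\<^sub>R y))) (at s)"
proof -
  let ?D = "frechet_derivative \<phi> (at (x + s *\<^sub>R y))"
  have d: "(\<phi> has_derivative ?D) (at (x + s *\<^sub>R y))"
    using smooth_differentiable[OF assms] frechet_derivative_works by blast
  then have lin: "linear ?D" by (rule has_derivative_linear)
  have "((\<lambda>s. x + s *\<^sub>R y) has_derivative (\<lambda>h. h *\<^sub>R y)) (at s)" by (auto intro!: derivative_eq_intros)
  from has_derivative_compose[OF this d]
  have "((\<lambda>s. \<phi> (x + s *\<^sub>R y)) has_derivative (\<lambda>h. ?D (h *\<^sub>R y))) (at s)" .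
  moreover have "?D (h *\<^sub>R y) = (\<Sum>i\<in>UNIV. y $ i * partial i \<phi> (x + s *\<^sub>R y)) * h" for h
  proof -
    have y: "(\<Sum>i\<in>UNIV. y $ i *\<^sub>R axis i 1) = y"
      by (simp add: vec_eq_iff axis_def if_distrib cong: if_cong)
    have "?D (\<Sum>i\<in>UNIV. y $ i *\<^sub>R axis i 1) = (\<Sum>i\<in>UNIV. ?D (y $ i *\<^sub>R axis i 1))"
      by (rule linear_sum[OF lin])
    then have "?D y = (\<Sum>i\<in>UNIV. y $ i *\<^sub>R ?D (axis i 1))"
      unfolding y linear_cmul[OF lin] .
    then show ?thesis using linear_cmul[OF lin, of h y] by (simp add: partial_def mult.commute)
  qed
  ultimately show ?thesis by (simp add: has_field_derivative_def)
qed

lemma smooth_difference_integral: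
  assumes "smooth \<phi>"
  shows "\<phi> (x + y) - \<phi> x = (\<integral>t. indicator {0..1} t * (\<Sum>i\<in>UNIV. y $ i * partial i \<phi> (x + t *\<^sub>R y)) \<partial>lborel)"
proof -
  have "isCont (\<lambda>t. \<Sum>i\<in>UNIV. y $ i * partial i \<phi> (x + t *\<^sub>R y)) t" for t
  proof -
    have c: "isCont (partial i \<phi>) z" for i z
      using smooth_differentiable[OF smooth_partial[OF assms]] differentiable_imp_continuous_within by blast
    have "isCont (\<lambda>t. partial i \<phi> (x + t *\<^sub>R y)) t" for i
      by (rule isCont_o2[where f = "\<lambda>t. x + t *\<^sub>R y", OF _ c]) (intro continuous_intros)
    then show ?thesis by (intro continuous_sum continuous_mult continuous_const)
  qed
  from integral_FTC_Icc_real[OF _ smooth_line_deriv[OF assms] this, of 0 1]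
  show ?thesis by (simp add: mult.commute[of "indicator _ _"])
qed

lemma norm_sum_scaleR_le:
  fixes y :: R3 and z :: "complex ^ 3"
  shows "(norm (\<Sum>i\<in>UNIV. y $ i *\<^sub>R z $ i))\<^sup>2 \<le> (norm y)\<^sup>2 * (norm z)\<^sup>2"
proof -
  have "norm (\<Sum>i\<in>UNIV. y $ i *\<^sub>R z $ i) \<le> (\<Sum>i\<in>UNIV. \<bar>y $ i\<bar> * norm (z $ i))"
    by (rule order_trans[OF norm_sum]) simp
  then have "(norm (\<Sum>i\<in>UNIV. y $ i *\<^sub>R z $ i))\<^sup>2 \<le> (\<Sum>i\<in>UNIV. \<bar>y $ i\<bar> * norm (z $ i))\<^sup>2"
    by (intro power_mono) auto
  also have "\<dots> \<le> (\<Sum>i\<in>UNIV. \<bar>y $ i\<bar>\<^sup>2) * (\<Sum>i\<in>UNIV. (norm (z $ i))\<^sup>2)" by (rule Cauchy_Schwarz_ineq_sum)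
  also have "\<dots> = (norm y)\<^sup>2 * (norm z)\<^sup>2"
    unfolding norm_vec_power2 power2_norm_eq_inner[of y] inner_vec_def
    by (simp only: power2_abs inner_real_def power2_eq_square[symmetric])
  finally show ?thesis .
qed

lemma integral_complex_L2_lborel:
  fixes f :: "R3 \<Rightarrow> complex"
  assumes "f \<in> borel_measurable borel" "\<phi> \<in> test_functions"
  shows "(\<integral>x. f x * complex_of_real (\<phi> x) \<partial>lebesgue) = (\<integral>x. \<phi> x *\<^sub>R f x \<partial>lborel)"
proof -
  have [measurable]: "\<phi> \<in> borel_measurable borel" "f \<in> borel_measurable borel" using assms test_measurable by auto
  have "(\<integral>x. f x * complex_of_real (\<phi> x) \<partial>lebesgue) = (\<integral>x. f x * complex_of_real (\<phi> x) \<partial>lborel)"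
    by (rule integral_completion) measurable
  then show ?thesis by (simp add: scaleR_conv_of_real mult.commute)
qed

lemma integrable_test_lborel:
  fixes f :: "R3 \<Rightarrow> complex"
  assumes "f \<in> L2" "f \<in> borel_measurable borel" "\<phi> \<in> test_functions"
  shows "integrable lborel (\<lambda>x. \<phi> x *\<^sub>R f x)"
proof -
  have [measurable]: "\<phi> \<in> borel_measurable borel" "f \<in> borel_measurable borel" using assms test_measurable by auto
  show ?thesis using loc_integrable_test[OF L2_loc_integrable[OF assms(1)] assms(3)]
    by (subst (asm) integrable_completion) auto
qed

lemma L2_translate:
  fixes f :: "R3 \<Rightarrow> 'b::euclidean_space"
  assumes "f \<in> L2" and m[measurable]: "f \<in> borel_measurable borel"
  shows "(\<lambda>x. f (x + y)) \<in> L2" "sqn (\<lambda>x. f (x + y)) \<le> sqn f"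
proof -
  have "(\<integral>\<^sup>+x. ennreal ((norm (f (x + y)))\<^sup>2) \<partial>lborel) = (\<integral>\<^sup>+x. ennreal ((norm (f x))\<^sup>2) \<partial>lborel)"
    by (rule nn_integral_lborel_translate) measurable
  then have "(\<integral>\<^sup>+x. ennreal ((norm (f (x + y)))\<^sup>2) \<partial>lborel) \<le> ennreal (sqn f)"
    using L2_nn_integral[OF assms] by simp
  then show "(\<lambda>x. f (x + y)) \<in> L2" "sqn (\<lambda>x. f (x + y)) \<le> sqn f"
    by (intro L2I_nn_integral; simp; measurable)+
qed

definition dir_deriv :: "R3 \<Rightarrow> (R3 \<Rightarrow> complex ^ 3) \<Rightarrow> R3 \<Rightarrow> real \<Rightarrow> complex" where
  "dir_deriv y G x t = (\<Sum>i\<in>UNIV. y $ i *\<^sub>R G (x + t *\<^sub>R y) $ i)"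

lemma dir_deriv_measurable:
  assumes "G \<in> borel_measurable borel"
  shows "(\<lambda>p. dir_deriv y G (fst p) (snd p)) \<in> borel_measurable (lborel \<Otimes>\<^sub>M lborel)"
    and "(\<lambda>p. dir_deriv y G (snd p) (fst p)) \<in> borel_measurable (lborel \<Otimes>\<^sub>M lborel)"
    and "(\<lambda>t. dir_deriv y G x t) \<in> borel_measurable borel"
    and "(\<lambda>x. dir_deriv y G x t) \<in> borel_measurable borel"
proof -
  have [measurable]: "(\<lambda>x. G x $ i) \<in> borel_measurable borel" for i
    using assms by (rule borel_measurable_vec_nth)
  show "(\<lambda>p. dir_deriv y G (fst p) (snd p)) \<in> borel_measurable (lborel \<Otimes>\<^sub>M lborel)"
    "(\<lambda>p. dir_deriv y G (snd p) (fst p)) \<in> borel_measurable (lborel \<Otimes>\<^sub>M lborel)"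
    "(\<lambda>t. dir_deriv y G x t) \<in> borel_measurable borel"
    "(\<lambda>x. dir_deriv y G x t) \<in> borel_measurable borel"
    unfolding dir_deriv_def by measurable
qed

text \<open>The increment \<open>u (x + y) - u x\<close> that the fundamental theorem of calculus
  predicts for a function with gradient \<open>G\<close>.\<close>

definition line_integral :: "R3 \<Rightarrow> (R3 \<Rightarrow> complex ^ 3) \<Rightarrow> R3 \<Rightarrow> complex" where
  "line_integral y G x = (\<integral>t. indicator {0..1} t *\<^sub>R dir_deriv y G x t \<partial>lborel)"

lemma line_integral_measurable:
  assumes "G \<in> borel_measurable borel"
  shows "line_integral y G \<in> borel_measurable borel"
proof -
  have "(\<lambda>(x, t). indicator {0..1} t *\<^sub>R dir_deriv y G x t) \<in> borel_measurable (lborel \<Otimes>\<^sub>M lborel)"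
    using dir_deriv_measurable(1)[OF assms] unfolding split_beta by measurable
  then have "(\<lambda>x. \<integral>t. indicator {0..1} t *\<^sub>R dir_deriv y G x t \<partial>lborel) \<in> borel_measurable lborel"
    by (rule lborel.borel_measurable_lebesgue_integral)
  then show ?thesis unfolding line_integral_def[abs_def] by simp
qed

text \<open>For fixed \<open>t\<close> the integral over \<open>x\<close> is a translate of the
  integral of |y . G|^2, hence bounded independently of \<open>t\<close>, and \<open>t\<close> runs
  through an interval of length 1.\<close>

lemma dir_deriv_nn_integral:
  assumes "G \<in> L2" and G[measurable]: "G \<in> borel_measurable borel"
  shows "(\<integral>\<^sup>+x. \<integral>\<^sup>+t. indicator {0..1} t * ennreal ((norm (dir_deriv y G x t))\<^sup>2) \<partial>lborel \<partial>lborel)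
    \<le> ennreal ((norm y)\<^sup>2 * sqn G)"
proof -
  note m = dir_deriv_measurable[OF G]
  have mm: "(\<lambda>(x, t). indicator {0..1} t * ennreal ((norm (dir_deriv y G x t))\<^sup>2)) \<in> borel_measurable (lborel \<Otimes>\<^sub>M lborel)"
    using m(1) unfolding split_beta by measurable
  have "(\<integral>\<^sup>+x. \<integral>\<^sup>+t. indicator {0..1} t * ennreal ((norm (dir_deriv y G x t))\<^sup>2) \<partial>lborel \<partial>lborel)
     = (\<integral>\<^sup>+t. \<integral>\<^sup>+x. indicator {0..1} t * ennreal ((norm (dir_deriv y G x t))\<^sup>2) \<partial>lborel \<partial>lborel)"
    by (rule lborel_pair.Fubini'[OF mm, symmetric])
  also have "\<dots> = (\<integral>\<^sup>+t. indicator {0..1} t * (\<integral>\<^sup>+x. ennreal ((norm (dir_deriv y G x t))\<^sup>2) \<partial>lborel) \<partial>lborel)"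
    using m(4) by (intro nn_integral_cong nn_integral_cmult) measurable
  also have "\<dots> \<le> (\<integral>\<^sup>+t. indicator {0..1::real} t * ennreal ((norm y)\<^sup>2 * sqn G) \<partial>lborel)"
  proof (intro nn_integral_mono mult_left_mono)
    fix t :: real
    have "(\<integral>\<^sup>+x. ennreal ((norm (dir_deriv y G x t))\<^sup>2) \<partial>lborel) \<le> (\<integral>\<^sup>+x. ennreal ((norm y)\<^sup>2) * ennreal ((norm (G (x + t *\<^sub>R y)))\<^sup>2) \<partial>lborel)"
      by (intro nn_integral_mono) (simp add: ennreal_mult[symmetric] dir_deriv_def norm_sum_scaleR_le ennreal_leI)
    also have "\<dots> = ennreal ((norm y)\<^sup>2) * (\<integral>\<^sup>+x. ennreal ((norm (G (x + t *\<^sub>R y)))\<^sup>2) \<partial>lborel)"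
      by (rule nn_integral_cmult) measurable
    also have "(\<integral>\<^sup>+x. ennreal ((norm (G (x + t *\<^sub>R y)))\<^sup>2) \<partial>lborel) = (\<integral>\<^sup>+x. ennreal ((norm (G x))\<^sup>2) \<partial>lborel)"
      by (rule nn_integral_lborel_translate) measurable
    also have "\<dots> = ennreal (sqn G)" by (rule L2_nn_integral[OF assms])
    finally show "(\<integral>\<^sup>+x. ennreal ((norm (dir_deriv y G x t))\<^sup>2) \<partial>lborel) \<le> ennreal ((norm y)\<^sup>2 * sqn G)"
      by (simp add: ennreal_mult)
  qed simp
  also have "\<dots> = (\<integral>\<^sup>+t. indicator {0..1::real} t \<partial>lborel) * ennreal ((norm y)\<^sup>2 * sqn G)"
    by (rule nn_integral_multc) measurable
  also have "\<dots> = ennreal ((norm y)\<^sup>2 * sqn G)" by simp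
  finally show ?thesis .
qed

lemma line_integral_L2:
  assumes "G \<in> L2" and G[measurable]: "G \<in> borel_measurable borel"
  shows "line_integral y G \<in> L2" "sqn (line_integral y G) \<le> (norm y)\<^sup>2 * sqn G"
proof -
  have "(\<integral>\<^sup>+x. ennreal ((norm (line_integral y G x))\<^sup>2) \<partial>lborel)
    \<le> (\<integral>\<^sup>+x. \<integral>\<^sup>+t. indicator {0..1} t * ennreal ((norm (dir_deriv y G x t))\<^sup>2) \<partial>lborel \<partial>lborel)"
    unfolding line_integral_def
    by (intro nn_integral_mono integral_unit_interval_power2 dir_deriv_measurable G)
  also have "\<dots> \<le> ennreal ((norm y)\<^sup>2 * sqn G)" by (rule dir_deriv_nn_integral[OF assms])
  finally have *: "(\<integral>\<^sup>+x. ennreal ((norm (line_integral y G x))\<^sup>2) \<partial>lborel) \<le> ennreal ((norm y)\<^sup>2 * sqn G)" .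
  have "0 \<le> (norm y)\<^sup>2 * sqn G" by simp
  from L2I_nn_integral[OF line_integral_measurable[OF G] * this]
  show "line_integral y G \<in> L2" "sqn (line_integral y G) \<le> (norm y)\<^sup>2 * sqn G" by auto
qed

lemma line_integral_test:
  assumes GL: "G \<in> L2" and G[measurable]: "G \<in> borel_measurable borel" and \<phi>: "\<phi> \<in> test_functions"
  shows "(\<integral>x. \<phi> x *\<^sub>R line_integral y G x \<partial>lborel)
      = (\<integral>t. indicator {0..1} t *\<^sub>R (\<integral>x. \<phi> x *\<^sub>R dir_deriv y G x t \<partial>lborel) \<partial>lborel)"
proof -
  note m = dir_deriv_measurable[OF G]
  have [measurable]: "\<phi> \<in> borel_measurable borel" using \<phi> by (rule test_measurable)
  define f where "f x t = indicator {0..1} t *\<^sub>R (\<phi> x *\<^sub>R dir_deriv y G x t)" for x t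
  have fm: "(\<lambda>p. f (fst p) (snd p)) \<in> borel_measurable (lborel \<Otimes>\<^sub>M lborel)"
    unfolding f_def using m(1) by measurable
  have \<phi>2: "(\<integral>\<^sup>+x. ennreal ((\<phi> x)\<^sup>2) \<partial>lborel) = ennreal (sqn (\<lambda>x. complex_of_real (\<phi> x)))"
    using L2_nn_integral[OF test_function_L2[OF \<phi>]] by simp
  have "(\<integral>\<^sup>+x. \<integral>\<^sup>+t. ennreal (norm (f x t)) \<partial>lborel \<partial>lborel)
    \<le> (\<integral>\<^sup>+x. \<integral>\<^sup>+t. (indicator {0..1} t * ennreal ((\<phi> x)\<^sup>2) + indicator {0..1} t * ennreal ((norm (dir_deriv y G x t))\<^sup>2)) \<partial>lborel \<partial>lborel)"
  proof (intro nn_integral_mono)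
    fix x and t :: real
    have "\<bar>\<phi> x\<bar> * norm (dir_deriv y G x t) \<le> (\<phi> x)\<^sup>2 + (norm (dir_deriv y G x t))\<^sup>2"
      using sum_squares_bound[of "\<bar>\<phi> x\<bar>" "norm (dir_deriv y G x t)"] mult_nonneg_nonneg[OF abs_ge_zero[of "\<phi> x"] norm_ge_zero[of "dir_deriv y G x t"]]
      unfolding power2_abs by linarith
    then show "ennreal (norm (f x t)) \<le> indicator {0..1} t * ennreal ((\<phi> x)\<^sup>2) + indicator {0..1} t * ennreal ((norm (dir_deriv y G x t))\<^sup>2)"
      by (auto simp: f_def indicator_def ennreal_plus[symmetric] simp del: ennreal_plus intro!: ennreal_leI)
  qed
  also have "\<dots> = (\<integral>\<^sup>+x. (ennreal ((\<phi> x)\<^sup>2) + \<integral>\<^sup>+t. indicator {0..1} t * ennreal ((norm (dir_deriv y G x t))\<^sup>2) \<partial>lborel) \<partial>lborel)"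
  proof (rule nn_integral_cong)
    fix x
    have "(\<integral>\<^sup>+t. (indicator {0..1} t * ennreal ((\<phi> x)\<^sup>2) + indicator {0..1} t * ennreal ((norm (dir_deriv y G x t))\<^sup>2)) \<partial>lborel)
     = (\<integral>\<^sup>+t. indicator {0..1::real} t * ennreal ((\<phi> x)\<^sup>2) \<partial>lborel) + (\<integral>\<^sup>+t. indicator {0..1} t * ennreal ((norm (dir_deriv y G x t))\<^sup>2) \<partial>lborel)"
      using m(3)[of y x] by (intro nn_integral_add) measurable
    moreover have "(\<integral>\<^sup>+t. indicator {0..1::real} t * ennreal ((\<phi> x)\<^sup>2) \<partial>lborel) = ennreal ((\<phi> x)\<^sup>2)"
      by (subst nn_integral_multc) auto
    ultimately show "(\<integral>\<^sup>+t. (indicator {0..1} t * ennreal ((\<phi> x)\<^sup>2) + indicator {0..1} t * ennreal ((norm (dir_deriv y G x t))\<^sup>2)) \<partial>lborel)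
     = ennreal ((\<phi> x)\<^sup>2) + (\<integral>\<^sup>+t. indicator {0..1} t * ennreal ((norm (dir_deriv y G x t))\<^sup>2) \<partial>lborel)" by simp
  qed
  also have "\<dots> = (\<integral>\<^sup>+x. ennreal ((\<phi> x)\<^sup>2) \<partial>lborel) + (\<integral>\<^sup>+x. \<integral>\<^sup>+t. indicator {0..1} t * ennreal ((norm (dir_deriv y G x t))\<^sup>2) \<partial>lborel \<partial>lborel)"
  proof (rule nn_integral_add)
    have "(\<lambda>(x, t). indicator {0..1} t * ennreal ((norm (dir_deriv y G x t))\<^sup>2)) \<in> borel_measurable (lborel \<Otimes>\<^sub>M lborel)"
      using m(1) unfolding split_beta by measurable
    then show "(\<lambda>x. \<integral>\<^sup>+t. indicator {0..1} t * ennreal ((norm (dir_deriv y G x t))\<^sup>2) \<partial>lborel) \<in> borel_measurable lborel"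
      by (rule lborel.borel_measurable_nn_integral)
  qed measurable
  also have "\<dots> \<le> ennreal (sqn (\<lambda>x. complex_of_real (\<phi> x))) + ennreal ((norm y)\<^sup>2 * sqn G)"
    unfolding \<phi>2 by (intro add_left_mono dir_deriv_nn_integral assms)
  also have "\<dots> < \<infinity>" by simp
  finally have fin: "(\<integral>\<^sup>+x. \<integral>\<^sup>+t. ennreal (norm (f x t)) \<partial>lborel \<partial>lborel) < \<infinity>" .
  have "integrable (lborel \<Otimes>\<^sub>M lborel) (\<lambda>p. f (fst p) (snd p))"
    by (rule integrable_lborel_pairI[OF fm]) (use fin in simp)
  then have "(\<integral>t. (\<integral>x. f x t \<partial>lborel) \<partial>lborel) = (\<integral>x. (\<integral>t. f x t \<partial>lborel) \<partial>lborel)"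
    by (intro lborel_pair.Fubini_integral) (simp add: split_beta')
  moreover have "(\<integral>t. f x t \<partial>lborel) = \<phi> x *\<^sub>R line_integral y G x" for x
  proof -
    have "(\<integral>t. f x t \<partial>lborel) = (\<integral>t. \<phi> x *\<^sub>R (indicator {0..1} t *\<^sub>R dir_deriv y G x t) \<partial>lborel)"
      by (rule Bochner_Integration.integral_cong) (auto simp: f_def mult.commute)
    then show ?thesis by (simp add: line_integral_def del: scaleR_scaleR)
  qed
  moreover have "(\<integral>x. f x t \<partial>lborel) = indicator {0..1} t *\<^sub>R (\<integral>x. \<phi> x *\<^sub>R dir_deriv y G x t \<partial>lborel)" for t
    unfolding f_def by (simp del: scaleR_scaleR)
  ultimately show ?thesis by simp
qed

lemma test_difference_integral:
  assumes u: "u \<in> L2" and um[measurable]: "u \<in> borel_measurable borel" and \<phi>: "\<phi> \<in> test_functions"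
  shows "(\<integral>x. (\<phi> (x - y) - \<phi> x) *\<^sub>R u x \<partial>lborel) =
    (\<integral>t. indicator {0..1} t *\<^sub>R (\<integral>x. (\<Sum>i\<in>UNIV. - y $ i * partial i \<phi> (x - t *\<^sub>R y)) *\<^sub>R (u x :: complex) \<partial>lborel) \<partial>lborel)"
proof -
  define K where "K x t = (\<Sum>i\<in>UNIV. - y $ i * partial i \<phi> (x - t *\<^sub>R y))" for x t
  have sm: "smooth \<phi>" using \<phi> by (simp add: test_function_iff)
  have [measurable]: "\<phi> \<in> borel_measurable borel" "\<And>i. partial i \<phi> \<in> borel_measurable borel"
    using \<phi> test_measurable test_function_partial by auto
  have "\<exists>B\<ge>0. \<forall>x. \<bar>partial i \<phi> x\<bar> \<le> B" for i
    using test_function_bounded[OF test_function_partial[OF \<phi>, of i]] by metis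
  then obtain B where B: "\<And>i x. \<bar>partial i \<phi> x\<bar> \<le> B i" "\<And>i. 0 \<le> B i" by metis
  have "\<exists>R. \<forall>x. norm x > R \<longrightarrow> partial i \<phi> x = 0" for i
    using test_function_support[OF test_function_partial[OF \<phi>, of i]] by metis
  then obtain R where R: "\<And>i x. norm x > R i \<Longrightarrow> partial i \<phi> x = 0" by metis
  define C where "C = (\<Sum>i\<in>UNIV. \<bar>y $ i\<bar> * B i)"
  \<comment> \<open>All translates of the partial derivatives by \<open>t *\<^sub>R y\<close> with
    \<open>t\<close> in [0, 1] vanish outside the ball of radius \<open>S\<close>, which gives one
    integrable bound for Fubini.\<close>
  define S where "S = (\<Sum>i\<in>UNIV. \<bar>R i\<bar>) + norm y"
  have C0: "0 \<le> C" unfolding C_def using B(2) by (intro sum_nonneg mult_nonneg_nonneg) auto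
  have K: "\<bar>K x t\<bar> \<le> C * indicator (cball 0 S) x" if t: "t \<in> {0..1}" for x t
  proof (cases "norm x \<le> S")
    case True
    have "\<bar>K x t\<bar> \<le> (\<Sum>i\<in>UNIV. \<bar>- y $ i * partial i \<phi> (x - t *\<^sub>R y)\<bar>)" unfolding K_def by (rule sum_abs)
    also have "\<dots> \<le> C" unfolding C_def using B by (intro sum_mono) (simp add: abs_mult mult_left_mono)
    finally show ?thesis using True by simp
  next
    case False
    have "partial i \<phi> (x - t *\<^sub>R y) = 0" for i
    proof (rule R)
      have "\<bar>R i\<bar> \<le> (\<Sum>i\<in>UNIV. \<bar>R i\<bar>)" by (rule member_le_sum) auto
      moreover have "norm (t *\<^sub>R y) \<le> norm y" using t by (simp add: mult_left_le_one_le)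
      moreover have "norm x - norm (t *\<^sub>R y) \<le> norm (x - t *\<^sub>R y)" by (rule norm_triangle_ineq2)
      ultimately show "R i < norm (x - t *\<^sub>R y)" using False unfolding S_def by linarith
    qed
    then show ?thesis using False by (simp add: K_def)
  qed
  define f where "f x t = indicator {0..1} t *\<^sub>R (K x t *\<^sub>R u x)" for x t
  have Km: "(\<lambda>p. K (fst p) (snd p)) \<in> borel_measurable (lborel \<Otimes>\<^sub>M lborel)"
    unfolding K_def by measurable
  have fm: "(\<lambda>p. f (fst p) (snd p)) \<in> borel_measurable (lborel \<Otimes>\<^sub>M lborel)"
    unfolding f_def using Km by measurable
  have "integrable lebesgue (\<lambda>x. norm (indicator (cball 0 S) x *\<^sub>R u x))"
    using L2_loc_integrable[OF u] unfolding loc_integrable_def by (intro integrable_norm) blast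
  moreover have [measurable]: "(\<lambda>x. indicator (cball 0 S) x *\<^sub>R u x) \<in> borel_measurable borel"
    by (rule borel_measurable_scaleR[OF borel_measurable_indicator um]) simp
  then have cm: "(\<lambda>x. norm (indicator (cball 0 S) x *\<^sub>R u x)) \<in> borel_measurable lborel" by measurable
  ultimately have iu: "integrable lborel (\<lambda>x. norm (indicator (cball 0 S) x *\<^sub>R u x))"
    using integrable_completion[OF cm] by blast
  have "(\<integral>\<^sup>+x. \<integral>\<^sup>+t. ennreal (norm (f x t)) \<partial>lborel \<partial>lborel)
    \<le> (\<integral>\<^sup>+x. \<integral>\<^sup>+t. indicator {0..1::real} t * ennreal (C * norm (indicator (cball 0 S) x *\<^sub>R u x)) \<partial>lborel \<partial>lborel)"
  proof (intro nn_integral_mono)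
    fix x and t :: real
    show "ennreal (norm (f x t)) \<le> indicator {0..1::real} t * ennreal (C * norm (indicator (cball 0 S) x *\<^sub>R u x))"
    proof (cases "t \<in> {0..1}")
      case True
      have "\<bar>K x t\<bar> * norm (u x) \<le> C * indicator (cball 0 S) x * norm (u x)"
        using K[OF True, of x] by (rule mult_right_mono) simp
      then show ?thesis using True by (simp add: f_def ennreal_leI mult.assoc)
    qed (simp add: f_def)
  qed
  also have "\<dots> = (\<integral>\<^sup>+x. ennreal (C * norm (indicator (cball 0 S) x *\<^sub>R u x)) \<partial>lborel)"
  proof (rule nn_integral_cong)
    fix x
    have "(\<integral>\<^sup>+t. indicator {0..1::real} t * ennreal (C * norm (indicator (cball 0 S) x *\<^sub>R u x)) \<partial>lborel)
      = (\<integral>\<^sup>+t. indicator {0..1::real} t \<partial>lborel) * ennreal (C * norm (indicator (cball 0 S) x *\<^sub>R u x))"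
      by (rule nn_integral_multc) measurable
    then show "(\<integral>\<^sup>+t. indicator {0..1::real} t * ennreal (C * norm (indicator (cball 0 S) x *\<^sub>R u x)) \<partial>lborel)
      = ennreal (C * norm (indicator (cball 0 S) x *\<^sub>R u x))" by simp
  qed
  also have "\<dots> = ennreal (\<integral>x. C * norm (indicator (cball 0 S) x *\<^sub>R u x) \<partial>lborel)"
    by (rule nn_integral_eq_integral[OF integrable_mult_right[OF iu]]) (simp add: C0)
  also have "\<dots> < \<infinity>" by simp
  finally have fin: "(\<integral>\<^sup>+x. \<integral>\<^sup>+t. ennreal (norm (f x t)) \<partial>lborel \<partial>lborel) < \<infinity>" .
  have "integrable (lborel \<Otimes>\<^sub>M lborel) (\<lambda>p. f (fst p) (snd p))"
    by (rule integrable_lborel_pairI[OF fm]) (use fin in simp)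
  then have "(\<integral>t. (\<integral>x. f x t \<partial>lborel) \<partial>lborel) = (\<integral>x. (\<integral>t. f x t \<partial>lborel) \<partial>lborel)"
    by (intro lborel_pair.Fubini_integral) (simp add: split_beta')
  moreover have "(\<integral>t. f x t \<partial>lborel) = (\<phi> (x - y) - \<phi> x) *\<^sub>R u x" for x
  proof -
    have "(\<integral>t. f x t \<partial>lborel) = (\<integral>t. (indicator {0..1} t * K x t) *\<^sub>R u x \<partial>lborel)"
      by (simp add: f_def)
    also have "\<dots> = (\<integral>t. indicator {0..1} t * K x t \<partial>lborel) *\<^sub>R u x"
    proof (rule integral_scaleR_left)
      have [measurable]: "(\<lambda>t. K x t) \<in> borel_measurable borel" unfolding K_def by measurable
      show "integrable lborel (\<lambda>t. indicator {0..1} t * K x t)"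
      proof (rule Bochner_Integration.integrable_bound)
        show "integrable lborel (\<lambda>t. C * indicator {0..1::real} t)" by simp
        have "\<bar>indicator {0..1} t * K x t\<bar> \<le> \<bar>C * indicator {0..1} t\<bar>" for t :: real
          using K[of t x] C0 by (cases "t \<in> {0..1}"; cases "x \<in> cball 0 S") auto
        then show "AE t in lborel. norm (indicator {0..1} t * K x t) \<le> norm (C * indicator {0..1} t)" by simp
      qed measurable
    qed
    also have "(\<integral>t. indicator {0..1} t * K x t \<partial>lborel) = \<phi> (x - y) - \<phi> x"
      using smooth_difference_integral[OF sm, of x "-y"] by (simp add: K_def)
    finally show ?thesis .
  qed
  moreover have "(\<integral>x. f x t \<partial>lborel) = indicator {0..1} t *\<^sub>R (\<integral>x. K x t *\<^sub>R u x \<partial>lborel)" for t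
    unfolding f_def by (simp del: scaleR_scaleR)
  ultimately show ?thesis by (simp add: K_def)
qed

text \<open>Against a test function the translation is moved to the test function, for which the
  classical fundamental theorem holds. Its derivative is then moved back onto \<open>u\<close> as
  \<open>G\<close>, and undoing the translation recovers the line integral.\<close>

theorem wgrad_translate_AE:
  assumes w: "wgrad u G" and um[measurable]: "u \<in> borel_measurable borel" and G: "G \<in> borel_measurable borel"
  shows "AE x in lebesgue. u (x + y) - u x - line_integral y G x = 0"
proof (rule AE_zero_of_test_functions)
  note L = wgradD(1,2)[OF w]
  note [measurable] = line_integral_measurable[OF G]
  show "loc_integrable (\<lambda>x. u (x + y) - u x - line_integral y G x)"
    by (intro L2_loc_integrable L2_diff L2_translate line_integral_L2 L um G)
  fix \<phi> :: "R3 \<Rightarrow> real" assume \<phi>: "\<phi> \<in> test_functions"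
  have [measurable]: "\<phi> \<in> borel_measurable borel" using \<phi> by (rule test_measurable)
  have Gi[measurable]: "(\<lambda>x. G x $ i) \<in> borel_measurable borel" for i
    using G by (rule borel_measurable_vec_nth)
  have I1: "integrable lborel (\<lambda>x. \<phi> x *\<^sub>R u (x + y))"
    by (intro integrable_test_lborel L2_translate L um \<phi>) measurable
  have I2: "integrable lborel (\<lambda>x. \<phi> x *\<^sub>R u x)"
    by (intro integrable_test_lborel L um \<phi>)
  have I3: "integrable lborel (\<lambda>x. \<phi> x *\<^sub>R line_integral y G x)"
    by (intro integrable_test_lborel line_integral_L2 line_integral_measurable L G \<phi>)
  have I4: "integrable lborel (\<lambda>x. \<phi> (x - y) *\<^sub>R u x)"
    by (intro integrable_test_lborel L um test_function_translate \<phi>)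
  have "(\<integral>x. \<phi> x *\<^sub>R (u (x + y) - u x - line_integral y G x) \<partial>lebesgue) =
    (\<integral>x. \<phi> x *\<^sub>R (u (x + y) - u x - line_integral y G x) \<partial>lborel)"
    by (rule integral_completion) measurable
  also have "\<dots> = (\<integral>x. \<phi> x *\<^sub>R u (x + y) \<partial>lborel) - (\<integral>x. \<phi> x *\<^sub>R u x \<partial>lborel) - (\<integral>x. \<phi> x *\<^sub>R line_integral y G x \<partial>lborel)"
    using I1 I2 I3 by (simp add: scaleR_diff_right)
  also have "(\<integral>x. \<phi> x *\<^sub>R u (x + y) \<partial>lborel) = (\<integral>x. \<phi> (x - y) *\<^sub>R u x \<partial>lborel)"
    using integral_lborel_translate[of "\<lambda>x. \<phi> (x - y) *\<^sub>R u x" y] by simp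
  also have "\<dots> - (\<integral>x. \<phi> x *\<^sub>R u x \<partial>lborel) = (\<integral>x. (\<phi> (x - y) - \<phi> x) *\<^sub>R u x \<partial>lborel)"
    using I4 I2 by (simp add: scaleR_diff_left)
  also have "\<dots> = (\<integral>t. indicator {0..1} t *\<^sub>R (\<integral>x. (\<Sum>i\<in>UNIV. - y $ i * partial i \<phi> (x - t *\<^sub>R y)) *\<^sub>R u x \<partial>lborel) \<partial>lborel)"
    by (rule test_difference_integral[OF L(1) um \<phi>])
  also have "\<dots> = (\<integral>t. indicator {0..1} t *\<^sub>R (\<integral>x. \<phi> x *\<^sub>R dir_deriv y G x t \<partial>lborel) \<partial>lborel)"
  proof -
    have "(\<integral>x. (\<Sum>i\<in>UNIV. - y $ i * partial i \<phi> (x - t *\<^sub>R y)) *\<^sub>R u x \<partial>lborel) = (\<integral>x. \<phi> x *\<^sub>R dir_deriv y G x t \<partial>lborel)" for t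
    proof -
      \<comment> \<open>For fixed \<open>t\<close> the translated test function is itself a test
        function, so the defining identity of the weak gradient applies to it.\<close>
      define \<psi> where "\<psi> x = \<phi> (x - t *\<^sub>R y)" for x
      have \<psi>: "\<psi> \<in> test_functions" unfolding \<psi>_def[abs_def] by (rule test_function_translate[OF \<phi>])
      have p: "partial i \<phi> (x - t *\<^sub>R y) = partial i \<psi> x" for i x
        unfolding \<psi>_def[abs_def] using partial_translate(1)[of \<phi> i "t *\<^sub>R y"] \<phi> smooth_differentiable
        by (auto simp: test_function_iff)
      have [measurable]: "\<psi> \<in> borel_measurable borel" using \<psi> by (rule test_measurable)
      have J1: "integrable lborel (\<lambda>x. partial i \<psi> x *\<^sub>R u x)" for i
        by (intro integrable_test_lborel L um test_function_partial \<psi>)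
      have J2: "integrable lborel (\<lambda>x. \<psi> x *\<^sub>R G x $ i)" for i
        by (intro integrable_test_lborel L2_vec_nth L Gi \<psi>)
      have "(\<integral>x. (\<Sum>i\<in>UNIV. - y $ i * partial i \<phi> (x - t *\<^sub>R y)) *\<^sub>R u x \<partial>lborel)
        = (\<integral>x. (\<Sum>i\<in>UNIV. - y $ i *\<^sub>R (partial i \<psi> x *\<^sub>R u x)) \<partial>lborel)"
        unfolding p by (simp add: scaleR_sum_left)
      also have "\<dots> = (\<Sum>i\<in>UNIV. - y $ i *\<^sub>R (\<integral>x. partial i \<psi> x *\<^sub>R u x \<partial>lborel))"
        using J1 by (subst Bochner_Integration.integral_sum) (auto simp del: scaleR_scaleR)
      also have "\<dots> = (\<Sum>i\<in>UNIV. y $ i *\<^sub>R (\<integral>x. \<psi> x *\<^sub>R G x $ i \<partial>lborel))"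
      proof (rule sum.cong[OF refl])
        fix i
        have "(\<integral>x. partial i \<psi> x *\<^sub>R u x \<partial>lborel) = - (\<integral>x. \<psi> x *\<^sub>R G x $ i \<partial>lborel)"
          using wgradD(3)[OF w \<psi>, of i] integral_complex_L2_lborel[OF um test_function_partial[OF \<psi>]]
            integral_complex_L2_lborel[OF Gi \<psi>] by simp
        then show "- y $ i *\<^sub>R (\<integral>x. partial i \<psi> x *\<^sub>R u x \<partial>lborel) = y $ i *\<^sub>R (\<integral>x. \<psi> x *\<^sub>R G x $ i \<partial>lborel)" by simp
      qed
      also have "\<dots> = (\<integral>x. (\<Sum>i\<in>UNIV. y $ i *\<^sub>R (\<psi> x *\<^sub>R G x $ i)) \<partial>lborel)"
        using J2 by (subst Bochner_Integration.integral_sum) (auto simp del: scaleR_scaleR)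
      also have "\<dots> = (\<integral>x. \<psi> x *\<^sub>R (\<Sum>i\<in>UNIV. y $ i *\<^sub>R G x $ i) \<partial>lborel)"
        by (simp add: scaleR_sum_right mult.commute)
      also have "\<dots> = (\<integral>x. \<psi> (x + t *\<^sub>R y) *\<^sub>R (\<Sum>i\<in>UNIV. y $ i *\<^sub>R G (x + t *\<^sub>R y) $ i) \<partial>lborel)"
        by (rule integral_lborel_translate[symmetric]) measurable
      finally show ?thesis by (simp add: \<psi>_def dir_deriv_def)
    qed
    then show ?thesis by simp
  qed
  also have "\<dots> = (\<integral>x. \<phi> x *\<^sub>R line_integral y G x \<partial>lborel)"
    by (rule line_integral_test[OF L(2) G \<phi>, symmetric])
  finally show "(\<integral>x. \<phi> x *\<^sub>R (u (x + y) - u x - line_integral y G x) \<partial>lebesgue) = 0" by simp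
qed

corollary wgrad_translate:
  assumes w: "wgrad u G" and um[measurable]: "u \<in> borel_measurable borel"
  shows "sqn (\<lambda>x. u (x + y) - u x) \<le> (norm y)\<^sup>2 * sqn G"
proof -
  note L = wgradD(1,2)[OF w]
  obtain G' where G': "G' \<in> borel_measurable borel" and ae: "AE x in lebesgue. G x = G' x"
    using ex_borel_representative[OF L2D(1)[OF L(2)]] by blast
  have w': "wgrad u G'"
    by (rule wgrad_cong_AE[OF w L2D(1)[OF L(1)] borel_measurable_lebesgueI[OF G'] _ ae]) simp
  have "sqn (\<lambda>x. u (x + y) - u x) = sqn (line_integral y G')"
  proof (rule sqn_cong_AE)
    show "(\<lambda>x. u (x + y) - u x) \<in> borel_measurable lebesgue" by (rule borel_measurable_lebesgueI) measurable
    show "line_integral y G' \<in> borel_measurable lebesgue"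
      by (intro borel_measurable_lebesgueI line_integral_measurable G')
    show "AE x in lebesgue. u (x + y) - u x = line_integral y G' x"
      using wgrad_translate_AE[OF w' um G', of y] by eventually_elim simp
  qed
  also have "\<dots> \<le> (norm y)\<^sup>2 * sqn G'" using line_integral_L2(2)[OF wgradD(2)[OF w'] G'] .
  also have "sqn G' = sqn G"
    using ae by (intro sqn_cong_AE borel_measurable_lebesgueI[OF G'] L2D(1)[OF L(2)]) (auto elim!: eventually_mono)
  finally show ?thesis .
qed

text \<open>Each difference quotient of \<phi> has integral 0 by translation invariance, and the
  quotients converge to the partial derivative under a common integrable bound.\<close>

lemma integral_partial_zero:
  assumes \<phi>: "\<phi> \<in> test_functions"
  shows "(\<integral>x. partial i \<phi> x \<partial>lborel) = 0"
proof -
  obtain R where R: "\<And>x. norm x > R \<Longrightarrow> \<phi> x = 0" "R > 0" using test_function_support[OF \<phi>] by blast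
  obtain B where B: "\<And>x. \<bar>partial i \<phi> x\<bar> \<le> B" using test_function_bounded[OF test_function_partial[OF \<phi>]] by blast
  have sm: "smooth \<phi>" using \<phi> by (simp add: test_function_iff)
  have [measurable]: "\<phi> \<in> borel_measurable borel" "partial i \<phi> \<in> borel_measurable borel"
    using \<phi> test_measurable test_function_partial by auto
  let ?e = "axis i 1 :: R3"
  have d: "((\<lambda>s. \<phi> (x + s *\<^sub>R ?e)) has_real_derivative partial i \<phi> (x + s *\<^sub>R ?e)) (at s)" for x s
  proof -
    have "(\<Sum>j\<in>UNIV. ?e $ j * F j) = (\<Sum>j\<in>UNIV. if j = i then F j else 0)" for F :: "3 \<Rightarrow> real"
      by (rule sum.cong) (auto simp: axis_def)
    then show ?thesis using smooth_line_deriv[OF sm, of x ?e s] by simp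
  qed
  define q where "q n x = (\<phi> (x + (1 / real (Suc n)) *\<^sub>R ?e) - \<phi> x) * real (Suc n)" for n x
  have qm[measurable]: "q n \<in> borel_measurable borel" for n unfolding q_def[abs_def] by measurable
  have ipos: "integrable lborel \<phi>"
    using loc_integrable_test[OF L2_loc_integrable[OF test_function_L2[OF \<phi>]] \<phi>]
  proof -
    obtain B0 where B0: "\<And>x. \<bar>\<phi> x\<bar> \<le> B0" "0 \<le> B0" using test_function_bounded[OF \<phi>] by blast
    have "integrable lborel (\<lambda>x. B0 * indicator (cball (0::R3) R) x)"
      using emeasure_lborel_cball_finite[of "0::R3" R] by (intro integrable_mult_right) (simp add: integrable_indicator_iff)
    then show ?thesis
      by (rule Bochner_Integration.integrable_bound) (use B0 R in \<open>auto simp: indicator_def intro!: AE_I2\<close>)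
  qed
  have q0: "(\<integral>x. q n x \<partial>lborel) = 0" for n
  proof -
    have "integrable lborel (\<lambda>x. \<phi> (x + (1 / real (Suc n)) *\<^sub>R ?e))"
    proof -
      have "integrable (distr lborel borel ((+) ((1 / real (Suc n)) *\<^sub>R ?e))) \<phi>" unfolding lborel_distr_plus by (rule ipos)
      then show ?thesis by (subst (asm) integrable_distr_eq) (auto simp: add.commute)
    qed
    then show ?thesis using ipos integral_lborel_translate[of \<phi> "(1 / real (Suc n)) *\<^sub>R ?e"]
      by (simp add: q_def)
  qed
  have "(\<lambda>n. \<integral>x. q n x \<partial>lborel) \<longlonglongrightarrow> (\<integral>x. partial i \<phi> x \<partial>lborel)"
  proof (rule integral_dominated_convergence)
    show "integrable lborel (\<lambda>x. \<bar>B\<bar> * indicator (cball (0::R3) (R + 1)) x)"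
      using emeasure_lborel_cball_finite[of "0::R3" "R + 1"] by (intro integrable_mult_right) (simp add: integrable_indicator_iff)
    show "AE x in lborel. (\<lambda>n. q n x) \<longlonglongrightarrow> partial i \<phi> x"
    proof (rule AE_I2)
      fix x
      have "((\<lambda>h. (\<phi> (x + (0 + h) *\<^sub>R ?e) - \<phi> (x + 0 *\<^sub>R ?e)) / h) \<longlongrightarrow> partial i \<phi> (x + 0 *\<^sub>R ?e)) (at 0)"
        using d[of x 0] unfolding DERIV_def .
      moreover have "filterlim (\<lambda>n. 1 / real (Suc n)) (at 0) sequentially"
        unfolding filterlim_at using LIMSEQ_Suc[OF lim_1_over_n] by auto
      ultimately have "(\<lambda>n. (\<phi> (x + (0 + 1 / real (Suc n)) *\<^sub>R ?e) - \<phi> (x + 0 *\<^sub>R ?e)) / (1 / real (Suc n))) \<longlonglongrightarrow> partial i \<phi> (x + 0 *\<^sub>R ?e)"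
        by (rule filterlim_compose)
      then show "(\<lambda>n. q n x) \<longlonglongrightarrow> partial i \<phi> x" by (simp add: q_def)
    qed
    fix n
    show "AE x in lborel. norm (q n x) \<le> \<bar>B\<bar> * indicator (cball 0 (R + 1)) x"
    proof (rule AE_I2)
      fix x
      let ?h = "1 / real (Suc n)"
      have h: "0 < ?h" "?h \<le> 1" by auto
      show "norm (q n x) \<le> \<bar>B\<bar> * indicator (cball 0 (R + 1)) x"
      proof (cases "norm x \<le> R + 1")
        case True
        \<comment> \<open>The mean value theorem bounds the quotient by the derivative. Outside the
          ball of radius \<open>R + 1\<close> the quotient vanishes because the step is at most
          1.\<close>
        obtain z where "\<phi> (x + ?h *\<^sub>R ?e) - \<phi> (x + 0 *\<^sub>R ?e) = (?h - 0) * partial i \<phi> (x + z *\<^sub>R ?e)"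
          using MVT2[OF h(1), of "\<lambda>s. \<phi> (x + s *\<^sub>R ?e)" "\<lambda>s. partial i \<phi> (x + s *\<^sub>R ?e)"] d by blast
        then have "q n x = partial i \<phi> (x + z *\<^sub>R ?e)" by (simp add: q_def del: of_nat_Suc)
        then show ?thesis using B[of "x + z *\<^sub>R ?e"] True by simp
      next
        case False
        have "norm x - norm (- (?h *\<^sub>R ?e)) \<le> norm (x - (- (?h *\<^sub>R ?e)))" by (rule norm_triangle_ineq2)
        moreover have "norm (- (?h *\<^sub>R ?e)) = ?h" using h by simp
        ultimately have "R < norm (x + ?h *\<^sub>R ?e)" using False h(2) unfolding diff_minus_eq_add by linarith
        then show ?thesis using False R by (simp add: q_def del: of_nat_Suc)
      qed
    qed
  qed measurable
  then show ?thesis using q0 by (simp add: LIMSEQ_const_iff)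
qed

text \<open>Integration by parts in the form that the partial derivative of the product of \<psi>
  and \<phi> has integral 0.\<close>

lemma wgrad_test_function:
  assumes \<psi>: "\<psi> \<in> test_functions"
  shows "wgrad (\<lambda>x. complex_of_real (\<psi> x)) (\<lambda>x. \<chi> i. complex_of_real (partial i \<psi> x))"
  unfolding wgrad_def has_weak_gradient_def
proof (intro conjI ballI allI L2_vec_lambda test_function_L2 test_function_partial \<psi>)
  fix \<phi> :: "R3 \<Rightarrow> real" and i assume \<phi>: "\<phi> \<in> test_functions"
  have sm: "smooth \<psi>" "smooth \<phi>" using \<psi> \<phi> by (auto simp: test_function_iff)
  have [measurable]: "\<phi> \<in> borel_measurable borel" "partial i \<phi> \<in> borel_measurable borel"
     "\<psi> \<in> borel_measurable borel" "partial i \<psi> \<in> borel_measurable borel"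
    using \<phi> \<psi> test_measurable test_function_partial by auto
  have p: "partial i (\<lambda>x. \<psi> x * \<phi> x) x = \<psi> x * partial i \<phi> x + partial i \<psi> x * \<phi> x" for x
    by (rule partial_mult) (use sm smooth_differentiable in auto)
  note I = L2_integrable_mult[OF test_function_L2[OF \<psi>] test_function_L2[OF test_function_partial[OF \<phi>, of i]]]
    L2_integrable_mult[OF test_function_L2[OF test_function_partial[OF \<psi>, of i]] test_function_L2[OF \<phi>]]
  have "(\<integral>x. complex_of_real (\<psi> x) * complex_of_real (partial i \<phi> x) \<partial>lebesgue)
      + (\<integral>x. complex_of_real (partial i \<psi> x) * complex_of_real (\<phi> x) \<partial>lebesgue)
      = (\<integral>x. complex_of_real (partial i (\<lambda>x. \<psi> x * \<phi> x) x) \<partial>lebesgue)"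
    using I by (simp add: p flip: Bochner_Integration.integral_add)
  also have "\<dots> = (\<integral>x. complex_of_real (partial i (\<lambda>x. \<psi> x * \<phi> x) x) \<partial>lborel)"
    unfolding p by (rule integral_completion) measurable
  also have "\<dots> = complex_of_real (\<integral>x. partial i (\<lambda>x. \<psi> x * \<phi> x) x \<partial>lborel)"
    by (rule integral_complex_of_real)
  also have "\<dots> = 0" using integral_partial_zero[OF test_function_mult[OF sm(1) \<phi>]] by simp
  finally show "(\<integral>x. complex_of_real (\<psi> x) * complex_of_real (partial i \<phi> x) \<partial>lebesgue) =
    - (\<integral>x. (\<chi> i. complex_of_real (partial i \<psi> x)) $ i * complex_of_real (\<phi> x) \<partial>lebesgue)"
    by (simp add: eq_neg_iff_add_eq_0)
qed


section \<open>Compactness in \<open>L\<^sup>2\<close>\<close>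

definition cell_index :: "real \<Rightarrow> R3 \<Rightarrow> int ^ 3" where
  "cell_index r x = (\<chi> i. \<lfloor>x $ i / r\<rfloor>)"

definition cell :: "real \<Rightarrow> int ^ 3 \<Rightarrow> R3 set" where
  "cell r z = {y. cell_index r y = z}"

lemma mem_cell: "y \<in> cell r z \<longleftrightarrow> (\<forall>i. \<lfloor>y $ i / r\<rfloor> = z $ i)"
  by (simp add: cell_def cell_index_def vec_eq_iff)

lemma mem_cell_iff: "0 < r \<Longrightarrow> y \<in> cell r z \<longleftrightarrow> (\<forall>i. r * z $ i \<le> y $ i \<and> y $ i < r * (z $ i + 1))"
  unfolding mem_cell floor_eq_iff by (simp add: field_simps)

lemma cell_borel [measurable]: "cell r z \<in> sets borel"
proof -
  have "{y\<in>space borel. \<forall>i. \<lfloor>y $ i / r\<rfloor> = z $ i} \<in> sets (borel :: R3 measure)" by measurable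
  then show ?thesis by (simp add: mem_cell[symmetric])
qed

lemma emeasure_cell:
  assumes r: "0 < r"
  shows "emeasure lborel (cell r z) = ennreal (r ^ 3)"
proof -
  define a :: R3 where "a = (\<chi> i. r * z $ i)"
  define b :: R3 where "b = (\<chi> i. r * (z $ i + 1))"
  have ab: "(b - a) \<bullet> c = r" if "c \<in> Basis" for c
    using that by (auto simp: a_def b_def Basis_vec_def inner_axis algebra_simps)
  have le: "a \<bullet> c \<le> b \<bullet> c" if "c \<in> Basis" for c using ab[OF that] r by (simp add: inner_diff_left)
  have p: "(\<Prod>c\<in>Basis. (b - a) \<bullet> c) = r ^ 3"
  proof -
    have "(\<Prod>c\<in>Basis. (b - a) \<bullet> c) = (\<Prod>c\<in>(Basis :: R3 set). r)" using ab by (intro prod.cong) auto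
    then show ?thesis by simp
  qed
  have 1: "box a b \<subseteq> cell r z"
    by (auto simp: mem_box_cart mem_cell_iff[OF r] a_def b_def less_imp_le)
  have 2: "cell r z \<subseteq> cbox a b"
    by (auto simp: mem_box_cart mem_cell_iff[OF r] a_def b_def less_imp_le)
  have "emeasure lborel (box a b) \<le> emeasure lborel (cell r z)"
    by (rule emeasure_mono[OF 1]) simp
  moreover have "emeasure lborel (cell r z) \<le> emeasure lborel (cbox a b)"
    by (rule emeasure_mono[OF 2]) simp
  ultimately show ?thesis using emeasure_lborel_box[OF le] emeasure_lborel_cbox[OF le] p by simp
qed

text \<open>The conditional expectation on the grid of side \<open>r\<close>. It serves as the
  smoothing of \<open>u\<close>, both in the compactness theorem and, with a side depending on a
  level, in \<open>H1_tail_estimate\<close>.\<close>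

definition cell_avg :: "real \<Rightarrow> (R3 \<Rightarrow> complex) \<Rightarrow> R3 \<Rightarrow> complex" where
  "cell_avg r u x = (1 / r ^ 3) *\<^sub>R (\<integral>y. indicator (cell r (cell_index r x)) y *\<^sub>R u y \<partial>lborel)"

lemma pred_same_cell:
  "Measurable.pred (lborel \<Otimes>\<^sub>M lborel) (\<lambda>p :: R3 \<times> R3. snd p \<in> cell r (cell_index r (fst p)))"
proof -
  have [measurable]: "(\<lambda>p :: R3 \<times> R3. fst p $ i) \<in> borel_measurable (lborel \<Otimes>\<^sub>M lborel)"
    "(\<lambda>p :: R3 \<times> R3. snd p $ i) \<in> borel_measurable (lborel \<Otimes>\<^sub>M lborel)" for i
    by (rule measurable_compose[OF measurable_fst], simp) (rule measurable_compose[OF measurable_snd], simp)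
  show ?thesis unfolding mem_cell cell_index_def vec_lambda_beta by measurable
qed

lemma cell_avg_measurable:
  assumes [measurable]: "u \<in> borel_measurable borel"
  shows "cell_avg r u \<in> borel_measurable borel"
proof -
  note [measurable] = pred_same_cell
  have "(\<lambda>(x, y). indicator (cell r (cell_index r x)) y *\<^sub>R u y) \<in> borel_measurable (lborel \<Otimes>\<^sub>M lborel)"
    unfolding split_beta' indicator_def by measurable
  then have "(\<lambda>x. \<integral>y. indicator (cell r (cell_index r x)) y *\<^sub>R u y \<partial>lborel) \<in> borel_measurable lborel"
    by (rule lborel.borel_measurable_lebesgue_integral)
  then show ?thesis unfolding cell_avg_def[abs_def] by simp
qed

lemma norm_cell_integral_le:
  assumes "u \<in> L2" "u \<in> borel_measurable borel" and r: "0 < r"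
  shows "(norm (\<integral>y. indicator (cell r z) y *\<^sub>R u y \<partial>lborel))\<^sup>2 \<le> r ^ 3 * sqn u"
proof -
  note [measurable] = assms(2)
  have "ennreal ((norm (\<integral>y. indicator (cell r z) y *\<^sub>R u y \<partial>lborel))\<^sup>2)
    \<le> ennreal (r ^ 3) * (\<integral>\<^sup>+y. indicator (cell r z) y * ennreal ((norm (u y))\<^sup>2) \<partial>lborel)"
    by (rule norm_set_integral_power2_le) (use r in \<open>auto simp: emeasure_cell assms\<close>)
  also have "\<dots> \<le> ennreal (r ^ 3) * (\<integral>\<^sup>+y. ennreal ((norm (u y))\<^sup>2) \<partial>lborel)"
    by (intro mult_left_mono nn_integral_mono) (auto simp: indicator_def)
  also have "\<dots> = ennreal (r ^ 3 * sqn u)"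
    unfolding L2_nn_integral[OF assms(1,2)] using r by (simp add: ennreal_mult)
  finally show ?thesis using r by (simp add: ennreal_le_iff)
qed

lemma inverse_square_mult: "0 < a \<Longrightarrow> (1 / a)\<^sup>2 * a = 1 / (a :: real)"
  by (simp add: power2_eq_square)

lemma norm_cell_avg_le:
  assumes "u \<in> L2" "u \<in> borel_measurable borel" and r: "0 < r"
  shows "(norm (cell_avg r u x))\<^sup>2 \<le> sqn u / r ^ 3"
proof -
  have "(norm (cell_avg r u x))\<^sup>2 = (1 / r ^ 3)\<^sup>2 * (norm (\<integral>y. indicator (cell r (cell_index r x)) y *\<^sub>R u y \<partial>lborel))\<^sup>2"
    using r by (simp add: cell_avg_def power_mult_distrib power_divide)
  also have "\<dots> \<le> (1 / r ^ 3)\<^sup>2 * (r ^ 3 * sqn u)"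
    by (intro mult_left_mono norm_cell_integral_le assms) simp
  also have "\<dots> = (1 / r ^ 3)\<^sup>2 * r ^ 3 * sqn u" by simp
  also have "\<dots> = sqn u / r ^ 3" unfolding inverse_square_mult[OF zero_less_power[OF r]] by simp
  finally show ?thesis .
qed

text \<open>A Poincare inequality by translations. By Jensen the square at \<open>x\<close> is at
  most the mean of |u x - u y|^2 over the cell of \<open>x\<close>. There y - x lies in a cube of
  side 2 r, which has volume 8 r^3 and on which |y - x|^2 is at most 3 r^2; the translation estimate
  then gives the constant 24 = 8 * 3.\<close>

lemma sqn_sub_cell_avg:
  assumes w: "wgrad u G" and um[measurable]: "u \<in> borel_measurable borel" and r: "0 < r"
  shows "(\<lambda>x. u x - cell_avg r u x) \<in> L2" "sqn (\<lambda>x. u x - cell_avg r u x) \<le> 24 * r\<^sup>2 * sqn G"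
proof -
  note L = wgradD(1,2)[OF w]
  note [measurable] = pred_same_cell
  let ?Q = "\<lambda>x. cell r (cell_index r x)"
  let ?B = "cbox (\<chi> i. - r) (\<chi> i. r) :: R3 set"
  have iu: "integrable lborel (\<lambda>y. indicator (cell r z) y *\<^sub>R u y)" for z
  proof -
    have "(indicator (cell r z) :: R3 \<Rightarrow> real) \<in> L2"
    proof (rule indicator_finite_L2)
      show "cell r z \<in> sets lebesgue" using cell_borel by simp
      show "emeasure lebesgue (cell r z) < \<infinity>" using emeasure_cell[OF r, of z] cell_borel by simp
    qed
    moreover have "(\<lambda>y. indicator (cell r z) y *\<^sub>R u y) \<in> borel_measurable borel" by measurable
    ultimately have "integrable lebesgue (\<lambda>y. indicator (cell r z) y *\<^sub>R u y)"
      using L(1) by (intro L2_integrable_bilinear[where f = "indicator (cell r z) :: R3 \<Rightarrow> real" and g = u])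
        (auto intro!: borel_measurable_lebesgueI)
    then show ?thesis by (subst (asm) integrable_completion) auto
  qed
  have pt: "ennreal ((norm (u x - cell_avg r u x))\<^sup>2)
     \<le> ennreal (1 / r ^ 3) * (\<integral>\<^sup>+y. indicator (?Q x) y * ennreal ((norm (u x - u y))\<^sup>2) \<partial>lborel)" for x
  proof -
    have i1: "integrable lborel (\<lambda>y. indicator (?Q x) y *\<^sub>R u x)"
      using emeasure_cell[OF r] by (intro integrable_scaleR_left) (simp add: integrable_indicator_iff)
    have "(\<integral>y. indicator (?Q x) y *\<^sub>R (u x - u y) \<partial>lborel) = (\<integral>y. indicator (?Q x) y *\<^sub>R u x \<partial>lborel) - (\<integral>y. indicator (?Q x) y *\<^sub>R u y \<partial>lborel)"
      unfolding scaleR_diff_right by (rule Bochner_Integration.integral_diff[OF i1 iu])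
    also have "(\<integral>y. indicator (?Q x) y *\<^sub>R u x \<partial>lborel) = r ^ 3 *\<^sub>R u x"
      using emeasure_cell[OF r] r by (simp add: measure_def)
    finally have "u x - cell_avg r u x = (1 / r ^ 3) *\<^sub>R (\<integral>y. indicator (?Q x) y *\<^sub>R (u x - u y) \<partial>lborel)"
      using r by (simp add: cell_avg_def scaleR_diff_right)
    then have "(norm (u x - cell_avg r u x))\<^sup>2 = (1 / r ^ 3)\<^sup>2 * (norm (\<integral>y. indicator (?Q x) y *\<^sub>R (u x - u y) \<partial>lborel))\<^sup>2"
      using r by (simp add: power_mult_distrib power_divide)
    then have "ennreal ((norm (u x - cell_avg r u x))\<^sup>2)
       = ennreal ((1 / r ^ 3)\<^sup>2) * ennreal ((norm (\<integral>y. indicator (?Q x) y *\<^sub>R (u x - u y) \<partial>lborel))\<^sup>2)"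
      by (simp add: ennreal_mult)
    also have "\<dots> \<le> ennreal ((1 / r ^ 3)\<^sup>2) * (ennreal (r ^ 3) * (\<integral>\<^sup>+y. indicator (?Q x) y * ennreal ((norm (u x - u y))\<^sup>2) \<partial>lborel))"
      by (intro mult_left_mono norm_set_integral_power2_le) (use r in \<open>auto simp: emeasure_cell\<close>)
    also have "\<dots> = ennreal (1 / r ^ 3) * (\<integral>\<^sup>+y. indicator (?Q x) y * ennreal ((norm (u x - u y))\<^sup>2) \<partial>lborel)"
      using r inverse_square_mult[OF zero_less_power[OF r], of 3]
      by (simp only: mult.assoc[symmetric]) (simp add: ennreal_mult[symmetric] del: power_mult)
    finally show ?thesis .
  qed
  have sub: "z \<in> ?B" if "x + z \<in> ?Q x" for x z
  proof -
    have "x \<in> ?Q x" by (simp add: cell_def)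
    then have "\<And>i. r * cell_index r x $ i \<le> x $ i \<and> x $ i < r * (cell_index r x $ i + 1)"
      unfolding mem_cell_iff[OF r] by blast
    moreover have "\<And>i. r * cell_index r x $ i \<le> (x + z) $ i \<and> (x + z) $ i < r * (cell_index r x $ i + 1)"
      using that unfolding mem_cell_iff[OF r] by blast
    ultimately have "- r \<le> z $ i \<and> z $ i \<le> r" for i
      by (simp add: algebra_simps) (smt (verit))
    then show ?thesis by (simp add: mem_box_cart)
  qed
  have nz: "(norm z)\<^sup>2 \<le> 3 * r\<^sup>2" if "z \<in> ?B" for z
  proof -
    have "\<bar>z $ i\<bar> \<le> r" for i using that by (auto simp: mem_box_cart abs_le_iff) (metis minus_le_iff)
    then have "(z $ i)\<^sup>2 \<le> r\<^sup>2" for i using r by (simp add: abs_le_square_iff[symmetric])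
    then have "(\<Sum>i\<in>UNIV. (z $ i)\<^sup>2) \<le> (\<Sum>i\<in>(UNIV :: 3 set). r\<^sup>2)" by (intro sum_mono)
    moreover have "(norm z)\<^sup>2 = (\<Sum>i\<in>UNIV. (z $ i)\<^sup>2)"
      unfolding power2_norm_eq_inner inner_vec_def by (simp add: power2_eq_square)
    ultimately show ?thesis by simp
  qed
  have Bm: "emeasure lborel ?B = ennreal (8 * r ^ 3)"
  proof -
    have d: "((\<chi> i. r) - (\<chi> i. - r)) \<bullet> c = 2 * r" if "c \<in> Basis" for c :: R3
      using that by (auto simp: Basis_vec_def inner_axis)
    then have le: "(\<chi> i. - r) \<bullet> c \<le> (\<chi> i. r) \<bullet> c" if "c \<in> Basis" for c :: R3
      using that r by (simp add: inner_diff_left) (smt (verit))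
    have "(\<Prod>c\<in>(Basis :: R3 set). ((\<chi> i. r) - (\<chi> i. - r)) \<bullet> c) = (\<Prod>c\<in>(Basis :: R3 set). 2 * r)"
      using d by (intro prod.cong) auto
    then show ?thesis using emeasure_lborel_cbox[of "(\<chi> i. - r) :: R3" "\<chi> i. r"] le by (simp add: power_mult_distrib)
  qed
  have "(\<integral>\<^sup>+x. ennreal ((norm (u x - cell_avg r u x))\<^sup>2) \<partial>lborel)
    \<le> (\<integral>\<^sup>+x. ennreal (1 / r ^ 3) * (\<integral>\<^sup>+y. indicator (?Q x) y * ennreal ((norm (u x - u y))\<^sup>2) \<partial>lborel) \<partial>lborel)"
    by (intro nn_integral_mono pt)
  \<comment> \<open>After the substitution y = x + z the cell is enlarged to the cube
    \<open>?B\<close>, which does not depend on \<open>x\<close>, so that the integrations can be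
    interchanged.\<close>
  also have "\<dots> \<le> (\<integral>\<^sup>+x. ennreal (1 / r ^ 3) * (\<integral>\<^sup>+z. indicator ?B z * ennreal ((norm (u (x + z) - u x))\<^sup>2) \<partial>lborel) \<partial>lborel)"
  proof (rule nn_integral_mono, rule mult_left_mono)
    fix x
    have "(\<integral>\<^sup>+y. indicator (?Q x) y * ennreal ((norm (u x - u y))\<^sup>2) \<partial>lborel)
       = (\<integral>\<^sup>+z. indicator (?Q x) (z + x) * ennreal ((norm (u x - u (z + x)))\<^sup>2) \<partial>lborel)"
      by (rule nn_integral_lborel_translate[symmetric]) measurable
    also have "\<dots> \<le> (\<integral>\<^sup>+z. indicator ?B z * ennreal ((norm (u (x + z) - u x))\<^sup>2) \<partial>lborel)"
    proof (intro nn_integral_mono mult_mono)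
      fix z show "indicator (?Q x) (z + x) \<le> (indicator ?B z :: ennreal)"
        using sub[of x z] unfolding indicator_def by (simp only: add.commute[of z x]) auto
    qed (auto simp: norm_minus_commute add.commute)
    finally show "(\<integral>\<^sup>+y. indicator (?Q x) y * ennreal ((norm (u x - u y))\<^sup>2) \<partial>lborel)
       \<le> (\<integral>\<^sup>+z. indicator ?B z * ennreal ((norm (u (x + z) - u x))\<^sup>2) \<partial>lborel)" .
  qed simp
  also have "\<dots> = ennreal (1 / r ^ 3) * (\<integral>\<^sup>+x. (\<integral>\<^sup>+z. indicator ?B z * ennreal ((norm (u (x + z) - u x))\<^sup>2) \<partial>lborel) \<partial>lborel)"
    by (rule nn_integral_cmult) measurable
  also have "(\<integral>\<^sup>+x. (\<integral>\<^sup>+z. indicator ?B z * ennreal ((norm (u (x + z) - u x))\<^sup>2) \<partial>lborel) \<partial>lborel)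
    = (\<integral>\<^sup>+z. (\<integral>\<^sup>+x. indicator ?B z * ennreal ((norm (u (x + z) - u x))\<^sup>2) \<partial>lborel) \<partial>lborel)"
    by (rule lborel_pair.Fubini'[symmetric]) measurable
  also have "\<dots> \<le> (\<integral>\<^sup>+z. ennreal (3 * r\<^sup>2 * sqn G) * indicator ?B z \<partial>lborel)"
  proof (intro nn_integral_mono)
    fix z
    have "(\<integral>\<^sup>+x. indicator ?B z * ennreal ((norm (u (x + z) - u x))\<^sup>2) \<partial>lborel) = indicator ?B z * (\<integral>\<^sup>+x. ennreal ((norm (u (x + z) - u x))\<^sup>2) \<partial>lborel)"
      by (rule nn_integral_cmult) measurable
    also have "(\<integral>\<^sup>+x. ennreal ((norm (u (x + z) - u x))\<^sup>2) \<partial>lborel) = ennreal (sqn (\<lambda>x. u (x + z) - u x))"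
      by (rule L2_nn_integral) (intro L2_diff L2_translate L um, measurable)
    also have "indicator ?B z * ennreal (sqn (\<lambda>x. u (x + z) - u x)) \<le> indicator ?B z * ennreal (3 * r\<^sup>2 * sqn G)"
    proof (cases "z \<in> ?B")
      case True
      have "sqn (\<lambda>x. u (x + z) - u x) \<le> (norm z)\<^sup>2 * sqn G" by (rule wgrad_translate[OF w um])
      also have "\<dots> \<le> 3 * r\<^sup>2 * sqn G" using nz[OF True] by (intro mult_right_mono) auto
      finally show ?thesis by (intro mult_left_mono ennreal_leI) auto
    qed simp
    finally show "(\<integral>\<^sup>+x. indicator ?B z * ennreal ((norm (u (x + z) - u x))\<^sup>2) \<partial>lborel) \<le> ennreal (3 * r\<^sup>2 * sqn G) * indicator ?B z"
      by (simp add: mult.commute)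
  qed
  also have "\<dots> = ennreal (3 * r\<^sup>2 * sqn G) * ennreal (8 * r ^ 3)"
    unfolding Bm[symmetric] by (rule nn_integral_cmult_indicator) simp
  also have "ennreal (1 / r ^ 3) * (ennreal (3 * r\<^sup>2 * sqn G) * ennreal (8 * r ^ 3)) = ennreal (24 * r\<^sup>2 * sqn G)"
    using r by (simp add: ennreal_mult'[symmetric])
  finally have *: "(\<integral>\<^sup>+x. ennreal ((norm (u x - cell_avg r u x))\<^sup>2) \<partial>lborel) \<le> ennreal (24 * r\<^sup>2 * sqn G)"
    by (simp add: mult_left_mono)
  have m: "(\<lambda>x. u x - cell_avg r u x) \<in> borel_measurable borel"
    using cell_avg_measurable[OF um] by measurable
  from L2I_nn_integral[OF m *] show "(\<lambda>x. u x - cell_avg r u x) \<in> L2" "sqn (\<lambda>x. u x - cell_avg r u x) \<le> 24 * r\<^sup>2 * sqn G"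
    by auto
qed

section \<open>Extraction of convergent subsequences\<close>

lemma diagonal_convergent_subsequence:
  fixes a :: "nat \<Rightarrow> 'k::countable \<Rightarrow> 'b::euclidean_space"
  assumes bdd: "\<And>k. bounded (range (\<lambda>n. a n k))"
  obtains s :: "nat \<Rightarrow> nat" where "strict_mono s" "\<And>k. convergent (\<lambda>n. a (s n) k)"
proof -
  interpret subseqs "\<lambda>k s. convergent (\<lambda>n. a (s n) (from_nat k))"
  proof
    fix k and s :: "nat \<Rightarrow> nat"
    have "bounded (range (\<lambda>n. a (s n) (from_nat k)))"
      by (rule bounded_subset[OF bdd[of "from_nat k"]]) auto
    then obtain l r where "strict_mono (r :: nat \<Rightarrow> nat)" "((\<lambda>n. a (s n) (from_nat k)) \<circ> r) \<longlonglongrightarrow> l"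
      using bounded_imp_convergent_subsequence by blast
    then show "\<exists>r'. strict_mono r' \<and> convergent (\<lambda>n. a ((s \<circ> r') n) (from_nat k))"
      by (auto simp: o_def convergent_def)
  qed
  have "convergent (\<lambda>n. a (diagseq n) k)" for k
  proof -
    have "convergent (\<lambda>n. a ((diagseq \<circ> ((+) (Suc (to_nat k)))) n) (from_nat (to_nat k)))"
    proof (rule diagseq_holds)
      fix r s :: "nat \<Rightarrow> nat" and n assume "strict_mono r" "convergent (\<lambda>i. a (s i) (from_nat n))"
      then show "convergent (\<lambda>i. a ((s \<circ> r) i) (from_nat n))"
        using convergent_subseq_convergent[of "\<lambda>i. a (s i) (from_nat n)" r] by (simp add: o_def)
    qed
    then have "convergent (\<lambda>n. a (diagseq (n + Suc (to_nat k))) k)" by (simp add: add.commute)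
    then show ?thesis using convergent_ignore_initial_segment[of "\<lambda>n. a (diagseq n) k" "Suc (to_nat k)"] by simp
  qed
  with subseq_diagseq show ?thesis using that by blast
qed

lemma sqn_le_imp_L2_norm_le: "sqn f \<le> c\<^sup>2 \<Longrightarrow> 0 \<le> c \<Longrightarrow> L2_norm f \<le> c"
  unfolding L2_norm_sqrt by (rule real_le_lsqrt) auto

text \<open>
  On a ball the cell averages take finitely many values, and by the translation estimate for weak
  gradients they approximate in \<open>L\<^sup>2\<close> uniformly along the sequence.
\<close>

theorem H1_tight_compactness:
  fixes u :: "nat \<Rightarrow> R3 \<Rightarrow> complex"
  assumes w: "\<And>n. wgrad (u n) (G n)" and um[measurable]: "\<And>n. u n \<in> borel_measurable borel"
    and A: "\<And>n. sqn (u n) \<le> A" and K: "\<And>n. sqn (G n) \<le> K"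
    and tight: "\<And>e. e > 0 \<Longrightarrow> \<exists>R N. \<forall>n\<ge>N. sqn (\<lambda>x. indicator (- cball 0 R) x *\<^sub>R u n x) \<le> e"
  obtains s :: "nat \<Rightarrow> nat" where "strict_mono s"
    "\<And>e. e > 0 \<Longrightarrow> \<exists>N. \<forall>m\<ge>N. \<forall>n\<ge>N. sqn (\<lambda>x. u (s m) x - u (s n) x) \<le> e"
proof -
  note L = wgradD(1,2)[OF w]
  define rr where "rr j = 1 / real (Suc j)" for j
  have rr: "0 < rr j" for j by (simp add: rr_def)
  \<comment> \<open>The integrals over all cells of all grids of side 1/(j+1) form a countable
    family of bounded sequences, so one diagonal subsequence serves every grid.\<close>
  define a where "a n k = (case k of (j, z) \<Rightarrow> \<integral>y. indicator (cell (rr j) z) y *\<^sub>R u n y \<partial>lborel)" for n and k :: "nat \<times> (int ^ 3)"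
  have "bounded (range (\<lambda>n. a n k))" for k
  proof -
    obtain j z where k: "k = (j, z)" by (cases k)
    have "norm (a n k) \<le> sqrt (rr j ^ 3 * A)" for n
    proof (rule real_le_rsqrt)
      have "(norm (a n k))\<^sup>2 \<le> rr j ^ 3 * sqn (u n)"
        unfolding a_def k by (simp add: norm_cell_integral_le[OF L(1) um rr])
      also have "\<dots> \<le> rr j ^ 3 * A" using A rr[of j] by (intro mult_left_mono) auto
      finally show "(norm (a n k))\<^sup>2 \<le> rr j ^ 3 * A" .
    qed
    then show ?thesis by (auto simp: bounded_iff)
  qed
  then obtain s :: "nat \<Rightarrow> nat" where s: "strict_mono s" "\<And>k. convergent (\<lambda>n. a (s n) k)"
    using diagonal_convergent_subsequence by blast
  define V where "V j n = cell_avg (rr j) (u (s n))" for j n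
  have Vm[measurable]: "V j n \<in> borel_measurable borel" for j n unfolding V_def by (rule cell_avg_measurable) (rule um)
  have Vconv: "convergent (\<lambda>n. V j n x)" for j x
  proof -
    have "V j n x = (1 / rr j ^ 3) *\<^sub>R a (s n) (j, cell_index (rr j) x)" for n
      by (simp add: V_def cell_avg_def a_def)
    moreover obtain l where "(\<lambda>n. a (s n) (j, cell_index (rr j) x)) \<longlonglongrightarrow> l"
      using s(2)[of "(j, cell_index (rr j) x)"] by (auto simp: convergent_def)
    ultimately show ?thesis by (auto simp: convergent_def intro!: exI tendsto_scaleR)
  qed
  define Y where "Y j x = lim (\<lambda>n. V j n x)" for j x
  have Ym[measurable]: "Y j \<in> borel_measurable borel" for j unfolding Y_def[abs_def] by measurable
  have Ylim: "(\<lambda>n. V j n x) \<longlonglongrightarrow> Y j x" for j x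
    using Vconv by (simp add: Y_def convergent_LIMSEQ_iff)
  define M where "M j = sqrt (A / rr j ^ 3)" for j
  have VM: "norm (V j n x) \<le> M j" for j n x
    unfolding M_def
  proof (rule real_le_rsqrt)
    have "(norm (V j n x))\<^sup>2 \<le> sqn (u (s n)) / rr j ^ 3" unfolding V_def by (rule norm_cell_avg_le[OF L(1) um rr])
    also have "\<dots> \<le> A / rr j ^ 3" using A rr[of j] by (intro divide_right_mono) auto
    finally show "(norm (V j n x))\<^sup>2 \<le> A / rr j ^ 3" .
  qed
  have YM: "norm (Y j x) \<le> M j" for j x
    by (rule LIMSEQ_le_const2[OF tendsto_norm[OF Ylim]]) (use VM in auto)
  have indm[measurable]: "(\<lambda>x. indicator (cball (0::R3) R) x :: real) \<in> borel_measurable borel" for R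
    by (rule borel_measurable_indicator) simp
  have dct: "(\<lambda>n. sqn (\<lambda>x. indicator (cball 0 R) x *\<^sub>R (V j n x - Y j x))) \<longlonglongrightarrow> 0" for j R
  proof -
    have "(\<lambda>n. \<integral>x. indicator (cball 0 R) x * (norm (V j n x - Y j x))\<^sup>2 \<partial>lborel) \<longlonglongrightarrow> (\<integral>x. 0 \<partial>(lborel :: R3 measure))"
    proof (rule integral_dominated_convergence)
      show "integrable lborel (\<lambda>x. (2 * M j)\<^sup>2 * indicator (cball (0::R3) R) x)"
        using emeasure_lborel_cball_finite[of "0::R3" R] by (intro integrable_mult_right) (simp add: integrable_indicator_iff)
      show "AE x in lborel. (\<lambda>n. indicator (cball 0 R) x * (norm (V j n x - Y j x))\<^sup>2) \<longlonglongrightarrow> 0"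
      proof (rule AE_I2)
        fix x
        have "(\<lambda>n. indicator (cball 0 R) x * (norm (V j n x - Y j x))\<^sup>2) \<longlonglongrightarrow> indicator (cball 0 R) x * (norm (Y j x - Y j x))\<^sup>2"
          by (intro tendsto_intros Ylim)
        then show "(\<lambda>n. indicator (cball 0 R) x * (norm (V j n x - Y j x))\<^sup>2) \<longlonglongrightarrow> 0" by simp
      qed
      fix n
      have "(norm (V j n x - Y j x))\<^sup>2 \<le> (2 * M j)\<^sup>2" for x
        using norm_triangle_ineq4[of "V j n x" "Y j x"] VM[of j n x] YM[of j x] by (intro power_mono) auto
      then show "AE x in lborel. norm (indicator (cball 0 R) x * (norm (V j n x - Y j x))\<^sup>2) \<le> (2 * M j)\<^sup>2 * indicator (cball 0 R) x"
        by (intro AE_I2) (auto simp: indicator_def)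
    qed measurable
    moreover have "sqn (\<lambda>x. indicator (cball 0 R) x *\<^sub>R (V j n x - Y j x)) = (\<integral>x. indicator (cball 0 R) x * (norm (V j n x - Y j x))\<^sup>2 \<partial>lborel)" for n
    proof -
      have "(\<lambda>x. indicator (cball 0 R) x *\<^sub>R (V j n x - Y j x)) \<in> borel_measurable borel" by measurable
      from sqn_lborel[OF this] show ?thesis
        by (simp add: power_mult_distrib) (rule Bochner_Integration.integral_cong, auto simp: indicator_def)
    qed
    ultimately show ?thesis by simp
  qed
  have "\<exists>N. \<forall>m\<ge>N. \<forall>n\<ge>N. sqn (\<lambda>x. u (s m) x - u (s n) x) \<le> e" if e: "e > 0" for e
  proof -
    \<comment> \<open>Three errors of norm at most \<open>d\<close> separate each member from a
      fixed function, so two members differ by at most 6 d = sqrt e.\<close>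
    define d where "d = sqrt e / 6"
    have d0: "0 \<le> d" and d2: "d\<^sup>2 = e / 36" using e by (auto simp: d_def power_divide)
    have e36: "e / 36 > 0" using e by simp
    obtain R N1 where N1: "\<And>n. n \<ge> N1 \<Longrightarrow> sqn (\<lambda>x. indicator (- cball 0 R) x *\<^sub>R u n x) \<le> e / 36"
      using tight[OF e36] by blast
    \<comment> \<open>The grid is so fine that the averaging error 24 r^2 K is at most d^2 = e /
      36.\<close>
    obtain j :: nat where j: "24 * K * 36 / e \<le> real j" using real_arch_simple by blast
    have jK: "24 * (rr j)\<^sup>2 * K \<le> e / 36"
    proof -
      have "24 * K \<le> e / 36 * real j" using j e by (simp add: field_simps)
      also have "\<dots> \<le> e / 36 * (real (Suc j))\<^sup>2"
        using e by (intro mult_left_mono) (auto simp: power2_eq_square algebra_simps)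
      finally show ?thesis by (simp add: rr_def power_divide field_simps)
    qed
    obtain N2 where N2: "\<And>n. n \<ge> N2 \<Longrightarrow> sqn (\<lambda>x. indicator (cball 0 R) x *\<^sub>R (V j n x - Y j x)) \<le> e / 36"
    proof -
      from order_tendstoD(2)[OF dct[of R j] e36] obtain N2 where
        "\<And>n. n \<ge> N2 \<Longrightarrow> sqn (\<lambda>x. indicator (cball 0 R) x *\<^sub>R (V j n x - Y j x)) < e / 36"
        by (auto simp: eventually_sequentially)
      then show ?thesis using that less_imp_le by blast
    qed
    define D where "D n x = u (s n) x - indicator (cball 0 R) x *\<^sub>R Y j x" for n x
    have D: "D n \<in> L2 \<and> L2_norm (D n) \<le> 3 * d" if n: "n \<ge> max N1 N2" for n
    proof -
      \<comment> \<open>In this order: the mass outside the ball, the averaging error inside it, and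
        the distance of the averages from their limit inside it.\<close>
      let ?f1 = "\<lambda>x. indicator (- cball 0 R) x *\<^sub>R u (s n) x"
      let ?f2 = "\<lambda>x. indicator (cball 0 R) x *\<^sub>R (u (s n) x - V j n x)"
      let ?f3 = "\<lambda>x. indicator (cball 0 R) x *\<^sub>R (V j n x - Y j x)"
      have f: "?f1 \<in> borel_measurable borel" "?f2 \<in> borel_measurable borel" "?f3 \<in> borel_measurable borel"
      proof -
        have [measurable]: "(\<lambda>x. indicator (- cball (0::R3) R) x :: real) \<in> borel_measurable borel"
          by (rule borel_measurable_indicator) simp
        show "?f1 \<in> borel_measurable borel" "?f2 \<in> borel_measurable borel" "?f3 \<in> borel_measurable borel" by measurable
      qed
      note sa = sqn_sub_cell_avg[OF w um rr, of "s n" j, folded V_def]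
      have l1: "?f1 \<in> L2"
        by (rule L2_dominated[OF L(1), of _ 1]) (use f in \<open>auto simp: indicator_def intro: borel_measurable_lebesgueI\<close>)
      have l2: "?f2 \<in> L2"
        by (rule L2_dominated[OF sa(1), of _ 1]) (use f in \<open>auto simp: indicator_def intro: borel_measurable_lebesgueI\<close>)
      have l3: "?f3 \<in> L2"
      proof (rule L2_dominated[of "indicator (cball (0::R3) R) :: R3 \<Rightarrow> real" _ "2 * M j"])
        show "(indicator (cball (0::R3) R) :: R3 \<Rightarrow> real) \<in> L2"
          by (rule indicator_finite_L2[OF _ emeasure_lebesgue_cball]) simp
        have "norm (V j n x - Y j x) \<le> 2 * M j" for x
          using norm_triangle_ineq4[of "V j n x" "Y j x"] VM[of j n x] YM[of j x] by linarith
        then show "AE x in lebesgue. norm (?f3 x) \<le> 2 * M j * norm (indicator (cball 0 R) x :: real)"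
          by (intro AE_I2) (auto simp: indicator_def)
      qed (use f in \<open>auto intro: borel_measurable_lebesgueI\<close>)
      have "n \<le> s n" using s(1) by (rule seq_suble)
      then have b1: "L2_norm ?f1 \<le> d" using N1[of "s n"] n d0 d2 by (intro sqn_le_imp_L2_norm_le) auto
      have "sqn ?f2 \<le> sqn (\<lambda>x. u (s n) x - V j n x)"
        by (rule sqn_mono[OF sa(1)]) (use f in \<open>auto simp: indicator_def intro: borel_measurable_lebesgueI\<close>)
      also have "\<dots> \<le> 24 * (rr j)\<^sup>2 * sqn (G (s n))" by (rule sa(2))
      also have "\<dots> \<le> 24 * (rr j)\<^sup>2 * K" using K by (intro mult_left_mono) auto
      finally have b2: "L2_norm ?f2 \<le> d" using jK d0 d2 by (intro sqn_le_imp_L2_norm_le) auto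
      have b3: "L2_norm ?f3 \<le> d" using N2[of n] n d0 d2 by (intro sqn_le_imp_L2_norm_le) auto
      have eq: "D n = (\<lambda>x. (?f1 x + ?f2 x) + ?f3 x)"
        by (rule ext) (auto simp: D_def indicator_def)
      have l12: "(\<lambda>x. ?f1 x + ?f2 x) \<in> L2" using L2_add[OF l1 l2] .
      show ?thesis unfolding eq
        using L2_add[OF l12 l3] L2_norm_triangle[OF l12 l3] L2_norm_triangle[OF l1 l2] b1 b2 b3 by linarith
    qed
    have "sqn (\<lambda>x. u (s m) x - u (s n) x) \<le> e" if mn: "m \<ge> max N1 N2" "n \<ge> max N1 N2" for m n
    proof -
      have eq: "(\<lambda>x. u (s m) x - u (s n) x) = (\<lambda>x. D m x + - D n x)" by (auto simp: D_def)
      have "L2_norm (\<lambda>x. D m x + - D n x) \<le> L2_norm (D m) + L2_norm (\<lambda>x. - D n x)"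
        using D mn by (intro L2_norm_triangle L2_uminus) blast+
      also have "\<dots> \<le> 6 * d" using D[OF mn(1)] D[OF mn(2)] by (simp add: L2_norm_sqrt sqn_uminus)
      finally have "(L2_norm (\<lambda>x. D m x + - D n x))\<^sup>2 \<le> (6 * d)\<^sup>2" by (intro power_mono) auto
      then show ?thesis unfolding eq L2_norm_power2 using d2 by (simp add: power_mult_distrib)
    qed
    then show ?thesis by blast
  qed
  with s(1) show ?thesis using that by blast
qed


section \<open>The Fourier transform\<close>

lemma gauss_1d:
  assumes e: "0 < e"
  shows "integrable lborel (\<lambda>t. iexp (t * x) * complex_of_real (exp (- (e\<^sup>2 * t\<^sup>2) / 2)))"
    and "(\<integral>t. iexp (t * x) * complex_of_real (exp (- (e\<^sup>2 * t\<^sup>2) / 2)) \<partial>lborel) =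
      complex_of_real (sqrt (2 * pi) / e * exp (- x\<^sup>2 / (2 * e\<^sup>2)))"
proof -
  have nd: "normal_density 0 (1 / e) t = e / sqrt (2 * pi) * exp (- (e\<^sup>2 * t\<^sup>2) / 2)" for t
    using e by (simp add: normal_density_def real_sqrt_divide real_sqrt_mult field_simps)
  have ig: "integrable lborel (\<lambda>t. exp (- (e\<^sup>2 * t\<^sup>2) / 2))"
  proof -
    have "integrable lborel (\<lambda>t. sqrt (2 * pi) / e * normal_density 0 (1 / e) t)"
      using e by (intro integrable_mult_right integrable_normal_density) auto
    then show ?thesis using e by (simp add: nd)
  qed
  show int: "integrable lborel (\<lambda>t. iexp (t * x) * complex_of_real (exp (- (e\<^sup>2 * t\<^sup>2) / 2)))"
    by (rule Bochner_Integration.integrable_bound[OF ig]) (auto simp: norm_mult)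
  \<comment> \<open>The characteristic function of the standard normal distribution at x / e,
    followed by the substitution s = e t.\<close>
  have "complex_of_real (exp (- (x / e)\<^sup>2 / 2)) = char std_normal_distribution (x / e)"
    by (simp add: char_std_normal_distribution)
  also have "\<dots> = (\<integral>s. std_normal_density s *\<^sub>R iexp ((x / e) * s) \<partial>lborel)"
    unfolding char_def by (subst integral_density) auto
  also have "\<dots> = \<bar>e\<bar> *\<^sub>R (\<integral>t. std_normal_density (0 + e * t) *\<^sub>R iexp ((x / e) * (0 + e * t)) \<partial>lborel)"
    using e by (intro lborel_integral_real_affine) auto
  also have "\<dots> = complex_of_real (e / sqrt (2 * pi)) * (\<integral>t. iexp (t * x) * complex_of_real (exp (- (e\<^sup>2 * t\<^sup>2) / 2)) \<partial>lborel)"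
  proof -
    have "(\<integral>t. std_normal_density (0 + e * t) *\<^sub>R iexp ((x / e) * (0 + e * t)) \<partial>lborel)
      = (\<integral>t. complex_of_real (1 / sqrt (2 * pi)) * (iexp (t * x) * complex_of_real (exp (- (e\<^sup>2 * t\<^sup>2) / 2))) \<partial>lborel)"
      using e by (intro Bochner_Integration.integral_cong refl)
        (simp add: std_normal_density_def scaleR_conv_of_real power_mult_distrib mult.commute)
    then show ?thesis using e by (simp add: scaleR_conv_of_real)
  qed
  finally show "(\<integral>t. iexp (t * x) * complex_of_real (exp (- (e\<^sup>2 * t\<^sup>2) / 2)) \<partial>lborel) =
      complex_of_real (sqrt (2 * pi) / e * exp (- x\<^sup>2 / (2 * e\<^sup>2)))"
    using e by (simp add: field_simps power_divide)
qed

lemma integral_lborel_prod: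
  fixes g :: "'a::euclidean_space \<Rightarrow> real \<Rightarrow> complex"
  assumes "\<And>b. b \<in> Basis \<Longrightarrow> integrable lborel (g b)"
  shows "(\<integral>x. (\<Prod>b\<in>Basis. g b (x \<bullet> b)) \<partial>lborel) = (\<Prod>b\<in>Basis. (\<integral>t. g b t \<partial>lborel))"
proof -
  interpret product_sigma_finite "\<lambda>b::'a. lborel :: real measure" ..
  have [measurable]: "g b \<in> borel_measurable borel" if "b \<in> Basis" for b
    using assms[OF that] by (auto dest: borel_measurable_integrable)
  have "(\<integral>x. (\<Prod>b\<in>Basis. g b (x \<bullet> b)) \<partial>lborel) = (\<integral>f. (\<Prod>b\<in>Basis. g b ((\<Sum>b\<in>Basis. f b *\<^sub>R b) \<bullet> b)) \<partial>(\<Pi>\<^sub>M b\<in>(Basis :: 'a set). lborel))"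
    by (subst lborel_eq, rule integral_distr) measurable
  also have "\<dots> = (\<integral>f. (\<Prod>b\<in>Basis. g b (f b)) \<partial>(\<Pi>\<^sub>M b\<in>(Basis :: 'a set). lborel))"
    by (intro Bochner_Integration.integral_cong refl prod.cong) simp
  also have "\<dots> = (\<Prod>b\<in>Basis. (\<integral>t. g b t \<partial>lborel))"
    by (rule product_integral_prod) (use assms in auto)
  finally show ?thesis .
qed

definition gauss :: "real \<Rightarrow> R3 \<Rightarrow> real" where
  "gauss e k = exp (- (e\<^sup>2 * (norm k)\<^sup>2) / 2)"

text \<open>The Fourier transform of \<open>gauss e\<close>, by \<open>integral_gauss\<close>. Its
  total mass is (2 pi)^3 for every positive \<open>e\<close>; this is the constant of
  \<open>bessel\<close>.\<close>

definition gauss_ft :: "real \<Rightarrow> R3 \<Rightarrow> real" where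
  "gauss_ft e x = (sqrt (2 * pi) / e) ^ 3 * exp (- (norm x)\<^sup>2 / (2 * e\<^sup>2))"

lemma gauss_measurable [measurable]: "gauss e \<in> borel_measurable borel" "gauss_ft e \<in> borel_measurable borel"
  unfolding gauss_def[abs_def] gauss_ft_def[abs_def] by measurable

lemma norm_power2_Basis: "(norm (x :: R3))\<^sup>2 = (\<Sum>b\<in>Basis. (x \<bullet> b)\<^sup>2)"
  unfolding power2_norm_eq_inner by (subst euclidean_inner) (simp add: power2_eq_square)

lemma integral_gauss:
  assumes e: "0 < e"
  shows "(\<integral>k. iexp (k \<bullet> x) * complex_of_real (gauss e k) \<partial>lborel) = complex_of_real (gauss_ft e x)"
proof -
  have "iexp (k \<bullet> x) * complex_of_real (gauss e k) =
     (\<Prod>b\<in>Basis. iexp ((k \<bullet> b) * (x \<bullet> b)) * complex_of_real (exp (- (e\<^sup>2 * (k \<bullet> b)\<^sup>2) / 2)))" for k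
  proof -
    have "iexp (k \<bullet> x) = (\<Prod>b\<in>Basis. iexp ((k \<bullet> b) * (x \<bullet> b)))"
      by (subst euclidean_inner[of k x]) (simp add: exp_sum[symmetric] sum_distrib_left)
    moreover have "gauss e k = (\<Prod>b\<in>Basis. exp (- (e\<^sup>2 * (k \<bullet> b)\<^sup>2) / 2))"
      unfolding gauss_def norm_power2_Basis
      by (simp add: exp_sum[symmetric] sum_distrib_left sum_negf sum_divide_distrib)
    ultimately show ?thesis by (simp add: prod.distrib)
  qed
  then have "(\<integral>k. iexp (k \<bullet> x) * complex_of_real (gauss e k) \<partial>lborel)
    = (\<integral>k. (\<Prod>b\<in>Basis. iexp ((k \<bullet> b) * (x \<bullet> b)) * complex_of_real (exp (- (e\<^sup>2 * (k \<bullet> b)\<^sup>2) / 2))) \<partial>lborel)"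
    by simp
  also have "\<dots> = (\<Prod>b\<in>Basis. (\<integral>t. iexp (t * (x \<bullet> b)) * complex_of_real (exp (- (e\<^sup>2 * t\<^sup>2) / 2)) \<partial>lborel))"
    by (rule integral_lborel_prod) (rule gauss_1d(1)[OF e])
  also have "\<dots> = (\<Prod>b\<in>(Basis :: R3 set). complex_of_real (sqrt (2 * pi) / e * exp (- (x \<bullet> b)\<^sup>2 / (2 * e\<^sup>2))))"
    by (intro prod.cong refl gauss_1d(2)[OF e])
  also have "\<dots> = complex_of_real (\<Prod>b\<in>(Basis :: R3 set). sqrt (2 * pi) / e * exp (- (x \<bullet> b)\<^sup>2 / (2 * e\<^sup>2)))"
    by (rule of_real_prod[symmetric])
  also have "(\<Prod>b\<in>(Basis :: R3 set). sqrt (2 * pi) / e * exp (- (x \<bullet> b)\<^sup>2 / (2 * e\<^sup>2))) = gauss_ft e x"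
    unfolding gauss_ft_def norm_power2_Basis prod.distrib
    by (simp add: exp_sum[symmetric] sum_negf sum_divide_distrib)
  finally show ?thesis .
qed

lemma nn_integral_gauss:
  assumes e: "0 < e"
  shows "(\<integral>\<^sup>+k. ennreal (gauss e k) \<partial>lborel) = ennreal ((sqrt (2 * pi) / e) ^ 3)"
proof -
  have g: "gauss e k = (\<Prod>b\<in>Basis. exp (- (e\<^sup>2 * (k \<bullet> b)\<^sup>2) / 2))" for k
    unfolding gauss_def norm_power2_Basis
    by (simp add: exp_sum[symmetric] sum_distrib_left sum_negf sum_divide_distrib)
  have 1: "(\<integral>\<^sup>+t. ennreal (exp (- (e\<^sup>2 * t\<^sup>2) / 2)) \<partial>lborel) = ennreal (sqrt (2 * pi) / e)"
  proof -
    have i: "integrable lborel (\<lambda>t. exp (- (e\<^sup>2 * t\<^sup>2) / 2))"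
      using integrable_norm[OF gauss_1d(1)[OF e, of 0]] by simp
    have "complex_of_real (\<integral>t. exp (- (e\<^sup>2 * t\<^sup>2) / 2) \<partial>lborel) = complex_of_real (sqrt (2 * pi) / e)"
      using gauss_1d(2)[OF e, of 0] by (simp flip: integral_complex_of_real)
    then have "(\<integral>t. exp (- (e\<^sup>2 * t\<^sup>2) / 2) \<partial>lborel) = sqrt (2 * pi) / e" unfolding of_real_eq_iff .
    then show ?thesis using nn_integral_eq_integral[OF i] by simp
  qed
  have "(\<integral>\<^sup>+k. ennreal (gauss e k) \<partial>lborel) = (\<integral>\<^sup>+k. (\<Prod>b\<in>Basis. ennreal (exp (- (e\<^sup>2 * (k \<bullet> b)\<^sup>2) / 2))) \<partial>(lborel :: R3 measure))"
    unfolding g by (intro nn_integral_cong) (simp add: prod_ennreal)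
  also have "\<dots> = (\<Prod>b\<in>(Basis :: R3 set). (\<integral>\<^sup>+t. ennreal (exp (- (e\<^sup>2 * t\<^sup>2) / 2)) \<partial>lborel))"
    by (rule nn_integral_lborel_prod) auto
  also have "\<dots> = ennreal ((sqrt (2 * pi) / e) ^ 3)"
    unfolding 1 using e by (simp add: ennreal_power)
  finally show ?thesis .
qed

lemma integrable_gauss: "0 < e \<Longrightarrow> integrable lborel (gauss e)"
  by (rule integrableI_nonneg) (auto simp: nn_integral_gauss, simp add: gauss_def)

lemma nn_integral_gauss_ft:
  assumes e: "0 < e"
  shows "(\<integral>\<^sup>+x. ennreal (gauss_ft e x) \<partial>lborel) = ennreal ((2 * pi) ^ 3)"
proof -
  have g: "gauss_ft e x = (sqrt (2 * pi) / e) ^ 3 * gauss (1 / e) x" for x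
    by (simp add: gauss_ft_def gauss_def power_divide)
  have "(\<integral>\<^sup>+x. ennreal (gauss_ft e x) \<partial>lborel) = (\<integral>\<^sup>+x. ennreal ((sqrt (2 * pi) / e) ^ 3) * ennreal (gauss (1 / e) x) \<partial>lborel)"
    unfolding g using e by (intro nn_integral_cong ennreal_mult) (auto simp: gauss_def)
  also have "\<dots> = ennreal ((sqrt (2 * pi) / e) ^ 3) * (\<integral>\<^sup>+x. ennreal (gauss (1 / e) x) \<partial>lborel)"
    by (rule nn_integral_cmult) measurable
  also have "\<dots> = ennreal ((sqrt (2 * pi) / e) ^ 3) * ennreal ((sqrt (2 * pi) / (1 / e)) ^ 3)"
    using e by (subst nn_integral_gauss) auto
  also have "\<dots> = ennreal ((sqrt (2 * pi) / e) ^ 3 * (sqrt (2 * pi) / (1 / e)) ^ 3)"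
    using e by (intro ennreal_mult[symmetric]) auto
  also have "(sqrt (2 * pi) / e) ^ 3 * (sqrt (2 * pi) / (1 / e)) ^ 3 = (2 * pi) ^ 3"
    using e by (simp flip: power_mult_distrib)
  finally show ?thesis .
qed

text \<open>Sign and normalization are those of the coupling term in \<open>energy\<close>, whose
  inner integral is \<open>ft\<close> of |u|^2.\<close>

definition ft :: "(R3 \<Rightarrow> real) \<Rightarrow> R3 \<Rightarrow> complex" where
  "ft f k = (\<integral>x. exp (\<i> * complex_of_real (k \<bullet> x)) * complex_of_real (f x) \<partial>lebesgue)"

lemma ft_lborel:
  "f \<in> borel_measurable borel \<Longrightarrow> ft f k = (\<integral>x. iexp (k \<bullet> x) * complex_of_real (f x) \<partial>lborel)"
  unfolding ft_def by (rule integral_completion) measurable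

lemma norm_ft_le: "norm (ft f k) \<le> (\<integral>x. \<bar>f x\<bar> \<partial>lebesgue)"
proof -
  have "norm (ft f k) \<le> (\<integral>x. norm (exp (\<i> * complex_of_real (k \<bullet> x)) * complex_of_real (f x)) \<partial>lebesgue)"
    unfolding ft_def by (rule integral_norm_bound)
  then show ?thesis by (simp add: norm_mult)
qed

lemma ft_cong_AE:
  assumes "f \<in> borel_measurable lebesgue" "g \<in> borel_measurable lebesgue" "AE x in lebesgue. f x = g x"
  shows "ft f = ft g"
proof
  fix k :: R3
  have [measurable]: "(\<lambda>x. exp (\<i> * complex_of_real (k \<bullet> x))) \<in> borel_measurable lebesgue"
    by (rule borel_measurable_lebesgueI) measurable
  note assms(1,2)[measurable]
  show "ft f k = ft g k" unfolding ft_def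
    by (rule integral_cong_AE) (use assms(3) in \<open>auto elim!: eventually_mono\<close>)
qed

lemma integrable_ft:
  assumes "integrable lebesgue f"
  shows "integrable lebesgue (\<lambda>x. exp (\<i> * complex_of_real (k \<bullet> x)) * complex_of_real (f x))"
proof (rule Bochner_Integration.integrable_bound[OF assms])
  have [measurable]: "(\<lambda>x. exp (\<i> * complex_of_real (k \<bullet> x))) \<in> borel_measurable lebesgue"
    by (rule borel_measurable_lebesgueI) measurable
  have [measurable]: "f \<in> borel_measurable lebesgue" using assms by simp
  show "(\<lambda>x. exp (\<i> * complex_of_real (k \<bullet> x)) * complex_of_real (f x)) \<in> borel_measurable lebesgue" by measurable
qed (auto simp: norm_mult)

lemma ft_add: "integrable lebesgue f \<Longrightarrow> integrable lebesgue g \<Longrightarrow> ft (\<lambda>x. f x + g x) k = ft f k + ft g k"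
  using integrable_ft[of f k] integrable_ft[of g k] by (simp add: ft_def distrib_left)

lemma ft_diff: "integrable lebesgue f \<Longrightarrow> integrable lebesgue g \<Longrightarrow> ft (\<lambda>x. f x - g x) k = ft f k - ft g k"
  using integrable_ft[of f k] integrable_ft[of g k] by (simp add: ft_def right_diff_distrib)

lemma ft_borel_measurable:
  assumes "f \<in> borel_measurable lebesgue"
  shows "ft f \<in> borel_measurable borel"
proof -
  obtain f' where f'[measurable]: "f' \<in> borel_measurable borel" and ae: "AE x in lborel. f x = f' x"
    using completion_ex_borel_measurable_real[OF assms] by auto
  have eq: "ft f = ft f'"
    by (rule ft_cong_AE) (use assms f' ae in \<open>auto simp: AE_lebesgue_iff intro: borel_measurable_lebesgueI\<close>)
  have "(\<lambda>(k, x). iexp (k \<bullet> x) * complex_of_real (f' x)) \<in> borel_measurable (lborel \<Otimes>\<^sub>M lborel)"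
    unfolding split_beta' by measurable
  then have "(\<lambda>k. \<integral>x. iexp (k \<bullet> x) * complex_of_real (f' x) \<partial>lborel) \<in> borel_measurable lborel"
    by (rule lborel.borel_measurable_lebesgue_integral)
  then show ?thesis unfolding eq ft_lborel[OF f', abs_def] by simp
qed

text \<open>The Gaussian weight makes the integral over \<open>k\<close> absolutely convergent, so
  Fubini turns it into the double integral of f(x) f(y) \<open>gauss_ft e (x - y)\<close>. Bounding
  |f(x) f(y)| by half the sum of the squares leaves the mass of \<open>gauss_ft e\<close> as a
  factor, uniformly in \<open>e\<close>.\<close>

lemma bessel_gauss:
  assumes [measurable]: "f \<in> borel_measurable borel" and i: "integrable lborel f" and i2: "integrable lborel (\<lambda>x. (f x)\<^sup>2)"
    and e: "0 < e"
  shows "(\<integral>\<^sup>+k. ennreal (gauss e k * (norm (ft f k))\<^sup>2) \<partial>lborel) \<le> ennreal ((2 * pi) ^ 3 * (\<integral>x. (f x)\<^sup>2 \<partial>lborel))"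
proof -
  define A where "A = (\<integral>x. \<bar>f x\<bar> \<partial>lborel)"
  have A: "(\<integral>\<^sup>+x. ennreal \<bar>f x\<bar> \<partial>lborel) = ennreal A"
    unfolding A_def by (rule nn_integral_eq_integral) (use i in auto)
  have A0: "0 \<le> A" unfolding A_def by (rule integral_nonneg_AE) simp
  have Ale: "norm (ft f k) \<le> A" for k
    unfolding A_def using norm_ft_le[of f k] integral_completion[of "\<lambda>x. \<bar>f x\<bar>" lborel] by simp
  have ftm[measurable]: "ft f \<in> borel_measurable borel" by (rule ft_borel_measurable) (rule borel_measurable_lebesgueI, measurable)
  have G: "(\<integral>\<^sup>+k. ennreal (gauss e k) \<partial>lborel) = ennreal (\<integral>k. gauss e k \<partial>lborel)"
    by (rule nn_integral_eq_integral[OF integrable_gauss[OF e]]) (simp add: gauss_def)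
  have ge0: "0 \<le> gauss e k" for k by (simp add: gauss_def)
  have gf0: "0 \<le> gauss_ft e k" for k using e by (simp add: gauss_ft_def)
  \<comment> \<open>The convolution of \<open>f\<close> with \<open>gauss_ft e\<close>. The two
    Fubini arguments that follow bring in the two factors of |ft f|^2 one after the other.\<close>
  define h where "h y = (\<integral>x. complex_of_real (f x) * complex_of_real (gauss_ft e (x - y)) \<partial>lborel)" for y
  have inner: "(\<integral>k. complex_of_real (gauss e k) * iexp (- (k \<bullet> y)) * ft f k \<partial>lborel) = h y" for y
  proof -
    define F where "F k x = complex_of_real (gauss e k) * iexp (- (k \<bullet> y)) * (iexp (k \<bullet> x) * complex_of_real (f x))" for k x
    have Fm: "(\<lambda>p. F (fst p) (snd p)) \<in> borel_measurable (lborel \<Otimes>\<^sub>M lborel)"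
      unfolding F_def by measurable
    have "(\<integral>\<^sup>+k. \<integral>\<^sup>+x. ennreal (norm (F k x)) \<partial>lborel \<partial>lborel) = (\<integral>\<^sup>+k. ennreal (gauss e k) * (\<integral>\<^sup>+x. ennreal \<bar>f x\<bar> \<partial>lborel) \<partial>lborel)"
    proof (rule nn_integral_cong)
      fix k
      have "(\<integral>\<^sup>+x. ennreal (norm (F k x)) \<partial>lborel) = (\<integral>\<^sup>+x. ennreal (gauss e k) * ennreal \<bar>f x\<bar> \<partial>lborel)"
        using ge0 by (intro nn_integral_cong) (simp add: F_def norm_mult ennreal_mult)
      also have "\<dots> = ennreal (gauss e k) * (\<integral>\<^sup>+x. ennreal \<bar>f x\<bar> \<partial>lborel)" by (rule nn_integral_cmult) measurable
      finally show "(\<integral>\<^sup>+x. ennreal (norm (F k x)) \<partial>lborel) = ennreal (gauss e k) * (\<integral>\<^sup>+x. ennreal \<bar>f x\<bar> \<partial>lborel)" .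
    qed
    also have "\<dots> = (\<integral>\<^sup>+k. ennreal (gauss e k) \<partial>lborel) * ennreal A"
      unfolding A by (rule nn_integral_multc) measurable
    also have "\<dots> < \<infinity>" unfolding G by (simp add: ennreal_mult_less_top)
    finally have "integrable (lborel \<Otimes>\<^sub>M lborel) (\<lambda>p. F (fst p) (snd p))"
      by (intro integrable_lborel_pairI[OF Fm]) simp
    then have "(\<integral>x. (\<integral>k. F k x \<partial>lborel) \<partial>lborel) = (\<integral>k. (\<integral>x. F k x \<partial>lborel) \<partial>lborel)"
      by (intro lborel_pair.Fubini_integral) (simp add: split_beta')
    moreover have "(\<integral>x. F k x \<partial>lborel) = complex_of_real (gauss e k) * iexp (- (k \<bullet> y)) * ft f k" for k
      unfolding F_def by (subst ft_lborel) simp_all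
    moreover have "(\<integral>k. F k x \<partial>lborel) = complex_of_real (f x) * complex_of_real (gauss_ft e (x - y))" for x
    proof -
      have "(\<integral>k. F k x \<partial>lborel) = (\<integral>k. complex_of_real (f x) * (iexp (k \<bullet> (x - y)) * complex_of_real (gauss e k)) \<partial>lborel)"
        by (intro Bochner_Integration.integral_cong refl)
          (simp add: F_def inner_diff_right right_diff_distrib exp_diff exp_minus field_simps)
      then show ?thesis by (simp add: integral_gauss[OF e])
    qed
    ultimately show ?thesis by (simp add: h_def)
  qed
  have outer: "(\<integral>k. complex_of_real (gauss e k * (norm (ft f k))\<^sup>2) \<partial>lborel) = (\<integral>y. complex_of_real (f y) * h y \<partial>lborel)"
  proof -
    define F where "F k y = complex_of_real (f y) * (complex_of_real (gauss e k) * iexp (- (k \<bullet> y)) * ft f k)" for k y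
    have Fm: "(\<lambda>p. F (fst p) (snd p)) \<in> borel_measurable (lborel \<Otimes>\<^sub>M lborel)"
      unfolding F_def by measurable
    have "(\<integral>\<^sup>+k. \<integral>\<^sup>+y. ennreal (norm (F k y)) \<partial>lborel \<partial>lborel) \<le> (\<integral>\<^sup>+k. ennreal (gauss e k) * (ennreal A * (\<integral>\<^sup>+y. ennreal \<bar>f y\<bar> \<partial>lborel)) \<partial>lborel)"
    proof (rule nn_integral_mono)
      fix k
      have "(\<integral>\<^sup>+y. ennreal (norm (F k y)) \<partial>lborel) \<le> (\<integral>\<^sup>+y. ennreal (gauss e k) * (ennreal A * ennreal \<bar>f y\<bar>) \<partial>lborel)"
      proof (rule nn_integral_mono)
        fix y
        have "norm (F k y) \<le> gauss e k * (A * \<bar>f y\<bar>)"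
          using mult_left_mono[OF Ale[of k], of "gauss e k * \<bar>f y\<bar>"] ge0[of k] by (simp add: F_def norm_mult mult_ac)
        then have "ennreal (norm (F k y)) \<le> ennreal (gauss e k * (A * \<bar>f y\<bar>))" by (rule ennreal_leI)
        then show "ennreal (norm (F k y)) \<le> ennreal (gauss e k) * (ennreal A * ennreal \<bar>f y\<bar>)"
          using ge0[of k] A0 by (simp add: ennreal_mult)
      qed
      also have "\<dots> = ennreal (gauss e k) * (\<integral>\<^sup>+y. ennreal A * ennreal \<bar>f y\<bar> \<partial>lborel)" by (rule nn_integral_cmult) measurable
      also have "(\<integral>\<^sup>+y. ennreal A * ennreal \<bar>f y\<bar> \<partial>lborel) = ennreal A * (\<integral>\<^sup>+y. ennreal \<bar>f y\<bar> \<partial>lborel)" by (rule nn_integral_cmult) measurable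
      finally show "(\<integral>\<^sup>+y. ennreal (norm (F k y)) \<partial>lborel) \<le> ennreal (gauss e k) * (ennreal A * (\<integral>\<^sup>+y. ennreal \<bar>f y\<bar> \<partial>lborel))" .
    qed
    also have "\<dots> = (\<integral>\<^sup>+k. ennreal (gauss e k) \<partial>lborel) * (ennreal A * ennreal A)"
      unfolding A by (rule nn_integral_multc) measurable
    also have "\<dots> < \<infinity>" unfolding G by (simp add: ennreal_mult_less_top)
    finally have "integrable (lborel \<Otimes>\<^sub>M lborel) (\<lambda>p. F (fst p) (snd p))"
      by (intro integrable_lborel_pairI[OF Fm]) simp
    then have "(\<integral>y. (\<integral>k. F k y \<partial>lborel) \<partial>lborel) = (\<integral>k. (\<integral>y. F k y \<partial>lborel) \<partial>lborel)"
      by (intro lborel_pair.Fubini_integral) (simp add: split_beta')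
    moreover have "(\<integral>k. F k y \<partial>lborel) = complex_of_real (f y) * h y" for y
      unfolding F_def by (simp only: integral_mult_right_zero inner)
    moreover have "(\<integral>y. F k y \<partial>lborel) = complex_of_real (gauss e k * (norm (ft f k))\<^sup>2)" for k
    proof -
      have "(\<integral>y. F k y \<partial>lborel) = (\<integral>y. (complex_of_real (gauss e k) * ft f k) * cnj (iexp (k \<bullet> y) * complex_of_real (f y)) \<partial>lborel)"
        by (intro Bochner_Integration.integral_cong refl) (simp add: F_def mult_ac exp_cnj)
      also have "\<dots> = (complex_of_real (gauss e k) * ft f k) * cnj (\<integral>y. iexp (k \<bullet> y) * complex_of_real (f y) \<partial>lborel)"
        unfolding integral_mult_right_zero by (subst Bochner_Integration.integral_cnj) (rule refl)
      also have "\<dots> = complex_of_real (gauss e k) * (ft f k * cnj (ft f k))" by (subst (3) ft_lborel) simp_all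
      finally show ?thesis by (simp add: complex_norm_square[symmetric])
    qed
    ultimately show ?thesis by simp
  qed
  have hm[measurable]: "h \<in> borel_measurable borel"
  proof -
    have "(\<lambda>(y, x). complex_of_real (f x) * complex_of_real (gauss_ft e (x - y))) \<in> borel_measurable (lborel \<Otimes>\<^sub>M lborel)"
      unfolding split_beta' by measurable
    then have "(\<lambda>y. \<integral>x. complex_of_real (f x) * complex_of_real (gauss_ft e (x - y)) \<partial>lborel) \<in> borel_measurable lborel"
      by (rule lborel.borel_measurable_lebesgue_integral)
    then show ?thesis by (simp add: h_def[abs_def])
  qed
  have gi: "integrable lborel (\<lambda>k. gauss e k * (norm (ft f k))\<^sup>2)"
  proof (rule Bochner_Integration.integrable_bound)
    show "integrable lborel (\<lambda>k. A\<^sup>2 * gauss e k)" using integrable_gauss[OF e] by simp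
    have "(norm (ft f k))\<^sup>2 \<le> A\<^sup>2" for k using Ale[of k] by (intro power_mono) auto
    then show "AE k in lborel. norm (gauss e k * (norm (ft f k))\<^sup>2) \<le> norm (A\<^sup>2 * gauss e k)"
      using ge0 by (intro AE_I2) (simp add: abs_mult mult.commute[of "gauss e _"] mult_right_mono)
  qed measurable
  let ?S = "\<integral>x. (f x)\<^sup>2 \<partial>lborel"
  have S: "(\<integral>\<^sup>+x. ennreal ((f x)\<^sup>2) \<partial>lborel) = ennreal ?S" by (rule nn_integral_eq_integral[OF i2]) simp
  have S0: "0 \<le> ?S" by (rule integral_nonneg_AE) simp
  have "ennreal (\<integral>k. gauss e k * (norm (ft f k))\<^sup>2 \<partial>lborel) = ennreal (norm (\<integral>k. complex_of_real (gauss e k * (norm (ft f k))\<^sup>2) \<partial>lborel))"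
  proof -
    have "0 \<le> (\<integral>k. gauss e k * (norm (ft f k))\<^sup>2 \<partial>lborel)" by (rule integral_nonneg_AE) (simp add: ge0)
    then show ?thesis unfolding integral_complex_of_real norm_of_real by simp
  qed
  also have "\<dots> = ennreal (norm (\<integral>y. complex_of_real (f y) * h y \<partial>lborel))" by (simp only: outer)
  also have "\<dots> \<le> (\<integral>\<^sup>+y. ennreal (norm (complex_of_real (f y) * h y)) \<partial>lborel)"
  \<comment> \<open>A function that is not integrable has the default integral 0, and the bound is
    trivial.\<close>
  proof (cases "integrable lborel (\<lambda>y. complex_of_real (f y) * h y)")
    case True then show ?thesis by (rule integral_norm_bound_ennreal)
  next
    case False then show ?thesis by (simp add: not_integrable_integral_eq)
  qed
  also have "\<dots> \<le> (\<integral>\<^sup>+y. \<integral>\<^sup>+x. ennreal ((f y)\<^sup>2 / 2) * ennreal (gauss_ft e (x - y)) + ennreal ((f x)\<^sup>2 / 2) * ennreal (gauss_ft e (x - y)) \<partial>lborel \<partial>lborel)"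
  proof (rule nn_integral_mono)
    fix y
    have "ennreal (norm (h y)) \<le> (\<integral>\<^sup>+x. ennreal (norm (complex_of_real (f x) * complex_of_real (gauss_ft e (x - y)))) \<partial>lborel)"
    proof (cases "integrable lborel (\<lambda>x. complex_of_real (f x) * complex_of_real (gauss_ft e (x - y)))")
      case True then show ?thesis unfolding h_def by (rule integral_norm_bound_ennreal)
    next
      case False then show ?thesis by (simp add: h_def not_integrable_integral_eq)
    qed
    then have "ennreal (norm (complex_of_real (f y) * h y)) \<le> ennreal \<bar>f y\<bar> * (\<integral>\<^sup>+x. ennreal (norm (complex_of_real (f x) * complex_of_real (gauss_ft e (x - y)))) \<partial>lborel)"
      by (simp add: norm_mult ennreal_mult mult_left_mono)
    also have "\<dots> = (\<integral>\<^sup>+x. ennreal \<bar>f y\<bar> * ennreal (norm (complex_of_real (f x) * complex_of_real (gauss_ft e (x - y)))) \<partial>lborel)"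
      by (rule nn_integral_cmult[symmetric]) measurable
    also have "\<dots> \<le> (\<integral>\<^sup>+x. ennreal ((f y)\<^sup>2 / 2) * ennreal (gauss_ft e (x - y)) + ennreal ((f x)\<^sup>2 / 2) * ennreal (gauss_ft e (x - y)) \<partial>lborel)"
    proof (rule nn_integral_mono)
      fix x
      have "\<bar>f y\<bar> * \<bar>f x\<bar> \<le> (f y)\<^sup>2 / 2 + (f x)\<^sup>2 / 2"
        using sum_squares_bound[of "\<bar>f y\<bar>" "\<bar>f x\<bar>"] unfolding power2_abs by linarith
      then have "\<bar>f y\<bar> * \<bar>f x\<bar> * gauss_ft e (x - y) \<le> ((f y)\<^sup>2 / 2 + (f x)\<^sup>2 / 2) * gauss_ft e (x - y)"
        using gf0 by (intro mult_right_mono)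
      then have "\<bar>f y\<bar> * norm (complex_of_real (f x) * complex_of_real (gauss_ft e (x - y))) \<le> (f y)\<^sup>2 / 2 * gauss_ft e (x - y) + (f x)\<^sup>2 / 2 * gauss_ft e (x - y)"
        using gf0[of "x - y"] by (simp add: norm_mult algebra_simps)
      then have "ennreal (\<bar>f y\<bar> * norm (complex_of_real (f x) * complex_of_real (gauss_ft e (x - y)))) \<le> ennreal ((f y)\<^sup>2 / 2 * gauss_ft e (x - y) + (f x)\<^sup>2 / 2 * gauss_ft e (x - y))"
        by (rule ennreal_leI)
      then show "ennreal \<bar>f y\<bar> * ennreal (norm (complex_of_real (f x) * complex_of_real (gauss_ft e (x - y)))) \<le> ennreal ((f y)\<^sup>2 / 2) * ennreal (gauss_ft e (x - y)) + ennreal ((f x)\<^sup>2 / 2) * ennreal (gauss_ft e (x - y))"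
        using gf0[of "x - y"] by (simp only: ennreal_mult[symmetric] abs_ge_zero norm_ge_zero ennreal_plus[symmetric] zero_le_power2 divide_nonneg_nonneg zero_le_numeral mult_nonneg_nonneg)
    qed
    finally show "ennreal (norm (complex_of_real (f y) * h y)) \<le> \<dots>" .
  qed
  also have "\<dots> = (\<integral>\<^sup>+y. \<integral>\<^sup>+x. ennreal ((f y)\<^sup>2 / 2) * ennreal (gauss_ft e (x - y)) \<partial>lborel \<partial>lborel)
     + (\<integral>\<^sup>+y. \<integral>\<^sup>+x. ennreal ((f x)\<^sup>2 / 2) * ennreal (gauss_ft e (x - y)) \<partial>lborel \<partial>lborel)"
    by (subst nn_integral_add[symmetric]) (auto intro!: nn_integral_cong nn_integral_add)
  also have "(\<integral>\<^sup>+y. \<integral>\<^sup>+x. ennreal ((f x)\<^sup>2 / 2) * ennreal (gauss_ft e (x - y)) \<partial>lborel \<partial>lborel)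
     = (\<integral>\<^sup>+x. \<integral>\<^sup>+y. ennreal ((f x)\<^sup>2 / 2) * ennreal (gauss_ft e (x - y)) \<partial>lborel \<partial>lborel)"
    by (rule lborel_pair.Fubini') measurable
  also have "\<dots> = (\<integral>\<^sup>+x. ennreal ((f x)\<^sup>2 / 2) * ennreal ((2 * pi) ^ 3) \<partial>lborel)"
  proof (rule nn_integral_cong)
    fix x
    have sym: "gauss_ft e (x - y) = gauss_ft e (y + - x)" for y by (simp add: gauss_ft_def norm_minus_commute)
    have "(\<integral>\<^sup>+y. ennreal ((f x)\<^sup>2 / 2) * ennreal (gauss_ft e (x - y)) \<partial>lborel) = ennreal ((f x)\<^sup>2 / 2) * (\<integral>\<^sup>+y. ennreal (gauss_ft e (y + - x)) \<partial>lborel)"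
      unfolding sym by (rule nn_integral_cmult) measurable
    also have "(\<integral>\<^sup>+y. ennreal (gauss_ft e (y + - x)) \<partial>lborel) = ennreal ((2 * pi) ^ 3)"
      by (subst nn_integral_lborel_translate) (use nn_integral_gauss_ft[OF e] in auto)
    finally show "(\<integral>\<^sup>+y. ennreal ((f x)\<^sup>2 / 2) * ennreal (gauss_ft e (x - y)) \<partial>lborel) = ennreal ((f x)\<^sup>2 / 2) * ennreal ((2 * pi) ^ 3)" .
  qed
  also have "(\<integral>\<^sup>+y. \<integral>\<^sup>+x. ennreal ((f y)\<^sup>2 / 2) * ennreal (gauss_ft e (x - y)) \<partial>lborel \<partial>lborel) = (\<integral>\<^sup>+x. ennreal ((f x)\<^sup>2 / 2) * ennreal ((2 * pi) ^ 3) \<partial>lborel)"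
  proof (rule nn_integral_cong)
    fix y
    have "(\<integral>\<^sup>+x. ennreal ((f y)\<^sup>2 / 2) * ennreal (gauss_ft e (x - y)) \<partial>lborel) = ennreal ((f y)\<^sup>2 / 2) * (\<integral>\<^sup>+x. ennreal (gauss_ft e (x + - y)) \<partial>lborel)"
      by (simp add: nn_integral_cmult)
    also have "(\<integral>\<^sup>+x. ennreal (gauss_ft e (x + - y)) \<partial>lborel) = ennreal ((2 * pi) ^ 3)"
      by (subst nn_integral_lborel_translate) (use nn_integral_gauss_ft[OF e] in auto)
    finally show "(\<integral>\<^sup>+x. ennreal ((f y)\<^sup>2 / 2) * ennreal (gauss_ft e (x - y)) \<partial>lborel) = ennreal ((f y)\<^sup>2 / 2) * ennreal ((2 * pi) ^ 3)" .
  qed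
  also have "(\<integral>\<^sup>+x. ennreal ((f x)\<^sup>2 / 2) * ennreal ((2 * pi) ^ 3) \<partial>lborel) = ennreal (?S / 2) * ennreal ((2 * pi) ^ 3)"
  proof -
    have "(\<integral>\<^sup>+x. ennreal ((f x)\<^sup>2 / 2) \<partial>lborel) = ennreal (?S / 2)"
      using nn_integral_eq_integral[of lborel "\<lambda>x. (f x)\<^sup>2 / 2"] i2 by simp
    then show ?thesis by (subst nn_integral_multc) auto
  qed
  also have "ennreal (?S / 2) * ennreal ((2 * pi) ^ 3) + ennreal (?S / 2) * ennreal ((2 * pi) ^ 3) = ennreal ((2 * pi) ^ 3 * ?S)"
    using S0 by (simp add: ennreal_mult[symmetric] ennreal_plus[symmetric] del: ennreal_plus)
  finally show ?thesis using nn_integral_eq_integral[OF gi] ge0 by simp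
qed

text \<open>One half of Plancherel's theorem: the Gaussian weight tends to 1, and Fatou's lemma
  keeps the uniform bound.\<close>

theorem bessel:
  assumes [measurable]: "f \<in> borel_measurable borel" and i: "integrable lborel f" "integrable lborel (\<lambda>x. (f x)\<^sup>2)"
  shows "(\<integral>\<^sup>+k. ennreal ((norm (ft f k))\<^sup>2) \<partial>lborel) \<le> ennreal ((2 * pi) ^ 3 * (\<integral>x. (f x)\<^sup>2 \<partial>lborel))"
proof -
  have [measurable]: "ft f \<in> borel_measurable borel" by (rule ft_borel_measurable) (rule borel_measurable_lebesgueI, measurable)
  let ?e = "\<lambda>n. 1 / real (Suc n)"
  have "(\<integral>\<^sup>+k. ennreal ((norm (ft f k))\<^sup>2) \<partial>lborel) = (\<integral>\<^sup>+k. liminf (\<lambda>n. ennreal (gauss (?e n) k * (norm (ft f k))\<^sup>2)) \<partial>lborel)"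
  proof (rule nn_integral_cong)
    fix k
    have "(\<lambda>n. ?e n) \<longlonglongrightarrow> 0" using LIMSEQ_Suc[OF lim_1_over_n] by simp
    then have "(\<lambda>n. gauss (?e n) k * (norm (ft f k))\<^sup>2) \<longlonglongrightarrow> exp (- (0\<^sup>2 * (norm k)\<^sup>2) / 2) * (norm (ft f k))\<^sup>2"
      unfolding gauss_def by (intro tendsto_intros) auto
    then have "(\<lambda>n. ennreal (gauss (?e n) k * (norm (ft f k))\<^sup>2)) \<longlonglongrightarrow> ennreal ((norm (ft f k))\<^sup>2)"
      by (intro tendsto_ennrealI) simp
    then show "ennreal ((norm (ft f k))\<^sup>2) = liminf (\<lambda>n. ennreal (gauss (?e n) k * (norm (ft f k))\<^sup>2))"
      using lim_imp_Liminf[OF trivial_limit_sequentially] by metis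
  qed
  also have "\<dots> \<le> liminf (\<lambda>n. \<integral>\<^sup>+k. ennreal (gauss (?e n) k * (norm (ft f k))\<^sup>2) \<partial>lborel)"
    by (rule nn_integral_liminf) measurable
  also have "\<dots> \<le> liminf (\<lambda>n. ennreal ((2 * pi) ^ 3 * (\<integral>x. (f x)\<^sup>2 \<partial>lborel)))"
    by (intro Liminf_mono always_eventually allI bessel_gauss assms) simp
  finally show ?thesis by (simp add: Liminf_const)
qed


section \<open>Densities and weak \<open>L\<^sup>3\<close> weights\<close>

lemma nn_integral_powr_from_0:
  assumes "a > -1" "0 \<le> c"
  shows "(\<integral>\<^sup>+x. ennreal (x powr a) * indicator {0..c} x \<partial>lborel) = ennreal (c powr (a + 1) / (a + 1))"
proof -
  have "((\<lambda>x. if x \<in> {0..c} then x powr a else 0) has_integral c powr (a + 1) / (a + 1)) UNIV"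
    unfolding has_integral_restrict_UNIV by (rule has_integral_powr_from_0[OF assms])
  then have "(\<integral>\<^sup>+x. ennreal (if x \<in> {0..c} then x powr a else 0) \<partial>lborel) = ennreal (c powr (a + 1) / (a + 1))"
    by (intro nn_integral_has_integral_lborel) auto
  moreover have "(\<integral>\<^sup>+x. ennreal (x powr a) * indicator {0..c} x \<partial>lborel) = (\<integral>\<^sup>+x. ennreal (if x \<in> {0..c} then x powr a else 0) \<partial>lborel)"
    by (rule nn_integral_cong) auto
  ultimately show ?thesis by simp
qed

lemma nn_integral_powr_to_inf:
  assumes "a < -1" "0 < c"
  shows "(\<integral>\<^sup>+x. ennreal (x powr a) * indicator {c..} x \<partial>lborel) = ennreal (- (c powr (a + 1)) / (a + 1))"
proof -
  have "((\<lambda>x. if x \<in> {c..} then x powr a else 0) has_integral - (c powr (a + 1)) / (a + 1)) UNIV"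
    unfolding has_integral_restrict_UNIV by (rule has_integral_powr_to_inf[OF assms])
  then have "(\<integral>\<^sup>+x. ennreal (if x \<in> {c..} then x powr a else 0) \<partial>lborel) = ennreal (- (c powr (a + 1)) / (a + 1))"
    by (intro nn_integral_has_integral_lborel) auto
  moreover have "(\<integral>\<^sup>+x. ennreal (x powr a) * indicator {c..} x \<partial>lborel) = (\<integral>\<^sup>+x. ennreal (if x \<in> {c..} then x powr a else 0) \<partial>lborel)"
    by (rule nn_integral_cong) auto
  ultimately show ?thesis by simp
qed

lemma powr_pow: "0 < x \<Longrightarrow> (x powr a) ^ n = x powr (real n * a)"
  by (simp add: powr_powr mult.commute flip: powr_realpow)

lemma pow_powr: "0 < (x::real) \<Longrightarrow> (x ^ n) powr a = x powr (real n * a)"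
  by (simp add: powr_powr flip: powr_realpow)

text \<open>96 is 4 times the 24 of \<open>sqn_sub_cell_avg\<close>. The 4 comes from |u| \<le> 2 |u
  - avg| after squaring, the power of 4 from the side of the cells.\<close>

definition tail_const :: real where "tail_const = 96 * 4 powr (2/3)"

text \<open>The cells are so large that averages over them are at most l / 2. Where |u| exceeds
  \<open>l\<close>, its deviation from the average is then at least |u| / 2, and the Poincare
  inequality on cells applies. This is a weak form of the Gagliardo-Nirenberg bound of the integral
  of |u|^(10/3) by \<open>a powr (2/3) * K\<close>.\<close>

lemma H1_tail_estimate:
  assumes w: "wgrad u G" and um[measurable]: "u \<in> borel_measurable borel"
    and a: "sqn u \<le> a" "0 < a" and K: "sqn G \<le> K" and l: "0 < l"
  shows "(\<integral>\<^sup>+x. indicator {x. l < norm (u x)} x * ennreal ((norm (u x))\<^sup>2) \<partial>lborel)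
    \<le> ennreal (tail_const * l powr (-4/3) * (a powr (2/3) * K))"
proof -
  \<comment> \<open>The solution of a / r^3 = (l / 2)^2, the bound of
    \<open>norm_cell_avg_le\<close>.\<close>
  define r where "r = (4 * a / l\<^sup>2) powr (1/3)"
  have q: "0 < 4 * a / l\<^sup>2" using a l by simp
  have r: "0 < r" unfolding r_def using a l by simp
  have r3: "r ^ 3 = 4 * a / l\<^sup>2"
    using q a l unfolding r_def powr_pow[OF q] by simp
  have "r\<^sup>2 = (4 * a / l\<^sup>2) powr (2/3)"
    using powr_pow[OF q, of "1/3" 2] unfolding r_def by simp
  also have "\<dots> = (4 * a) powr (2/3) / (l\<^sup>2) powr (2/3)" by (rule powr_divide)
  also have "(l\<^sup>2) powr (2/3) = l powr (4/3)" using pow_powr[OF l, of 2 "2/3"] by simp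
  also have "(4 * a) powr (2/3) / l powr (4/3) = 4 powr (2/3) * a powr (2/3) * l powr (-4/3)"
    using a by (simp add: powr_mult powr_minus_divide)
  finally have r2: "r\<^sup>2 = 4 powr (2/3) * a powr (2/3) * l powr (-4/3)" .
  note sa = sqn_sub_cell_avg[OF w um r]
  have am: "(\<lambda>x. u x - cell_avg r u x) \<in> borel_measurable borel"
    using cell_avg_measurable[OF um] by measurable
  have pt: "indicator {x. l < norm (u x)} x * ennreal ((norm (u x))\<^sup>2) \<le> 4 * ennreal ((norm (u x - cell_avg r u x))\<^sup>2)" for x
  proof (cases "l < norm (u x)")
    case True
    have "(norm (cell_avg r u x))\<^sup>2 \<le> sqn u / r ^ 3" by (rule norm_cell_avg_le[OF wgradD(1)[OF w] um r])
    also have "\<dots> \<le> a / r ^ 3" using a r by (intro divide_right_mono) auto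
    also have "\<dots> = (l / 2)\<^sup>2" unfolding r3 using a l by (simp add: power_divide)
    finally have "norm (cell_avg r u x) \<le> l / 2" using l by (simp add: power2_le_iff_abs_le)
    then have "norm (u x) \<le> 2 * norm (u x - cell_avg r u x)"
      using norm_triangle_ineq2[of "u x" "cell_avg r u x"] True by linarith
    then have "(norm (u x))\<^sup>2 \<le> (2 * norm (u x - cell_avg r u x))\<^sup>2" by (intro power_mono) auto
    then have "ennreal ((norm (u x))\<^sup>2) \<le> ennreal (4 * (norm (u x - cell_avg r u x))\<^sup>2)"
      by (intro ennreal_leI) (simp add: power_mult_distrib)
    then show ?thesis using True by (simp add: ennreal_mult)
  qed simp
  have "(\<integral>\<^sup>+x. indicator {x. l < norm (u x)} x * ennreal ((norm (u x))\<^sup>2) \<partial>lborel)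
    \<le> (\<integral>\<^sup>+x. 4 * ennreal ((norm (u x - cell_avg r u x))\<^sup>2) \<partial>lborel)"
    by (intro nn_integral_mono pt)
  also have "\<dots> = 4 * (\<integral>\<^sup>+x. ennreal ((norm (u x - cell_avg r u x))\<^sup>2) \<partial>lborel)"
    using cell_avg_measurable[OF um] by (intro nn_integral_cmult) measurable
  also have "\<dots> = 4 * ennreal (sqn (\<lambda>x. u x - cell_avg r u x))" by (simp only: L2_nn_integral[OF sa(1) am])
  also have "\<dots> = ennreal (4 * sqn (\<lambda>x. u x - cell_avg r u x))" by (simp add: ennreal_mult)
  also have "\<dots> \<le> ennreal (tail_const * l powr (-4/3) * (a powr (2/3) * K))"
  proof (rule ennreal_leI)
    have "4 * sqn (\<lambda>x. u x - cell_avg r u x) \<le> 4 * (24 * r\<^sup>2 * sqn G)" by (rule mult_left_mono[OF sa(2)]) simp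
    also have "\<dots> \<le> 4 * (24 * r\<^sup>2 * K)" using K by (intro mult_left_mono) auto
    also have "\<dots> = tail_const * l powr (-4/3) * (a powr (2/3) * K)" unfolding r2 tail_const_def by simp
    finally show "4 * sqn (\<lambda>x. u x - cell_avg r u x) \<le> tail_const * l powr (-4/3) * (a powr (2/3) * K)" .
  qed
  finally show ?thesis .
qed

lemma nn_integral_linear:
  assumes "0 \<le> c"
  shows "(\<integral>\<^sup>+s. ennreal (2 * s) * indicator {0..c} s \<partial>lborel) = ennreal (c\<^sup>2)"
proof -
  have "(\<integral>\<^sup>+s. ennreal (2 * s) * indicator {0..c} s \<partial>lborel) = ennreal (c\<^sup>2 - 0\<^sup>2)"
    by (rule nn_integral_FTC_Icc) (auto intro!: derivative_eq_intros assms)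
  then show ?thesis by simp
qed

text \<open>Layer cake: |u|^4 is |u|^2 times the integral of 2 s over [0, |u|]. After the
  interchange the tail estimate leaves the integral of 2 s^(-1/3) over [0, l], which converges at 0
  and produces the factor 3.\<close>

lemma H1_truncated_fourth_power:
  assumes w: "wgrad u G" and um[measurable]: "u \<in> borel_measurable borel"
    and a: "sqn u \<le> a" "0 < a" and K: "sqn G \<le> K" and l: "0 < l"
  shows "(\<integral>\<^sup>+x. indicator {x. norm (u x) \<le> l} x * ennreal ((norm (u x)) ^ 4) \<partial>lborel)
    \<le> ennreal (3 * tail_const * l powr (2/3) * (a powr (2/3) * K))"
proof -
  let ?P = "a powr (2/3) * K"
  have K0: "0 \<le> K" using K sqn_nonneg[of G] by linarith
  have tc: "0 \<le> tail_const" by (simp add: tail_const_def)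
  have "(\<integral>\<^sup>+x. indicator {x. norm (u x) \<le> l} x * ennreal ((norm (u x)) ^ 4) \<partial>lborel)
    \<le> (\<integral>\<^sup>+x. \<integral>\<^sup>+s. ennreal (2 * s) * indicator {0..l} s * (indicator {x. s < norm (u x)} x * ennreal ((norm (u x))\<^sup>2)) \<partial>lborel \<partial>lborel)"
  proof (rule nn_integral_mono)
    fix x
    show "indicator {x. norm (u x) \<le> l} x * ennreal ((norm (u x)) ^ 4) \<le> (\<integral>\<^sup>+s. ennreal (2 * s) * indicator {0..l} s * (indicator {x. s < norm (u x)} x * ennreal ((norm (u x))\<^sup>2)) \<partial>lborel)"
    proof (cases "norm (u x) \<le> l")
      case True
      have "(norm (u x)) ^ 4 = (norm (u x))\<^sup>2 * (norm (u x))\<^sup>2" by (simp add: power2_eq_square power4_eq_xxxx)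
      then have "ennreal ((norm (u x)) ^ 4) = ennreal ((norm (u x))\<^sup>2) * ennreal ((norm (u x))\<^sup>2)"
        by (simp only: ennreal_mult zero_le_power2)
      then have "indicator {x. norm (u x) \<le> l} x * ennreal ((norm (u x)) ^ 4) = ennreal ((norm (u x))\<^sup>2) * ennreal ((norm (u x))\<^sup>2)"
        using True by simp
      also have "\<dots> = (\<integral>\<^sup>+s. ennreal (2 * s) * indicator {0..norm (u x)} s \<partial>lborel) * ennreal ((norm (u x))\<^sup>2)"
        by (subst nn_integral_linear) auto
      also have "\<dots> = (\<integral>\<^sup>+s. ennreal (2 * s) * indicator {0..norm (u x)} s * ennreal ((norm (u x))\<^sup>2) \<partial>lborel)"
        by (rule nn_integral_multc[symmetric]) measurable
      also have "\<dots> \<le> (\<integral>\<^sup>+s. ennreal (2 * s) * indicator {0..l} s * (indicator {x. s < norm (u x)} x * ennreal ((norm (u x))\<^sup>2)) \<partial>lborel)"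
      proof (rule nn_integral_mono_AE)
        \<comment> \<open>The endpoint s = |u| lies in the closed interval but not in the strict
          tail set; it is a null set.\<close>
        have "AE s in lborel. s \<noteq> norm (u x)" by (rule AE_lborel_singleton)
        then show "AE s in lborel. ennreal (2 * s) * indicator {0..norm (u x)} s * ennreal ((norm (u x))\<^sup>2) \<le> ennreal (2 * s) * indicator {0..l} s * (indicator {x. s < norm (u x)} x * ennreal ((norm (u x))\<^sup>2))"
          by eventually_elim (use True in \<open>auto simp: indicator_def\<close>)
      qed
      finally show ?thesis .
    qed simp
  qed
  also have "\<dots> = (\<integral>\<^sup>+s. \<integral>\<^sup>+x. ennreal (2 * s) * indicator {0..l} s * (indicator {x. s < norm (u x)} x * ennreal ((norm (u x))\<^sup>2)) \<partial>lborel \<partial>lborel)"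
    unfolding indicator_def by (rule lborel_pair.Fubini'[symmetric]) measurable
  also have "\<dots> \<le> (\<integral>\<^sup>+s. ennreal (2 * tail_const * ?P) * (ennreal (s powr (-1/3)) * indicator {0..l} s) \<partial>lborel)"
  proof (rule nn_integral_mono)
    fix s :: real
    show "(\<integral>\<^sup>+x. ennreal (2 * s) * indicator {0..l} s * (indicator {x. s < norm (u x)} x * ennreal ((norm (u x))\<^sup>2)) \<partial>lborel) \<le> ennreal (2 * tail_const * ?P) * (ennreal (s powr (-1/3)) * indicator {0..l} s)"
    proof (cases "0 < s \<and> s \<le> l")
      case True
      have "(\<integral>\<^sup>+x. ennreal (2 * s) * indicator {0..l} s * (indicator {x. s < norm (u x)} x * ennreal ((norm (u x))\<^sup>2)) \<partial>lborel)
        = ennreal (2 * s) * indicator {0..l} s * (\<integral>\<^sup>+x. indicator {x. s < norm (u x)} x * ennreal ((norm (u x))\<^sup>2) \<partial>lborel)"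
        by (rule nn_integral_cmult) measurable
      also have "\<dots> \<le> ennreal (2 * s) * indicator {0..l} s * ennreal (tail_const * s powr (-4/3) * ?P)"
        using True by (intro mult_left_mono H1_tail_estimate[OF w um a K]) auto
      also have "\<dots> = ennreal (2 * s * (tail_const * s powr (-4/3) * ?P))"
        using True tc K0 a by (simp add: ennreal_mult)
      also have "2 * s * (tail_const * s powr (-4/3) * ?P) = 2 * tail_const * ?P * (s powr (-1/3))"
      proof -
        have "s powr 1 * s powr (-4/3) = s powr (1 + (-4/3))" by (rule powr_add[symmetric])
        then have e: "s * s powr (-4/3) = s powr (-1/3)" using True by simp
        have "2 * s * (tail_const * s powr (-4/3) * ?P) = 2 * tail_const * ?P * (s * s powr (-4/3))"
          by (simp only: mult_ac)
        then show ?thesis unfolding e .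
      qed
      also have "ennreal (2 * tail_const * ?P * (s powr (-1/3))) = ennreal (2 * tail_const * ?P) * (ennreal (s powr (-1/3)) * indicator {0..l} s)"
        using True tc K0 a by (simp add: ennreal_mult'[symmetric])
      finally show ?thesis .
    next
      case False
      then have z: "ennreal (2 * s) * indicator {0..l} s = 0" by (auto simp: indicator_def ennreal_eq_0_iff)
      show ?thesis unfolding z by simp
    qed
  qed
  also have "\<dots> = ennreal (2 * tail_const * ?P) * (\<integral>\<^sup>+s. ennreal (s powr (-1/3)) * indicator {0..l} s \<partial>lborel)"
    by (rule nn_integral_cmult) measurable
  also have "\<dots> = ennreal (2 * tail_const * ?P) * ennreal (l powr (2/3) / (2/3))"
    using nn_integral_powr_from_0[of "-1/3" l] l by simp
  also have "\<dots> = ennreal (3 * tail_const * l powr (2/3) * ?P)"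
    using tc K0 a by (simp add: ennreal_mult'[symmetric])
  finally show ?thesis .
qed

text \<open>First summand: Bessel for the part of the density below the level. Second summand: the
  sup bound for the Fourier transform of the part above. Both carry the 2 of
  \<open>norm_add_power2_le\<close>.\<close>

definition density_const :: real where
  "density_const = 6 * (2 * pi) ^ 3 * tail_const + 2 * tail_const\<^sup>2"

lemma density_const_pos: "0 < density_const"
  unfolding density_const_def tail_const_def by (intro add_pos_pos) auto

lemma norm_add_power2_le: "(norm (x + y))\<^sup>2 \<le> 2 * (norm (x :: complex))\<^sup>2 + 2 * (norm y)\<^sup>2"
proof -
  have "(norm (x + y))\<^sup>2 \<le> (norm x + norm y)\<^sup>2" by (intro power_mono norm_triangle_ineq) simp
  also have "\<dots> \<le> 2 * (norm x)\<^sup>2 + 2 * (norm y)\<^sup>2"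
    using sum_squares_bound[of "norm x" "norm y"] by (simp add: power2_sum)
  finally show ?thesis .
qed

theorem ft_density_estimate:
  assumes w: "wgrad u G" and um[measurable]: "u \<in> borel_measurable borel"
    and a: "sqn u \<le> a" "0 < a" and K: "sqn G \<le> K" "0 < K"
    and E[measurable]: "E \<in> sets borel" and tau: "emeasure lborel E \<le> ennreal \<tau>" "0 < \<tau>"
  shows "(\<integral>\<^sup>+k. indicator E k * ennreal ((norm (ft (\<lambda>x. (norm (u x))\<^sup>2) k))\<^sup>2) \<partial>lborel)
     \<le> ennreal (density_const * (a powr (2/3) * K) powr (6/5) * \<tau> powr (1/5))"
proof -
  define P where "P = a powr (2/3) * K"
  have P: "0 < P" unfolding P_def using a K by simp
  \<comment> \<open>the level balancing the \<open>L\<^sup>2\<close> bound of the part of the density below it and the \<open>L\<^sup>1\<close> bound of the part above\<close>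
  define l where "l = (\<tau> * P) powr (3/10)"
  have l: "0 < l" unfolding l_def using tau P by simp
  have tc: "0 < tail_const" by (simp add: tail_const_def)
  define f1 where "f1 x = indicator {x. norm (u x) \<le> l} x * (norm (u x))\<^sup>2" for x
  define f2 where "f2 x = indicator {x. l < norm (u x)} x * (norm (u x))\<^sup>2" for x
  have [measurable]: "f1 \<in> borel_measurable borel" "f2 \<in> borel_measurable borel"
    unfolding f1_def[abs_def] f2_def[abs_def] indicator_def by measurable
  have iu: "integrable lborel (\<lambda>x. (norm (u x))\<^sup>2)"
    using L2D(2)[OF wgradD(1)[OF w]] by (subst (asm) integrable_completion) auto
  have i1: "integrable lborel f1"
    by (rule Bochner_Integration.integrable_bound[OF iu]) (auto simp: f1_def indicator_def)
  have i2: "integrable lborel f2"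
    by (rule Bochner_Integration.integrable_bound[OF iu]) (auto simp: f2_def indicator_def)
  have b1: "(\<integral>\<^sup>+x. ennreal ((f1 x)\<^sup>2) \<partial>lborel) \<le> ennreal (3 * tail_const * l powr (2/3) * P)"
  proof -
    have "(\<integral>\<^sup>+x. ennreal ((f1 x)\<^sup>2) \<partial>lborel) = (\<integral>\<^sup>+x. indicator {x. norm (u x) \<le> l} x * ennreal ((norm (u x)) ^ 4) \<partial>lborel)"
      by (rule nn_integral_cong) (auto simp: f1_def indicator_def)
    then show ?thesis unfolding P_def using H1_truncated_fourth_power[OF w um a K(1) l] by simp
  qed
  have nn1: "0 \<le> 3 * tail_const * l powr (2/3) * P" using tc P by simp
  have i11: "integrable lborel (\<lambda>x. (f1 x)\<^sup>2)"
    using b1 by (intro integrableI_bounded) (auto simp: top.extremum_strict less_top[symmetric] top_unique)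
  have s1: "(\<integral>x. (f1 x)\<^sup>2 \<partial>lborel) \<le> 3 * tail_const * l powr (2/3) * P"
    using b1 nn_integral_eq_integral[OF i11] nn1 by (simp add: ennreal_le_iff)
  have b2: "(\<integral>\<^sup>+x. ennreal (f2 x) \<partial>lborel) \<le> ennreal (tail_const * l powr (-4/3) * P)"
  proof -
    have "(\<integral>\<^sup>+x. ennreal (f2 x) \<partial>lborel) = (\<integral>\<^sup>+x. indicator {x. l < norm (u x)} x * ennreal ((norm (u x))\<^sup>2) \<partial>lborel)"
      by (rule nn_integral_cong) (auto simp: f2_def indicator_def)
    then show ?thesis unfolding P_def using H1_tail_estimate[OF w um a K(1) l] by simp
  qed
  have nn2: "0 \<le> tail_const * l powr (-4/3) * P" using tc P by simp
  have f20: "0 \<le> f2 x" for x by (simp add: f2_def)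
  have s2: "(\<integral>x. \<bar>f2 x\<bar> \<partial>lebesgue) \<le> tail_const * l powr (-4/3) * P"
    using b2 nn_integral_eq_integral[OF i2] nn2 f20 integral_completion[of f2 lborel] by (simp add: ennreal_le_iff)
  have L1: "integrable lebesgue f1" "integrable lebesgue f2"
    using i1 i2 by (subst integrable_completion; simp)+
  have split: "ft (\<lambda>x. (norm (u x))\<^sup>2) k = ft f1 k + ft f2 k" for k
  proof -
    have "(\<lambda>x. (norm (u x))\<^sup>2) = (\<lambda>x. f1 x + f2 x)" by (auto simp: f1_def f2_def indicator_def)
    then show ?thesis using ft_add[OF L1] by simp
  qed
  have [measurable]: "ft f1 \<in> borel_measurable borel"
    by (rule ft_borel_measurable) (rule borel_measurable_lebesgueI, measurable)
  have n2: "(norm (ft f2 k))\<^sup>2 \<le> (tail_const * l powr (-4/3) * P)\<^sup>2" for k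
    by (rule power_mono[OF order_trans[OF norm_ft_le s2]]) simp
  have "(\<integral>\<^sup>+k. indicator E k * ennreal ((norm (ft (\<lambda>x. (norm (u x))\<^sup>2) k))\<^sup>2) \<partial>lborel)
    \<le> (\<integral>\<^sup>+k. 2 * ennreal ((norm (ft f1 k))\<^sup>2) + ennreal (2 * (tail_const * l powr (-4/3) * P)\<^sup>2) * indicator E k \<partial>lborel)"
  proof (rule nn_integral_mono)
    fix k
    have "(norm (ft (\<lambda>x. (norm (u x))\<^sup>2) k))\<^sup>2 \<le> 2 * (norm (ft f1 k))\<^sup>2 + 2 * (tail_const * l powr (-4/3) * P)\<^sup>2"
      unfolding split using norm_add_power2_le[of "ft f1 k" "ft f2 k"] n2[of k] by linarith
    then have "ennreal ((norm (ft (\<lambda>x. (norm (u x))\<^sup>2) k))\<^sup>2) \<le> ennreal (2 * (norm (ft f1 k))\<^sup>2 + 2 * (tail_const * l powr (-4/3) * P)\<^sup>2)"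
      by (rule ennreal_leI)
    also have "\<dots> = 2 * ennreal ((norm (ft f1 k))\<^sup>2) + ennreal (2 * (tail_const * l powr (-4/3) * P)\<^sup>2)"
      by (subst ennreal_plus) (auto simp: ennreal_mult')
    finally show "indicator E k * ennreal ((norm (ft (\<lambda>x. (norm (u x))\<^sup>2) k))\<^sup>2)
       \<le> 2 * ennreal ((norm (ft f1 k))\<^sup>2) + ennreal (2 * (tail_const * l powr (-4/3) * P)\<^sup>2) * indicator E k"
      by (cases "k \<in> E") auto
  qed
  also have "\<dots> = 2 * (\<integral>\<^sup>+k. ennreal ((norm (ft f1 k))\<^sup>2) \<partial>lborel) + ennreal (2 * (tail_const * l powr (-4/3) * P)\<^sup>2) * emeasure lborel E"
    by (subst nn_integral_add) (auto simp: nn_integral_cmult nn_integral_cmult_indicator)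
  also have "\<dots> \<le> 2 * ennreal ((2 * pi) ^ 3 * (3 * tail_const * l powr (2/3) * P)) + ennreal (2 * (tail_const * l powr (-4/3) * P)\<^sup>2) * ennreal \<tau>"
  proof (intro add_mono mult_left_mono)
    have "(\<integral>\<^sup>+k. ennreal ((norm (ft f1 k))\<^sup>2) \<partial>lborel) \<le> ennreal ((2 * pi) ^ 3 * (\<integral>x. (f1 x)\<^sup>2 \<partial>lborel))"
      by (rule bessel) (use i1 i11 in auto)
    also have "\<dots> \<le> ennreal ((2 * pi) ^ 3 * (3 * tail_const * l powr (2/3) * P))"
      by (intro ennreal_leI mult_left_mono s1) simp
    finally show "(\<integral>\<^sup>+k. ennreal ((norm (ft f1 k))\<^sup>2) \<partial>lborel) \<le> ennreal ((2 * pi) ^ 3 * (3 * tail_const * l powr (2/3) * P))" .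
  qed (use tau in auto)
  also have "\<dots> = ennreal (2 * ((2 * pi) ^ 3 * (3 * tail_const * l powr (2/3) * P)) + 2 * (tail_const * l powr (-4/3) * P)\<^sup>2 * \<tau>)"
    using tc P tau by (simp add: ennreal_mult' ennreal_plus)
  \<comment> \<open>The two terms scale as l^(2/3) P and l^(-8/3) P^2 \<tau>. They coincide when
    l^(10/3) = \<tau> P, which is the choice of \<open>l\<close>.\<close>
  also have "2 * ((2 * pi) ^ 3 * (3 * tail_const * l powr (2/3) * P)) + 2 * (tail_const * l powr (-4/3) * P)\<^sup>2 * \<tau>
    = density_const * P powr (6/5) * \<tau> powr (1/5)"
  proof -
    have 1: "l powr (2/3) * P = P powr (6/5) * \<tau> powr (1/5)"
    proof -
      have "l powr (2/3) * P = \<tau> powr (1/5) * P powr (1/5) * P powr 1"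
        unfolding l_def using tau P by (simp add: powr_powr powr_mult)
      also have "\<dots> = \<tau> powr (1/5) * P powr (1/5 + 1)" by (simp only: powr_add mult.assoc)
      finally show ?thesis by (simp add: mult.commute)
    qed
    have 2: "(l powr (-4/3) * P)\<^sup>2 * \<tau> = P powr (6/5) * \<tau> powr (1/5)"
    proof -
      have "(l powr (-4/3))\<^sup>2 = l powr (-8/3)" using powr_pow[OF l, of "-4/3" 2] by simp
      also have "\<dots> = \<tau> powr (-4/5) * P powr (-4/5)"
        unfolding l_def using tau P by (simp add: powr_powr powr_mult)
      finally have "(l powr (-4/3) * P)\<^sup>2 * \<tau> = (P powr (-4/5) * P powr 2) * (\<tau> powr (-4/5) * \<tau> powr 1)"
        using P tau by (simp add: power_mult_distrib)
      then show ?thesis unfolding powr_add[symmetric] by simp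
    qed
    have m1: "2 * (tail_const * l powr (-4/3) * P)\<^sup>2 * \<tau> = 2 * tail_const\<^sup>2 * ((l powr (-4/3) * P)\<^sup>2 * \<tau>)"
      by (simp add: power_mult_distrib mult.assoc)
    have m2: "2 * ((2 * pi) ^ 3 * (3 * tail_const * l powr (2/3) * P)) = 6 * (2 * pi) ^ 3 * tail_const * (l powr (2/3) * P)"
      by simp
    show ?thesis unfolding m1 m2 1 2 density_const_def by (simp only: distrib_right mult.assoc)
  qed
  finally show ?thesis unfolding P_def .
qed

text \<open>Layer cake in the values of |W|. Low levels use \<open>hc\<close> on the superlevel set,
  of measure at most (M / t)^3, which gives t^(-3/5), integrable at 0. High levels use the sup bound
  \<open>hd\<close>, which gives t^(-3), integrable at infinity.\<close>

theorem weak_L3_integral_estimate: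
  fixes W :: "R3 \<Rightarrow> real" and h :: "R3 \<Rightarrow> complex"
  assumes [measurable]: "W \<in> borel_measurable borel" "h \<in> borel_measurable borel"
    and W: "\<And>t. 0 < t \<Longrightarrow> emeasure lborel {k. t < \<bar>W k\<bar>} \<le> ennreal ((M / t) ^ 3)"
    and M: "0 < M" and d: "0 < d" and c: "0 < c"
    and hd: "\<And>k. (norm (h k))\<^sup>2 \<le> d"
    and hc: "\<And>E \<tau>. E \<in> sets borel \<Longrightarrow> emeasure lborel E \<le> ennreal \<tau> \<Longrightarrow> 0 < \<tau> \<Longrightarrow>
       (\<integral>\<^sup>+k. indicator E k * ennreal ((norm (h k))\<^sup>2) \<partial>lborel) \<le> ennreal (c * \<tau> powr (1/5))"
  shows "(\<integral>\<^sup>+k. ennreal (\<bar>W k\<bar> * (norm (h k))\<^sup>2) \<partial>lborel) \<le> ennreal (3 * M * c powr (5/6) * d powr (1/6))"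
proof -
  \<comment> \<open>The level at which c1 t^(2/5) = c2 t^(-2). The two ranges then contribute 5/2
    and 1/2 times the same product, whence the factor 3.\<close>
  define t0 where "t0 = M * (d / c) powr (5/12)"
  have t0: "0 < t0" unfolding t0_def using M c d by simp
  define c1 where "c1 = c * M powr (3/5)"
  define c2 where "c2 = d * M ^ 3"
  have c12: "0 \<le> c1" "0 \<le> c2" using M c d by (auto simp: c1_def c2_def)
  let ?\<Phi> = "\<lambda>t. \<integral>\<^sup>+k. indicator {k. t < \<bar>W k\<bar>} k * ennreal ((norm (h k))\<^sup>2) \<partial>lborel"
  have "(\<integral>\<^sup>+k. ennreal (\<bar>W k\<bar> * (norm (h k))\<^sup>2) \<partial>lborel)
     = (\<integral>\<^sup>+k. \<integral>\<^sup>+t. indicator {0..} t * (indicator {k. t < \<bar>W k\<bar>} k * ennreal ((norm (h k))\<^sup>2)) \<partial>lborel \<partial>lborel)"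
  proof (rule nn_integral_cong)
    fix k
    have "(\<integral>\<^sup>+t. indicator {0..} t * (indicator {k. t < \<bar>W k\<bar>} k * ennreal ((norm (h k))\<^sup>2)) \<partial>lborel)
      = (\<integral>\<^sup>+t. ennreal ((norm (h k))\<^sup>2) * indicator {0..<\<bar>W k\<bar>} t \<partial>lborel)"
      by (rule nn_integral_cong) (auto simp: indicator_def)
    also have "\<dots> = ennreal ((norm (h k))\<^sup>2) * ennreal \<bar>W k\<bar>"
      by (subst nn_integral_cmult_indicator) auto
    finally show "ennreal (\<bar>W k\<bar> * (norm (h k))\<^sup>2) = (\<integral>\<^sup>+t. indicator {0..} t * (indicator {k. t < \<bar>W k\<bar>} k * ennreal ((norm (h k))\<^sup>2)) \<partial>lborel)"
      by (simp add: ennreal_mult mult.commute)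
  qed
  also have "\<dots> = (\<integral>\<^sup>+t. \<integral>\<^sup>+k. indicator {0..} t * (indicator {k. t < \<bar>W k\<bar>} k * ennreal ((norm (h k))\<^sup>2)) \<partial>lborel \<partial>lborel)"
    unfolding indicator_def by (rule lborel_pair.Fubini'[symmetric]) measurable
  also have "\<dots> = (\<integral>\<^sup>+t. indicator {0..} t * ?\<Phi> t \<partial>lborel)"
    by (intro nn_integral_cong nn_integral_cmult) measurable
  also have "\<dots> \<le> (\<integral>\<^sup>+t. ennreal c1 * (ennreal (t powr (-3/5)) * indicator {0..t0} t) + ennreal c2 * (ennreal (t powr (-3)) * indicator {t0..} t) \<partial>lborel)"
  proof (rule nn_integral_mono_AE)
    have b: "indicator {0..} t * ?\<Phi> t \<le> ennreal c1 * (ennreal (t powr (-3/5)) * indicator {0..t0} t) + ennreal c2 * (ennreal (t powr (-3)) * indicator {t0..} t)" if "t \<noteq> 0" for t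
    proof -
      consider "t < 0" | "0 < t" "t \<le> t0" | "t0 < t" using \<open>t \<noteq> 0\<close> by linarith
      then show ?thesis
      proof cases
        case 1 then show ?thesis by simp
      next
        case 2
        have "?\<Phi> t \<le> ennreal (c * ((M / t) ^ 3) powr (1/5))"
          by (rule hc) (use W[OF 2(1)] 2 M in auto)
        also have "c * ((M / t) ^ 3) powr (1/5) = c1 * t powr (-3/5)"
        proof -
          have "((M / t) ^ 3) powr (1/5) = (M / t) powr (3/5)"
            using pow_powr[of "M / t" 3 "1/5"] 2 M by simp
          also have "\<dots> = M powr (3/5) * t powr (-3/5)" using 2 M by (simp add: powr_divide powr_minus_divide)
          finally show ?thesis by (simp add: c1_def)
        qed
        finally have "?\<Phi> t \<le> ennreal c1 * ennreal (t powr (-3/5))" using c12 by (simp add: ennreal_mult)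
        then have "indicator {0..} t * ?\<Phi> t \<le> ennreal c1 * (ennreal (t powr (-3/5)) * indicator {0..t0} t)" using 2 by simp
        then show ?thesis by (rule order_trans) simp
      next
        case 3
        have "?\<Phi> t \<le> (\<integral>\<^sup>+k. ennreal d * indicator {k. t < \<bar>W k\<bar>} k \<partial>lborel)"
          by (intro nn_integral_mono) (auto simp: indicator_def intro: ennreal_leI hd)
        also have "\<dots> = ennreal d * emeasure lborel {k. t < \<bar>W k\<bar>}" by (rule nn_integral_cmult_indicator) measurable
        also have "\<dots> \<le> ennreal d * ennreal ((M / t) ^ 3)" using W[of t] 3 t0 by (intro mult_left_mono) auto
        also have "\<dots> = ennreal (c2 * t powr (-3))"
          using 3 t0 d M by (simp add: c2_def ennreal_mult[symmetric] powr_minus_divide power_divide)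
        finally have "?\<Phi> t \<le> ennreal c2 * ennreal (t powr (-3))" using c12 by (simp add: ennreal_mult)
        then have "indicator {0..} t * ?\<Phi> t \<le> ennreal c2 * (ennreal (t powr (-3)) * indicator {t0..} t)" using 3 t0 by simp
        then show ?thesis by (rule order_trans) simp
      qed
    qed
    have "AE t in lborel. t \<noteq> (0::real)" by (rule AE_lborel_singleton)
    then show "AE t in lborel. indicator {0..} t * ?\<Phi> t \<le> ennreal c1 * (ennreal (t powr (-3/5)) * indicator {0..t0} t) + ennreal c2 * (ennreal (t powr (-3)) * indicator {t0..} t)"
      by eventually_elim (rule b)
  qed
  also have "\<dots> = ennreal c1 * ennreal (t0 powr (2/5) / (2/5)) + ennreal c2 * ennreal (t0 powr (-2) / 2)"
  proof -
    have "(\<integral>\<^sup>+t. ennreal (t powr (-3/5)) * indicator {0..t0} t \<partial>lborel) = ennreal (t0 powr (2/5) / (2/5))"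
      using nn_integral_powr_from_0[of "-3/5" t0] t0 by simp
    moreover have "(\<integral>\<^sup>+t. ennreal (t powr (-3)) * indicator {t0..} t \<partial>lborel) = ennreal (t0 powr (-2) / 2)"
      using nn_integral_powr_to_inf[of "-3" t0] t0 by simp
    ultimately show ?thesis by (subst nn_integral_add) (auto simp: nn_integral_cmult)
  qed
  also have "\<dots> = ennreal (c1 * (t0 powr (2/5) / (2/5)) + c2 * (t0 powr (-2) / 2))"
  proof -
    have "ennreal c1 * ennreal A + ennreal c2 * ennreal B = ennreal (c1 * A + c2 * B)" if "0 \<le> A" "0 \<le> B" for A B
      using c12 that by (simp add: ennreal_mult[symmetric] ennreal_plus[symmetric] del: ennreal_plus)
    then show ?thesis by simp
  qed
  also have "c1 * (t0 powr (2/5) / (2/5)) + c2 * (t0 powr (-2) / 2) = 3 * M * c powr (5/6) * d powr (1/6)"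
  proof -
    have 1: "c1 * t0 powr (2/5) = M * c powr (5/6) * d powr (1/6)"
    proof -
      have "t0 powr (2/5) = M powr (2/5) * (d powr (1/6) * c powr (-1/6))"
        unfolding t0_def using M c d by (simp add: powr_mult powr_powr powr_divide powr_minus_divide)
      then have "c1 * t0 powr (2/5) = (M powr (3/5) * M powr (2/5)) * (c powr 1 * c powr (-1/6)) * d powr (1/6)"
        using c by (simp add: c1_def)
      then show ?thesis unfolding powr_add[symmetric] using M by simp
    qed
    have 2: "c2 * t0 powr (-2) = M * c powr (5/6) * d powr (1/6)"
    proof -
      have "t0 powr (-2) = M powr (-2) * (d powr (-5/6) * c powr (5/6))"
        unfolding t0_def using M c d by (simp add: powr_mult powr_powr powr_divide powr_minus_divide)
      moreover have "M ^ 3 = M powr 3" using M by simp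
      ultimately have "c2 * t0 powr (-2) = (M powr 3 * M powr (-2)) * (d powr 1 * d powr (-5/6)) * c powr (5/6)"
        using d by (simp add: c2_def)
      then show ?thesis unfolding powr_add[symmetric] using M by simp
    qed
    have "c1 * (t0 powr (2/5) / (2/5)) + c2 * (t0 powr (-2) / 2) = 5/2 * (c1 * t0 powr (2/5)) + 1/2 * (c2 * t0 powr (-2))" by simp
    then show ?thesis unfolding 1 2 by simp
  qed
  finally show ?thesis .
qed

text \<open>The factor 3 is that of \<open>weak_L3_integral_estimate\<close>, and 5/6 is the
  exponent with which the constant of \<open>ft_density_estimate\<close> enters there.\<close>

definition hartree_const :: real where
  "hartree_const = 3 * density_const powr (5/6)"

lemma hartree_const_pos: "0 < hartree_const"
  using density_const_pos by (simp add: hartree_const_def)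

lemma norm_ft_density_le: "norm (ft (\<lambda>x. (norm (u x))\<^sup>2) k) \<le> sqn u"
  using norm_ft_le[of "\<lambda>x. (norm (u x))\<^sup>2" k] by (simp add: sqn_def)

text \<open>The exponents fit: the power 5/6 of the bound on sets contributes
  \<open>a powr (2/3) * K\<close>, the power 1/6 of the sup bound a^2 contributes a^(1/3), and
  together they give the product of \<open>a\<close> and \<open>K\<close>. The bounds are strictly
  positive so that real powers can be combined.\<close>

lemma hartree_weak_estimate_strict:
  assumes [measurable]: "W \<in> borel_measurable borel"
    and W: "\<And>t. 0 < t \<Longrightarrow> emeasure lborel {k. t < \<bar>W k\<bar>} \<le> ennreal ((M / t) ^ 3)" and M: "0 < M"
    and w: "wgrad u G" and um[measurable]: "u \<in> borel_measurable borel"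
    and a: "sqn u \<le> a" "0 < a" and K: "sqn G \<le> K" "0 < K"
  shows "(\<integral>\<^sup>+k. ennreal (\<bar>W k\<bar> * (norm (ft (\<lambda>x. (norm (u x))\<^sup>2) k))\<^sup>2) \<partial>lborel) \<le> ennreal (hartree_const * M * a * K)"
proof -
  let ?c = "density_const * (a powr (2/3) * K) powr (6/5)"
  have "(\<integral>\<^sup>+k. ennreal (\<bar>W k\<bar> * (norm (ft (\<lambda>x. (norm (u x))\<^sup>2) k))\<^sup>2) \<partial>lborel) \<le> ennreal (3 * M * ?c powr (5/6) * (a\<^sup>2) powr (1/6))"
  proof (rule weak_L3_integral_estimate)
    show "ft (\<lambda>x. (norm (u x))\<^sup>2) \<in> borel_measurable borel"
      by (rule ft_borel_measurable) (rule borel_measurable_lebesgueI, measurable)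
    show "0 < ?c" using density_const_pos a K by simp
    show "(norm (ft (\<lambda>x. (norm (u x))\<^sup>2) k))\<^sup>2 \<le> a\<^sup>2" for k
      using norm_ft_density_le[of u k] a by (intro power_mono) auto
    show "(\<integral>\<^sup>+k. indicator E k * ennreal ((norm (ft (\<lambda>x. (norm (u x))\<^sup>2) k))\<^sup>2) \<partial>lborel) \<le> ennreal (?c * \<tau> powr (1/5))"
      if "E \<in> sets borel" "emeasure lborel E \<le> ennreal \<tau>" "0 < \<tau>" for E \<tau>
      by (rule ft_density_estimate[OF w um a K that])
  qed (use W M a in auto)
  also have "3 * M * ?c powr (5/6) * (a\<^sup>2) powr (1/6) = hartree_const * M * a * K"
  proof -
    have "?c powr (5/6) = density_const powr (5/6) * (a powr (2/3) * K)"
      using density_const_pos a K by (simp add: powr_mult powr_powr)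
    moreover have "(a\<^sup>2) powr (1/6) = a powr (1/3)" using pow_powr[OF a(2), of 2 "1/6"] by simp
    moreover have "a powr (2/3) * a powr (1/3) = a" unfolding powr_add[symmetric] using a by simp
    ultimately show ?thesis by (simp add: hartree_const_def mult_ac)
  qed
  finally show ?thesis .
qed

lemma L3_weak_norm_nonneg: "W \<in> L3_weak \<Longrightarrow> 0 \<le> L3_weak_norm W"
  unfolding L3_weak_norm_def L3_weak_def
  by (rule order_trans[OF _ cSUP_upper[of 1]]) auto

lemma L3_weak_representative:
  assumes "W \<in> L3_weak"
  obtains W' where "W' \<in> borel_measurable borel" "AE k in lebesgue. W k = W' k"
    "\<And>t. 0 < t \<Longrightarrow> emeasure lborel {k. t < \<bar>W' k\<bar>} \<le> ennreal ((L3_weak_norm W / t) ^ 3)"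
proof -
  have Wm: "W \<in> borel_measurable lebesgue" using assms by (simp add: L3_weak_def)
  obtain W' where W'[measurable]: "W' \<in> borel_measurable borel" and ae: "AE k in lborel. W k = W' k"
    using completion_ex_borel_measurable_real[OF Wm] by auto
  have "emeasure lborel {k. t < \<bar>W' k\<bar>} \<le> ennreal ((L3_weak_norm W / t) ^ 3)" if t: "0 < t" for t
  proof -
    let ?A = "{k. \<bar>W k\<bar> > t}"
    have fin: "emeasure lebesgue ?A < \<infinity>" using assms t by (simp add: L3_weak_def)
    have "t * root 3 (measure lebesgue ?A) \<le> L3_weak_norm W"
      unfolding L3_weak_norm_def using assms t by (intro cSUP_upper) (auto simp: L3_weak_def)
    then have "root 3 (measure lebesgue ?A) \<le> L3_weak_norm W / t" using t by (simp add: field_simps)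
    then have "root 3 (measure lebesgue ?A) ^ 3 \<le> (L3_weak_norm W / t) ^ 3" by (intro power_mono) auto
    then have le: "measure lebesgue ?A \<le> (L3_weak_norm W / t) ^ 3" by simp
    have B: "{k. t < \<bar>W' k\<bar>} \<in> sets borel" by measurable
    have Al: "?A \<in> sets lebesgue"
    proof -
      have "{k \<in> space lebesgue. t < \<bar>W k\<bar>} \<in> sets lebesgue" using Wm by measurable
      then show ?thesis by simp
    qed
    have "emeasure lborel {k. t < \<bar>W' k\<bar>} = emeasure lebesgue {k. t < \<bar>W' k\<bar>}" using B by simp
    also have "\<dots> = emeasure lebesgue ?A"
      by (rule emeasure_eq_AE) (use ae Al B in \<open>auto simp: AE_lebesgue_iff elim!: eventually_mono\<close>)
    also have "\<dots> = ennreal (measure lebesgue ?A)" using fin by (intro emeasure_eq_ennreal_measure) auto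
    also have "\<dots> \<le> ennreal ((L3_weak_norm W / t) ^ 3)" by (rule ennreal_leI[OF le])
    finally show ?thesis .
  qed
  then show ?thesis using that[OF W' ae[folded AE_lebesgue_iff]] by blast
qed

text \<open>Reduced to Borel representatives, and to strictly positive bounds by adding
  \<open>e\<close> to the three factors; \<open>e\<close> tends to 0 at the end.\<close>

theorem hartree_weak_estimate:
  assumes W: "W \<in> L3_weak" and w: "wgrad u G"
  shows "integrable lebesgue (\<lambda>k. \<bar>W k\<bar> * (norm (ft (\<lambda>x. (norm (u x))\<^sup>2) k))\<^sup>2)"
    and "(\<integral>k. \<bar>W k\<bar> * (norm (ft (\<lambda>x. (norm (u x))\<^sup>2) k))\<^sup>2 \<partial>lebesgue) \<le> hartree_const * L3_weak_norm W * sqn u * sqn G"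
proof -
  let ?M = "L3_weak_norm W"
  obtain W' where W'[measurable]: "W' \<in> borel_measurable borel" and ae: "AE k in lebesgue. W k = W' k"
    and W't: "\<And>t. 0 < t \<Longrightarrow> emeasure lborel {k. t < \<bar>W' k\<bar>} \<le> ennreal ((?M / t) ^ 3)"
    using L3_weak_representative[OF W] by blast
  have M0: "0 \<le> ?M" by (rule L3_weak_norm_nonneg[OF W])
  have Wm: "W \<in> borel_measurable lebesgue" using W by (simp add: L3_weak_def)
  note um = L2D(1)[OF wgradD(1)[OF w]]
  obtain u' where u'[measurable]: "u' \<in> borel_measurable borel" and aeu: "AE x in lebesgue. u x = u' x"
    using ex_borel_representative[OF um] by blast
  have w': "wgrad u' G"
    by (rule wgrad_cong_AE[OF w borel_measurable_lebesgueI[OF u'] L2D(1)[OF wgradD(2)[OF w]] aeu]) simp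
  have su: "sqn u' = sqn u" using aeu by (intro sqn_cong_AE um borel_measurable_lebesgueI[OF u']) auto
  have fe: "ft (\<lambda>x. (norm (u x))\<^sup>2) = ft (\<lambda>x. (norm (u' x))\<^sup>2)" (is "?f = ?f'")
  proof (rule ft_cong_AE)
    show "(\<lambda>x. (norm (u x))\<^sup>2) \<in> borel_measurable lebesgue" using um by measurable
    show "(\<lambda>x. (norm (u' x))\<^sup>2) \<in> borel_measurable lebesgue" by (rule borel_measurable_lebesgueI) measurable
    show "AE x in lebesgue. (norm (u x))\<^sup>2 = (norm (u' x))\<^sup>2" using aeu by eventually_elim simp
  qed
  have fm[measurable]: "?f' \<in> borel_measurable borel"
    by (rule ft_borel_measurable) (rule borel_measurable_lebesgueI, measurable)
  let ?X = "\<lambda>k. \<bar>W' k\<bar> * (norm (?f' k))\<^sup>2"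
  have est: "(\<integral>\<^sup>+k. ennreal (?X k) \<partial>lborel) \<le> ennreal (hartree_const * (?M + e) * (sqn u + e) * (sqn G + e))" if e: "0 < e" for e
  proof (rule hartree_weak_estimate_strict[OF W' _ _ w' u'])
    fix t :: real assume t: "0 < t"
    have "(?M / t) ^ 3 \<le> ((?M + e) / t) ^ 3" using M0 e t by (intro power_mono divide_right_mono) auto
    then show "emeasure lborel {k. t < \<bar>W' k\<bar>} \<le> ennreal (((?M + e) / t) ^ 3)"
      using W't[OF t] by (meson ennreal_leI order_trans)
  qed (use M0 e su sqn_nonneg[of u] sqn_nonneg[of G] in \<open>auto simp: add_nonneg_pos\<close>)
  have Xi: "integrable lborel ?X"
  proof (rule integrableI_bounded)
    have "(\<integral>\<^sup>+k. ennreal (norm (?X k)) \<partial>lborel) = (\<integral>\<^sup>+k. ennreal (?X k) \<partial>lborel)" by (rule nn_integral_cong) simp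
    also have "\<dots> \<le> ennreal (hartree_const * (?M + 1) * (sqn u + 1) * (sqn G + 1))" by (rule est) simp
    also have "\<dots> < \<infinity>" by simp
    finally show "(\<integral>\<^sup>+k. ennreal (norm (?X k)) \<partial>lborel) < \<infinity>" .
  qed measurable
  have Xm: "?X \<in> borel_measurable lebesgue" by (rule borel_measurable_lebesgueI) measurable
  have aeX: "AE k in lebesgue. ?X k = \<bar>W k\<bar> * (norm (?f k))\<^sup>2"
    using ae by eventually_elim (simp add: fe)
  have fm': "?f \<in> borel_measurable lebesgue" unfolding fe by (rule borel_measurable_lebesgueI[OF fm])
  have Ym: "(\<lambda>k. \<bar>W k\<bar> * (norm (?f k))\<^sup>2) \<in> borel_measurable lebesgue"
    using Wm fm' by measurable
  have XL: "integrable lebesgue ?X" using Xi by (subst integrable_completion) auto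
  show "integrable lebesgue (\<lambda>k. \<bar>W k\<bar> * (norm (?f k))\<^sup>2)"
    by (rule integrable_cong_AE_imp[OF XL Ym aeX])
  have "(\<integral>k. \<bar>W k\<bar> * (norm (?f k))\<^sup>2 \<partial>lebesgue) = (\<integral>k. ?X k \<partial>lebesgue)"
    by (rule integral_cong_AE[OF Ym Xm]) (use aeX in \<open>auto elim!: eventually_mono\<close>)
  also have "\<dots> = (\<integral>k. ?X k \<partial>lborel)" by (rule integral_completion) measurable
  also have "\<dots> \<le> hartree_const * (?M + 0) * (sqn u + 0) * (sqn G + 0)"
  proof (rule tendsto_lowerbound)
    show "((\<lambda>e. hartree_const * (?M + e) * (sqn u + e) * (sqn G + e)) \<longlongrightarrow> hartree_const * (?M + 0) * (sqn u + 0) * (sqn G + 0)) (at_right 0)"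
      by (intro tendsto_intros)
    have "(\<integral>k. ?X k \<partial>lborel) \<le> hartree_const * (?M + e) * (sqn u + e) * (sqn G + e)" if e: "0 < e" for e
    proof -
      have "0 \<le> hartree_const * (?M + e) * (sqn u + e) * (sqn G + e)"
        using hartree_const_pos M0 e sqn_nonneg[of u] sqn_nonneg[of G] by (intro mult_nonneg_nonneg add_nonneg_nonneg) auto
      then show ?thesis using est[OF e] nn_integral_eq_integral[OF Xi] by (simp add: ennreal_le_iff)
    qed
    then show "\<forall>\<^sub>F e in at_right 0. (\<integral>k. ?X k \<partial>lborel) \<le> hartree_const * (?M + e) * (sqn u + e) * (sqn G + e)"
      by (auto simp: eventually_at_filter)
  qed simp
  finally show "(\<integral>k. \<bar>W k\<bar> * (norm (?f k))\<^sup>2 \<partial>lebesgue) \<le> hartree_const * ?M * sqn u * sqn G" by simp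
qed


section \<open>Quadratic forms\<close>

lemma ip_cong_AE:
  assumes "f \<in> borel_measurable lebesgue" "f' \<in> borel_measurable lebesgue"
    "g \<in> borel_measurable lebesgue" "g' \<in> borel_measurable lebesgue"
    "AE x in lebesgue. f x = f' x" "AE x in lebesgue. g x = g' x"
  shows "ip f g = ip f' g'"
proof -
  have "AE x in lebesgue. f x \<bullet> g x = f' x \<bullet> g' x"
    using assms(5,6) by eventually_elim simp
  then show ?thesis unfolding ip_def using assms(1-4) by (intro integral_cong_AE borel_measurable_inner)
qed

lemma ip_self: "ip f f = sqn f"
  by (simp add: ip_def sqn_def power2_norm_eq_inner)

lemma of_real_vec_scale: "complex_of_real c *s (G :: complex ^ 3) = c *\<^sub>R G"
  by (simp only: vec_eq_iff vector_smult_component vector_scaleR_component) (simp add: scaleR_conv_of_real)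

lemma wgrad_scaleR: "wgrad u G \<Longrightarrow> wgrad (\<lambda>x. c *\<^sub>R u x) (\<lambda>x. c *\<^sub>R G x)"
  using wgrad_cmult[of u G "complex_of_real c"] by (simp add: of_real_vec_scale scaleR_conv_of_real[of c "_ :: complex"])

lemma H1_measurable:
  "u \<in> H1 \<Longrightarrow> u \<in> L2" "u \<in> H1 \<Longrightarrow> weak_grad u \<in> L2"
  "u \<in> H1 \<Longrightarrow> u \<in> borel_measurable lebesgue" "u \<in> H1 \<Longrightarrow> weak_grad u \<in> borel_measurable lebesgue"
  using wgradD[OF wgrad_weak_grad] L2D by blast+

lemma weak_grad_add_AE: "u \<in> H1 \<Longrightarrow> v \<in> H1 \<Longrightarrow> AE x in lebesgue. weak_grad (\<lambda>x. u x + v x) x = weak_grad u x + weak_grad v x"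
  by (rule wgrad_AE[OF wgrad_add]) (rule wgrad_weak_grad, assumption)+

lemma weak_grad_scaleR_AE: "u \<in> H1 \<Longrightarrow> AE x in lebesgue. weak_grad (\<lambda>x. c *\<^sub>R u x) x = c *\<^sub>R weak_grad u x"
  by (rule wgrad_AE[OF wgrad_scaleR]) (rule wgrad_weak_grad)

lemma H1_add: "u \<in> H1 \<Longrightarrow> v \<in> H1 \<Longrightarrow> (\<lambda>x. u x + v x) \<in> H1"
  by (rule wgrad_H1[OF wgrad_add]) (rule wgrad_weak_grad, assumption)+

lemma H1_cmult: "u \<in> H1 \<Longrightarrow> (\<lambda>x. c * u x) \<in> H1"
  by (rule wgrad_H1[OF wgrad_cmult]) (rule wgrad_weak_grad)

definition qform :: "(R3 \<Rightarrow> real) \<Rightarrow> (R3 \<Rightarrow> complex) \<Rightarrow> real" where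
  "qform V u = sqn (weak_grad u) + (\<integral>x. V x * (norm (u x))\<^sup>2 \<partial>lebesgue)"

text \<open>The real part of \<open>schroedinger_form\<close>, see
  \<open>schroedinger_form_Re\<close>.\<close>

definition bform :: "(R3 \<Rightarrow> real) \<Rightarrow> (R3 \<Rightarrow> complex) \<Rightarrow> (R3 \<Rightarrow> complex) \<Rightarrow> real" where
  "bform V u v = ip (weak_grad u) (weak_grad v) + (\<integral>x. V x * (u x \<bullet> v x) \<partial>lebesgue)"

definition pos_energy :: "(R3 \<Rightarrow> real) \<Rightarrow> (R3 \<Rightarrow> complex) \<Rightarrow> real" where
  "pos_energy V u = (\<integral>x. pos_part V x * (norm (u x))\<^sup>2 \<partial>lebesgue)"

lemma pos_part_nonneg: "0 \<le> pos_part V x"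
  by (simp add: pos_part_def)

text \<open>Hypothesis A allows any real \<open>b\<close>; the nonnegativity assumed here is
  arranged by passing to \<open>max b 0\<close>.\<close>

locale form_bounded_potential =
  fixes V :: "R3 \<Rightarrow> real" and a b :: real
  assumes V_measurable [measurable]: "V \<in> borel_measurable lebesgue"
    and V_form_bounded: "form_bounded V a b"
    and a_nonneg: "0 \<le> a" and a_less: "a < 1" and b_nonneg: "0 \<le> b"
begin

lemma pos_part_measurable [measurable]: "pos_part V \<in> borel_measurable lebesgue"
  unfolding pos_part_def[abs_def] by measurable

lemma V_split: "(\<lambda>x. V x * (norm (u x))\<^sup>2) = (\<lambda>x. pos_part V x * (norm (u x))\<^sup>2 - neg_part V x * (norm (u x))\<^sup>2)"
  by (rule ext) (simp add: pos_part_def neg_part_def max_def)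

lemma abs_V_split: "(\<lambda>x. \<bar>V x\<bar> * (norm (u x))\<^sup>2) = (\<lambda>x. pos_part V x * (norm (u x))\<^sup>2 + neg_part V x * (norm (u x))\<^sup>2)"
  by (rule ext) (simp add: pos_part_def neg_part_def max_def)

lemma domainD:
  assumes "u \<in> form_domain V"
  shows "u \<in> H1" "u \<in> L2" "weak_grad u \<in> L2" "u \<in> borel_measurable lebesgue" "weak_grad u \<in> borel_measurable lebesgue"
    "integrable lebesgue (\<lambda>x. pos_part V x * (norm (u x))\<^sup>2)"
    "integrable lebesgue (\<lambda>x. neg_part V x * (norm (u x))\<^sup>2)"
    "integrable lebesgue (\<lambda>x. V x * (norm (u x))\<^sup>2)"
    "integrable lebesgue (\<lambda>x. \<bar>V x\<bar> * (norm (u x))\<^sup>2)"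
    "wgrad u (weak_grad u)"
proof -
  show 1: "u \<in> H1" and 2: "integrable lebesgue (\<lambda>x. pos_part V x * (norm (u x))\<^sup>2)"
    using assms by (auto simp: form_domain_def)
  show 3: "integrable lebesgue (\<lambda>x. neg_part V x * (norm (u x))\<^sup>2)"
    using V_form_bounded 1 by (auto simp: form_bounded_def)
  show "integrable lebesgue (\<lambda>x. V x * (norm (u x))\<^sup>2)"
    unfolding V_split using 2 3 by (rule Bochner_Integration.integrable_diff)
  show "integrable lebesgue (\<lambda>x. \<bar>V x\<bar> * (norm (u x))\<^sup>2)"
    unfolding abs_V_split using 2 3 by (rule Bochner_Integration.integrable_add)
  show "wgrad u (weak_grad u)" by (rule wgrad_weak_grad[OF 1])
qed (use assms H1_measurable in \<open>auto simp: form_domain_def\<close>)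

lemma qform_coercive:
  assumes "u \<in> form_domain V"
  shows "(1 - a) * sqn (weak_grad u) + pos_energy V u \<le> qform V u + b * sqn u"
proof -
  note d = domainD[OF assms]
  have "(\<integral>x. V x * (norm (u x))\<^sup>2 \<partial>lebesgue) = pos_energy V u - (\<integral>x. neg_part V x * (norm (u x))\<^sup>2 \<partial>lebesgue)"
    unfolding pos_energy_def V_split by (rule Bochner_Integration.integral_diff[OF d(6,7)])
  moreover have "(\<integral>x. neg_part V x * (norm (u x))\<^sup>2 \<partial>lebesgue) \<le> a * sqn (weak_grad u) + b * sqn u"
    using V_form_bounded d(1) unfolding form_bounded_def sqn_def by blast
  ultimately show ?thesis by (simp add: qform_def algebra_simps)
qed

lemma pos_energy_nonneg: "0 \<le> pos_energy V u"
  unfolding pos_energy_def by (rule integral_nonneg_AE) (simp add: pos_part_nonneg)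

lemma qform_ge: "u \<in> form_domain V \<Longrightarrow> - b * sqn u \<le> qform V u"
proof -
  assume u: "u \<in> form_domain V"
  have "0 \<le> (1 - a) * sqn (weak_grad u)" using a_less by simp
  then show ?thesis using qform_coercive[OF u] pos_energy_nonneg[of u] by linarith
qed

lemma form_domain_add:
  assumes "u \<in> form_domain V" "v \<in> form_domain V"
  shows "(\<lambda>x. u x + v x) \<in> form_domain V"
proof -
  note d = domainD[OF assms(1)] and e = domainD[OF assms(2)]
  have "integrable lebesgue (\<lambda>x. pos_part V x * (norm (u x + v x))\<^sup>2)"
  proof (rule Bochner_Integration.integrable_bound)
    show "integrable lebesgue (\<lambda>x. 2 * (pos_part V x * (norm (u x))\<^sup>2) + 2 * (pos_part V x * (norm (v x))\<^sup>2))"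
      using d(6) e(6) by simp
    show "(\<lambda>x. pos_part V x * (norm (u x + v x))\<^sup>2) \<in> borel_measurable lebesgue"
      using d(4) e(4) by measurable
    show "AE x in lebesgue. norm (pos_part V x * (norm (u x + v x))\<^sup>2) \<le> norm (2 * (pos_part V x * (norm (u x))\<^sup>2) + 2 * (pos_part V x * (norm (v x))\<^sup>2))"
    proof (rule AE_I2)
      fix x
      have "pos_part V x * (norm (u x + v x))\<^sup>2 \<le> pos_part V x * (2 * (norm (u x))\<^sup>2 + 2 * (norm (v x))\<^sup>2)"
        by (intro mult_left_mono norm_add_power2_le pos_part_nonneg)
      then show "norm (pos_part V x * (norm (u x + v x))\<^sup>2) \<le> norm (2 * (pos_part V x * (norm (u x))\<^sup>2) + 2 * (pos_part V x * (norm (v x))\<^sup>2))"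
        using pos_part_nonneg[of V x] by (simp add: algebra_simps)
    qed
  qed
  then show ?thesis using H1_add d(1) e(1) by (simp add: form_domain_def)
qed

lemma form_domain_cmult:
  assumes "u \<in> form_domain V" shows "(\<lambda>x. c * u x) \<in> form_domain V"
proof -
  have "(\<lambda>x. pos_part V x * (norm (c * u x))\<^sup>2) = (\<lambda>x. (norm c)\<^sup>2 * (pos_part V x * (norm (u x))\<^sup>2))"
    by (auto simp: norm_mult power_mult_distrib)
  then show ?thesis using domainD[OF assms] H1_cmult by (simp add: form_domain_def)
qed

lemma form_domain_scaleR: "u \<in> form_domain V \<Longrightarrow> (\<lambda>x. c *\<^sub>R u x) \<in> form_domain V"
  using form_domain_cmult[of u "complex_of_real c"] by (simp add: scaleR_conv_of_real)

lemma form_domain_diff: "u \<in> form_domain V \<Longrightarrow> v \<in> form_domain V \<Longrightarrow> (\<lambda>x. u x - v x) \<in> form_domain V"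
  using form_domain_add[OF _ form_domain_scaleR[of v "-1"], of u] by simp

lemma integrable_V_inner:
  assumes "u \<in> form_domain V" "v \<in> form_domain V" and [measurable]: "h \<in> borel_measurable lebesgue"
    and h: "\<And>x. norm (h x) \<le> norm (u x) * norm (v x)"
  shows "integrable lebesgue (\<lambda>x. V x *\<^sub>R (h x :: 'c::euclidean_space))"
proof (rule Bochner_Integration.integrable_bound)
  show "integrable lebesgue (\<lambda>x. \<bar>V x\<bar> * (norm (u x))\<^sup>2 + \<bar>V x\<bar> * (norm (v x))\<^sup>2)"
    using domainD(9)[OF assms(1)] domainD(9)[OF assms(2)] by simp
  show "AE x in lebesgue. norm (V x *\<^sub>R h x) \<le> norm (\<bar>V x\<bar> * (norm (u x))\<^sup>2 + \<bar>V x\<bar> * (norm (v x))\<^sup>2)"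
  proof (rule AE_I2)
    fix x
    have "norm (u x) * norm (v x) \<le> (norm (u x))\<^sup>2 + (norm (v x))\<^sup>2"
      using sum_squares_bound[of "norm (u x)" "norm (v x)"]
        mult_nonneg_nonneg[OF norm_ge_zero[of "u x"] norm_ge_zero[of "v x"]] by linarith
    then have "norm (h x) \<le> (norm (u x))\<^sup>2 + (norm (v x))\<^sup>2" using h[of x] by linarith
    then have "\<bar>V x\<bar> * norm (h x) \<le> \<bar>V x\<bar> * ((norm (u x))\<^sup>2 + (norm (v x))\<^sup>2)" by (intro mult_left_mono) auto
    then show "norm (V x *\<^sub>R h x) \<le> norm (\<bar>V x\<bar> * (norm (u x))\<^sup>2 + \<bar>V x\<bar> * (norm (v x))\<^sup>2)"
      by (simp add: distrib_left)
  qed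
qed measurable

lemma integrable_V_ip:
  "u \<in> form_domain V \<Longrightarrow> v \<in> form_domain V \<Longrightarrow> integrable lebesgue (\<lambda>x. V x * (u x \<bullet> v x))"
  using integrable_V_inner[of u v "\<lambda>x. u x \<bullet> v x"] domainD(4)[of u] domainD(4)[of v]
  by (simp add: Cauchy_Schwarz_ineq2 borel_measurable_inner)

lemma bform_commute: "bform V u v = bform V v u"
  by (simp add: bform_def ip_commute inner_commute)

lemma bform_self: "bform V u u = qform V u"
  by (simp add: bform_def qform_def ip_self power2_norm_eq_inner)

lemma bform_add:
  assumes "u \<in> form_domain V" "v \<in> form_domain V" "w \<in> form_domain V"
  shows "bform V u (\<lambda>x. v x + w x) = bform V u v + bform V u w"
proof -
  note d = domainD[OF assms(1)] domainD[OF assms(2)] domainD[OF assms(3)] domainD[OF form_domain_add[OF assms(2,3)]]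
  have "ip (weak_grad u) (weak_grad (\<lambda>x. v x + w x)) = ip (weak_grad u) (\<lambda>x. weak_grad v x + weak_grad w x)"
    by (rule ip_cong_AE) (use d weak_grad_add_AE in auto)
  moreover have "(\<integral>x. V x * (u x \<bullet> (v x + w x)) \<partial>lebesgue) = (\<integral>x. V x * (u x \<bullet> v x) \<partial>lebesgue) + (\<integral>x. V x * (u x \<bullet> w x) \<partial>lebesgue)"
    using integrable_V_ip[OF assms(1,2)] integrable_V_ip[OF assms(1,3)] by (simp add: inner_add_right distrib_left)
  ultimately show ?thesis using ip_add[of "weak_grad u" "weak_grad v" "weak_grad w"] d by (simp add: bform_def)
qed

lemma bform_scaleR:
  assumes "u \<in> form_domain V" "v \<in> form_domain V"
  shows "bform V u (\<lambda>x. c *\<^sub>R v x) = c * bform V u v"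
proof -
  note d = domainD[OF assms(1)] domainD[OF assms(2)] domainD[OF form_domain_scaleR[OF assms(2), of c]]
  have "ip (weak_grad u) (weak_grad (\<lambda>x. c *\<^sub>R v x)) = ip (weak_grad u) (\<lambda>x. c *\<^sub>R weak_grad v x)"
    by (rule ip_cong_AE) (use d weak_grad_scaleR_AE in auto)
  moreover have "(\<integral>x. V x * (u x \<bullet> (c *\<^sub>R v x)) \<partial>lebesgue) = c * (\<integral>x. V x * (u x \<bullet> v x) \<partial>lebesgue)"
    by (simp add: mult.left_commute)
  ultimately show ?thesis by (simp add: bform_def ip_scaleR distrib_left)
qed

lemma qform_add:
  assumes "u \<in> form_domain V" "v \<in> form_domain V"
  shows "qform V (\<lambda>x. u x + v x) = qform V u + 2 * bform V u v + qform V v"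
proof -
  note s = form_domain_add[OF assms]
  have "qform V (\<lambda>x. u x + v x) = bform V (\<lambda>x. u x + v x) (\<lambda>x. u x + v x)" by (simp add: bform_self)
  also have "\<dots> = bform V (\<lambda>x. u x + v x) u + bform V (\<lambda>x. u x + v x) v" by (rule bform_add[OF s assms])
  also have "\<dots> = bform V u (\<lambda>x. u x + v x) + bform V v (\<lambda>x. u x + v x)" by (simp only: bform_commute)
  also have "\<dots> = bform V u u + bform V u v + (bform V v u + bform V v v)"
    by (simp only: bform_add[OF assms(1) assms] bform_add[OF assms(2) assms])
  finally show ?thesis using bform_commute[of u v] by (simp add: bform_self)
qed

lemma qform_scaleR: "u \<in> form_domain V \<Longrightarrow> qform V (\<lambda>x. c *\<^sub>R u x) = c\<^sup>2 * qform V u"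
  using bform_scaleR[OF form_domain_scaleR[of u c], of u c] bform_scaleR[of u u c] bform_commute[of "\<lambda>x. c *\<^sub>R u x" u]
  by (simp add: bform_self power2_eq_square)

text \<open>The squared Hilbert norm of the form domain, for which it is complete by
  \<open>form_domain_complete\<close>.\<close>

definition fnorm2 :: "(R3 \<Rightarrow> complex) \<Rightarrow> real" where
  "fnorm2 u = sqn u + sqn (weak_grad u) + pos_energy V u"

lemma pos_energy_sqn: "pos_energy V u = sqn (\<lambda>x. complex_of_real (sqrt (pos_part V x)) * u x)"
  by (simp add: pos_energy_def sqn_def norm_mult power_mult_distrib pos_part_nonneg)

lemma sqrt_pos_L2: "u \<in> form_domain V \<Longrightarrow> (\<lambda>x. complex_of_real (sqrt (pos_part V x)) * u x) \<in> L2"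
proof -
  assume u: "u \<in> form_domain V"
  note d = domainD[OF u]
  have "(\<lambda>x. complex_of_real (sqrt (pos_part V x)) * u x) \<in> borel_measurable lebesgue" using d(4) by measurable
  then show ?thesis using d(6) by (simp add: L2_def norm_mult power_mult_distrib pos_part_nonneg)
qed

lemma weak_grad_diff_sqn:
  assumes "u \<in> form_domain V" "v \<in> form_domain V"
  shows "sqn (weak_grad (\<lambda>x. u x - v x)) = sqn (\<lambda>x. weak_grad u x - weak_grad v x)"
  by (rule wgrad_sqn[OF wgrad_diff[OF domainD(10)[OF assms(1)] domainD(10)[OF assms(2)]]])

lemma fnorm2_nonneg: "0 \<le> fnorm2 u"
  unfolding fnorm2_def using pos_energy_nonneg[of u] sqn_nonneg[of u] sqn_nonneg[of "weak_grad u"] by linarith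

text \<open>The functions, their gradients and their products with sqrt(V_+) each converge in
  \<open>L2\<close>. The second limit is the gradient of the first because gradients are closed; the
  third is identified along a subsequence converging almost everywhere.\<close>

theorem form_domain_complete:
  assumes u: "\<And>n. u n \<in> form_domain V"
    and C: "\<And>e. e > 0 \<Longrightarrow> \<exists>N. \<forall>m\<ge>N. \<forall>n\<ge>N. fnorm2 (\<lambda>x. u m x - u n x) \<le> e"
  obtains v where "v \<in> form_domain V" "(\<lambda>n. fnorm2 (\<lambda>x. u n x - v x)) \<longlonglongrightarrow> 0"
proof -
  note d = domainD[OF u]
  let ?p = "\<lambda>n x. complex_of_real (sqrt (pos_part V x)) * u n x"
  have le: "sqn w \<le> fnorm2 w" "sqn (weak_grad w) \<le> fnorm2 w" "pos_energy V w \<le> fnorm2 w" for w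
    unfolding fnorm2_def using pos_energy_nonneg[of w] sqn_nonneg[of w] sqn_nonneg[of "weak_grad w"] by linarith+
  have C': "\<exists>N. \<forall>m\<ge>N. \<forall>n\<ge>N. g m n \<le> e" if g: "\<And>m n. g m n \<le> fnorm2 (\<lambda>x. u m x - u n x)" and e: "e > 0"
    for g :: "nat \<Rightarrow> nat \<Rightarrow> real" and e
  proof -
    obtain N where N: "\<And>m n. m \<ge> N \<Longrightarrow> n \<ge> N \<Longrightarrow> fnorm2 (\<lambda>x. u m x - u n x) \<le> e" using C[OF e] by blast
    have "g m n \<le> e" if "m \<ge> N" "n \<ge> N" for m n using order_trans[OF g N[OF that]] .
    then show ?thesis by blast
  qed
  have C1: "\<exists>N. \<forall>m\<ge>N. \<forall>n\<ge>N. sqn (\<lambda>x. u m x - u n x) \<le> e" if e: "e > 0" for e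
    by (rule C'[OF le(1) e])
  have C2: "\<exists>N. \<forall>m\<ge>N. \<forall>n\<ge>N. sqn (\<lambda>x. weak_grad (u m) x - weak_grad (u n) x) \<le> e" if e: "e > 0" for e
    by (rule C'[OF _ e]) (simp only: weak_grad_diff_sqn[OF u u, symmetric] le(2))
  have peq: "sqn (\<lambda>x. ?p m x - ?p n x) = pos_energy V (\<lambda>x. u m x - u n x)" for m n
    unfolding pos_energy_sqn by (simp add: right_diff_distrib)
  have C3: "\<exists>N. \<forall>m\<ge>N. \<forall>n\<ge>N. sqn (\<lambda>x. ?p m x - ?p n x) \<le> e" if e: "e > 0" for e
    by (rule C'[OF _ e]) (simp only: peq le(3))
  obtain v where v: "v \<in> L2" "(\<lambda>n. sqn (\<lambda>x. u n x - v x)) \<longlonglongrightarrow> 0"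
    using L2_complete[OF d(2) C1] by blast
  obtain G where G: "G \<in> L2" "(\<lambda>n. sqn (\<lambda>x. weak_grad (u n) x - G x)) \<longlonglongrightarrow> 0"
    using L2_complete[OF d(3) C2] by blast
  obtain p where p: "p \<in> L2" "(\<lambda>n. sqn (\<lambda>x. ?p n x - p x)) \<longlonglongrightarrow> 0"
    using L2_complete[OF sqrt_pos_L2[OF u] C3] by blast
  have w: "wgrad v G" by (rule wgrad_limit[OF d(10) v(1) G(1) v(2) G(2)])
  obtain r1 :: "nat \<Rightarrow> nat" where r1: "strict_mono r1" "AE x in lebesgue. (\<lambda>n. u (r1 n) x) \<longlonglongrightarrow> v x"
    using L2_subseq_AE[OF d(2) v] by blast
  have lim2: "(\<lambda>n. sqn (\<lambda>x. ?p (r1 n) x - p x)) \<longlonglongrightarrow> 0"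
    using LIMSEQ_subseq_LIMSEQ[OF p(2) r1(1)] by (simp add: o_def)
  obtain r2 :: "nat \<Rightarrow> nat" where r2: "strict_mono r2" "AE x in lebesgue. (\<lambda>n. ?p (r1 (r2 n)) x) \<longlonglongrightarrow> p x"
    using L2_subseq_AE[OF sqrt_pos_L2[OF u] p(1) lim2] by blast
  have pv: "AE x in lebesgue. p x = complex_of_real (sqrt (pos_part V x)) * v x"
    using r1(2) r2(2)
  proof eventually_elim
    case (elim x)
    have "(\<lambda>n. u (r1 (r2 n)) x) \<longlonglongrightarrow> v x" using LIMSEQ_subseq_LIMSEQ[OF elim(1) r2(1)] by (simp add: o_def)
    then have "(\<lambda>n. ?p (r1 (r2 n)) x) \<longlonglongrightarrow> complex_of_real (sqrt (pos_part V x)) * v x" by (intro tendsto_intros)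
    then show ?case using elim(2) LIMSEQ_unique by blast
  qed
  have vm[measurable]: "v \<in> borel_measurable lebesgue" using L2D(1)[OF v(1)] .
  have m: "(\<lambda>x. complex_of_real (sqrt (pos_part V x)) * v x) \<in> borel_measurable lebesgue" by measurable
  have "(\<lambda>x. complex_of_real (sqrt (pos_part V x)) * v x) \<in> L2" by (rule L2_cong_AE[OF p(1) m pv])
  then have "integrable lebesgue (\<lambda>x. pos_part V x * (norm (v x))\<^sup>2)"
    using L2D(2) by (fastforce simp: norm_mult power_mult_distrib pos_part_nonneg)
  then have vQ: "v \<in> form_domain V" using wgrad_H1[OF w] by (simp add: form_domain_def)
  have gr: "sqn (weak_grad (\<lambda>x. u n x - v x)) = sqn (\<lambda>x. weak_grad (u n) x - G x)" for n
    by (rule wgrad_sqn[OF wgrad_diff[OF d(10) w]])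
  have pe: "pos_energy V (\<lambda>x. u n x - v x) = sqn (\<lambda>x. ?p n x - p x)" for n
  proof -
    have "pos_energy V (\<lambda>x. u n x - v x) = sqn (\<lambda>x. ?p n x - complex_of_real (sqrt (pos_part V x)) * v x)"
      unfolding pos_energy_sqn by (simp add: right_diff_distrib)
    also have "\<dots> = sqn (\<lambda>x. ?p n x - p x)"
      by (rule sqn_cong_AE) (use pv L2D(1)[OF sqrt_pos_L2[OF u]] m L2D(1)[OF p(1)] in auto)
    finally show ?thesis .
  qed
  have "(\<lambda>n. fnorm2 (\<lambda>x. u n x - v x)) \<longlonglongrightarrow> 0 + 0 + 0"
    unfolding fnorm2_def gr pe by (intro tendsto_add v(2) G(2) p(2))
  then show ?thesis using that[OF vQ] by simp
qed

lemma bform_bound_beta: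
  assumes pos: "\<And>u. u \<in> form_domain V \<Longrightarrow> 0 \<le> qform V u + \<beta> * sqn u"
    and "u \<in> form_domain V" "v \<in> form_domain V"
  shows "(bform V u v + \<beta> * ip u v)\<^sup>2 \<le> (qform V u + \<beta> * sqn u) * (qform V v + \<beta> * sqn v)"
proof (rule discriminant_le)
  fix t :: real
  note sv = form_domain_scaleR[OF assms(3), of t]
  have "0 \<le> qform V (\<lambda>x. u x + t *\<^sub>R v x) + \<beta> * sqn (\<lambda>x. u x + t *\<^sub>R v x)"
    by (rule pos[OF form_domain_add[OF assms(2) sv]])
  also have "\<dots> = qform V u + 2 * t * bform V u v + t\<^sup>2 * qform V v + \<beta> * (sqn u + 2 * t * ip u v + t\<^sup>2 * sqn v)"
    using qform_add[OF assms(2) sv] bform_scaleR[OF assms(2,3), of t] qform_scaleR[OF assms(3), of t]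
      sqn_add[OF domainD(2)[OF assms(2)] domainD(2)[OF sv]] by (simp add: ip_scaleR sqn_scaleR)
  finally show "0 \<le> (qform V u + \<beta> * sqn u) + 2 * t * (bform V u v + \<beta> * ip u v) + t\<^sup>2 * (qform V v + \<beta> * sqn v)"
    by (simp add: algebra_simps)
qed (use pos assms in auto)

text \<open>
  Replaces the Lax--Milgram theorem in the construction of the resolvent. The distance of two near
  minimizers is controlled by the parallelogram identity.
\<close>

theorem near_minimizers_converge:
  fixes w :: "R3 \<Rightarrow> complex"
  defines "\<Phi> \<equiv> \<lambda>\<beta> u. qform V u + \<beta> * sqn u - 2 * ip w u"
  assumes c: "0 < c" and co: "\<And>u. u \<in> form_domain V \<Longrightarrow> c * fnorm2 u \<le> qform V u + \<beta> * sqn u"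
    and w: "w \<in> L2" and u: "\<And>n. u n \<in> form_domain V" and e: "e \<longlonglongrightarrow> 0"
    and up: "\<And>n. \<Phi> \<beta> (u n) \<le> d + e n"
    and lo: "\<And>m n. n \<le> m \<Longrightarrow> d - e n \<le> \<Phi> \<beta> (\<lambda>x. (1/2) *\<^sub>R (u m x + u n x))"
  obtains v where "v \<in> form_domain V" "(\<lambda>n. sqn (\<lambda>x. u n x - v x)) \<longlonglongrightarrow> 0" "\<Phi> \<beta> v \<le> d"
proof -
  define q where "q u = qform V u + \<beta> * sqn u" for u
  have q0: "0 \<le> q u" if "u \<in> form_domain V" for u
  proof -
    have "0 \<le> c * fnorm2 u" using c fnorm2_nonneg[of u] by simp
    then show ?thesis using co[OF that] unfolding q_def by linarith
  qed
  note L = domainD(2)[OF u]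
  \<comment> \<open>Parallelogram identity: the form at the difference equals 2 \<Phi>(u_m) + 2
    \<Phi>(u_n) - 4 \<Phi>(midpoint), the linear terms cancelling. The error at the midpoint is that
    of the smaller index \<open>n\<close>, because for minima over decreasing sets the midpoint is
    only known to lie in the set of index \<open>n\<close>.\<close>
  have key: "c * fnorm2 (\<lambda>x. u m x - u n x) \<le> 2 * e m + 6 * e n" if mn: "n \<le> m" for m n
  proof -
    note s = form_domain_add[OF u u, of m n] and df = form_domain_diff[OF u u, of m n]
    have neg: "(\<lambda>x. - u n x) \<in> form_domain V" using form_domain_scaleR[OF u, of "-1" n] by simp
    have bneg: "bform V (u m) (\<lambda>x. - u n x) = - bform V (u m) (u n)" using bform_scaleR[OF u u, of m "-1" n] by simp
    have qneg: "qform V (\<lambda>x. - u n x) = qform V (u n)" using qform_scaleR[OF u, of "-1" n] by simp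
    have qd: "qform V (\<lambda>x. u m x - u n x) = qform V (u m) - 2 * bform V (u m) (u n) + qform V (u n)"
      using qform_add[OF u neg, of m] bneg qneg by simp
    have "q (\<lambda>x. u m x + u n x) + q (\<lambda>x. u m x - u n x) = 2 * q (u m) + 2 * q (u n)"
      unfolding q_def qd qform_add[OF u u] sqn_diff[OF L L] sqn_add[OF L L] by (simp add: algebra_simps)
    moreover have "\<Phi> \<beta> (\<lambda>x. (1/2) *\<^sub>R (u m x + u n x)) = (1/4) * q (\<lambda>x. u m x + u n x) - (ip w (u m) + ip w (u n))"
      unfolding \<Phi>_def q_def qform_scaleR[OF s] sqn_scaleR ip_scaleR ip_add[OF w L L]
      by (simp add: power2_eq_square algebra_simps)
    moreover have "\<Phi> \<beta> (u m) = q (u m) - 2 * ip w (u m)" "\<Phi> \<beta> (u n) = q (u n) - 2 * ip w (u n)"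
      by (auto simp: \<Phi>_def q_def)
    ultimately have "q (\<lambda>x. u m x - u n x) \<le> 2 * e m + 6 * e n"
      using up[of m] up[of n] lo[OF mn] by linarith
    then show ?thesis using co[OF df] unfolding q_def by linarith
  qed
  have C: "\<exists>N. \<forall>m\<ge>N. \<forall>n\<ge>N. fnorm2 (\<lambda>x. u m x - u n x) \<le> \<epsilon>" if \<epsilon>: "\<epsilon> > 0" for \<epsilon>
  proof -
    from LIMSEQ_D[OF e, of "c * \<epsilon> / 8"] c \<epsilon> obtain N where N: "\<And>n. n \<ge> N \<Longrightarrow> \<bar>e n\<bar> < c * \<epsilon> / 8" by auto
    have *: "fnorm2 (\<lambda>x. u m x - u n x) \<le> \<epsilon>" if "m \<ge> N" "n \<ge> N" "n \<le> m" for m n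
    proof -
      have "c * fnorm2 (\<lambda>x. u m x - u n x) \<le> c * \<epsilon>" using key[OF that(3)] N[OF that(1)] N[OF that(2)] by linarith
      then show ?thesis using c by simp
    qed
    have sym: "fnorm2 (\<lambda>x. u m x - u n x) = fnorm2 (\<lambda>x. u n x - u m x)" for m n
    proof -
      have "sqn (weak_grad (\<lambda>x. u m x - u n x)) = sqn (weak_grad (\<lambda>x. u n x - u m x))"
        unfolding weak_grad_diff_sqn[OF u u] by (rule sqn_minus_commute)
      then show ?thesis unfolding fnorm2_def pos_energy_def by (simp add: sqn_minus_commute[of "u m"] norm_minus_commute)
    qed
    have "fnorm2 (\<lambda>x. u m x - u n x) \<le> \<epsilon>" if "m \<ge> N" "n \<ge> N" for m n
      using *[OF that] *[OF that(2,1)] sym[of m n] by (cases "n \<le> m") auto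
    then show ?thesis by blast
  qed
  obtain v where v: "v \<in> form_domain V" "(\<lambda>n. fnorm2 (\<lambda>x. u n x - v x)) \<longlonglongrightarrow> 0"
    using form_domain_complete[OF u C] by blast
  have s0: "(\<lambda>n. sqn (\<lambda>x. u n x - v x)) \<longlonglongrightarrow> 0"
  proof (rule tendsto_sandwich[OF _ _ tendsto_const v(2)])
    show "\<forall>\<^sub>F n in sequentially. sqn (\<lambda>x. u n x - v x) \<le> fnorm2 (\<lambda>x. u n x - v x)"
      unfolding fnorm2_def using pos_energy_nonneg by (intro always_eventually allI) (simp add: add.assoc)
  qed simp
  have qle: "q z \<le> (1 + \<bar>\<beta>\<bar> + b) * fnorm2 z" if z: "z \<in> form_domain V" for z
  proof -
    have "(\<integral>x. V x * (norm (z x))\<^sup>2 \<partial>lebesgue) \<le> pos_energy V z"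
      unfolding pos_energy_def using domainD(6,8)[OF z]
      by (intro integral_mono) (auto intro!: mult_right_mono simp: pos_part_def)
    then have "q z \<le> sqn (weak_grad z) + pos_energy V z + \<beta> * sqn z" unfolding q_def qform_def by linarith
    moreover have "\<beta> * sqn z \<le> \<bar>\<beta>\<bar> * sqn z" by (intro mult_right_mono) auto
    moreover have f: "sqn z \<le> fnorm2 z" "sqn (weak_grad z) + pos_energy V z \<le> fnorm2 z"
      unfolding fnorm2_def using pos_energy_nonneg[of z] sqn_nonneg[of "weak_grad z"] sqn_nonneg[of z] by linarith+
    moreover have "\<bar>\<beta>\<bar> * sqn z \<le> \<bar>\<beta>\<bar> * fnorm2 z" by (intro mult_left_mono f) simp
    moreover have "0 \<le> b * fnorm2 z" using b_nonneg fnorm2_nonneg[of z] by simp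
    moreover have "(1 + \<bar>\<beta>\<bar> + b) * fnorm2 z = fnorm2 z + \<bar>\<beta>\<bar> * fnorm2 z + b * fnorm2 z" by (simp add: algebra_simps)
    ultimately show ?thesis by linarith
  qed
  define t where "t n = fnorm2 (\<lambda>x. u n x - v x)" for n
  have t: "t \<longlonglongrightarrow> 0" using v(2) by (simp add: t_def[abs_def])
  define M where "M = 1 + \<bar>\<beta>\<bar> + b"
  \<comment> \<open>The form is expanded at u_n = v + z. The square of \<open>z\<close> is dropped,
    being nonnegative, and the mixed term is bounded by Cauchy-Schwarz for the form.\<close>
  have bnd: "q v \<le> q (u n) + 2 * sqrt (q v * (M * t n))" for n
  proof -
    let ?z = "\<lambda>x. u n x - v x"
    have z: "?z \<in> form_domain V" by (rule form_domain_diff[OF u v(1)])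
    have eq: "u n = (\<lambda>x. v x + ?z x)" by auto
    define X where "X = bform V v ?z + \<beta> * ip v ?z"
    define Y where "Y = sqrt (q v * (M * t n))"
    have "q (u n) = q v + 2 * X + q ?z"
      using qform_add[OF v(1) z] sqn_add[OF domainD(2)[OF v(1)] domainD(2)[OF z]]
      unfolding q_def X_def by (simp add: algebra_simps)
    moreover have "\<bar>X\<bar> \<le> Y"
      unfolding X_def Y_def
    proof (rule real_le_rsqrt)
      have "(bform V v ?z + \<beta> * ip v ?z)\<^sup>2 \<le> q v * q ?z"
        unfolding q_def by (rule bform_bound_beta[OF _ v(1) z]) (use q0 in \<open>auto simp: q_def\<close>)
      also have "\<dots> \<le> q v * (M * t n)" unfolding t_def M_def by (intro mult_left_mono qle[OF z] q0[OF v(1)])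
      finally show "\<bar>bform V v ?z + \<beta> * ip v ?z\<bar>\<^sup>2 \<le> q v * (M * t n)" by simp
    qed
    ultimately have "q v \<le> q (u n) + 2 * Y" using q0[OF z] by linarith
    then show ?thesis unfolding Y_def .
  qed
  have ipc: "\<bar>ip w (u n) - ip w v\<bar> \<le> L2_norm w * L2_norm (\<lambda>x. u n x - v x)" for n
  proof -
    have dL: "(\<lambda>x. u n x - v x) \<in> L2" by (rule L2_diff[OF L domainD(2)[OF v(1)]])
    have "ip w (u n) = ip w v + ip w (\<lambda>x. u n x - v x)"
      using ip_add[OF w domainD(2)[OF v(1)] dL] by simp
    then show ?thesis using ip_le[OF w dL] by simp
  qed
  have fin: "\<Phi> \<beta> v \<le> d + (e n + 2 * sqrt (q v * (M * t n)) + 2 * (L2_norm w * L2_norm (\<lambda>x. u n x - v x)))" for n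
    using up[of n] bnd[of n] ipc[of n] unfolding \<Phi>_def q_def by linarith
  have "(\<lambda>n. d + (e n + 2 * sqrt (q v * (M * t n)) + 2 * (L2_norm w * L2_norm (\<lambda>x. u n x - v x)))) \<longlonglongrightarrow> d + (0 + 2 * sqrt (q v * (M * 0)) + 2 * (L2_norm w * sqrt 0))"
    unfolding L2_norm_sqrt[of "\<lambda>x. u _ x - v x"] by (intro tendsto_intros e t s0)
  then have "\<Phi> \<beta> v \<le> d + (0 + 2 * sqrt (q v * (M * 0)) + 2 * (L2_norm w * sqrt 0))"
    by (rule LIMSEQ_le_const) (use fin in auto)
  then have "\<Phi> \<beta> v \<le> d" by simp
  with v(1) s0 show ?thesis using that by blast
qed

end


section \<open>The bottom of the spectrum\<close>

context form_bounded_potential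
begin

lemma form_domain_cong_AE:
  assumes u: "u \<in> form_domain V" and [measurable]: "v \<in> borel_measurable lebesgue"
    and ae: "AE x in lebesgue. u x = v x"
  shows "v \<in> form_domain V" "qform V v = qform V u" "sqn v = sqn u"
proof -
  note d = domainD[OF u]
  have [measurable]: "u \<in> borel_measurable lebesgue" by (rule d(4))
  have w: "wgrad v (weak_grad u)" by (rule wgrad_cong_AE[OF d(10) assms(2) d(5) ae]) simp
  have aep: "AE x in lebesgue. pos_part V x * (norm (u x))\<^sup>2 = pos_part V x * (norm (v x))\<^sup>2"
    using ae by eventually_elim simp
  have aeV: "AE x in lebesgue. V x * (norm (v x))\<^sup>2 = V x * (norm (u x))\<^sup>2"
    using ae by eventually_elim simp
  have "integrable lebesgue (\<lambda>x. pos_part V x * (norm (v x))\<^sup>2)"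
    by (rule integrable_cong_AE_imp[OF d(6) _ aep]) measurable
  then show "v \<in> form_domain V" using wgrad_H1[OF w] by (simp add: form_domain_def)
  have "(\<integral>x. V x * (norm (v x))\<^sup>2 \<partial>lebesgue) = (\<integral>x. V x * (norm (u x))\<^sup>2 \<partial>lebesgue)"
    by (rule integral_cong_AE[OF _ _ aeV]) measurable
  then show "qform V v = qform V u" using wgrad_sqn[OF w] by (simp add: qform_def)
  show "sqn v = sqn u" by (rule sqn_cong_AE) (use ae in auto)
qed

text \<open>The assumption controls the L2 part. A change of the shift alters the form by a multiple
  of that part, and coercivity then controls the gradient and the energy of V_+.\<close>

lemma qform_bound_fnorm2:
  assumes g: "0 < \<gamma>" and co: "\<And>u. u \<in> form_domain V \<Longrightarrow> \<gamma> * sqn u \<le> qform V u + \<beta> * sqn u"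
  obtains c where "0 < c" "\<And>u. u \<in> form_domain V \<Longrightarrow> c * fnorm2 u \<le> qform V u + \<beta> * sqn u"
proof -
  define k where "k = 1 - a"
  have k: "0 < k" "k \<le> 1" using a_less a_nonneg by (auto simp: k_def)
  define C where "C = 1 / \<gamma> + (1 + \<bar>b - \<beta>\<bar> / \<gamma>) / k"
  have C: "0 < C" unfolding C_def using g k by (intro add_pos_pos divide_pos_pos add_pos_nonneg) auto
  have "fnorm2 u \<le> C * (qform V u + \<beta> * sqn u)" if u: "u \<in> form_domain V" for u
  proof -
    let ?X = "qform V u + \<beta> * sqn u"
    have s: "sqn u \<le> ?X / \<gamma>" using co[OF u] g by (simp add: pos_le_divide_eq mult.commute)
    have "k * sqn (weak_grad u) + k * pos_energy V u \<le> k * sqn (weak_grad u) + 1 * pos_energy V u"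
      using k pos_energy_nonneg by (intro add_mono mult_right_mono) auto
    also have "\<dots> \<le> ?X + (b - \<beta>) * sqn u" using qform_coercive[OF u] unfolding k_def by (simp add: algebra_simps)
    also have "(b - \<beta>) * sqn u \<le> \<bar>b - \<beta>\<bar> * (?X / \<gamma>)" by (rule mult_mono) (use s in auto)
    finally have "k * (sqn (weak_grad u) + pos_energy V u) \<le> (1 + \<bar>b - \<beta>\<bar> / \<gamma>) * ?X"
      by (simp add: algebra_simps add_divide_distrib)
    then have "sqn (weak_grad u) + pos_energy V u \<le> (1 + \<bar>b - \<beta>\<bar> / \<gamma>) * ?X / k"
      using k by (simp add: pos_le_divide_eq mult.commute)
    then have "fnorm2 u \<le> ?X / \<gamma> + (1 + \<bar>b - \<beta>\<bar> / \<gamma>) * ?X / k" using s unfolding fnorm2_def by linarith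
    also have "\<dots> = C * ?X" by (simp add: C_def distrib_right)
    finally show ?thesis .
  qed
  then have "(1 / C) * fnorm2 u \<le> qform V u + \<beta> * sqn u" if "u \<in> form_domain V" for u
    using that C by (simp add: divide_le_eq mult.commute)
  then show ?thesis using that[of "1 / C"] C by simp
qed

lemma sqn_add_le:
  assumes "f \<in> L2" "g \<in> L2" shows "sqn (\<lambda>x. f x + g x) \<le> 2 * sqn f + 2 * sqn g"
  using sqn_parallelogram[OF assms] sqn_nonneg[of "\<lambda>x. f x - g x"] by linarith

lemma tendsto_sqn:
  assumes "\<And>n. f n \<in> L2" "g \<in> L2" "(\<lambda>n. sqn (\<lambda>x. f n x - g x)) \<longlonglongrightarrow> 0"
  shows "(\<lambda>n. sqn (f n)) \<longlonglongrightarrow> sqn g"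
proof -
  have "(\<lambda>n. L2_norm (f n) - L2_norm g) \<longlonglongrightarrow> 0"
  proof (rule Lim_null_comparison)
    show "(\<lambda>n. L2_norm (\<lambda>x. f n x - g x)) \<longlonglongrightarrow> 0"
      using tendsto_real_sqrt[OF assms(3)] by (simp add: L2_norm_sqrt)
    show "\<forall>\<^sub>F n in sequentially. norm (L2_norm (f n) - L2_norm g) \<le> L2_norm (\<lambda>x. f n x - g x)"
      using L2_norm_rev_triangle[OF assms(1,2)] by (intro always_eventually allI) simp
  qed
  then have "(\<lambda>n. L2_norm (f n)) \<longlonglongrightarrow> L2_norm g" by (rule LIM_zero_cancel)
  then have "(\<lambda>n. (L2_norm (f n))\<^sup>2) \<longlonglongrightarrow> (L2_norm g)\<^sup>2" by (rule tendsto_power)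
  then show ?thesis by (simp add: L2_norm_power2)
qed

text \<open>The shifted form is minimized over decreasing L2 balls \<open>K j\<close> around
  \<open>v\<close>. The minimal values increase with \<open>j\<close> and stay below
  \<open>D\<close>, because the sequence eventually enters each ball. Near minimizers over the balls
  are therefore Cauchy in the form norm; their limit in L2 is \<open>v\<close>, and the form there
  is at most the limit of the minimal values.\<close>

theorem qform_lower_semicontinuous:
  assumes u: "\<And>n. u n \<in> form_domain V" and v: "v \<in> L2" and lim: "(\<lambda>n. sqn (\<lambda>x. u n x - v x)) \<longlonglongrightarrow> 0"
    and up: "\<And>n. qform V (u n) \<le> B + e n" and e: "e \<longlonglongrightarrow> 0"
  shows "v \<in> form_domain V" "qform V v \<le> B"
proof -
  \<comment> \<open>With this shift the form dominates \<open>sqn\<close>.\<close>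
  define \<beta> where "\<beta> = b + 1"
  define q where "q w = qform V w + \<beta> * sqn w" for w
  have co: "1 * sqn w \<le> qform V w + \<beta> * sqn w" if "w \<in> form_domain V" for w
    using qform_ge[OF that] by (simp add: \<beta>_def algebra_simps)
  obtain c where c: "0 < c" "\<And>w. w \<in> form_domain V \<Longrightarrow> c * fnorm2 w \<le> qform V w + \<beta> * sqn w"
    using qform_bound_fnorm2[OF zero_less_one co] by blast
  have q0: "0 \<le> q w" if "w \<in> form_domain V" for w
    using co[OF that] sqn_nonneg[of w] unfolding q_def by linarith
  define K where "K j = {w \<in> form_domain V. sqn (\<lambda>x. w x - v x) \<le> 1 / real (Suc j)}" for j :: nat
  have Kev: "\<forall>\<^sub>F n in sequentially. u n \<in> K j" for j
  proof -
    have "0 < 1 / real (Suc j)" by simp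
    from order_tendstoD(2)[OF lim this] show ?thesis
      by eventually_elim (use u in \<open>auto simp: K_def\<close>)
  qed
  have Kne: "K j \<noteq> {}" for j using eventually_happens[OF Kev[of j]] by auto
  have Kmono: "K m \<subseteq> K n" if "n \<le> m" for m n
    using that frac_le[of 1 1 "real (Suc n)" "real (Suc m)"] by (auto simp: K_def intro: order_trans)
  define dd where "dd j = Inf (q ` K j)" for j
  have bdd: "bdd_below (q ` K j)" for j by (rule bdd_belowI[of _ 0]) (auto simp: K_def q0)
  have dd_le: "dd j \<le> q w" if "w \<in> K j" for j w
    unfolding dd_def by (rule cInf_lower[OF _ bdd]) (use that in auto)
  define D where "D = B + \<beta> * sqn v"
  have dD: "dd j \<le> D" for j
  proof (rule tendsto_lowerbound)
    have "(\<lambda>n. B + e n + \<beta> * sqn (u n)) \<longlonglongrightarrow> B + 0 + \<beta> * sqn v"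
      by (intro tendsto_add tendsto_mult tendsto_const e tendsto_sqn[OF domainD(2)[OF u] v lim])
    then show "(\<lambda>n. B + e n + \<beta> * sqn (u n)) \<longlonglongrightarrow> D" by (simp add: D_def)
    show "\<forall>\<^sub>F n in sequentially. dd j \<le> B + e n + \<beta> * sqn (u n)"
      using Kev[of j]
    proof eventually_elim
      case (elim n)
      show ?case using dd_le[OF elim] up[of n] unfolding q_def by linarith
    qed
  qed simp
  have inc: "incseq dd"
    unfolding incseq_def
  proof (intro allI impI)
    fix n m :: nat assume "n \<le> m"
    show "dd n \<le> dd m" unfolding dd_def using Kmono[OF \<open>n \<le> m\<close>] Kne[of m] bdd[of n]
      by (intro cInf_superset_mono) auto
  qed
  obtain d where d: "dd \<longlonglongrightarrow> d" "\<And>j. dd j \<le> d" using incseq_convergent[OF inc, of D] dD by blast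
  have d_le: "d \<le> D" by (rule LIMSEQ_le_const2[OF d(1)]) (use dD in auto)
  have "\<exists>w\<in>K j. q w \<le> dd j + 1 / real (Suc j)" for j
  proof -
    have "Inf (q ` K j) < dd j + 1 / real (Suc j)" by (simp add: dd_def)
    moreover have "q ` K j \<noteq> {}" using Kne by simp
    ultimately obtain y where "y \<in> q ` K j" "y < dd j + 1 / real (Suc j)"
      using cInf_lessD by meson
    then show ?thesis by (auto intro!: bexI less_imp_le)
  qed
  then obtain w where w: "\<And>j. w j \<in> K j" "\<And>j. q (w j) \<le> dd j + 1 / real (Suc j)" by metis
  have wQ: "w j \<in> form_domain V" for j using w(1)[of j] by (simp add: K_def)
  \<comment> \<open>Two errors: the distance of the minimal value over \<open>K j\<close> from its
    limit, and the slack in the choice of \<open>w j\<close>.\<close>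
  define ee where "ee j = (d - dd j) + 1 / real (Suc j)" for j
  have ee: "ee \<longlonglongrightarrow> 0"
  proof -
    have "(\<lambda>j. (d - dd j) + 1 / real (Suc j)) \<longlonglongrightarrow> (d - d) + 0"
      by (intro tendsto_intros d(1)) (use LIMSEQ_Suc[OF lim_1_over_n] in simp)
    then show ?thesis by (simp add: ee_def[abs_def])
  qed
  have ip0: "ip (\<lambda>x. 0) z = 0" for z :: "R3 \<Rightarrow> complex" by (simp add: ip_def)
  obtain v' where v': "v' \<in> form_domain V" "(\<lambda>n. sqn (\<lambda>x. w n x - v' x)) \<longlonglongrightarrow> 0"
    "qform V v' + \<beta> * sqn v' - 2 * ip (\<lambda>x. 0) v' \<le> d"
  proof (rule near_minimizers_converge[OF c L2_zero wQ ee])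
    show "qform V (w n) + \<beta> * sqn (w n) - 2 * ip (\<lambda>x. 0) (w n) \<le> d + ee n" for n
      using w(2)[of n] d(2)[of n] unfolding ip0 q_def ee_def by linarith
    fix m n :: nat assume mn: "n \<le> m"
    let ?z = "\<lambda>x. (1/2) *\<^sub>R (w m x + w n x)"
    have zQ: "?z \<in> form_domain V" by (intro form_domain_scaleR form_domain_add wQ)
    have f: "(\<lambda>x. (1/2) *\<^sub>R (w k x - v x)) \<in> L2" for k
      by (intro L2_scaleR L2_diff domainD(2) wQ v)
    \<comment> \<open>The balls are convex and decreasing, so the midpoint of \<open>w m\<close> and
      \<open>w n\<close> lies in \<open>K n\<close>.\<close>
    have "sqn (\<lambda>x. ?z x - v x) = sqn (\<lambda>x. (1/2) *\<^sub>R (w m x - v x) + (1/2) *\<^sub>R (w n x - v x))"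
      by (rule arg_cong[of _ _ sqn], rule ext) (simp add: scaleR_diff_right scaleR_add_right field_simps scaleR_conv_of_real)
    also have "\<dots> \<le> 2 * sqn (\<lambda>x. (1/2) *\<^sub>R (w m x - v x)) + 2 * sqn (\<lambda>x. (1/2) *\<^sub>R (w n x - v x))"
      by (rule sqn_add_le[OF f f])
    also have "\<dots> = (sqn (\<lambda>x. w m x - v x) + sqn (\<lambda>x. w n x - v x)) / 2"
      unfolding sqn_scaleR by (simp add: power2_eq_square)
    also have "\<dots> \<le> 1 / real (Suc n)"
    proof -
      have "w m \<in> K n" using w(1)[of m] Kmono[OF mn] by blast
      then have "sqn (\<lambda>x. w m x - v x) \<le> 1 / real (Suc n)" by (simp add: K_def)
      moreover have "sqn (\<lambda>x. w n x - v x) \<le> 1 / real (Suc n)" using w(1)[of n] by (simp add: K_def)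
      moreover have "(x + y) / 2 \<le> c" if "x \<le> c" "y \<le> c" for x y c :: real using that by simp
      ultimately show ?thesis by blast
    qed
    finally have "?z \<in> K n" using zQ by (simp add: K_def)
    then have "dd n \<le> q ?z" by (rule dd_le)
    moreover have "0 \<le> 1 / real (Suc n)" by simp
    ultimately show "d - ee n \<le> qform V ?z + \<beta> * sqn ?z - 2 * ip (\<lambda>x. 0) ?z"
      unfolding ip0 q_def ee_def by linarith
  qed
  have wv: "(\<lambda>n. sqn (\<lambda>x. w n x - v x)) \<longlonglongrightarrow> 0"
  proof (rule tendsto_sandwich[OF _ _ tendsto_const])
    show "(\<lambda>n. 1 / real (Suc n)) \<longlonglongrightarrow> 0" using LIMSEQ_Suc[OF lim_1_over_n] by simp
    show "\<forall>\<^sub>F n in sequentially. sqn (\<lambda>x. w n x - v x) \<le> 1 / real (Suc n)"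
      using w(1) by (intro always_eventually allI) (auto simp: K_def)
  qed simp
  have L: "(\<lambda>x. v' x - v x) \<in> L2" by (rule L2_diff[OF domainD(2)[OF v'(1)] v])
  have "sqn (\<lambda>x. v' x - v x) \<le> 2 * sqn (\<lambda>x. w n x - v' x) + 2 * sqn (\<lambda>x. w n x - v x)" for n
  proof -
    have "sqn (\<lambda>x. (v' x - w n x) + (w n x - v x)) \<le> 2 * sqn (\<lambda>x. v' x - w n x) + 2 * sqn (\<lambda>x. w n x - v x)"
      by (intro sqn_add_le L2_diff domainD(2) wQ v v'(1))
    then show ?thesis by (simp add: sqn_minus_commute[of v'])
  qed
  moreover have "(\<lambda>n. 2 * sqn (\<lambda>x. w n x - v' x) + 2 * sqn (\<lambda>x. w n x - v x)) \<longlonglongrightarrow> 2 * 0 + 2 * 0"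
    by (intro tendsto_intros v'(2) wv)
  ultimately have "sqn (\<lambda>x. v' x - v x) \<le> 2 * 0 + 2 * 0"
    by (intro LIMSEQ_le_const) auto
  then have "sqn (\<lambda>x. v' x - v x) = 0" using sqn_nonneg[of "\<lambda>x. v' x - v x"] by linarith
  then have ae: "AE x in lebesgue. v' x = v x" using sqn_zero_AE[OF L] by simp
  note cg = form_domain_cong_AE[OF v'(1) L2D(1)[OF v] ae]
  show "v \<in> form_domain V" by (rule cg)
  show "qform V v \<le> B" using v'(3) d_le cg(2,3) unfolding ip0 D_def by simp
qed

section \<open>The operator and the bottom of its spectrum\<close>

lemma schroedinger_form_Re:
  assumes "u \<in> form_domain V" "v \<in> form_domain V"
  shows "Re (schroedinger_form V u v) = bform V u v"
    and "schroedinger_form V u (\<lambda>x. \<i> * v x) = - \<i> * schroedinger_form V u v"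
proof -
  note d = domainD[OF assms(1)] and e = domainD[OF assms(2)]
  have [measurable]: "u \<in> borel_measurable lebesgue" "v \<in> borel_measurable lebesgue" by (fact d(4) e(4))+
  have i1: "integrable lebesgue (\<lambda>x. \<Sum>i\<in>UNIV. weak_grad u x $ i * cnj (weak_grad v x $ i))"
    by (intro Bochner_Integration.integrable_sum L2_integrable_mult L2_cnj L2_vec_nth d(3) e(3))
  have cm: "(\<lambda>x. u x * cnj (v x)) \<in> borel_measurable lebesgue"
    by (intro borel_measurable_times d(4) L2D(1)[OF L2_cnj[OF e(2)]])
  have "integrable lebesgue (\<lambda>x. V x *\<^sub>R (u x * cnj (v x)))"
    by (rule integrable_V_inner[OF assms cm]) (simp add: norm_mult)
  then have i2: "integrable lebesgue (\<lambda>x. complex_of_real (V x) * u x * cnj (v x))"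
    by (simp add: scaleR_conv_of_real mult.assoc)
  have "Re (\<Sum>i\<in>UNIV. weak_grad u x $ i * cnj (weak_grad v x $ i)) = weak_grad u x \<bullet> weak_grad v x" for x
    by (simp add: inner_vec_def inner_complex_def)
  then have "Re (\<integral>x. (\<Sum>i\<in>UNIV. weak_grad u x $ i * cnj (weak_grad v x $ i)) \<partial>lebesgue) = ip (weak_grad u) (weak_grad v)"
    using integral_Re[OF i1] by (simp add: ip_def)
  moreover have "Re (\<integral>x. complex_of_real (V x) * u x * cnj (v x) \<partial>lebesgue) = (\<integral>x. V x * (u x \<bullet> v x) \<partial>lebesgue)"
    using integral_Re[OF i2] by (simp add: inner_complex_def mult.assoc distrib_left)
  ultimately show "Re (schroedinger_form V u v) = bform V u v" by (simp add: schroedinger_form_def bform_def)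
  have ae: "AE x in lebesgue. weak_grad (\<lambda>x. \<i> * v x) x = \<i> *s weak_grad v x"
    by (rule wgrad_AE[OF wgrad_cmult[OF e(10)]])
  have "(\<integral>x. (\<Sum>i\<in>UNIV. weak_grad u x $ i * cnj (weak_grad (\<lambda>x. \<i> * v x) x $ i)) \<partial>lebesgue)
     = (\<integral>x. - \<i> * (\<Sum>i\<in>UNIV. weak_grad u x $ i * cnj (weak_grad v x $ i)) \<partial>lebesgue)"
  proof (rule integral_cong_AE)
    have "integrable lebesgue (\<lambda>x. \<Sum>i\<in>UNIV. weak_grad u x $ i * cnj (weak_grad (\<lambda>x. \<i> * v x) x $ i))"
      by (intro Bochner_Integration.integrable_sum L2_integrable_mult L2_cnj L2_vec_nth d(3) domainD(3) form_domain_cmult assms)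
    then show "(\<lambda>x. \<Sum>i\<in>UNIV. weak_grad u x $ i * cnj (weak_grad (\<lambda>x. \<i> * v x) x $ i)) \<in> borel_measurable lebesgue"
      by (rule borel_measurable_integrable)
    show "(\<lambda>x. - \<i> * (\<Sum>i\<in>UNIV. weak_grad u x $ i * cnj (weak_grad v x $ i))) \<in> borel_measurable lebesgue"
      by (intro borel_measurable_times borel_measurable_const borel_measurable_integrable[OF i1])
    show "AE x in lebesgue. (\<Sum>i\<in>UNIV. weak_grad u x $ i * cnj (weak_grad (\<lambda>x. \<i> * v x) x $ i)) = - \<i> * (\<Sum>i\<in>UNIV. weak_grad u x $ i * cnj (weak_grad v x $ i))"
      using ae by eventually_elim (simp add: sum_distrib_left mult_ac)
  qed
  also have "\<dots> = - \<i> * (\<integral>x. (\<Sum>i\<in>UNIV. weak_grad u x $ i * cnj (weak_grad v x $ i)) \<partial>lebesgue)"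
    by (rule integral_mult_right_zero)
  finally have 1: "(\<integral>x. (\<Sum>i\<in>UNIV. weak_grad u x $ i * cnj (weak_grad (\<lambda>x. \<i> * v x) x $ i)) \<partial>lebesgue)
    = - \<i> * (\<integral>x. (\<Sum>i\<in>UNIV. weak_grad u x $ i * cnj (weak_grad v x $ i)) \<partial>lebesgue)" .
  have "(\<integral>x. complex_of_real (V x) * u x * cnj (\<i> * v x) \<partial>lebesgue) = (\<integral>x. - \<i> * (complex_of_real (V x) * u x * cnj (v x)) \<partial>lebesgue)"
    by (rule Bochner_Integration.integral_cong) auto
  also have "\<dots> = - \<i> * (\<integral>x. complex_of_real (V x) * u x * cnj (v x) \<partial>lebesgue)"
    by (rule integral_mult_right_zero)
  finally show "schroedinger_form V u (\<lambda>x. \<i> * v x) = - \<i> * schroedinger_form V u v"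
    using 1 by (simp add: schroedinger_form_def distrib_left)
qed

text \<open>The form domain is a complex vector space: testing the real identity with
  \<open>\<i> * v\<close> as well as with \<open>v\<close> yields the imaginary part.\<close>

lemma schroedinger_op_iff:
  "schroedinger_op V u h \<longleftrightarrow> u \<in> form_domain V \<and> h \<in> L2 \<and> (\<forall>v\<in>form_domain V. bform V u v = ip h v)"
proof -
  have eq: "(\<forall>v\<in>form_domain V. schroedinger_form V u v = (\<integral>x. h x * cnj (v x) \<partial>lebesgue)) \<longleftrightarrow> (\<forall>v\<in>form_domain V. bform V u v = ip h v)"
    if u: "u \<in> form_domain V" and h: "h \<in> L2"
  proof -
    have Re: "Re (\<integral>x. h x * cnj (v x) \<partial>lebesgue) = ip h v" if v: "v \<in> form_domain V" for v
      using integral_Re[OF L2_integrable_mult[OF h L2_cnj[OF domainD(2)[OF v]]]]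
      by (simp add: ip_def inner_complex_def)
    have im: "(\<integral>x. h x * cnj (\<i> * v x) \<partial>lebesgue) = - \<i> * (\<integral>x. h x * cnj (v x) \<partial>lebesgue)" for v
    proof -
      have "(\<integral>x. h x * cnj (\<i> * v x) \<partial>lebesgue) = (\<integral>x. - \<i> * (h x * cnj (v x)) \<partial>lebesgue)"
        by (rule Bochner_Integration.integral_cong) auto
      then show ?thesis by (simp only: integral_mult_right_zero)
    qed
    show ?thesis
    proof
      assume *: "\<forall>v\<in>form_domain V. schroedinger_form V u v = (\<integral>x. h x * cnj (v x) \<partial>lebesgue)"
      then show "\<forall>v\<in>form_domain V. bform V u v = ip h v"
        using schroedinger_form_Re(1)[OF u] Re by metis
    next
      assume *: "\<forall>v\<in>form_domain V. bform V u v = ip h v"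
      show "\<forall>v\<in>form_domain V. schroedinger_form V u v = (\<integral>x. h x * cnj (v x) \<partial>lebesgue)"
      proof
        fix v assume v: "v \<in> form_domain V"
        note iv = form_domain_cmult[OF v, of \<i>]
        have "Re (schroedinger_form V u v) = Re (\<integral>x. h x * cnj (v x) \<partial>lebesgue)"
          using * v schroedinger_form_Re(1)[OF u v] Re[OF v] by simp
        moreover have "Re (- \<i> * schroedinger_form V u v) = Re (- \<i> * (\<integral>x. h x * cnj (v x) \<partial>lebesgue))"
          using * iv schroedinger_form_Re(1)[OF u iv] Re[OF iv] unfolding schroedinger_form_Re(2)[OF u v] im by simp
        ultimately show "schroedinger_form V u v = (\<integral>x. h x * cnj (v x) \<partial>lebesgue)"
          by (simp add: complex_eq_iff)
      qed
    qed
  qed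
  then show ?thesis unfolding schroedinger_op_def by blast
qed

end

text \<open>Guarantees normalized vectors in the form domain, so that \<open>ground_energy\<close>
  is an infimum over a nonempty set.\<close>

locale nontrivial_potential = form_bounded_potential +
  assumes nontrivial: "\<exists>u\<in>form_domain V. 0 < sqn u"
begin

definition ground_energy :: real where
  "ground_energy = Inf (qform V ` {u \<in> form_domain V. sqn u = 1})"

lemma normalized:
  assumes "u \<in> form_domain V" "0 < sqn u"
  shows "(\<lambda>x. (1 / sqrt (sqn u)) *\<^sub>R u x) \<in> form_domain V" "sqn (\<lambda>x. (1 / sqrt (sqn u)) *\<^sub>R u x) = 1"
    "qform V (\<lambda>x. (1 / sqrt (sqn u)) *\<^sub>R u x) = qform V u / sqn u"
  using assms by (auto intro: form_domain_scaleR simp: sqn_scaleR qform_scaleR power_divide)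

lemma sphere_nonempty: "{u \<in> form_domain V. sqn u = 1} \<noteq> {}"
  using nontrivial normalized by blast

lemma sphere_bdd_below: "bdd_below (qform V ` {u \<in> form_domain V. sqn u = 1})"
  by (rule bdd_belowI[of _ "- b"]) (use qform_ge in fastforce)

lemma ground_energy_le:
  assumes "u \<in> form_domain V" shows "ground_energy * sqn u \<le> qform V u"
proof (cases "sqn u = 0")
  case True
  then show ?thesis using qform_ge[OF assms] by simp
next
  case False
  then have s: "0 < sqn u" using sqn_nonneg[of u] by linarith
  have "ground_energy \<le> qform V u / sqn u"
    unfolding ground_energy_def using normalized[OF assms s]
    by (intro cInf_lower sphere_bdd_below) (metis (mono_tags, lifting) imageI mem_Collect_eq)
  then show ?thesis using s by (simp add: pos_le_divide_eq)
qed

lemma ground_energy_approx: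
  assumes "0 < e" obtains u where "u \<in> form_domain V" "sqn u = 1" "qform V u < ground_energy + e"
proof -
  have "Inf (qform V ` {u \<in> form_domain V. sqn u = 1}) < ground_energy + e"
    using assms by (simp add: ground_energy_def)
  then obtain y where "y \<in> qform V ` {u \<in> form_domain V. sqn u = 1}" "y < ground_energy + e"
    using cInf_lessD[of "qform V ` {u \<in> form_domain V. sqn u = 1}"] sphere_nonempty by blast
  then show ?thesis using that by blast
qed

lemma ground_energy_ge: "- b \<le> ground_energy"
  unfolding ground_energy_def using sphere_nonempty qform_ge by (intro cInf_greatest) fastforce+

lemma L2_shift: "w \<in> L2 \<Longrightarrow> u \<in> L2 \<Longrightarrow> (\<lambda>x. w x + complex_of_real s * u x) \<in> L2"
  by (intro L2_add L2_cmult)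

lemma ip_shift: "w \<in> L2 \<Longrightarrow> u \<in> L2 \<Longrightarrow> v \<in> L2 \<Longrightarrow> ip (\<lambda>x. w x + complex_of_real s * u x) v = ip w v + s * ip u v"
proof -
  assume "w \<in> L2" "u \<in> L2" "v \<in> L2"
  then have "ip v (\<lambda>x. w x + s *\<^sub>R u x) = ip v w + s * ip v u"
    using ip_add[of v w "\<lambda>x. s *\<^sub>R u x"] L2_scaleR[of u s] by (simp add: ip_scaleR)
  then show ?thesis by (simp add: scaleR_conv_of_real ip_commute[of _ v])
qed

text \<open>A solution of (H - s) u = w is a minimizer of q(u) - s |u|^2 - 2 <w, u>, whose quadratic
  part is coercive for \<open>s\<close> below the ground energy. The bound for the resolvent follows
  by testing the equation with \<open>u\<close> itself.\<close>

lemma below_ground_energy_resolvent: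
  assumes s: "s < ground_energy"
  shows "complex_of_real s \<in> resolvent_set V"
proof -
  define \<gamma> where "\<gamma> = ground_energy - s"
  have g: "0 < \<gamma>" using s by (simp add: \<gamma>_def)
  have co: "\<gamma> * sqn u \<le> qform V u + (- s) * sqn u" if "u \<in> form_domain V" for u
    using ground_energy_le[OF that] by (simp add: \<gamma>_def algebra_simps)
  obtain c where c: "0 < c" "\<And>u. u \<in> form_domain V \<Longrightarrow> c * fnorm2 u \<le> qform V u + (- s) * sqn u"
    using qform_bound_fnorm2[OF g co] by blast
  have "(\<exists>u. schroedinger_op V u (\<lambda>x. w x + complex_of_real s * u x)) \<and>
     (\<forall>u. schroedinger_op V u (\<lambda>x. w x + complex_of_real s * u x) \<longrightarrow> L2_norm u \<le> (1 / \<gamma>) * L2_norm w)"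
    if w: "w \<in> L2" for w
  proof (intro conjI allI impI)
    define \<Phi> where "\<Phi> u = qform V u + (- s) * sqn u - 2 * ip w u" for u
    \<comment> \<open>Completing the square in the norm of \<open>u\<close>.\<close>
    have lower: "- ((L2_norm w)\<^sup>2 / \<gamma>) \<le> \<Phi> u" if u: "u \<in> form_domain V" for u
    proof -
      have "\<Phi> u \<ge> \<gamma> * sqn u - 2 * (L2_norm w * L2_norm u)"
        using co[OF u] ip_le[OF w domainD(2)[OF u]] unfolding \<Phi>_def by linarith
      moreover have "0 \<le> (\<gamma> * L2_norm u - L2_norm w)\<^sup>2 / \<gamma>" using g by simp
      moreover have "(\<gamma> * L2_norm u - L2_norm w)\<^sup>2 / \<gamma> = \<gamma> * (L2_norm u)\<^sup>2 - 2 * (L2_norm w * L2_norm u) + (L2_norm w)\<^sup>2 / \<gamma>"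
        using g by (simp add: power2_diff field_simps power2_eq_square)
      ultimately show ?thesis unfolding L2_norm_power2[of u] by linarith
    qed
    define d where "d = Inf (\<Phi> ` form_domain V)"
    have bdd: "bdd_below (\<Phi> ` form_domain V)" by (rule bdd_belowI2[OF lower])
    have d_le: "d \<le> \<Phi> u" if "u \<in> form_domain V" for u
      unfolding d_def by (rule cInf_lower[OF imageI[OF that] bdd])
    have ne: "\<Phi> ` form_domain V \<noteq> {}" using nontrivial by blast
    have "\<exists>u\<in>form_domain V. \<Phi> u \<le> d + 1 / real (Suc n)" for n
    proof -
      have "Inf (\<Phi> ` form_domain V) < d + 1 / real (Suc n)" by (simp add: d_def)
      then obtain y where "y \<in> \<Phi> ` form_domain V" "y < d + 1 / real (Suc n)" using cInf_lessD[OF ne] by blast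
      then show ?thesis by (auto intro: less_imp_le)
    qed
    then obtain u where u: "\<And>n. u n \<in> form_domain V" "\<And>n. \<Phi> (u n) \<le> d + 1 / real (Suc n)" by metis
    have e: "(\<lambda>n. 1 / real (Suc n)) \<longlonglongrightarrow> 0" using LIMSEQ_Suc[OF lim_1_over_n] by simp
    obtain v where v: "v \<in> form_domain V" "\<Phi> v \<le> d"
    proof (rule near_minimizers_converge[OF c w u(1) e])
      show "qform V (u n) + (- s) * sqn (u n) - 2 * ip w (u n) \<le> d + 1 / real (Suc n)" for n
        using u(2)[of n] by (simp only: \<Phi>_def)
      fix m n :: nat
      have "d \<le> \<Phi> (\<lambda>x. (1/2) *\<^sub>R (u m x + u n x))"
        by (intro d_le form_domain_scaleR form_domain_add u(1))
      moreover have "0 \<le> 1 / real (Suc n)" by simp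
      ultimately show "d - 1 / real (Suc n) \<le> qform V (\<lambda>x. (1/2) *\<^sub>R (u m x + u n x)) + (- s) * sqn (\<lambda>x. (1/2) *\<^sub>R (u m x + u n x)) - 2 * ip w (\<lambda>x. (1/2) *\<^sub>R (u m x + u n x))"
        unfolding \<Phi>_def by linarith
    next
      fix z assume "z \<in> form_domain V" "qform V z + (- s) * sqn z - 2 * ip w z \<le> d"
      then show thesis using that unfolding \<Phi>_def by blast
    qed
    have "bform V v \<phi> = ip (\<lambda>x. w x + complex_of_real s * v x) \<phi>" if \<phi>: "\<phi> \<in> form_domain V" for \<phi>
    proof -
      define x where "x = bform V v \<phi> - s * ip v \<phi> - ip w \<phi>"
      define y where "y = qform V \<phi> - s * sqn \<phi>"
      \<comment> \<open>First variation: comparison with v + t \<phi> leaves a nonnegative quadratic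
        polynomial in \<open>t\<close> without constant term, so its linear coefficient is
        0.\<close>
      have "0 \<le> 0 + 2 * t * x + t\<^sup>2 * y" for t
      proof -
        note t\<phi> = form_domain_scaleR[OF \<phi>, of t]
        have "\<Phi> v \<le> \<Phi> (\<lambda>x. v x + t *\<^sub>R \<phi> x)"
          using v(2) d_le[OF form_domain_add[OF v(1) t\<phi>]] by linarith
        also have "\<dots> = \<Phi> v + 2 * t * x + t\<^sup>2 * y"
          unfolding \<Phi>_def x_def y_def qform_add[OF v(1) t\<phi>] bform_scaleR[OF v(1) \<phi>] qform_scaleR[OF \<phi>]
            sqn_add[OF domainD(2)[OF v(1)] domainD(2)[OF t\<phi>]] ip_add[OF w domainD(2)[OF v(1)] domainD(2)[OF t\<phi>]]
            ip_scaleR sqn_scaleR by (simp add: algebra_simps)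
        finally show ?thesis by simp
      qed
      moreover have "0 \<le> \<gamma> * sqn \<phi>" using g by simp
      then have "0 \<le> y" using co[OF \<phi>] unfolding y_def by linarith
      ultimately have "x\<^sup>2 \<le> 0 * y" by (intro discriminant_le) auto
      then have "x = 0" by simp
      then show ?thesis unfolding ip_shift[OF w domainD(2)[OF v(1)] domainD(2)[OF \<phi>]] x_def by simp
    qed
    then show "\<exists>u. schroedinger_op V u (\<lambda>x. w x + complex_of_real s * u x)"
      unfolding schroedinger_op_iff using v(1) L2_shift[OF w domainD(2)[OF v(1)]] by blast
  next
    fix u assume "schroedinger_op V u (\<lambda>x. w x + complex_of_real s * u x)"
    then have u: "u \<in> form_domain V" and eq: "bform V u u = ip (\<lambda>x. w x + complex_of_real s * u x) u"
      unfolding schroedinger_op_iff by blast+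
    note uL = domainD(2)[OF u]
    have "qform V u = ip w u + s * sqn u"
      using eq unfolding ip_shift[OF w uL uL] bform_self ip_self .
    then have "\<gamma> * (L2_norm u)\<^sup>2 \<le> L2_norm w * L2_norm u"
      using co[OF u] ip_le[OF w uL] unfolding L2_norm_power2 by linarith
    then have "L2_norm u = 0 \<or> \<gamma> * L2_norm u \<le> L2_norm w"
      using L2_norm_nonneg[of u] mult_right_le_imp_le[of "\<gamma> * L2_norm u" "L2_norm u" "L2_norm w"]
      by (cases "L2_norm u = 0") (auto simp: power2_eq_square mult.assoc[symmetric])
    then show "L2_norm u \<le> (1 / \<gamma>) * L2_norm w"
      using g by (auto simp: pos_le_divide_eq mult.commute)
  qed
  then show ?thesis unfolding resolvent_set_def by blast
qed

text \<open>A solution \<open>u\<close> of (H - E) u = \<phi> with \<phi> normalized and almost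
  optimal has <(H - E) u, \<phi>> = 1. Cauchy-Schwarz for the nonnegative form q - E bounds the
  square of this by the product of the values of q - E at \<open>u\<close>, at most
  \<open>K'\<close>, and at \<phi>, which can be made small.\<close>

lemma ground_energy_not_resolvent: "complex_of_real ground_energy \<notin> resolvent_set V"
proof
  let ?E = ground_energy
  assume "complex_of_real ?E \<in> resolvent_set V"
  then obtain K where K: "\<And>w. w \<in> L2 \<Longrightarrow> (\<exists>u. schroedinger_op V u (\<lambda>x. w x + complex_of_real ?E * u x)) \<and>
     (\<forall>u. schroedinger_op V u (\<lambda>x. w x + complex_of_real ?E * u x) \<longrightarrow> L2_norm u \<le> K * L2_norm w)"
    unfolding resolvent_set_def by blast
  define K' where "K' = max K 1"
  have K': "0 < K'" "K \<le> K'" by (auto simp: K'_def)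
  \<comment> \<open>The tolerance 1 / (2 K') makes the product of the two values at most 1/2.
    \<open>K'\<close> is positive even if the bound \<open>K\<close> is not.\<close>
  obtain \<phi> where \<phi>: "\<phi> \<in> form_domain V" "sqn \<phi> = 1" "qform V \<phi> < ?E + 1 / (2 * K')"
    using ground_energy_approx[of "1 / (2 * K')"] K' by auto
  note pL = domainD(2)[OF \<phi>(1)]
  obtain u where op: "schroedinger_op V u (\<lambda>x. \<phi> x + complex_of_real ?E * u x)" and le: "L2_norm u \<le> K * L2_norm \<phi>"
    using K[OF pL] by blast
  have u: "u \<in> form_domain V" and eq: "\<And>v. v \<in> form_domain V \<Longrightarrow> bform V u v = ip (\<lambda>x. \<phi> x + complex_of_real ?E * u x) v"
    using op unfolding schroedinger_op_iff by blast+
  note uL = domainD(2)[OF u]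
  have pos: "0 \<le> qform V z + (- ?E) * sqn z" if "z \<in> form_domain V" for z
    using ground_energy_le[OF that] by simp
  have n1: "L2_norm \<phi> = 1" using \<phi>(2) by (simp add: L2_norm_sqrt)
  have 1: "bform V u \<phi> + (- ?E) * ip u \<phi> = 1"
    using eq[OF \<phi>(1)] unfolding ip_shift[OF pL uL pL] ip_self \<phi>(2) by simp
  have "qform V u + (- ?E) * sqn u = ip \<phi> u"
    using eq[OF u] unfolding ip_shift[OF pL uL uL] bform_self ip_self by simp
  also have "\<dots> \<le> L2_norm \<phi> * L2_norm u" using ip_le[OF pL uL] by linarith
  also have "\<dots> \<le> K'" using le K' unfolding n1 by simp
  finally have 2: "qform V u + (- ?E) * sqn u \<le> K'" .
  have "1 \<le> (qform V u + (- ?E) * sqn u) * (qform V \<phi> + (- ?E) * sqn \<phi>)"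
    using bform_bound_beta[OF pos u \<phi>(1)] unfolding 1 by simp
  also have "\<dots> \<le> K' * (1 / (2 * K'))"
    using \<phi>(2,3) pos[OF \<phi>(1)] 2 K' by (intro mult_mono) auto
  also have "\<dots> = 1 / 2" using K' by simp
  finally show False by simp
qed

text \<open>The ground energy is itself a spectral value, hence the minimum of the real spectrum.
  All later use of \<open>\<mu>\<close> goes through this variational characterization.\<close>

theorem mu_eq_ground_energy: "\<mu> V = ground_energy"
  unfolding \<mu>_def
proof (rule cInf_eq_minimum)
  show "ground_energy \<in> {s. complex_of_real s \<in> spectrum V}"
    using ground_energy_not_resolvent by (simp add: spectrum_def)
  fix s assume "s \<in> {s. complex_of_real s \<in> spectrum V}"
  then show "ground_energy \<le> s"
    using below_ground_energy_resolvent[of s] by (auto simp: spectrum_def not_le[symmetric])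
qed

end


section \<open>Localization\<close>

text \<open>The witness is a bump on the unit box, which lies in the form domain because V_+ is
  integrable on its support.\<close>

lemma nontrivial_form_domain:
  assumes V[measurable]: "V \<in> borel_measurable lebesgue"
    and loc: "\<And>R. integrable lebesgue (\<lambda>x. indicator (cball 0 R) x * pos_part V x)"
  shows "\<exists>u\<in>form_domain V. 0 < sqn u"
proof
  define \<psi> where "\<psi> = box_bump 1 (0 :: R3) One"
  have \<psi>: "\<psi> \<in> test_functions" unfolding \<psi>_def by (rule box_bump_test)
  have [measurable]: "pos_part V \<in> borel_measurable lebesgue" unfolding pos_part_def[abs_def] by measurable
  have [measurable]: "\<psi> \<in> borel_measurable lebesgue" by (intro borel_measurable_lebesgueI test_measurable \<psi>)
  obtain R where R: "\<And>x. norm x > R \<Longrightarrow> \<psi> x = 0" using test_function_support[OF \<psi>] by blast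
  have b: "0 \<le> \<psi> x" "\<psi> x \<le> 1" for x unfolding \<psi>_def by (rule box_bump_bounds)+
  let ?u = "\<lambda>x. complex_of_real (\<psi> x)"
  have "integrable lebesgue (\<lambda>x. pos_part V x * (norm (?u x))\<^sup>2)"
  proof (rule Bochner_Integration.integrable_bound[OF loc[of R]])
    show "AE x in lebesgue. norm (pos_part V x * (norm (?u x))\<^sup>2) \<le> norm (indicator (cball 0 R) x * pos_part V x)"
    proof (rule AE_I2)
      fix x
      have "(\<psi> x)\<^sup>2 \<le> 1" using b[of x] by (simp add: power_le_one)
      then have "pos_part V x * (\<psi> x)\<^sup>2 \<le> pos_part V x * 1" by (intro mult_left_mono pos_part_nonneg)
      then show "norm (pos_part V x * (norm (?u x))\<^sup>2) \<le> norm (indicator (cball 0 R) x * pos_part V x)"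
        using R[of x] pos_part_nonneg[of V x] by (cases "norm x \<le> R") (auto simp: abs_mult)
    qed
  qed measurable
  then show "?u \<in> form_domain V" using wgrad_H1[OF wgrad_test_function[OF \<psi>]] by (simp add: form_domain_def)
  show "0 < sqn ?u"
  proof (rule ccontr)
    assume "\<not> 0 < sqn ?u"
    then have "sqn ?u = 0" using sqn_nonneg[of ?u] by linarith
    then have "AE x in lebesgue. ?u x = 0" by (rule sqn_zero_AE[OF test_function_L2[OF \<psi>]])
    then have "AE x in lborel. x \<notin> box 0 (One :: R3)"
      unfolding AE_lebesgue_iff
    proof eventually_elim
      case (elim x)
      have "\<psi> x \<noteq> 0" if "x \<in> box 0 One"
      proof -
        have "flat 1 (real 1 * (x $ i - 0 $ i)) * flat 1 (real 1 * ((One :: R3) $ i - x $ i)) \<noteq> 0" for i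
          using that by (auto simp: mem_box_cart flat_1)
        then show ?thesis unfolding \<psi>_def box_bump_def by (subst prod_zero_iff) auto
      qed
      then show ?case using elim by auto
    qed
    then have "emeasure lborel (box 0 (One :: R3)) = 0"
      by (subst (asm) AE_iff_measurable[OF _ refl]) auto
    then show False by (simp add: emeasure_lborel_box_eq)
  qed
qed

text \<open>
  The localization functions are the cosine and the sine of this angle, so that their squares add
  up to 1.
\<close>

definition cutoff_angle :: "real \<Rightarrow> R3 \<Rightarrow> real" where
  "cutoff_angle R x = pi / 2 * flat 1 ((\<Sum>i\<in>UNIV. x $ i * x $ i) * (1 / R\<^sup>2) - 1)"

lemma sum_nth_square: "(\<Sum>i\<in>UNIV. x $ i * x $ i) = (norm (x :: R3))\<^sup>2"
  by (simp add: power2_norm_eq_inner inner_vec_def)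

lemma smooth_cutoff_angle: "smooth (cutoff_angle R)"
  unfolding cutoff_angle_def[abs_def]
  by (intro smooth_mult[OF smooth_const smooth_flat[OF smooth_diff[OF smooth_mult[OF smooth_sum smooth_const] smooth_const]]]
      smooth_mult[OF smooth_nth smooth_nth]) simp

lemma cutoff_angle_bounds: "0 \<le> cutoff_angle R x" "cutoff_angle R x \<le> pi / 2"
  using flat_1_bounds mult_left_mono[OF flat_1_bounds(2), of "pi / 2"] by (auto simp: cutoff_angle_def)

lemma cutoff_angle_inside: "0 < R \<Longrightarrow> norm x \<le> R \<Longrightarrow> cutoff_angle R x = 0"
proof -
  assume R: "0 < R" and x: "norm x \<le> R"
  have "(norm x)\<^sup>2 \<le> R\<^sup>2" using x by (intro power_mono) auto
  then have "(norm x)\<^sup>2 * (1 / R\<^sup>2) - 1 \<le> 0" using R by (simp add: field_simps)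
  then show ?thesis by (simp add: cutoff_angle_def sum_nth_square flat_1)
qed

text \<open>The angle approaches pi/2 only at infinity. From pi/4 on, the square of its sine is at
  least 1/2, so the sine part carries half of the density beyond \<open>2 * R\<close>.\<close>

lemma cutoff_angle_outside:
  assumes "0 < R" "2 * R < norm x" shows "pi / 4 \<le> cutoff_angle R x"
proof -
  define t where "t = (norm x)\<^sup>2 * (1 / R\<^sup>2) - 1"
  have "(2 * R)\<^sup>2 \<le> (norm x)\<^sup>2" using assms by (intro power_mono) auto
  then have t: "3 \<le> t" using assms by (simp add: t_def field_simps power_mult_distrib)
  then have "1 / t \<le> 1 / 2" by (simp add: field_simps)
  moreover have "1 + - (1 / t) \<le> exp (- (1 / t))" by (rule exp_ge_add_one_self)
  moreover have "flat 1 t = exp (- (1 / t))" using t by (simp add: flat_1)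
  ultimately have "1 / 2 \<le> flat 1 t" by linarith
  then have "pi / 2 * (1 / 2) \<le> pi / 2 * flat 1 t" by (intro mult_left_mono) auto
  then show ?thesis by (simp add: cutoff_angle_def sum_nth_square t_def)
qed

text \<open>The inner function s = |x|^2 / R^2 - 1 has unbounded gradient, but the derivative of
  \<open>flat 1\<close> decays fast enough to compensate: with y = 1 / s the product is governed by
  (y^2 + y) exp(-y).\<close>

lemma partial_cutoff_angle:
  assumes R: "0 < R" shows "\<bar>partial i (cutoff_angle R) x\<bar> \<le> 2 * pi / R"
proof -
  define s where "s x = (\<Sum>i\<in>UNIV. x $ i * x $ i) * (1 / R\<^sup>2) - 1" for x :: R3
  have sm: "smooth s" unfolding s_def[abs_def]
    by (intro smooth_diff[OF smooth_mult[OF smooth_sum smooth_const] smooth_const] smooth_mult[OF smooth_nth smooth_nth]) simp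
  have ps: "partial i s x = 2 * x $ i * (1 / R\<^sup>2)"
  proof -
    have "((\<lambda>x :: R3. (x \<bullet> x) * c - 1) has_derivative (\<lambda>h. (x \<bullet> h + h \<bullet> x) * c)) (at x)" for c
      by (auto intro!: derivative_eq_intros)
    note this[of "1 / R\<^sup>2"]
    moreover have "s = (\<lambda>x. (x \<bullet> x) * (1 / R\<^sup>2) - 1)" by (auto simp: s_def inner_vec_def)
    ultimately have "(s has_derivative (\<lambda>h. (x \<bullet> h + h \<bullet> x) * (1 / R\<^sup>2))) (at x)" by simp
    from partial_eqI[OF this, of i] show ?thesis by (simp add: inner_axis inner_axis')
  qed
  define D where "D = flat (monom 1 2 * (1 - pderiv 1)) (s x)"
  have "((\<lambda>t. pi / 2 * flat 1 t) has_real_derivative pi / 2 * D) (at (s x))"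
    unfolding D_def by (intro DERIV_cmult flat_deriv)
  from partial_compose(1)[OF smooth_differentiable[OF sm] this, of i]
  have eq: "partial i (cutoff_angle R) x = pi / 2 * D * (2 * x $ i * (1 / R\<^sup>2))"
    unfolding ps by (simp add: cutoff_angle_def[abs_def] s_def)
  show ?thesis
  proof (cases "s x > 0")
    case False
    then show ?thesis using R unfolding eq D_def by (simp add: flat_def)
  next
    case True
    define y where "y = 1 / s x"
    have y: "0 < y" using True by (simp add: y_def)
    have D: "D = y\<^sup>2 * exp (- y)" using True by (simp add: D_def flat_def y_def poly_monom)
    have sx: "(norm x)\<^sup>2 = R\<^sup>2 * (1 + s x)" using R by (simp add: s_def sum_nth_square)
    have "(norm x)\<^sup>2 \<le> (R * (1 + s x))\<^sup>2"
      unfolding sx power_mult_distrib using True by (intro mult_left_mono) (auto simp: power2_eq_square algebra_simps)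
    then have "norm x \<le> R * (1 + s x)" by (rule power2_le_imp_le) (use R True in simp)
    moreover have "\<bar>x $ i\<bar> \<le> norm x" by (rule component_le_norm_cart)
    ultimately have xi: "\<bar>x $ i\<bar> \<le> R * (1 + s x)" by linarith
    \<comment> \<open>From exp y \<ge> 1 + y + y^2 / 2.\<close>
    have e: "y\<^sup>2 * exp (- y) * (1 + s x) \<le> 2"
    proof -
      have "1 + y + y\<^sup>2 / 2 \<le> exp y" using exp_lower_Taylor_quadratic[of y] y by simp
      then have "y\<^sup>2 + y \<le> 2 * exp y" using y by linarith
      moreover have "y\<^sup>2 * (1 + s x) = y\<^sup>2 + y" using True by (simp add: y_def power2_eq_square field_simps)
      ultimately have "(y\<^sup>2 * (1 + s x)) * exp (- y) \<le> 2 * exp y * exp (- y)" by (intro mult_right_mono) auto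
      moreover have "2 * exp y * exp (- y) = 2" by (simp add: exp_minus)
      moreover have "y\<^sup>2 * exp (- y) * (1 + s x) = (y\<^sup>2 * (1 + s x)) * exp (- y)" by (simp only: mult_ac)
      ultimately show ?thesis by linarith
    qed
    have "\<bar>partial i (cutoff_angle R) x\<bar> = pi * (D / R\<^sup>2) * \<bar>x $ i\<bar>"
      unfolding eq using D y by (simp add: abs_mult)
    also have "\<dots> \<le> pi * (D / R\<^sup>2) * (R * (1 + s x))"
      using D y xi by (intro mult_left_mono) auto
    also have "\<dots> = (D * (1 + s x)) * (pi / R)" using R by (simp add: power2_eq_square field_simps)
    also have "\<dots> \<le> 2 * (pi / R)" using e R unfolding D by (intro mult_right_mono) auto
    finally show ?thesis by simp
  qed
qed

text \<open>Three partial derivatives of the angle, each at most 2 pi / R, give 3 (2 pi)^2 = 12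
  pi^2.\<close>

definition ims_const :: real where "ims_const = 12 * pi\<^sup>2"

lemma form_domain_cutoff:
  assumes V: "V \<in> borel_measurable lebesgue" and u: "u \<in> form_domain V" and \<theta>: "smooth \<theta>"
    and B: "\<And>x. \<bar>\<theta> x\<bar> \<le> 1" "\<And>i x. \<bar>partial i \<theta> x\<bar> \<le> B" "1 \<le> B"
  shows "(\<lambda>x. complex_of_real (\<theta> x) * u x) \<in> form_domain V"
proof -
  have u1: "u \<in> H1" "integrable lebesgue (\<lambda>x. pos_part V x * (norm (u x))\<^sup>2)" using u by (auto simp: form_domain_def)
  have B1: "\<bar>\<theta> x\<bar> \<le> B" for x using B(1)[of x] B(3) by linarith
  have "(\<lambda>x. complex_of_real (\<theta> x) * u x) \<in> H1"
    by (rule wgrad_H1[OF wgrad_smooth_mult[OF wgrad_weak_grad[OF u1(1)] \<theta> B1 B(2)]])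
  moreover have "integrable lebesgue (\<lambda>x. pos_part V x * (norm (complex_of_real (\<theta> x) * u x))\<^sup>2)"
  proof (rule Bochner_Integration.integrable_bound[OF u1(2)])
    have [measurable]: "pos_part V \<in> borel_measurable lebesgue" "\<theta> \<in> borel_measurable lebesgue" "u \<in> borel_measurable lebesgue"
      using V H1_measurable(3)[OF u1(1)] borel_measurable_lebesgueI[OF smooth_measurable[OF \<theta>]]
      unfolding pos_part_def[abs_def] by measurable
    show "(\<lambda>x. pos_part V x * (norm (complex_of_real (\<theta> x) * u x))\<^sup>2) \<in> borel_measurable lebesgue" by measurable
    have "(norm (complex_of_real (\<theta> x) * u x))\<^sup>2 \<le> (norm (u x))\<^sup>2" for x
      using B(1)[of x] by (intro power_mono) (auto simp: norm_mult mult_left_le_one_le)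
    then show "AE x in lebesgue. norm (pos_part V x * (norm (complex_of_real (\<theta> x) * u x))\<^sup>2) \<le> norm (pos_part V x * (norm (u x))\<^sup>2)"
      using pos_part_nonneg[of V] by (intro AE_I2) (simp add: mult_left_mono)
  qed
  ultimately show ?thesis by (simp add: form_domain_def)
qed

text \<open>The two components are a rotation by \<alpha> of the pair (w, c z). Applied to the
  gradients of the cosine and the sine part this shows that their mixed terms cancel
  pointwise.\<close>

lemma rotation_norm:
  fixes w z :: complex and \<alpha> c :: real
  shows "(norm (complex_of_real (cos \<alpha>) * w + complex_of_real (- sin \<alpha> * c) * z))\<^sup>2
     + (norm (complex_of_real (sin \<alpha>) * w + complex_of_real (cos \<alpha> * c) * z))\<^sup>2 = (norm w)\<^sup>2 + c\<^sup>2 * (norm z)\<^sup>2"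
proof -
  have r: "(cos \<alpha> * x + - sin \<alpha> * c * y)\<^sup>2 + (sin \<alpha> * x + cos \<alpha> * c * y)\<^sup>2 = x\<^sup>2 + c\<^sup>2 * y\<^sup>2" for x y
  proof -
    have "(C * x + - S * c * y)\<^sup>2 + (S * x + C * c * y)\<^sup>2 = (S\<^sup>2 + C\<^sup>2) * (x\<^sup>2 + c\<^sup>2 * y\<^sup>2)" for S C
      by (simp add: power2_eq_square algebra_simps)
    from this[of "cos \<alpha>" "sin \<alpha>"] show ?thesis by (simp only: sin_cos_squared_add mult_1)
  qed
  have "(norm (complex_of_real (cos \<alpha>) * w + complex_of_real (- sin \<alpha> * c) * z))\<^sup>2
     + (norm (complex_of_real (sin \<alpha>) * w + complex_of_real (cos \<alpha> * c) * z))\<^sup>2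
     = ((cos \<alpha> * Re w + - sin \<alpha> * c * Re z)\<^sup>2 + (sin \<alpha> * Re w + cos \<alpha> * c * Re z)\<^sup>2)
     + ((cos \<alpha> * Im w + - sin \<alpha> * c * Im z)\<^sup>2 + (sin \<alpha> * Im w + cos \<alpha> * c * Im z)\<^sup>2)"
    unfolding cmod_power2 by simp
  then show ?thesis unfolding r cmod_power2 by (simp add: distrib_left)
qed

context form_bounded_potential
begin

text \<open>The squares of the cutoffs add up to 1, so the density and the potential energy split
  exactly, and the gradients cost only |grad \<theta>|^2 |u|^2.\<close>

theorem ims_localization:
  assumes u: "u \<in> form_domain V" and R: "0 < R"
  obtains p z where "p \<in> form_domain V" "z \<in> form_domain V"
    "\<And>x. (norm (p x))\<^sup>2 + (norm (z x))\<^sup>2 = (norm (u x))\<^sup>2"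
    "\<And>x. norm x \<le> R \<Longrightarrow> z x = 0"
    "\<And>x. 2 * R < norm x \<Longrightarrow> (norm (u x))\<^sup>2 \<le> 2 * (norm (z x))\<^sup>2"
    "sqn (weak_grad p) + sqn (weak_grad z) \<le> sqn (weak_grad u) + ims_const / R\<^sup>2 * sqn u"
    "qform V p + qform V z \<le> qform V u + ims_const / R\<^sup>2 * sqn u"
proof -
  note d = domainD[OF u]
  define \<theta> where "\<theta> = cutoff_angle R"
  have sm: "smooth \<theta>" unfolding \<theta>_def by (rule smooth_cutoff_angle)
  have pc: "partial i (\<lambda>x. cos (\<theta> x)) x = - sin (\<theta> x) * partial i \<theta> x" for i x
    by (rule partial_compose(1)[OF smooth_differentiable[OF sm]]) (rule DERIV_cos)
  have ps: "partial i (\<lambda>x. sin (\<theta> x)) x = cos (\<theta> x) * partial i \<theta> x" for i x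
    by (rule partial_compose(1)[OF smooth_differentiable[OF sm]]) (rule DERIV_sin)
  \<comment> \<open>Bounds the cutoffs as well as their derivatives, since
    \<open>wgrad_smooth_mult\<close> takes one bound for both.\<close>
  define B where "B = max 1 (2 * pi / R)"
  have pt: "\<bar>partial i \<theta> x\<bar> \<le> 2 * pi / R" for i x unfolding \<theta>_def by (rule partial_cutoff_angle[OF R])
  have B: "1 \<le> B" by (simp add: B_def)
  have ptB: "\<bar>partial i \<theta> x\<bar> \<le> B" for i x using pt[of i x] by (simp add: B_def)
  have Bc: "\<bar>partial i (\<lambda>x. cos (\<theta> x)) x\<bar> \<le> B" for i x
    using mult_mono[OF abs_sin_le_one[of "\<theta> x"] ptB[of i x]] B unfolding pc abs_mult by simp
  have Bs: "\<bar>partial i (\<lambda>x. sin (\<theta> x)) x\<bar> \<le> B" for i x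
    using mult_mono[OF abs_cos_le_one[of "\<theta> x"] ptB[of i x]] B unfolding ps abs_mult by simp
  define p where "p x = complex_of_real (cos (\<theta> x)) * u x" for x
  define z where "z x = complex_of_real (sin (\<theta> x)) * u x" for x
  have pQ: "p \<in> form_domain V" unfolding p_def[abs_def]
    by (rule form_domain_cutoff[OF V_measurable u smooth_cos[OF sm] _ Bc B]) simp
  have zQ: "z \<in> form_domain V" unfolding z_def[abs_def]
    by (rule form_domain_cutoff[OF V_measurable u smooth_sin[OF sm] _ Bs B]) simp
  have pz: "(norm (p x))\<^sup>2 + (norm (z x))\<^sup>2 = (norm (u x))\<^sup>2" for x
    unfolding p_def z_def norm_mult power_mult_distrib norm_of_real power2_abs
    using sin_cos_squared_add2[of "\<theta> x"] by (simp add: distrib_right[symmetric])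
  have z0: "z x = 0" if "norm x \<le> R" for x
    using cutoff_angle_inside[OF R that] by (simp add: z_def \<theta>_def)
  have out: "(norm (u x))\<^sup>2 \<le> 2 * (norm (z x))\<^sup>2" if x: "2 * R < norm x" for x
  proof -
    have "sin (pi / 4) \<le> sin (\<theta> x)"
      unfolding \<theta>_def using cutoff_angle_outside[OF R x] cutoff_angle_bounds(2)[of R x]
      by (intro sin_monotone_2pi_le) auto
    then have "(sin (pi / 4))\<^sup>2 \<le> (sin (\<theta> x))\<^sup>2" by (intro power_mono) (auto simp: sin_45)
    then have "1 \<le> 2 * (sin (\<theta> x))\<^sup>2" by (simp add: sin_45 power_divide)
    then have "1 * (norm (u x))\<^sup>2 \<le> 2 * (sin (\<theta> x))\<^sup>2 * (norm (u x))\<^sup>2" by (intro mult_right_mono) auto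
    then show ?thesis by (simp add: z_def norm_mult power_mult_distrib)
  qed
  let ?G = "weak_grad u"
  define Gp where "Gp x = (\<chi> i. complex_of_real (cos (\<theta> x)) * ?G x $ i + complex_of_real (partial i (\<lambda>x. cos (\<theta> x)) x) * u x)" for x
  define Gz where "Gz x = (\<chi> i. complex_of_real (sin (\<theta> x)) * ?G x $ i + complex_of_real (partial i (\<lambda>x. sin (\<theta> x)) x) * u x)" for x
  have le1: "\<bar>cos (\<theta> x)\<bar> \<le> B" "\<bar>sin (\<theta> x)\<bar> \<le> B" for x
    using abs_cos_le_one[of "\<theta> x"] abs_sin_le_one[of "\<theta> x"] B by linarith+
  have wp: "wgrad p Gp" unfolding p_def[abs_def] Gp_def[abs_def]
    by (rule wgrad_smooth_mult[OF d(10) smooth_cos[OF sm] le1(1) Bc])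
  have wz: "wgrad z Gz" unfolding z_def[abs_def] Gz_def[abs_def]
    by (rule wgrad_smooth_mult[OF d(10) smooth_sin[OF sm] le1(2) Bs])
  have "sqn Gp + sqn Gz = (\<integral>x. (norm (Gp x))\<^sup>2 + (norm (Gz x))\<^sup>2 \<partial>lebesgue)"
    unfolding sqn_def using L2D(2)[OF wgradD(2)[OF wp]] L2D(2)[OF wgradD(2)[OF wz]] by simp
  also have "\<dots> \<le> (\<integral>x. (norm (?G x))\<^sup>2 + ims_const / R\<^sup>2 * (norm (u x))\<^sup>2 \<partial>lebesgue)"
  proof (rule integral_mono)
    show "integrable lebesgue (\<lambda>x. (norm (Gp x))\<^sup>2 + (norm (Gz x))\<^sup>2)"
      using L2D(2)[OF wgradD(2)[OF wp]] L2D(2)[OF wgradD(2)[OF wz]] by simp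
    show "integrable lebesgue (\<lambda>x. (norm (?G x))\<^sup>2 + ims_const / R\<^sup>2 * (norm (u x))\<^sup>2)"
      using L2D(2)[OF d(2)] L2D(2)[OF d(3)] by simp
    fix x
    have "(norm (Gp x))\<^sup>2 + (norm (Gz x))\<^sup>2 = (\<Sum>i\<in>UNIV. (norm (?G x $ i))\<^sup>2 + (partial i \<theta> x)\<^sup>2 * (norm (u x))\<^sup>2)"
      unfolding norm_vec_power2 sum.distrib[symmetric] Gp_def Gz_def vec_lambda_beta pc ps
      by (intro sum.cong refl rotation_norm)
    also have "\<dots> \<le> (\<Sum>i\<in>UNIV. (norm (?G x $ i))\<^sup>2 + (2 * pi / R)\<^sup>2 * (norm (u x))\<^sup>2)"
    proof (intro sum_mono add_left_mono mult_right_mono)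
      fix i
      have "\<bar>partial i \<theta> x\<bar>\<^sup>2 \<le> (2 * pi / R)\<^sup>2" using pt[of i x] by (intro power_mono) auto
      then show "(partial i \<theta> x)\<^sup>2 \<le> (2 * pi / R)\<^sup>2" by simp
    qed simp
    also have "\<dots> = (norm (?G x))\<^sup>2 + ims_const / R\<^sup>2 * (norm (u x))\<^sup>2"
      unfolding norm_vec_power2 sum.distrib by (simp add: ims_const_def power_divide power_mult_distrib)
    finally show "(norm (Gp x))\<^sup>2 + (norm (Gz x))\<^sup>2 \<le> (norm (?G x))\<^sup>2 + ims_const / R\<^sup>2 * (norm (u x))\<^sup>2" .
  qed
  also have "\<dots> = sqn ?G + ims_const / R\<^sup>2 * sqn u"
    unfolding sqn_def using L2D(2)[OF d(2)] L2D(2)[OF d(3)] by simp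
  finally have gr: "sqn (weak_grad p) + sqn (weak_grad z) \<le> sqn ?G + ims_const / R\<^sup>2 * sqn u"
    using wgrad_sqn[OF wp] wgrad_sqn[OF wz] by simp
  have "(\<integral>x. V x * (norm (p x))\<^sup>2 \<partial>lebesgue) + (\<integral>x. V x * (norm (z x))\<^sup>2 \<partial>lebesgue) = (\<integral>x. V x * (norm (u x))\<^sup>2 \<partial>lebesgue)"
    using domainD(8)[OF pQ] domainD(8)[OF zQ] by (simp add: pz distrib_left[symmetric] flip: Bochner_Integration.integral_add)
  then have "qform V p + qform V z \<le> qform V u + ims_const / R\<^sup>2 * sqn u"
    using gr by (simp add: qform_def)
  with pQ zQ pz z0 out gr show ?thesis using that by blast
qed

end


section \<open>Elimination of the field\<close>

text \<open>V_+ is at most V1 + |V2|, and |V2| \<le> 1 + |V2|^(3/2) is locally integrable.\<close>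

lemma decomposition_pos_part_loc:
  assumes V: "V \<in> borel_measurable lebesgue" and dec: "decomposition_A V V1 V2"
  shows "integrable lebesgue (\<lambda>x. indicator (cball 0 R) x * pos_part V x)"
    and "integrable lebesgue (\<lambda>x. indicator (cball 0 R) x * pos_part V1 x)"
proof -
  let ?i = "\<lambda>x :: R3. indicator (cball 0 R) x :: real"
  have m: "V1 \<in> borel_measurable lebesgue" "V2 \<in> borel_measurable lebesgue" "\<And>x. 0 \<le> V1 x"
    and ae: "AE x in lebesgue. V x = V1 x + V2 x"
    using dec by (auto simp: decomposition_A_def Lp_loc_def)
  have "set_integrable lebesgue (cball 0 R) (\<lambda>x. \<bar>V1 x\<bar> powr 1)" "set_integrable lebesgue (cball 0 R) (\<lambda>x. \<bar>V2 x\<bar> powr (3/2))"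
    using dec compact_cball by (auto simp: decomposition_A_def Lp_loc_def)
  then have i1: "integrable lebesgue (\<lambda>x. ?i x * V1 x)" and i2: "integrable lebesgue (\<lambda>x. ?i x * \<bar>V2 x\<bar> powr (3/2))"
    using m(3) by (auto simp: set_integrable_def)
  have i0: "integrable lebesgue ?i"
    using emeasure_lebesgue_cball[of R] by (simp add: integrable_indicator_iff)
  have im: "?i \<in> borel_measurable lebesgue" by (rule borel_measurable_indicator) simp
  show "integrable lebesgue (\<lambda>x. ?i x * pos_part V1 x)"
    using i1 m(3) by (simp add: pos_part_def max_absorb1)
  show "integrable lebesgue (\<lambda>x. ?i x * pos_part V x)"
  proof (rule Bochner_Integration.integrable_bound)
    show "integrable lebesgue (\<lambda>x. ?i x * V1 x + ?i x + ?i x * \<bar>V2 x\<bar> powr (3/2))"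
      using i0 i1 i2 by (intro Bochner_Integration.integrable_add)
    have "pos_part V \<in> borel_measurable lebesgue" using V unfolding pos_part_def[abs_def] by measurable
    then show "(\<lambda>x. ?i x * pos_part V x) \<in> borel_measurable lebesgue" by (intro borel_measurable_times im)
    show "AE x in lebesgue. norm (?i x * pos_part V x) \<le> norm (?i x * V1 x + ?i x + ?i x * \<bar>V2 x\<bar> powr (3/2))"
      using ae
    proof eventually_elim
      case (elim x)
      have "\<bar>V2 x\<bar> \<le> 1 + \<bar>V2 x\<bar> powr (3/2)"
      proof (cases "\<bar>V2 x\<bar> \<le> 1")
        case True then show ?thesis using powr_ge_zero[of "\<bar>V2 x\<bar>" "3/2"] by linarith
      next
        case False
        then have "\<bar>V2 x\<bar> powr 1 \<le> \<bar>V2 x\<bar> powr (3/2)" by (intro powr_mono) auto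
        then show ?thesis using False by simp
      qed
      then have "pos_part V x \<le> V1 x + 1 + \<bar>V2 x\<bar> powr (3/2)"
        using m(3)[of x] powr_ge_zero[of "\<bar>V2 x\<bar>" "3/2"] unfolding pos_part_def elim by linarith
      then show ?case using pos_part_nonneg[of V x] by (auto simp: indicator_def)
    qed
  qed
qed

text \<open>The form bound of \<open>V\<close> survives enlarging \<open>b\<close> to
  \<open>max b 0\<close>; \<open>V1\<close>, being nonnegative, is form bounded with both constants
  0.\<close>

lemma decomposition_potentials:
  assumes V: "V \<in> borel_measurable lebesgue" and fb: "form_bounded V a b" and a: "0 \<le> a" "a < 1"
    and dec: "decomposition_A V V1 V2"
  shows "nontrivial_potential V a (max b 0)" "nontrivial_potential V1 0 0"
proof -
  have m: "V1 \<in> borel_measurable lebesgue" "\<And>x. 0 \<le> V1 x"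
    using dec by (auto simp: decomposition_A_def Lp_loc_def)
  show "nontrivial_potential V a (max b 0)"
  proof
    show "form_bounded V a (max b 0)"
      unfolding form_bounded_def
    proof (intro ballI conjI)
      fix u assume u: "u \<in> H1"
      show "integrable lebesgue (\<lambda>x. neg_part V x * (norm (u x))\<^sup>2)" using fb u by (auto simp: form_bounded_def)
      have "(\<integral>x. neg_part V x * (norm (u x))\<^sup>2 \<partial>lebesgue) \<le> a * (\<integral>x. (norm (weak_grad u x))\<^sup>2 \<partial>lebesgue) + b * (\<integral>x. (norm (u x))\<^sup>2 \<partial>lebesgue)"
        using fb u by (auto simp: form_bounded_def)
      also have "\<dots> \<le> a * (\<integral>x. (norm (weak_grad u x))\<^sup>2 \<partial>lebesgue) + max b 0 * (\<integral>x. (norm (u x))\<^sup>2 \<partial>lebesgue)"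
        by (intro add_left_mono mult_right_mono integral_nonneg_AE) auto
      finally show "(\<integral>x. neg_part V x * (norm (u x))\<^sup>2 \<partial>lebesgue) \<le> a * (\<integral>x. (norm (weak_grad u x))\<^sup>2 \<partial>lebesgue) + max b 0 * (\<integral>x. (norm (u x))\<^sup>2 \<partial>lebesgue)" .
    qed
  qed (use V a nontrivial_form_domain[OF V decomposition_pos_part_loc(1)[OF V dec]] in auto)
  have np: "neg_part V1 = (\<lambda>x. 0)" using m(2) by (auto simp: neg_part_def max_def)
  show "nontrivial_potential V1 0 0"
    by unfold_locales (use m np nontrivial_form_domain[OF m(1) decomposition_pos_part_loc(2)[OF V dec]] in \<open>auto simp: form_bounded_def\<close>)
qed

section \<open>The coupling energy\<close>

definition rho :: "(R3 \<Rightarrow> complex) \<Rightarrow> R3 \<Rightarrow> complex" where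
  "rho u = ft (\<lambda>x. (norm (u x))\<^sup>2)"

lemma norm_rho_le: "norm (rho u k) \<le> sqn u"
  unfolding rho_def by (rule norm_ft_density_le)

lemma rho_measurable:
  assumes "u \<in> L2" shows "rho u \<in> borel_measurable lebesgue"
proof -
  have "(\<lambda>x. (norm (u x))\<^sup>2) \<in> borel_measurable lebesgue" using L2D(1)[OF assms] by measurable
  then show ?thesis unfolding rho_def by (rule borel_measurable_lebesgueI[OF ft_borel_measurable])
qed

lemma rho_cong_AE:
  assumes "u \<in> borel_measurable lebesgue" "v \<in> borel_measurable lebesgue" "AE x in lebesgue. u x = v x"
  shows "rho u = rho v"
  unfolding rho_def
proof (rule ft_cong_AE)
  show "(\<lambda>x. (norm (u x))\<^sup>2) \<in> borel_measurable lebesgue" "(\<lambda>x. (norm (v x))\<^sup>2) \<in> borel_measurable lebesgue"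
    using assms(1,2) by measurable
  show "AE x in lebesgue. (norm (u x))\<^sup>2 = (norm (v x))\<^sup>2" using assms(3) by eventually_elim simp
qed

lemma rho_scaleR: "rho (\<lambda>x. c *\<^sub>R u x) k = complex_of_real (c\<^sup>2) * rho u k"
proof -
  have "rho (\<lambda>x. c *\<^sub>R u x) k = (\<integral>x. complex_of_real (c\<^sup>2) * (exp (\<i> * complex_of_real (k \<bullet> x)) * complex_of_real ((norm (u x))\<^sup>2)) \<partial>lebesgue)"
    unfolding rho_def ft_def by (intro Bochner_Integration.integral_cong refl) (simp add: power_mult_distrib)
  also have "\<dots> = complex_of_real (c\<^sup>2) * rho u k" unfolding rho_def ft_def by (rule integral_mult_right_zero)
  finally show ?thesis .
qed

locale field_weight =
  fixes W W1 W2 :: "R3 \<Rightarrow> real"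
  assumes W_measurable: "W \<in> borel_measurable lebesgue" and W_nonneg: "\<And>k. 0 \<le> W k"
    and W_dec: "decomposition_C W W1 W2"
begin

text \<open>The energy that the optimal field gains, by \<open>energy_minimal_field\<close>. It is
  homogeneous of degree 4 in \<open>u\<close>.\<close>

definition hart :: "(R3 \<Rightarrow> complex) \<Rightarrow> real" where
  "hart u = (\<integral>k. W k * (norm (rho u k))\<^sup>2 \<partial>lebesgue)"

text \<open>With an absolute value, because it is \<open>W\<close> that is nonnegative and not its
  two parts.\<close>

definition hart2 :: "(R3 \<Rightarrow> complex) \<Rightarrow> real" where
  "hart2 u = (\<integral>k. \<bar>W2 k\<bar> * (norm (rho u k))\<^sup>2 \<partial>lebesgue)"

definition mix2 :: "(R3 \<Rightarrow> complex) \<Rightarrow> (R3 \<Rightarrow> complex) \<Rightarrow> real" where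
  "mix2 u z = (\<integral>k. \<bar>W2 k\<bar> * (norm (rho u k) * norm (rho z k)) \<partial>lebesgue)"

abbreviation "M1 \<equiv> L1_norm W1"
abbreviation "A2 \<equiv> hartree_const * L3_weak_norm W2"

lemma W_facts: "AE k in lebesgue. W k = W1 k + W2 k" "integrable lebesgue W1" "W2 \<in> L3_weak"
  "W1 \<in> borel_measurable lebesgue" "W2 \<in> borel_measurable lebesgue"
  using W_dec by (auto simp: decomposition_C_def L3_weak_def)

lemma A2_nonneg: "0 \<le> A2"
  using hartree_const_pos L3_weak_norm_nonneg[OF W_facts(3)] by simp

lemma M1_nonneg: "0 \<le> M1"
  unfolding L1_norm_def by (rule integral_nonneg_AE) simp

lemma hart2_integrable: "u \<in> H1 \<Longrightarrow> integrable lebesgue (\<lambda>k. \<bar>W2 k\<bar> * (norm (rho u k))\<^sup>2)"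
  unfolding rho_def by (rule hartree_weak_estimate(1)[OF W_facts(3) wgrad_weak_grad])

lemma hart2_le: "u \<in> H1 \<Longrightarrow> hart2 u \<le> A2 * sqn u * sqn (weak_grad u)"
  unfolding hart2_def rho_def by (rule hartree_weak_estimate(2)[OF W_facts(3) wgrad_weak_grad])

lemma hart2_nonneg: "0 \<le> hart2 u"
  unfolding hart2_def by (rule integral_nonneg_AE) simp

lemma sqrt_W2_L2:
  fixes h :: "R3 \<Rightarrow> complex"
  assumes h: "h \<in> borel_measurable lebesgue" and i: "integrable lebesgue (\<lambda>k. \<bar>W2 k\<bar> * (norm (h k))\<^sup>2)"
  shows "(\<lambda>k. sqrt \<bar>W2 k\<bar> * norm (h k)) \<in> L2" "sqn (\<lambda>k. sqrt \<bar>W2 k\<bar> * norm (h k)) = (\<integral>k. \<bar>W2 k\<bar> * (norm (h k))\<^sup>2 \<partial>lebesgue)"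
proof -
  have "(\<lambda>k. sqrt \<bar>W2 k\<bar> * norm (h k)) \<in> borel_measurable lebesgue" using h W_facts(5) by measurable
  then show "(\<lambda>k. sqrt \<bar>W2 k\<bar> * norm (h k)) \<in> L2" using i by (simp add: L2_def power_mult_distrib)
  show "sqn (\<lambda>k. sqrt \<bar>W2 k\<bar> * norm (h k)) = (\<integral>k. \<bar>W2 k\<bar> * (norm (h k))\<^sup>2 \<partial>lebesgue)"
    by (simp add: sqn_def power_mult_distrib)
qed

lemma W2_Cauchy_Schwarz:
  fixes h l :: "R3 \<Rightarrow> complex"
  assumes h: "h \<in> borel_measurable lebesgue" "integrable lebesgue (\<lambda>k. \<bar>W2 k\<bar> * (norm (h k))\<^sup>2)"
    and l: "l \<in> borel_measurable lebesgue" "integrable lebesgue (\<lambda>k. \<bar>W2 k\<bar> * (norm (l k))\<^sup>2)"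
  shows "integrable lebesgue (\<lambda>k. \<bar>W2 k\<bar> * (norm (h k) * norm (l k)))"
    "(\<integral>k. \<bar>W2 k\<bar> * (norm (h k) * norm (l k)) \<partial>lebesgue)\<^sup>2 \<le> (\<integral>k. \<bar>W2 k\<bar> * (norm (h k))\<^sup>2 \<partial>lebesgue) * (\<integral>k. \<bar>W2 k\<bar> * (norm (l k))\<^sup>2 \<partial>lebesgue)"
proof -
  note H = sqrt_W2_L2[OF h] and L = sqrt_W2_L2[OF l]
  have eq: "(\<lambda>k. (sqrt \<bar>W2 k\<bar> * norm (h k)) \<bullet> (sqrt \<bar>W2 k\<bar> * norm (l k))) = (\<lambda>k. \<bar>W2 k\<bar> * (norm (h k) * norm (l k)))"
  proof
    fix k
    have "(sqrt \<bar>W2 k\<bar> * norm (h k)) \<bullet> (sqrt \<bar>W2 k\<bar> * norm (l k)) = (sqrt \<bar>W2 k\<bar> * sqrt \<bar>W2 k\<bar>) * (norm (h k) * norm (l k))"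
      by (simp only: inner_real_def mult_ac)
    then show "(sqrt \<bar>W2 k\<bar> * norm (h k)) \<bullet> (sqrt \<bar>W2 k\<bar> * norm (l k)) = \<bar>W2 k\<bar> * (norm (h k) * norm (l k))"
      by simp
  qed
  show "integrable lebesgue (\<lambda>k. \<bar>W2 k\<bar> * (norm (h k) * norm (l k)))"
    using L2_integrable_inner[OF H(1) L(1)] unfolding eq .
  show "(\<integral>k. \<bar>W2 k\<bar> * (norm (h k) * norm (l k)) \<partial>lebesgue)\<^sup>2 \<le> (\<integral>k. \<bar>W2 k\<bar> * (norm (h k))\<^sup>2 \<partial>lebesgue) * (\<integral>k. \<bar>W2 k\<bar> * (norm (l k))\<^sup>2 \<partial>lebesgue)"
    using ip_Cauchy_Schwarz[OF H(1) L(1)] unfolding ip_def eq H(2) L(2) .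
qed

lemma mix2:
  assumes "u \<in> H1" "z \<in> H1"
  shows "integrable lebesgue (\<lambda>k. \<bar>W2 k\<bar> * (norm (rho u k) * norm (rho z k)))" "(mix2 u z)\<^sup>2 \<le> hart2 u * hart2 z"
  unfolding mix2_def hart2_def
  using W2_Cauchy_Schwarz[OF rho_measurable hart2_integrable rho_measurable hart2_integrable] assms H1_measurable(1) by blast+

lemma W1_integrable:
  assumes h: "h \<in> borel_measurable lebesgue" and b: "\<And>k. \<bar>h k\<bar> \<le> B"
  shows "integrable lebesgue (\<lambda>k. \<bar>W1 k\<bar> * h k)" "(\<integral>k. \<bar>W1 k\<bar> * h k \<partial>lebesgue) \<le> M1 * B"
proof -
  have i: "integrable lebesgue (\<lambda>k. \<bar>W1 k\<bar> * B)" using W_facts(2) by simp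
  have le: "\<bar>W1 k\<bar> * \<bar>h k\<bar> \<le> \<bar>W1 k\<bar> * B" for k using b by (intro mult_left_mono) auto
  have B: "0 \<le> B" using b[of 0] by linarith
  show I: "integrable lebesgue (\<lambda>k. \<bar>W1 k\<bar> * h k)"
  proof (rule Bochner_Integration.integrable_bound[OF i])
    show "(\<lambda>k. \<bar>W1 k\<bar> * h k) \<in> borel_measurable lebesgue" using h W_facts(4) by measurable
    show "AE k in lebesgue. norm (\<bar>W1 k\<bar> * h k) \<le> norm (\<bar>W1 k\<bar> * B)"
      using le B by (intro AE_I2) (simp add: abs_mult)
  qed
  have "(\<integral>k. \<bar>W1 k\<bar> * h k \<partial>lebesgue) \<le> (\<integral>k. \<bar>W1 k\<bar> * B \<partial>lebesgue)"
  proof (rule integral_mono[OF I i])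
    fix k
    have "\<bar>W1 k\<bar> * h k \<le> \<bar>W1 k\<bar> * \<bar>h k\<bar>" by (intro mult_left_mono) auto
    then show "\<bar>W1 k\<bar> * h k \<le> \<bar>W1 k\<bar> * B" using le[of k] by linarith
  qed
  then show "(\<integral>k. \<bar>W1 k\<bar> * h k \<partial>lebesgue) \<le> M1 * B" by (simp add: L1_norm_def)
qed

text \<open>The integrable part of \<open>W\<close> is paired with the sup bound of
  \<open>h\<close>; the weak L^3 part is left to the estimates of \<open>hart2\<close> and
  \<open>mix2\<close>.\<close>

lemma W_integral_le:
  assumes h: "h \<in> borel_measurable lebesgue" and h0: "\<And>k. 0 \<le> h k" and b: "\<And>k. h k \<le> B"
    and i2: "integrable lebesgue (\<lambda>k. \<bar>W2 k\<bar> * h k)"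
  shows "integrable lebesgue (\<lambda>k. W k * h k)" "(\<integral>k. W k * h k \<partial>lebesgue) \<le> M1 * B + (\<integral>k. \<bar>W2 k\<bar> * h k \<partial>lebesgue)"
proof -
  have b': "\<bar>h k\<bar> \<le> B" for k using h0[of k] b[of k] by simp
  note W1i = W1_integrable[OF h b']
  have ae: "AE k in lebesgue. W k * h k \<le> \<bar>W1 k\<bar> * h k + \<bar>W2 k\<bar> * h k"
    using W_facts(1)
  proof eventually_elim
    case (elim k)
    have "W k * h k \<le> (\<bar>W1 k\<bar> + \<bar>W2 k\<bar>) * h k" using elim h0 by (intro mult_right_mono) auto
    then show ?case by (simp add: distrib_right)
  qed
  have isum: "integrable lebesgue (\<lambda>k. \<bar>W1 k\<bar> * h k + \<bar>W2 k\<bar> * h k)" using W1i(1) i2 by simp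
  show I: "integrable lebesgue (\<lambda>k. W k * h k)"
  proof (rule Bochner_Integration.integrable_bound[OF isum])
    show "(\<lambda>k. W k * h k) \<in> borel_measurable lebesgue" using h W_measurable by measurable
    show "AE k in lebesgue. norm (W k * h k) \<le> norm (\<bar>W1 k\<bar> * h k + \<bar>W2 k\<bar> * h k)"
      using ae by eventually_elim (use W_nonneg h0 in \<open>simp add: abs_mult\<close>)
  qed
  have "(\<integral>k. W k * h k \<partial>lebesgue) \<le> (\<integral>k. \<bar>W1 k\<bar> * h k + \<bar>W2 k\<bar> * h k \<partial>lebesgue)"
    by (rule integral_mono_AE[OF I isum ae])
  then show "(\<integral>k. W k * h k \<partial>lebesgue) \<le> M1 * B + (\<integral>k. \<bar>W2 k\<bar> * h k \<partial>lebesgue)"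
    using W1i i2 by simp
qed

lemma rho_square_le: "(norm (rho u k))\<^sup>2 \<le> (sqn u)\<^sup>2"
  by (rule power_mono[OF norm_rho_le]) simp

lemma rho_square_measurable: "u \<in> H1 \<Longrightarrow> (\<lambda>k. (norm (rho u k))\<^sup>2) \<in> borel_measurable lebesgue"
  using rho_measurable[OF H1_measurable(1)] by measurable

lemma hart_integrable: "u \<in> H1 \<Longrightarrow> integrable lebesgue (\<lambda>k. W k * (norm (rho u k))\<^sup>2)"
  by (rule W_integral_le(1)[OF rho_square_measurable _ rho_square_le hart2_integrable]) auto

lemma hart_le:
  assumes "u \<in> H1" shows "hart u \<le> M1 * (sqn u)\<^sup>2 + A2 * sqn u * sqn (weak_grad u)"
proof -
  have "hart u \<le> M1 * (sqn u)\<^sup>2 + hart2 u"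
    unfolding hart_def hart2_def
    by (rule W_integral_le(2)[OF rho_square_measurable _ rho_square_le hart2_integrable]) (use assms in auto)
  then show ?thesis using hart2_le[OF assms] by linarith
qed

lemma hart_nonneg: "0 \<le> hart u"
  unfolding hart_def by (rule integral_nonneg_AE) (simp add: W_nonneg)

lemma hart_scaleR: "hart (\<lambda>x. c *\<^sub>R u x) = c ^ 4 * hart u"
proof -
  have "(\<lambda>k. W k * (norm (rho (\<lambda>x. c *\<^sub>R u x) k))\<^sup>2) = (\<lambda>k. c ^ 4 * (W k * (norm (rho u k))\<^sup>2))"
    unfolding rho_scaleR norm_mult norm_of_real power_mult_distrib
    by (rule ext) (simp flip: power_mult)
  then show ?thesis unfolding hart_def by simp
qed

lemma hart_zero: "sqn u = 0 \<Longrightarrow> hart u = 0"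
  using norm_rho_le[of u] by (simp add: hart_def)

text \<open>The densities of \<open>p\<close> and \<open>z\<close> add up to that of
  \<open>u\<close>, hence so do their Fourier transforms. The excess of |rho u|^2 over |rho p|^2 is
  at most a mixed term plus |rho z|^2. The mixed term is kept as \<open>mix2\<close>, since it is
  later absorbed by the gradient of \<open>z\<close>.\<close>

lemma hart_localization:
  assumes u: "u \<in> H1" and p: "p \<in> H1" and z: "z \<in> H1"
    and pz: "\<And>x. (norm (p x))\<^sup>2 + (norm (z x))\<^sup>2 = (norm (u x))\<^sup>2"
  shows "hart u \<le> hart p + M1 * (2 * (sqn p * sqn z) + (sqn z)\<^sup>2) + 2 * mix2 p z + hart2 z"
proof -
  have int: "integrable lebesgue (\<lambda>x. (norm (w x))\<^sup>2)" if "w \<in> H1" for w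
    using L2D(2)[OF H1_measurable(1)[OF that]] .
  have sum: "rho u k = rho p k + rho z k" for k
    unfolding rho_def using ft_add[OF int[OF p] int[OF z], of k] by (simp add: pz)
  define h where "h k = 2 * (norm (rho p k) * norm (rho z k)) + (norm (rho z k))\<^sup>2" for k
  have pm: "rho p \<in> borel_measurable lebesgue" "rho z \<in> borel_measurable lebesgue"
    using rho_measurable H1_measurable(1) p z by auto
  have hm: "h \<in> borel_measurable lebesgue" unfolding h_def[abs_def] using pm by measurable
  have h0: "0 \<le> h k" for k by (simp add: h_def)
  have hB: "h k \<le> 2 * (sqn p * sqn z) + (sqn z)\<^sup>2" for k
    unfolding h_def by (intro add_mono mult_left_mono mult_mono norm_rho_le rho_square_le) auto
  have h2: "(\<lambda>k. \<bar>W2 k\<bar> * h k) = (\<lambda>k. 2 * (\<bar>W2 k\<bar> * (norm (rho p k) * norm (rho z k))) + \<bar>W2 k\<bar> * (norm (rho z k))\<^sup>2)"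
    by (rule ext) (simp add: h_def distrib_left)
  have i2: "integrable lebesgue (\<lambda>k. \<bar>W2 k\<bar> * h k)"
    unfolding h2 using mix2(1)[OF p z] hart2_integrable[OF z] by simp
  have e2: "(\<integral>k. \<bar>W2 k\<bar> * h k \<partial>lebesgue) = 2 * mix2 p z + hart2 z"
    unfolding h2 mix2_def hart2_def using mix2(1)[OF p z] hart2_integrable[OF z] by simp
  note Wh = W_integral_le[OF hm h0 hB i2]
  have "hart u \<le> (\<integral>k. W k * (norm (rho p k))\<^sup>2 + W k * h k \<partial>lebesgue)"
    unfolding hart_def
  proof (rule integral_mono[OF hart_integrable[OF u]])
    show "integrable lebesgue (\<lambda>k. W k * (norm (rho p k))\<^sup>2 + W k * h k)"
      using hart_integrable[OF p] Wh(1) by simp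
    fix k
    have "(norm (rho u k))\<^sup>2 \<le> (norm (rho p k) + norm (rho z k))\<^sup>2"
      unfolding sum by (intro power_mono norm_triangle_ineq) simp
    also have "\<dots> = (norm (rho p k))\<^sup>2 + h k" by (simp add: h_def power2_sum)
    finally have "W k * (norm (rho u k))\<^sup>2 \<le> W k * ((norm (rho p k))\<^sup>2 + h k)" by (rule mult_left_mono) (rule W_nonneg)
    then show "W k * (norm (rho u k))\<^sup>2 \<le> W k * (norm (rho p k))\<^sup>2 + W k * h k" by (simp add: distrib_left)
  qed
  also have "\<dots> = hart p + (\<integral>k. W k * h k \<partial>lebesgue)"
    unfolding hart_def using hart_integrable[OF p] Wh(1) by simp
  finally show ?thesis using Wh(2) unfolding e2 by linarith
qed

section \<open>Continuity of the coupling energy\<close>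

lemma L1_density_difference:
  assumes u: "u \<in> L2" "sqn u \<le> 1" and v: "v \<in> L2" "sqn v \<le> 1"
  shows "(\<integral>x. \<bar>(norm (u x))\<^sup>2 - (norm (v x))\<^sup>2\<bar> \<partial>lebesgue) \<le> 2 * L2_norm (\<lambda>x. u x - v x :: complex)"
proof -
  have d: "(\<lambda>x. u x - v x) \<in> L2" using L2_diff[OF u(1) v(1)] .
  have n: "(\<lambda>x. norm (w x)) \<in> L2" if "w \<in> L2" for w :: "R3 \<Rightarrow> complex"
    using that by (auto simp: L2_def)
  have s: "(\<lambda>x. norm (u x) + norm (v x)) \<in> L2" by (intro L2_add n u v)
  have i: "integrable lebesgue (\<lambda>x. norm (u x - v x) \<bullet> (norm (u x) + norm (v x)))"
    by (rule L2_integrable_inner[OF n[OF d] s])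
  have "(\<integral>x. \<bar>(norm (u x))\<^sup>2 - (norm (v x))\<^sup>2\<bar> \<partial>lebesgue) \<le> ip (\<lambda>x. norm (u x - v x)) (\<lambda>x. norm (u x) + norm (v x))"
    unfolding ip_def
  proof (rule integral_mono[OF _ i])
    show "integrable lebesgue (\<lambda>x. \<bar>(norm (u x))\<^sup>2 - (norm (v x))\<^sup>2\<bar>)"
      using L2D(2)[OF u(1)] L2D(2)[OF v(1)] by simp
    fix x
    have "\<bar>(norm (u x))\<^sup>2 - (norm (v x))\<^sup>2\<bar> = \<bar>norm (u x) - norm (v x)\<bar> * (norm (u x) + norm (v x))"
      by (simp add: power2_eq_square square_diff_square_factored abs_mult)
    also have "\<dots> \<le> norm (u x - v x) * (norm (u x) + norm (v x))"
      by (intro mult_right_mono norm_triangle_ineq3) auto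
    finally show "\<bar>(norm (u x))\<^sup>2 - (norm (v x))\<^sup>2\<bar> \<le> norm (u x - v x) \<bullet> (norm (u x) + norm (v x))" by simp
  qed
  also have "\<dots> \<le> L2_norm (\<lambda>x. norm (u x - v x)) * L2_norm (\<lambda>x. norm (u x) + norm (v x))"
    using ip_le[OF n[OF d] s] by linarith
  also have "\<dots> \<le> L2_norm (\<lambda>x. u x - v x) * 2"
  proof (intro mult_mono)
    have le1: "L2_norm w \<le> 1" if "sqn w \<le> 1" for w :: "R3 \<Rightarrow> complex" using that by (simp add: L2_norm_sqrt)
    have "L2_norm (\<lambda>x. norm (u x) + norm (v x)) \<le> L2_norm (\<lambda>x. norm (u x)) + L2_norm (\<lambda>x. norm (v x))"
      by (rule L2_norm_triangle[OF n[OF u(1)] n[OF v(1)]])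
    also have "\<dots> = L2_norm u + L2_norm v" by (simp add: L2_norm_def)
    also have "\<dots> \<le> 2" using le1[OF u(2)] le1[OF v(2)] by simp
    finally show "L2_norm (\<lambda>x. norm (u x) + norm (v x)) \<le> 2" .
  qed (auto simp: L2_norm_def)
  finally show ?thesis by simp
qed

text \<open>\<open>weak_L3_integral_estimate\<close> for the difference of the transforms: the bound
  on sets stays fixed, while the sup bound is the square of \<delta> and enters with exponent 1/6.
  So L2 closeness makes the integral small on bounded sets of H1.\<close>

lemma hart2_difference:
  assumes u: "wgrad u G" and um[measurable]: "u \<in> borel_measurable borel" and v: "wgrad v F" and vm[measurable]: "v \<in> borel_measurable borel"
    and b: "sqn u \<le> 1" "sqn v \<le> 1" "sqn G \<le> K" "sqn F \<le> K" "0 < K"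
    and \<delta>: "2 * L2_norm (\<lambda>x. u x - v x) \<le> \<delta>" "0 < \<delta>"
  shows "integrable lebesgue (\<lambda>k. \<bar>W2 k\<bar> * (norm (rho u k - rho v k))\<^sup>2)"
    "(\<integral>k. \<bar>W2 k\<bar> * (norm (rho u k - rho v k))\<^sup>2 \<partial>lebesgue) \<le> 3 * (L3_weak_norm W2 + 1) * (4 * (density_const * K powr (6/5))) powr (5/6) * (\<delta>\<^sup>2) powr (1/6)"
    "\<And>k. norm (rho u k - rho v k) \<le> \<delta>"
proof -
  \<comment> \<open>The added 1 keeps the constant positive also if \<open>W2\<close> is
    zero.\<close>
  let ?M = "L3_weak_norm W2 + 1"
  let ?c = "density_const * K powr (6/5)"
  obtain W' where W'[measurable]: "W' \<in> borel_measurable borel" and ae: "AE k in lebesgue. W2 k = W' k"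
    and W't: "\<And>t. 0 < t \<Longrightarrow> emeasure lborel {k. t < \<bar>W' k\<bar>} \<le> ennreal ((L3_weak_norm W2 / t) ^ 3)"
    using L3_weak_representative[OF W_facts(3)] by blast
  have M0: "0 \<le> L3_weak_norm W2" by (rule L3_weak_norm_nonneg[OF W_facts(3)])
  define h where "h k = rho u k - rho v k" for k
  have rm[measurable]: "rho u \<in> borel_measurable borel" "rho v \<in> borel_measurable borel"
    unfolding rho_def by (rule ft_borel_measurable, rule borel_measurable_lebesgueI, measurable)+
  have hm[measurable]: "h \<in> borel_measurable borel" unfolding h_def[abs_def] by measurable
  have i: "integrable lebesgue (\<lambda>x. (norm (u x))\<^sup>2)" "integrable lebesgue (\<lambda>x. (norm (v x))\<^sup>2)"
    using L2D(2) wgradD(1)[OF u] wgradD(1)[OF v] by blast+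
  have hd: "norm (h k) \<le> \<delta>" for k
  proof -
    have "h k = ft (\<lambda>x. (norm (u x))\<^sup>2 - (norm (v x))\<^sup>2) k" unfolding h_def rho_def by (rule ft_diff[OF i, symmetric])
    then have "norm (h k) \<le> (\<integral>x. \<bar>(norm (u x))\<^sup>2 - (norm (v x))\<^sup>2\<bar> \<partial>lebesgue)" using norm_ft_le by simp
    also have "\<dots> \<le> 2 * L2_norm (\<lambda>x. u x - v x)" by (rule L1_density_difference[OF wgradD(1)[OF u] b(1) wgradD(1)[OF v] b(2)])
    finally show ?thesis using \<delta> by linarith
  qed
  then show "norm (rho u k - rho v k) \<le> \<delta>" for k by (simp add: h_def)
  have one: "(1::real) powr (2/3) * K = K" by simp
  have est: "(\<integral>\<^sup>+k. ennreal (\<bar>W' k\<bar> * (norm (h k))\<^sup>2) \<partial>lborel) \<le> ennreal (3 * ?M * (4 * ?c) powr (5/6) * (\<delta>\<^sup>2) powr (1/6))"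
  proof (rule weak_L3_integral_estimate[OF W' hm])
    fix t :: real assume t: "0 < t"
    have "(L3_weak_norm W2 / t) ^ 3 \<le> (?M / t) ^ 3" using M0 t by (intro power_mono divide_right_mono) auto
    then have "ennreal ((L3_weak_norm W2 / t) ^ 3) \<le> ennreal ((?M / t) ^ 3)" by (rule ennreal_leI)
    then show "emeasure lborel {k. t < \<bar>W' k\<bar>} \<le> ennreal ((?M / t) ^ 3)"
      using W't[OF t] by (rule order_trans[rotated])
  next
    show "(norm (h k))\<^sup>2 \<le> \<delta>\<^sup>2" for k using hd[of k] by (intro power_mono) auto
    fix E :: "R3 set" and \<tau> :: real assume E[measurable]: "E \<in> sets borel" and tau: "emeasure lborel E \<le> ennreal \<tau>" "0 < \<tau>"
    have z1: "(0::real) < 1" by simp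
    note eu = ft_density_estimate[OF u um b(1) z1 b(3) b(5) E tau, folded rho_def, unfolded one]
    note ev = ft_density_estimate[OF v vm b(2) z1 b(4) b(5) E tau, folded rho_def, unfolded one]
    have "(\<integral>\<^sup>+k. indicator E k * ennreal ((norm (h k))\<^sup>2) \<partial>lborel)
      \<le> (\<integral>\<^sup>+k. 2 * (indicator E k * ennreal ((norm (rho u k))\<^sup>2)) + 2 * (indicator E k * ennreal ((norm (rho v k))\<^sup>2)) \<partial>lborel)"
    proof (rule nn_integral_mono)
      fix k
      have "(norm (h k))\<^sup>2 \<le> 2 * (norm (rho u k))\<^sup>2 + 2 * (norm (rho v k))\<^sup>2"
        using norm_add_power2_le[of "rho u k" "- rho v k"] by (simp add: h_def)
      then have "ennreal ((norm (h k))\<^sup>2) \<le> ennreal (2 * (norm (rho u k))\<^sup>2 + 2 * (norm (rho v k))\<^sup>2)" by (rule ennreal_leI)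
      also have "\<dots> = 2 * ennreal ((norm (rho u k))\<^sup>2) + 2 * ennreal ((norm (rho v k))\<^sup>2)"
        by (subst ennreal_plus) (auto simp: ennreal_mult')
      finally show "indicator E k * ennreal ((norm (h k))\<^sup>2) \<le> 2 * (indicator E k * ennreal ((norm (rho u k))\<^sup>2)) + 2 * (indicator E k * ennreal ((norm (rho v k))\<^sup>2))"
        by (cases "k \<in> E") auto
    qed
    also have "\<dots> = 2 * (\<integral>\<^sup>+k. indicator E k * ennreal ((norm (rho u k))\<^sup>2) \<partial>lborel) + 2 * (\<integral>\<^sup>+k. indicator E k * ennreal ((norm (rho v k))\<^sup>2) \<partial>lborel)"
      by (subst nn_integral_add) (auto simp: nn_integral_cmult)
    also have "\<dots> \<le> 2 * ennreal (?c * \<tau> powr (1/5)) + 2 * ennreal (?c * \<tau> powr (1/5))"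
      by (intro add_mono mult_left_mono eu ev) auto
    also have "\<dots> = ennreal (4 * ?c * \<tau> powr (1/5))"
    proof -
      have "0 \<le> ?c * \<tau> powr (1/5)" using density_const_pos by simp
      then have "2 * ennreal (?c * \<tau> powr (1/5)) + 2 * ennreal (?c * \<tau> powr (1/5)) = ennreal (2 * (?c * \<tau> powr (1/5)) + 2 * (?c * \<tau> powr (1/5)))"
        by (subst ennreal_plus) (auto simp: ennreal_mult')
      also have "2 * (?c * \<tau> powr (1/5)) + 2 * (?c * \<tau> powr (1/5)) = 4 * ?c * \<tau> powr (1/5)" by linarith
      finally show ?thesis .
    qed
    finally show "(\<integral>\<^sup>+k. indicator E k * ennreal ((norm (h k))\<^sup>2) \<partial>lborel) \<le> ennreal (4 * ?c * \<tau> powr (1/5))" .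
  qed (use M0 \<delta> density_const_pos b(5) in auto)
  let ?X = "\<lambda>k. \<bar>W' k\<bar> * (norm (h k))\<^sup>2"
  have Xi: "integrable lborel ?X"
  proof (rule integrableI_bounded)
    have "(\<integral>\<^sup>+k. ennreal (norm (?X k)) \<partial>lborel) = (\<integral>\<^sup>+k. ennreal (?X k) \<partial>lborel)" by (rule nn_integral_cong) simp
    also note est
    also have "ennreal (3 * ?M * (4 * ?c) powr (5/6) * (\<delta>\<^sup>2) powr (1/6)) < \<infinity>" by simp
    finally show "(\<integral>\<^sup>+k. ennreal (norm (?X k)) \<partial>lborel) < \<infinity>" .
  qed measurable
  have Xm: "?X \<in> borel_measurable lebesgue" by (rule borel_measurable_lebesgueI) measurable
  have XL: "integrable lebesgue ?X" using Xi by (subst integrable_completion) auto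
  have hm': "h \<in> borel_measurable lebesgue" by (rule borel_measurable_lebesgueI[OF hm])
  have Ym: "(\<lambda>k. \<bar>W2 k\<bar> * (norm (h k))\<^sup>2) \<in> borel_measurable lebesgue" using W_facts(5) hm' by measurable
  have aeX: "AE k in lebesgue. ?X k = \<bar>W2 k\<bar> * (norm (h k))\<^sup>2" using ae by eventually_elim simp
  have YI: "integrable lebesgue (\<lambda>k. \<bar>W2 k\<bar> * (norm (h k))\<^sup>2)" by (rule integrable_cong_AE_imp[OF XL Ym aeX])
  then show "integrable lebesgue (\<lambda>k. \<bar>W2 k\<bar> * (norm (rho u k - rho v k))\<^sup>2)" by (simp add: h_def)
  have "(\<integral>k. \<bar>W2 k\<bar> * (norm (h k))\<^sup>2 \<partial>lebesgue) = (\<integral>k. ?X k \<partial>lebesgue)"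
    by (rule integral_cong_AE[OF Ym Xm]) (use aeX in \<open>auto elim!: eventually_mono\<close>)
  also have "\<dots> = (\<integral>k. ?X k \<partial>lborel)" by (rule integral_completion) measurable
  also have "\<dots> \<le> 3 * ?M * (4 * ?c) powr (5/6) * (\<delta>\<^sup>2) powr (1/6)"
  proof -
    have "0 \<le> 3 * ?M * (4 * ?c) powr (5/6) * (\<delta>\<^sup>2) powr (1/6)" using M0 by simp
    then show ?thesis using est nn_integral_eq_integral[OF Xi] by (simp add: ennreal_le_iff)
  qed
  finally show "(\<integral>k. \<bar>W2 k\<bar> * (norm (rho u k - rho v k))\<^sup>2 \<partial>lebesgue) \<le> 3 * ?M * (4 * ?c) powr (5/6) * (\<delta>\<^sup>2) powr (1/6)"
    by (simp add: h_def)
qed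

theorem hart_tendsto:
  assumes u: "\<And>n. wgrad (u n) (G n)" and um: "\<And>n. u n \<in> borel_measurable borel"
    and v: "wgrad v F" and vm: "v \<in> borel_measurable borel"
    and b: "\<And>n. sqn (u n) \<le> 1" "sqn v \<le> 1" "\<And>n. sqn (G n) \<le> K" "sqn F \<le> K" "0 < K"
    and lim: "(\<lambda>n. sqn (\<lambda>x. u n x - v x)) \<longlonglongrightarrow> 0"
  shows "(\<lambda>n. hart (u n)) \<longlonglongrightarrow> hart v"
proof -
  \<comment> \<open>The second summand keeps \<delta> positive, as \<open>hart2_difference\<close>
    demands, and tends to 0.\<close>
  define \<delta> where "\<delta> n = 2 * L2_norm (\<lambda>x. u n x - v x) + 1 / real (Suc n)" for n
  have \<delta>0: "0 < \<delta> n" for n unfolding \<delta>_def by (intro add_nonneg_pos) auto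
  have \<delta>le: "2 * L2_norm (\<lambda>x. u n x - v x) \<le> \<delta> n" for n by (simp add: \<delta>_def)
  have \<delta>lim: "\<delta> \<longlonglongrightarrow> 0"
  proof -
    have "(\<lambda>n. 2 * sqrt (sqn (\<lambda>x. u n x - v x)) + 1 / real (Suc n)) \<longlonglongrightarrow> 2 * sqrt 0 + 0"
      by (intro tendsto_intros lim) (use LIMSEQ_Suc[OF lim_1_over_n] in simp)
    then show ?thesis by (simp add: \<delta>_def[abs_def] L2_norm_sqrt)
  qed
  define C where "C = 3 * (L3_weak_norm W2 + 1) * (4 * (density_const * K powr (6/5))) powr (5/6)"
  define T where "T n = C * ((\<delta> n)\<^sup>2) powr (1/6)" for n
  note hd = hart2_difference[OF u um v vm b \<delta>le \<delta>0]
  have Tlim: "T \<longlonglongrightarrow> 0"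
  proof -
    have "(\<lambda>n. C * ((\<delta> n)\<^sup>2) powr (1/6)) \<longlonglongrightarrow> C * (0\<^sup>2) powr (1/6)"
      by (intro tendsto_mult tendsto_const tendsto_powr' tendsto_power \<delta>lim) auto
    then show ?thesis by (simp add: T_def[abs_def])
  qed
  have uH: "u n \<in> H1" and vH: "v \<in> H1" for n using wgrad_H1 u v by blast+
  have rv: "norm (rho v k) \<le> 1" for k using norm_rho_le[of v k] b(2) by linarith
  have bound: "\<bar>hart (u n) - hart v\<bar> \<le> M1 * ((\<delta> n)\<^sup>2 + 2 * \<delta> n) + (T n + 2 * sqrt (T n * hart2 v))" for n
  proof -
    define h where "h k = rho (u n) k - rho v k" for k
    \<comment> \<open>A bound for the difference between |rho u_n|^2 and |rho v|^2. Its first term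
      is small by \<open>hart2_difference\<close>, its second by Cauchy-Schwarz.\<close>
    define l where "l k = (norm (h k))\<^sup>2 + 2 * (norm (h k) * norm (rho v k))" for k
    have m: "rho (u n) \<in> borel_measurable lebesgue" "rho v \<in> borel_measurable lebesgue"
      using rho_measurable H1_measurable(1) uH vH by auto
    have hm: "h \<in> borel_measurable lebesgue" unfolding h_def[abs_def] using m by measurable
    have lm: "l \<in> borel_measurable lebesgue" unfolding l_def[abs_def] using hm m by measurable
    have l0: "0 \<le> l k" for k by (simp add: l_def)
    have hn: "norm (h k) \<le> \<delta> n" for k unfolding h_def by (rule hd(3))
    have lB: "l k \<le> (\<delta> n)\<^sup>2 + 2 * \<delta> n" for k
    proof -
      have "norm (h k) * norm (rho v k) \<le> \<delta> n * 1" using hn rv \<delta>0[of n] by (intro mult_mono) auto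
      moreover have "(norm (h k))\<^sup>2 \<le> (\<delta> n)\<^sup>2" using hn by (intro power_mono) auto
      ultimately show ?thesis unfolding l_def by linarith
    qed
    have hi: "integrable lebesgue (\<lambda>k. \<bar>W2 k\<bar> * (norm (h k))\<^sup>2)" unfolding h_def by (rule hd(1))
    have hT: "(\<integral>k. \<bar>W2 k\<bar> * (norm (h k))\<^sup>2 \<partial>lebesgue) \<le> T n" unfolding h_def T_def C_def by (rule hd(2))
    note cs = W2_Cauchy_Schwarz[OF hm hi m(2) hart2_integrable[OF vH], folded hart2_def]
    have l2: "(\<lambda>k. \<bar>W2 k\<bar> * l k) = (\<lambda>k. \<bar>W2 k\<bar> * (norm (h k))\<^sup>2 + 2 * (\<bar>W2 k\<bar> * (norm (h k) * norm (rho v k))))"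
      by (rule ext) (simp add: l_def distrib_left)
    have li: "integrable lebesgue (\<lambda>k. \<bar>W2 k\<bar> * l k)" unfolding l2 using hi cs(1) by simp
    have "(\<integral>k. \<bar>W2 k\<bar> * (norm (h k) * norm (rho v k)) \<partial>lebesgue) \<le> sqrt (T n * hart2 v)"
    proof (rule real_le_rsqrt)
      show "(\<integral>k. \<bar>W2 k\<bar> * (norm (h k) * norm (rho v k)) \<partial>lebesgue)\<^sup>2 \<le> T n * hart2 v"
        by (rule order_trans[OF cs(2) mult_right_mono[OF hT hart2_nonneg]])
    qed
    then have lT: "(\<integral>k. \<bar>W2 k\<bar> * l k \<partial>lebesgue) \<le> T n + 2 * sqrt (T n * hart2 v)"
      unfolding l2 using hi cs(1) hT by simp
    note Wl = W_integral_le[OF lm l0 lB li]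
    have "\<bar>hart (u n) - hart v\<bar> = \<bar>\<integral>k. W k * (norm (rho (u n) k))\<^sup>2 - W k * (norm (rho v k))\<^sup>2 \<partial>lebesgue\<bar>"
      unfolding hart_def using hart_integrable[OF uH] hart_integrable[OF vH] by simp
    also have "\<dots> \<le> (\<integral>k. \<bar>W k * (norm (rho (u n) k))\<^sup>2 - W k * (norm (rho v k))\<^sup>2\<bar> \<partial>lebesgue)"
      using integral_norm_bound[of lebesgue "\<lambda>k. W k * (norm (rho (u n) k))\<^sup>2 - W k * (norm (rho v k))\<^sup>2"] by simp
    also have "\<dots> \<le> (\<integral>k. W k * l k \<partial>lebesgue)"
    proof (rule integral_mono[OF _ Wl(1)])
      show "integrable lebesgue (\<lambda>k. \<bar>W k * (norm (rho (u n) k))\<^sup>2 - W k * (norm (rho v k))\<^sup>2\<bar>)"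
        using hart_integrable[OF uH] hart_integrable[OF vH] by simp
      fix k
      have tr: "\<bar>norm (rho (u n) k) - norm (rho v k)\<bar> \<le> norm (h k)" unfolding h_def by (rule norm_triangle_ineq3)
      have "\<bar>(norm (rho (u n) k))\<^sup>2 - (norm (rho v k))\<^sup>2\<bar> = \<bar>norm (rho (u n) k) - norm (rho v k)\<bar> * (norm (rho (u n) k) + norm (rho v k))"
        by (simp add: power2_eq_square square_diff_square_factored abs_mult)
      also have "\<dots> \<le> norm (h k) * (norm (h k) + 2 * norm (rho v k))"
        using tr by (intro mult_mono) auto
      also have "\<dots> = l k" by (simp add: l_def power2_eq_square algebra_simps)
      finally have "W k * \<bar>(norm (rho (u n) k))\<^sup>2 - (norm (rho v k))\<^sup>2\<bar> \<le> W k * l k"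
        by (rule mult_left_mono) (rule W_nonneg)
      moreover have "\<bar>W k * (norm (rho (u n) k))\<^sup>2 - W k * (norm (rho v k))\<^sup>2\<bar> = W k * \<bar>(norm (rho (u n) k))\<^sup>2 - (norm (rho v k))\<^sup>2\<bar>"
        using W_nonneg[of k] by (simp add: right_diff_distrib[symmetric] abs_mult)
      ultimately show "\<bar>W k * (norm (rho (u n) k))\<^sup>2 - W k * (norm (rho v k))\<^sup>2\<bar> \<le> W k * l k" by simp
    qed
    finally show ?thesis using Wl(2) lT by linarith
  qed
  have "(\<lambda>n. M1 * ((\<delta> n)\<^sup>2 + 2 * \<delta> n) + (T n + 2 * sqrt (T n * hart2 v))) \<longlonglongrightarrow> M1 * (0\<^sup>2 + 2 * 0) + (0 + 2 * sqrt (0 * hart2 v))"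
    by (intro tendsto_intros \<delta>lim Tlim)
  then have "(\<lambda>n. M1 * ((\<delta> n)\<^sup>2 + 2 * \<delta> n) + (T n + 2 * sqrt (T n * hart2 v))) \<longlonglongrightarrow> 0" by simp
  then have "(\<lambda>n. hart (u n) - hart v) \<longlonglongrightarrow> 0"
    by (rule Lim_null_comparison[rotated]) (use bound in \<open>auto intro!: always_eventually\<close>)
  then show ?thesis by (rule LIM_zero_cancel)
qed

end

text \<open>Completing the square in sqrt(\<omega>) f with \<kappa> = g v rho / sqrt(\<omega>),
  whose squared modulus is W |rho|^2. The minimum is attained where sqrt(\<omega>) f is minus the
  conjugate of \<kappa>.\<close>

lemma energy_minimal_field:
  assumes fd: "field_data \<omega> v" and u: "u \<in> L2"
    and i: "integrable lebesgue (\<lambda>k. field_W \<omega> v g k * (norm (rho u k))\<^sup>2)"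
  shows "\<And>f. f \<in> field_states \<omega> \<Longrightarrow> qform V u - (\<integral>k. field_W \<omega> v g k * (norm (rho u k))\<^sup>2 \<partial>lebesgue) \<le> energy V \<omega> v g u f"
    and "\<exists>f\<in>field_states \<omega>. energy V \<omega> v g u f = qform V u - (\<integral>k. field_W \<omega> v g k * (norm (rho u k))\<^sup>2 \<partial>lebesgue)"
proof -
  have [measurable]: "\<omega> \<in> borel_measurable lebesgue" "v \<in> borel_measurable lebesgue" "rho u \<in> borel_measurable lebesgue"
    and w0: "\<And>k. 0 \<le> \<omega> k" and w: "AE k in lebesgue. 0 < \<omega> k"
    using fd rho_measurable[OF u] by (auto simp: field_data_def)
  define \<kappa> where "\<kappa> k = complex_of_real (g * v k / sqrt (\<omega> k)) * rho u k" for k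
  have \<kappa>m[measurable]: "\<kappa> \<in> borel_measurable lebesgue" unfolding \<kappa>_def[abs_def] by measurable
  have \<kappa>2: "(norm (\<kappa> k))\<^sup>2 = field_W \<omega> v g k * (norm (rho u k))\<^sup>2" for k
    unfolding \<kappa>_def field_W_def norm_mult norm_of_real power_mult_distrib power2_abs
    using real_sqrt_pow2[OF w0[of k]] by (simp add: power_divide power_mult_distrib divide_inverse mult_ac power_inverse)
  have \<kappa>L: "\<kappa> \<in> L2" using i \<kappa>m by (simp add: L2_def \<kappa>2)
  have \<kappa>s: "sqn \<kappa> = (\<integral>k. field_W \<omega> v g k * (norm (rho u k))\<^sup>2 \<partial>lebesgue)" by (simp add: sqn_def \<kappa>2)
  have en: "energy V \<omega> v g u f = qform V u + sqn (\<lambda>k. complex_of_real (sqrt (\<omega> k)) * f k + cnj (\<kappa> k)) - sqn \<kappa>"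
    if f: "f \<in> field_states \<omega>" for f
  proof -
    define h where "h k = complex_of_real (sqrt (\<omega> k)) * f k" for k
    have fm[measurable]: "f \<in> borel_measurable lebesgue" and hL: "h \<in> L2"
      using f by (auto simp: field_states_def h_def[abs_def])
    have hm[measurable]: "h \<in> borel_measurable lebesgue" using L2D(1)[OF hL] .
    have s: "(\<integral>k. \<omega> k * (norm (f k))\<^sup>2 \<partial>lebesgue) = sqn h"
      unfolding sqn_def h_def using w0 by (simp add: norm_mult power_mult_distrib)
    \<comment> \<open>The factor \<open>g\<close> is taken inside by a rule that holds without
      integrability: for \<open>g = 0\<close> the coupling integral may diverge, and both sides are
      0.\<close>
    have "complex_of_real g * (\<integral>k. complex_of_real (v k) * f k * rho u k \<partial>lebesgue) = (\<integral>k. complex_of_real g * (complex_of_real (v k) * f k * rho u k) \<partial>lebesgue)"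
      by (rule integral_mult_right_zero[symmetric])
    also have "\<dots> = (\<integral>k. h k * \<kappa> k \<partial>lebesgue)"
    proof (rule integral_cong_AE)
      show "AE k in lebesgue. complex_of_real g * (complex_of_real (v k) * f k * rho u k) = h k * \<kappa> k"
        using w by eventually_elim (simp add: h_def \<kappa>_def field_simps)
    qed measurable
    finally have cg: "complex_of_real g * (\<integral>k. complex_of_real (v k) * f k * rho u k \<partial>lebesgue) = (\<integral>k. h k * \<kappa> k \<partial>lebesgue)" .
    have "g * Re (\<integral>k. complex_of_real (v k) * f k * rho u k \<partial>lebesgue) = Re (\<integral>k. h k * \<kappa> k \<partial>lebesgue)"
      unfolding cg[symmetric] by simp
    also have "\<dots> = (\<integral>k. Re (h k * \<kappa> k) \<partial>lebesgue)"
      by (rule integral_Re[symmetric]) (rule L2_integrable_mult[OF hL \<kappa>L])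
    also have "\<dots> = ip h (\<lambda>k. cnj (\<kappa> k))" by (simp add: ip_def inner_complex_def)
    finally have c: "g * Re (\<integral>k. complex_of_real (v k) * f k * rho u k \<partial>lebesgue) = ip h (\<lambda>k. cnj (\<kappa> k))" .
    have "energy V \<omega> v g u f = qform V u + sqn h + 2 * ip h (\<lambda>k. cnj (\<kappa> k))"
      using c s by (simp add: energy_def qform_def sqn_def[of "weak_grad u"] rho_def ft_def)
    moreover have "sqn (\<lambda>k. h k + cnj (\<kappa> k)) = sqn h + 2 * ip h (\<lambda>k. cnj (\<kappa> k)) + sqn (\<lambda>k. cnj (\<kappa> k))"
      by (rule sqn_add[OF hL L2_cnj[OF \<kappa>L]])
    moreover have "sqn (\<lambda>k. cnj (\<kappa> k)) = sqn \<kappa>" by (simp add: sqn_def)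
    ultimately show ?thesis by (simp add: h_def)
  qed
  show "qform V u - (\<integral>k. field_W \<omega> v g k * (norm (rho u k))\<^sup>2 \<partial>lebesgue) \<le> energy V \<omega> v g u f" if "f \<in> field_states \<omega>" for f
    using en[OF that] sqn_nonneg[of "\<lambda>k. complex_of_real (sqrt (\<omega> k)) * f k + cnj (\<kappa> k)"] unfolding \<kappa>s by linarith
  \<comment> \<open>The zeros of \<omega>, where the quotient has the default value 0, form a null
    set.\<close>
  define f where "f k = - cnj (\<kappa> k) / complex_of_real (sqrt (\<omega> k))" for k
  have cm[measurable]: "(\<lambda>k. cnj (\<kappa> k)) \<in> borel_measurable lebesgue" using L2D(1)[OF L2_cnj[OF \<kappa>L]] .
  have fm: "f \<in> borel_measurable lebesgue" unfolding f_def[abs_def] by measurable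
  have sm: "(\<lambda>k. complex_of_real (sqrt (\<omega> k)) * f k) \<in> borel_measurable lebesgue" using fm by measurable
  have fk: "AE k in lebesgue. complex_of_real (sqrt (\<omega> k)) * f k = - cnj (\<kappa> k)"
    using w by eventually_elim (simp add: f_def)
  have "(\<lambda>k. complex_of_real (sqrt (\<omega> k)) * f k) \<in> L2"
    by (rule L2_cong_AE[OF L2_uminus[OF L2_cnj[OF \<kappa>L]] sm]) (use fk in \<open>auto elim!: eventually_mono\<close>)
  then have fs: "f \<in> field_states \<omega>" using fm by (simp add: field_states_def)
  have "sqn (\<lambda>k. complex_of_real (sqrt (\<omega> k)) * f k + cnj (\<kappa> k)) = sqn (\<lambda>k. 0 :: complex)"
  proof (rule sqn_cong_AE)
    show "(\<lambda>k. complex_of_real (sqrt (\<omega> k)) * f k + cnj (\<kappa> k)) \<in> borel_measurable lebesgue" using sm cm by measurable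
    show "AE k in lebesgue. complex_of_real (sqrt (\<omega> k)) * f k + cnj (\<kappa> k) = 0" using fk by eventually_elim simp
  qed simp
  then have "energy V \<omega> v g u f = qform V u - sqn \<kappa>" using en[OF fs] by (simp add: sqn_def)
  then show "\<exists>f\<in>field_states \<omega>. energy V \<omega> v g u f = qform V u - (\<integral>k. field_W \<omega> v g k * (norm (rho u k))\<^sup>2 \<partial>lebesgue)"
    using fs unfolding \<kappa>s by blast
qed


section \<open>Minimizing sequences\<close>

text \<open>
  Here \<open>m\<close> is the mass of the part of the state far out, \<open>q\<close> its quadratic form, \<open>G\<close> the square norm
  of its gradient and \<open>x\<close> its coupling with the rest. The two lower bounds of \<open>q\<close> are mixed with
  weights \<open>1 - \<theta>\<close> and \<open>\<theta>\<close>; the gradient term of the second one absorbs \<open>x\<close>.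
\<close>

lemma localized_mass_arithmetic:
  fixes a b c D L A M1 K m \<kappa> q G x \<nu> \<nu>' I :: real
  assumes c: "0 < c" and D: "0 < D" and L: "0 \<le> L" and A: "0 \<le> A" "4 * A \<le> c" and M1: "0 \<le> M1"
    and small: "M1 + A * (1 + 2 * (L + 1) / c + 4 * L / c) \<le> D / 30"
    and K: "K = 2 / c * (L + 1 + M1)"
    and mu: "\<nu> + b = L" "\<nu>' = \<nu> + D" "I \<le> \<nu>" and m: "0 \<le> m" and G: "0 \<le> G"
    and q1: "(\<nu>' - D / 4) * m \<le> q" and q2: "c * G - b * m \<le> q"
    and q3: "q - m * I \<le> \<kappa> + 2 * M1 * m + A * (K + 1) * m + 2 * x"
    and x: "x\<^sup>2 \<le> A\<^sup>2 * (K + 1) * m * G"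
  shows "m * D / 4 \<le> \<kappa>"
proof -
  \<comment> \<open>The weight with \<theta> (D + L) = D / 4: reserving this fraction of the form
    for the gradient costs at most a quarter of the gap.\<close>
  define \<theta> where "\<theta> = D / (4 * (D + L))"
  define t where "t = \<theta> * c"
  have DL: "0 < D + L" using D L by linarith
  have \<theta>0: "0 < \<theta>" unfolding \<theta>_def using D DL by simp
  have \<theta>1: "\<theta> \<le> 1" unfolding \<theta>_def using D L DL by (simp add: field_simps)
  have \<theta>DL: "\<theta> * (D + L) = D / 4" unfolding \<theta>_def using DL by (simp add: field_simps)
  have t: "0 < t" using \<theta>0 c by (simp add: t_def)
  have K0: "0 \<le> K" using c L M1 by (simp add: K)
  \<comment> \<open>\<open>X\<close> is A (K + 1) apart from the contribution of \<open>M1\<close>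
    to \<open>K\<close>. Smallness of \<open>Y\<close> is what yields A \<le> 2 t.\<close>
  define X where "X = A * (1 + 2 * (L + 1) / c)"
  define Y where "Y = A * (4 * L / c)"
  have XY: "A * (1 + 2 * (L + 1) / c + 4 * L / c) = X + Y" by (simp add: X_def Y_def distrib_left)
  have X0: "0 \<le> X" "0 \<le> Y" using A c L by (auto simp: X_def Y_def)
  have AK: "A * (K + 1) \<le> X + M1 / 2"
  proof -
    have "A * (K + 1) = X + (A / c) * (2 * M1)" unfolding K X_def using c by (simp add: field_simps)
    moreover have "(A / c) * (2 * M1) \<le> (1 / 4) * (2 * M1)" using A c M1 by (intro mult_right_mono) (auto simp: field_simps)
    ultimately show ?thesis by linarith
  qed
  have At: "A \<le> 2 * t"
  proof -
    have "A * (D + L) = A * D + Y * c / 4" unfolding Y_def using c by (simp add: field_simps)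
    also have "\<dots> \<le> (c / 4) * D + (D / 30) * c / 4"
      using A(2) D c X0 M1 small unfolding XY by (intro add_mono mult_right_mono divide_right_mono) auto
    also have "\<dots> \<le> (D / 4) * c * 2" using D c by simp
    also have "\<dots> = 2 * t * (D + L)" unfolding t_def \<theta>DL[symmetric] by (simp add: algebra_simps)
    finally show ?thesis using DL by simp
  qed
  define B where "B = A * (K + 1) * m"
  have B0: "0 \<le> B" using A K0 m by (simp add: B_def)
  \<comment> \<open>Arithmetic-geometric mean: x^2 \<le> A B G \<le> 2 t B G, so the gradient part t
    G of the reserved fraction absorbs the mixed term.\<close>
  have x2: "2 * x \<le> 2 * B + t * G"
  proof (rule power2_le_imp_le)
    have "x\<^sup>2 \<le> A * (B * G)" using x by (simp add: B_def power2_eq_square mult_ac)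
    also have "\<dots> \<le> 2 * t * (B * G)" using At B0 G by (intro mult_right_mono) auto
    finally have "(2 * x)\<^sup>2 \<le> 4 * (2 * B) * (t * G)" by (simp add: power_mult_distrib mult_ac)
    also have "\<dots> \<le> (2 * B + t * G)\<^sup>2"
      using zero_le_power2[of "2 * B - t * G"] by (simp add: power2_eq_square algebra_simps)
    finally show "(2 * x)\<^sup>2 \<le> (2 * B + t * G)\<^sup>2" .
  qed (use B0 t G in auto)
  have "(1 - \<theta>) * ((\<nu>' - D / 4) * m) + \<theta> * (c * G - b * m) \<le> (1 - \<theta>) * q + \<theta> * q"
    using q1 q2 \<theta>0 \<theta>1 by (intro add_mono mult_left_mono) auto
  also have "\<dots> = q" by (simp add: algebra_simps)
  also have "\<dots> \<le> m * I + \<kappa> + 2 * M1 * m + 3 * B + t * G" using q3 x2 unfolding B_def[symmetric] by linarith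
  also have "m * I \<le> m * \<nu>" using mu m by (intro mult_left_mono) auto
  finally have 1: "(1 - \<theta>) * ((\<nu>' - D / 4) * m) - \<theta> * b * m - m * \<nu> \<le> \<kappa> + 2 * M1 * m + 3 * B"
    by (simp add: t_def algebra_simps)
  have "(1 - \<theta>) * ((\<nu>' - D / 4) * m) - \<theta> * b * m - m * \<nu> = m * (D - D / 4 - \<theta> * (D + L) + \<theta> * D / 4)"
    unfolding mu(2) mu(1)[symmetric] by (simp add: field_simps)
  \<comment> \<open>Of the gap \<open>D\<close>, one quarter is lost in the first lower bound of
    \<open>q\<close> and at most one quarter to the reserved fraction.\<close>
  also have "\<dots> \<ge> m * (D / 2)"
    unfolding \<theta>DL using m \<theta>0 D by (intro mult_left_mono) auto
  finally have 2: "m * (D / 2) \<le> \<kappa> + 2 * M1 * m + 3 * B" using 1 by linarith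
  \<comment> \<open>The errors amount to at most 7/2 times the small quantity, that is 7 D / 60 < D
    / 4, and a quarter of the gap is left.\<close>
  have "B \<le> (X + M1 / 2) * m" unfolding B_def using AK m by (intro mult_right_mono) auto
  then have "2 * M1 * m + 3 * B \<le> (7 / 2 * M1 + 3 * X) * m" by (simp add: algebra_simps)
  also have "\<dots> \<le> (D / 4) * m" using small X0 M1 D m unfolding XY by (intro mult_right_mono) auto
  finally show ?thesis using 2 by (simp add: field_simps)
qed

text \<open>\<open>small_L3\<close> makes the reduced energy coercive. The bracket in
  \<open>small_gap\<close> has two origins: 1 + 2 (mu + b + 1)/(1 - a) is 1 plus the gradient bound
  of near minimizers apart from \<open>M1\<close>, and 4 (mu + b)/(1 - a) is what lets the far
  gradient absorb the mixed term.\<close>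

locale bound_state =
  nontrivial_potential V a b + outer: nontrivial_potential V1 0 0 + field_weight W W1 W2
  for V V1 V2 a b W W1 W2 +
  assumes decomposition: "decomposition_A V V1 V2"
    and small_L3: "4 * A2 \<le> 1 - a"
    and small_gap: "M1 + A2 * (1 + 2 * (\<mu> V + b + 1) / (1 - a) + 4 * (\<mu> V + b) / (1 - a)) \<le> (\<mu> V1 - \<mu> V) / 30"
begin

definition sphere_states :: "(R3 \<Rightarrow> complex) set" where
  "sphere_states = {u \<in> form_domain V. sqn u = 1}"

definition reduced_energy :: "(R3 \<Rightarrow> complex) \<Rightarrow> real" where
  "reduced_energy u = qform V u - hart u"

definition infimum :: real where
  "infimum = Inf (reduced_energy ` sphere_states)"

text \<open>Bounds the squared gradient of states whose reduced energy exceeds the infimum by at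
  most 1; this tolerance is the summand 1.\<close>

definition gradient_bound :: real where
  "gradient_bound = 2 / (1 - a) * (\<mu> V + b + 1 + M1)"

lemma gap: "0 < \<mu> V1 - \<mu> V"
  using decomposition by (simp add: decomposition_A_def)

lemma shifted_mu_nonneg: "0 \<le> \<mu> V + b"
  using ground_energy_ge by (simp add: mu_eq_ground_energy)

lemma gradient_bound_nonneg: "0 \<le> gradient_bound"
  unfolding gradient_bound_def using a_less shifted_mu_nonneg M1_nonneg by simp

lemma reduced_energy_coercive:
  assumes "u \<in> sphere_states"
  shows "(1 - a) / 2 * sqn (weak_grad u) \<le> reduced_energy u + b + M1"
proof -
  have u: "u \<in> form_domain V" "sqn u = 1" using assms by (auto simp: sphere_states_def)
  have "A2 * sqn (weak_grad u) \<le> (1 - a) / 4 * sqn (weak_grad u)" using small_L3 by (intro mult_right_mono) auto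
  moreover have "0 \<le> (1 - a) / 4 * sqn (weak_grad u)" using a_less by simp
  moreover have "(1 - a) * sqn (weak_grad u) \<le> qform V u + b"
    using qform_coercive[OF u(1)] pos_energy_nonneg[of u] u(2) by simp
  moreover have "hart u \<le> M1 + A2 * sqn (weak_grad u)" using hart_le[OF domainD(1)[OF u(1)]] u(2) by simp
  ultimately show ?thesis unfolding reduced_energy_def by (simp add: field_simps)
qed

lemma sphere_states_nonempty: "sphere_states \<noteq> {}"
  using sphere_nonempty by (simp add: sphere_states_def)

lemma infimum_le:
  assumes "u \<in> sphere_states" shows "infimum \<le> reduced_energy u"
  unfolding infimum_def
proof (rule cInf_lower)
  show "bdd_below (reduced_energy ` sphere_states)"
  proof (rule bdd_belowI2)
    fix u assume "u \<in> sphere_states"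
    moreover have "0 \<le> (1 - a) / 2 * sqn (weak_grad u)" using a_less by simp
    ultimately show "- b - M1 \<le> reduced_energy u" using reduced_energy_coercive[of u] by linarith
  qed
qed (use assms in auto)

lemma infimum_le_mu: "infimum \<le> \<mu> V"
proof (rule field_le_epsilon)
  fix e :: real assume "0 < e"
  then obtain u where u: "u \<in> form_domain V" "sqn u = 1" "qform V u < ground_energy + e"
    using ground_energy_approx by blast
  then have "infimum \<le> reduced_energy u" by (intro infimum_le) (simp add: sphere_states_def)
  then show "infimum \<le> \<mu> V + e" using u(3) hart_nonneg[of u] by (simp add: reduced_energy_def mu_eq_ground_energy)
qed

lemma infimum_approx:
  assumes "0 < e" obtains u where "u \<in> sphere_states" "reduced_energy u < infimum + e"
proof -
  have "Inf (reduced_energy ` sphere_states) < infimum + e" using assms by (simp add: infimum_def)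
  from cInf_lessD[OF _ this] show ?thesis using that sphere_states_nonempty by auto
qed

lemma sqn_weak_grad_le:
  assumes "u \<in> sphere_states" "reduced_energy u \<le> infimum + 1"
  shows "sqn (weak_grad u) \<le> gradient_bound"
proof -
  have "(1 - a) / 2 * sqn (weak_grad u) \<le> \<mu> V + b + 1 + M1"
    using reduced_energy_coercive[OF assms(1)] assms(2) infimum_le_mu by linarith
  then show ?thesis unfolding gradient_bound_def using a_less by (simp add: field_simps)
qed

text \<open>Normalizing \<open>p\<close> divides the form by its mass and the quartic coupling by
  the square of its mass. After multiplication by the mass, which is at most 1, the coupling is
  still divided by it, hence at least \<open>hart p\<close>. So splitting off mass brings no
  gain.\<close>

lemma infimum_scaled:
  assumes p: "p \<in> form_domain V" and le: "sqn p \<le> 1"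
  shows "sqn p * infimum + hart p \<le> qform V p"
proof (cases "sqn p = 0")
  case True
  then show ?thesis using qform_ge[OF p] hart_zero by simp
next
  case False
  then have l: "0 < sqn p" using sqn_nonneg[of p] by linarith
  note n = normalized[OF p l]
  have "infimum \<le> qform V p / sqn p - (1 / sqrt (sqn p)) ^ 4 * hart p"
    using infimum_le[of "\<lambda>x. (1 / sqrt (sqn p)) *\<^sub>R p x"] n by (simp add: sphere_states_def reduced_energy_def hart_scaleR)
  also have "(1 / sqrt (sqn p)) ^ 4 = 1 / (sqn p)\<^sup>2"
    using real_sqrt_pow2[of "sqn p"] power_mult[of "sqrt (sqn p)" 2 2] by (simp add: power_divide)
  finally have "sqn p * infimum \<le> sqn p * (qform V p / sqn p - 1 / (sqn p)\<^sup>2 * hart p)"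
    using l by (intro mult_left_mono) auto
  also have "\<dots> = qform V p - hart p / sqn p" using l by (simp add: field_simps power2_eq_square)
  also have "\<dots> \<le> qform V p - hart p" using l le hart_nonneg[of p] by (simp add: field_simps mult_left_le_one_le)
  finally show ?thesis by simp
qed

text \<open>On the support of \<open>z\<close> one has V \<ge> V1 - e, so \<open>z\<close> is in the
  form domain of \<open>V1\<close> and the bottom of the spectrum for \<open>V1\<close> bounds its
  form from below.\<close>

lemma qform_outside:
  assumes z: "z \<in> form_domain V" and R: "\<And>x. norm x \<le> R \<Longrightarrow> z x = 0"
    and e: "0 \<le> e" "\<And>x. R < norm x \<Longrightarrow> \<bar>V2 x\<bar> \<le> e"
  shows "(\<mu> V1 - e) * sqn z \<le> qform V z"
proof -
  have ae: "AE x in lebesgue. V x = V1 x + V2 x" and V1: "\<And>x. 0 \<le> V1 x"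
    using decomposition by (auto simp: decomposition_A_def)
  note zd = domainD[OF z]
  have le: "V1 x * (norm (z x))\<^sup>2 \<le> V x * (norm (z x))\<^sup>2 + e * (norm (z x))\<^sup>2" if "V x = V1 x + V2 x" for x
  proof (cases "norm x \<le> R")
    case False
    then have "V1 x \<le> V x + e" using e(2)[of x] that by auto
    then show ?thesis unfolding distrib_right[symmetric] by (intro mult_right_mono) auto
  qed (simp add: R)
  have i: "integrable lebesgue (\<lambda>x. V x * (norm (z x))\<^sup>2 + e * (norm (z x))\<^sup>2)"
    using zd(8) L2D(2)[OF zd(2)] by simp
  have m: "(\<lambda>x. V1 x * (norm (z x))\<^sup>2) \<in> borel_measurable lebesgue"
    using outer.V_measurable zd(4) by measurable
  have ae_le: "AE x in lebesgue. V1 x * (norm (z x))\<^sup>2 \<le> V x * (norm (z x))\<^sup>2 + e * (norm (z x))\<^sup>2"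
    using ae by eventually_elim (rule le)
  have i1: "integrable lebesgue (\<lambda>x. V1 x * (norm (z x))\<^sup>2)"
  proof (rule Bochner_Integration.integrable_bound[OF i m])
    show "AE x in lebesgue. norm (V1 x * (norm (z x))\<^sup>2) \<le> norm (V x * (norm (z x))\<^sup>2 + e * (norm (z x))\<^sup>2)"
      using ae_le
    proof eventually_elim
      case (elim x)
      moreover have "0 \<le> V1 x * (norm (z x))\<^sup>2" using V1 by simp
      ultimately show ?case by simp
    qed
  qed
  have "pos_part V1 = V1" using V1 by (auto simp: pos_part_def max_absorb1)
  then have z1: "z \<in> form_domain V1" using zd(1) i1 by (simp add: form_domain_def)
  have "\<mu> V1 * sqn z \<le> qform V1 z" unfolding outer.mu_eq_ground_energy by (rule outer.ground_energy_le[OF z1])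
  also have "\<dots> \<le> sqn (weak_grad z) + (\<integral>x. V x * (norm (z x))\<^sup>2 + e * (norm (z x))\<^sup>2 \<partial>lebesgue)"
    unfolding qform_def using integral_mono_AE[OF i1 i ae_le] by simp
  also have "\<dots> = qform V z + e * sqn z"
    using zd(8) L2D(2)[OF zd(2)] by (simp add: qform_def sqn_def[of z])
  finally show ?thesis by (simp add: algebra_simps)
qed

text \<open>Subtracting the lower bound of \<open>infimum_scaled\<close> for the near part from the
  energy of \<open>u\<close> leaves an upper bound for the form of the far part, which the gap
  permits only if its mass is of order \<kappa> + 1/R^2. The 8 is the 4 of
  \<open>localized_mass_arithmetic\<close> times the 2 of the localization.\<close>

theorem mass_outside:
  assumes u: "u \<in> sphere_states" "reduced_energy u \<le> infimum + \<kappa>" "\<kappa> \<le> 1"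
    and R: "0 < R" "ims_const / R\<^sup>2 \<le> 1" and V2: "\<And>x. R < norm x \<Longrightarrow> \<bar>V2 x\<bar> \<le> (\<mu> V1 - \<mu> V) / 4"
  shows "sqn (\<lambda>x. indicator (- cball 0 (2 * R)) x *\<^sub>R u x) * (\<mu> V1 - \<mu> V) \<le> 8 * (\<kappa> + ims_const / R\<^sup>2)"
proof -
  define D where "D = \<mu> V1 - \<mu> V"
  define K where "K = gradient_bound"
  have uS: "u \<in> form_domain V" "sqn u = 1" using u(1) by (auto simp: sphere_states_def)
  obtain p z where p: "p \<in> form_domain V" and z: "z \<in> form_domain V"
    and pz: "\<And>x. (norm (p x))\<^sup>2 + (norm (z x))\<^sup>2 = (norm (u x))\<^sup>2"
    and z0: "\<And>x. norm x \<le> R \<Longrightarrow> z x = 0"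
    and zu: "\<And>x. 2 * R < norm x \<Longrightarrow> (norm (u x))\<^sup>2 \<le> 2 * (norm (z x))\<^sup>2"
    and gr: "sqn (weak_grad p) + sqn (weak_grad z) \<le> sqn (weak_grad u) + ims_const / R\<^sup>2 * sqn u"
    and qf: "qform V p + qform V z \<le> qform V u + ims_const / R\<^sup>2 * sqn u"
    using ims_localization[OF uS(1) R(1)] by blast
  note pd = domainD[OF p] and zd = domainD[OF z] and ud = domainD[OF uS(1)]
  define m where "m = sqn z"
  have sp: "sqn p + m = 1"
    unfolding uS(2)[symmetric] m_def sqn_def pz[symmetric] using L2D(2)[OF pd(2)] L2D(2)[OF zd(2)] by simp
  have m: "0 \<le> m" "m \<le> 1" "sqn p \<le> 1" using sp sqn_nonneg[of p] sqn_nonneg[of z] unfolding m_def by linarith+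
  have guK: "sqn (weak_grad u) \<le> K" unfolding K_def using u by (intro sqn_weak_grad_le) auto
  have gp: "sqn (weak_grad p) \<le> K + 1" and gz: "sqn (weak_grad z) \<le> K + 1"
    using gr guK R(2) sqn_nonneg[of "weak_grad p"] sqn_nonneg[of "weak_grad z"] unfolding uS(2) mult_1_right by linarith+
  have K0: "0 \<le> K" unfolding K_def by (rule gradient_bound_nonneg)
  have h2z: "hart2 z \<le> A2 * m * sqn (weak_grad z)" unfolding m_def by (rule hart2_le[OF zd(1)])
  have h2z': "hart2 z \<le> A2 * (K + 1) * m"
  proof -
    have "A2 * m * sqn (weak_grad z) \<le> A2 * m * (K + 1)" using gz A2_nonneg m by (intro mult_left_mono) auto
    then show ?thesis using h2z by (simp add: mult_ac)
  qed
  have h2p: "hart2 p \<le> A2 * (K + 1)"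
  proof -
    have "A2 * sqn p * sqn (weak_grad p) \<le> A2 * 1 * (K + 1)"
      using gp A2_nonneg m by (intro mult_mono mult_left_mono) auto
    then show ?thesis using hart2_le[OF pd(1)] by simp
  qed
  have x: "(mix2 p z)\<^sup>2 \<le> A2\<^sup>2 * (K + 1) * m * sqn (weak_grad z)"
  proof -
    have "hart2 p * hart2 z \<le> (A2 * (K + 1)) * (A2 * m * sqn (weak_grad z))"
      using h2p h2z A2_nonneg K0 by (intro mult_mono) (auto simp: hart2_nonneg)
    then show ?thesis using mix2(2)[OF pd(1) zd(1)] by (simp add: power2_eq_square mult_ac)
  qed
  have "m * D / 4 \<le> \<kappa> + ims_const / R\<^sup>2"
  proof (rule localized_mass_arithmetic[where c = "1 - a" and L = "\<mu> V + b" and A = A2 and K = K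
        and \<nu> = "\<mu> V" and \<nu>' = "\<mu> V1" and I = infimum and q = "qform V z" and x = "mix2 p z"])
    show "qform V z - m * infimum \<le> \<kappa> + ims_const / R\<^sup>2 + 2 * M1 * m + A2 * (K + 1) * m + 2 * mix2 p z"
    proof -
      have h: "hart u \<le> hart p + M1 * (2 * (sqn p * m) + m\<^sup>2) + 2 * mix2 p z + hart2 z"
        unfolding m_def by (rule hart_localization[OF ud(1) pd(1) zd(1) pz])
      \<comment> \<open>Eliminating the near mass makes the \<open>M1\<close> term linear in
        \<open>m\<close>: 2 (1 - m) m + m^2 \<le> 2 m.\<close>
      have pm: "sqn p = 1 - m" using sp by simp
      have "2 * (sqn p * m) + m\<^sup>2 = 2 * m - m\<^sup>2" unfolding pm by (simp add: algebra_simps power2_eq_square)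
      then have "2 * (sqn p * m) + m\<^sup>2 \<le> 2 * m" using zero_le_power2[of m] by linarith
      then have "M1 * (2 * (sqn p * m) + m\<^sup>2) \<le> M1 * (2 * m)" using M1_nonneg by (intro mult_left_mono)
      moreover have "sqn p * infimum = infimum - m * infimum" unfolding pm by (simp add: algebra_simps)
      ultimately show ?thesis
        using h infimum_scaled[OF p m(3)] qf u(2) uS(2) h2z' unfolding reduced_energy_def by simp
    qed
    show "(\<mu> V1 - D / 4) * m \<le> qform V z"
      unfolding m_def D_def using gap by (intro qform_outside[OF z z0 _ V2]) auto
    show "(1 - a) * sqn (weak_grad z) - b * m \<le> qform V z"
      using qform_coercive[OF z] pos_energy_nonneg[of z] by (simp add: m_def)
    show "K = 2 / (1 - a) * (\<mu> V + b + 1 + M1)" by (simp add: K_def gradient_bound_def)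
  qed (use a_less gap shifted_mu_nonneg A2_nonneg M1_nonneg small_L3 small_gap infimum_le_mu m x in \<open>simp_all add: D_def\<close>)
  moreover have "sqn (\<lambda>x. indicator (- cball 0 (2 * R)) x *\<^sub>R u x) \<le> sqn (\<lambda>x. sqrt 2 *\<^sub>R z x)"
  proof (rule sqn_mono)
    have "indicator (- cball 0 (2 * R)) \<in> borel_measurable (lebesgue :: R3 measure)"
      by (rule borel_measurable_indicator) simp
    then show "(\<lambda>x. indicator (- cball 0 (2 * R)) x *\<^sub>R u x) \<in> borel_measurable lebesgue"
      using ud(4) by (intro borel_measurable_scaleR)
    show "AE x in lebesgue. norm (indicator (- cball 0 (2 * R)) x *\<^sub>R u x) \<le> norm (sqrt 2 *\<^sub>R z x)"
    proof (rule AE_I2)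
      fix x
      show "norm (indicator (- cball 0 (2 * R)) x *\<^sub>R u x) \<le> norm (sqrt 2 *\<^sub>R z x)"
      proof (cases "2 * R < norm x")
        case True
        then have "(norm (u x))\<^sup>2 \<le> (norm (sqrt 2 *\<^sub>R z x))\<^sup>2" using zu by (simp add: power_mult_distrib)
        then have "norm (u x) \<le> norm (sqrt 2 *\<^sub>R z x)" by (rule power2_le_imp_le) simp
        then show ?thesis using True by (simp add: indicator_def)
      qed (simp add: indicator_def)
    qed
    show "(\<lambda>x. sqrt 2 *\<^sub>R z x) \<in> L2" using domainD(2)[OF form_domain_scaleR[OF z]] .
  qed
  then have "sqn (\<lambda>x. indicator (- cball 0 (2 * R)) x *\<^sub>R u x) \<le> 2 * m" by (simp add: sqn_scaleR m_def)
  then have "sqn (\<lambda>x. indicator (- cball 0 (2 * R)) x *\<^sub>R u x) * D \<le> 2 * m * D"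
    using gap by (intro mult_right_mono) (auto simp: D_def)
  ultimately show ?thesis unfolding D_def by simp
qed

lemma near_minimizers_tight:
  assumes u: "\<And>n. u n \<in> sphere_states" "\<And>n. reduced_energy (u n) \<le> infimum + 1 / real (Suc n)" and e: "0 < e"
  shows "\<exists>R N. \<forall>n\<ge>N. sqn (\<lambda>x. indicator (- cball 0 R) x *\<^sub>R u n x) \<le> e"
proof -
  define D where "D = \<mu> V1 - \<mu> V"
  have D: "0 < D" using gap by (simp add: D_def)
  have "(V2 \<longlongrightarrow> 0) at_infinity" using decomposition by (simp add: decomposition_A_def)
  then have "\<exists>B. \<forall>x. norm x \<ge> B \<longrightarrow> dist (V2 x) 0 < D / 4" unfolding Lim_at_infinity using D by (metis zero_less_divide_iff zero_less_numeral)
  then obtain R0 where R0: "\<And>x. R0 \<le> norm x \<Longrightarrow> \<bar>V2 x\<bar> < D / 4" by auto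
  \<comment> \<open>Both terms of the bound 8 (\<kappa> + \<open>ims_const\<close> / R^2) of
    \<open>mass_outside\<close> are brought below \<open>s\<close>, so that it is at most 16 s \<le>
    e D; s \<le> 1 meets its side conditions.\<close>
  define s where "s = min 1 (e * D / 16)"
  have s: "0 < s" "s \<le> 1" "16 * s \<le> e * D" using e D by (auto simp: s_def)
  have c0: "0 \<le> ims_const" by (simp add: ims_const_def)
  \<comment> \<open>R \<ge> 1 gives R^2 \<ge> R, so \<open>ims_const\<close> / R^2 is at most
    \<open>s\<close>.\<close>
  define R where "R = max (max R0 1) (ims_const / s)"
  have R: "R0 \<le> R" "1 \<le> R" "ims_const / s \<le> R" by (auto simp: R_def)
  have "ims_const / R\<^sup>2 \<le> ims_const / R"
    using R(2) c0 by (intro divide_left_mono) (auto simp: power2_eq_square)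
  also have "\<dots> \<le> s" using R s by (simp add: field_simps)
  finally have cR: "ims_const / R\<^sup>2 \<le> s" .
  obtain N where N: "inverse (real (Suc N)) < s" using reals_Archimedean[OF s(1)] by auto
  have "sqn (\<lambda>x. indicator (- cball 0 (2 * R)) x *\<^sub>R u n x) \<le> e" if n: "N \<le> n" for n
  proof -
    define \<kappa> where "\<kappa> = 1 / real (Suc n)"
    have "1 / real (Suc n) \<le> 1 / real (Suc N)" using n by (intro divide_left_mono) auto
    then have \<kappa>: "\<kappa> \<le> s" using N by (simp add: \<kappa>_def inverse_eq_divide)
    have "sqn (\<lambda>x. indicator (- cball 0 (2 * R)) x *\<^sub>R u n x) * D \<le> 8 * (\<kappa> + ims_const / R\<^sup>2)"
      unfolding D_def
    proof (rule mass_outside[OF u(1)])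
      show "reduced_energy (u n) \<le> infimum + \<kappa>" using u(2)[of n] by (simp add: \<kappa>_def)
      show "\<bar>V2 x\<bar> \<le> (\<mu> V1 - \<mu> V) / 4" if "R < norm x" for x
        using R0[of x] R(1) that by (simp add: D_def)
      show "\<kappa> \<le> 1" "0 < R" "ims_const / R\<^sup>2 \<le> 1" using \<kappa> cR s(2) R(2) by linarith+
    qed
    also have "\<dots> \<le> 16 * s" using add_mono[OF \<kappa> cR] by simp
    also note s(3)
    finally show ?thesis using D by simp
  qed
  then show ?thesis by blast
qed

lemma reduced_energy_cong_AE:
  assumes u: "u \<in> sphere_states" and v: "v \<in> borel_measurable lebesgue" and ae: "AE x in lebesgue. u x = v x"
  shows "v \<in> sphere_states" "reduced_energy v = reduced_energy u"
proof -
  have ud: "u \<in> form_domain V" using u by (simp add: sphere_states_def)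
  note c = form_domain_cong_AE[OF ud v ae]
  show "v \<in> sphere_states" using c u by (simp add: sphere_states_def)
  have "rho v = rho u" using rho_cong_AE[OF domainD(4)[OF ud] v ae] by simp
  then show "reduced_energy v = reduced_energy u" using c(2) by (simp add: reduced_energy_def hart_def)
qed

text \<open>Lower semicontinuity is applied twice. With a crude bound for the coupling it first
  shows that the limit is in the form domain, which makes \<open>hart_tendsto\<close> applicable;
  with the convergence of the coupling it then gives the sharp bound.\<close>

theorem reduced_minimizer_exists: "\<exists>v\<in>sphere_states. reduced_energy v \<le> infimum"
proof -
  have "\<exists>u\<in>sphere_states. u \<in> borel_measurable borel \<and> reduced_energy u \<le> infimum + 1 / real (Suc n)" for n
  proof -
    obtain u where u: "u \<in> sphere_states" "reduced_energy u < infimum + 1 / real (Suc n)"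
      by (rule infimum_approx[of "1 / real (Suc n)"]) auto
    have um: "u \<in> borel_measurable lebesgue" using domainD(4) u(1) by (simp add: sphere_states_def)
    then obtain u' where u': "u' \<in> borel_measurable borel" "AE x in lebesgue. u x = u' x"
      using ex_borel_representative by blast
    have um': "u' \<in> borel_measurable lebesgue" by (rule borel_measurable_lebesgueI[OF u'(1)])
    note c = reduced_energy_cong_AE[OF u(1) um' u'(2)]
    have "reduced_energy u' \<le> infimum + 1 / real (Suc n)" unfolding c(2) by (rule less_imp_le[OF u(2)])
    with c(1) u'(1) show ?thesis by blast
  qed
  then obtain u where u: "\<And>n. u n \<in> sphere_states" "\<And>n. u n \<in> borel_measurable borel"
    "\<And>n. reduced_energy (u n) \<le> infimum + 1 / real (Suc n)" by metis
  have ud: "u n \<in> form_domain V" and us: "sqn (u n) = 1" for n using u(1)[of n] by (auto simp: sphere_states_def)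
  have ug: "sqn (weak_grad (u n)) \<le> gradient_bound" for n
  proof (rule sqn_weak_grad_le[OF u(1)])
    have "1 / real (Suc n) \<le> 1" by simp
    then show "reduced_energy (u n) \<le> infimum + 1" using u(3)[of n] by linarith
  qed
  have u1: "sqn (u n) \<le> 1" for n by (simp add: us)
  obtain s :: "nat \<Rightarrow> nat" where s: "strict_mono s"
    "\<And>e. e > 0 \<Longrightarrow> \<exists>N. \<forall>m\<ge>N. \<forall>n\<ge>N. sqn (\<lambda>x. u (s m) x - u (s n) x) \<le> e"
    using H1_tight_compactness[where u = u, OF domainD(10)[OF ud] u(2) u1 ug near_minimizers_tight[OF u(1,3)]] by metis
  obtain v' where v': "v' \<in> L2" "(\<lambda>n. sqn (\<lambda>x. u (s n) x - v' x)) \<longlonglongrightarrow> 0"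
    using L2_complete[OF domainD(2)[OF ud] s(2)] by blast
  \<comment> \<open>\<open>hart_tendsto\<close> is stated for Borel functions.\<close>
  obtain v where vb: "v \<in> borel_measurable borel" and ae: "AE x in lebesgue. v' x = v x"
    using ex_borel_representative[OF L2D(1)[OF v'(1)]] by blast
  have vm: "v \<in> borel_measurable lebesgue" by (rule borel_measurable_lebesgueI[OF vb])
  have v: "v \<in> L2" by (rule L2_cong_AE[OF v'(1) vm]) (use ae in \<open>auto elim!: eventually_mono\<close>)
  have "sqn (\<lambda>x. u (s n) x - v x) = sqn (\<lambda>x. u (s n) x - v' x)" for n
  proof (rule sqn_cong_AE)
    show "(\<lambda>x. u (s n) x - v x) \<in> borel_measurable lebesgue" "(\<lambda>x. u (s n) x - v' x) \<in> borel_measurable lebesgue"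
      using domainD(4)[OF ud] vm L2D(1)[OF v'(1)] by (auto intro: borel_measurable_diff)
    show "AE x in lebesgue. u (s n) x - v x = u (s n) x - v' x" using ae by eventually_elim simp
  qed
  then have lim: "(\<lambda>n. sqn (\<lambda>x. u (s n) x - v x)) \<longlonglongrightarrow> 0" using v'(2) by simp
  have "(\<lambda>n. sqn (u (s n))) \<longlonglongrightarrow> sqn v" by (rule tendsto_sqn[OF domainD(2)[OF ud] v lim])
  then have vs: "sqn v = 1" by (simp add: us LIMSEQ_const_iff)
  define r where "r n = 1 / real (Suc (s n))" for n
  have r0: "r \<longlonglongrightarrow> 0"
    using LIMSEQ_subseq_LIMSEQ[OF LIMSEQ_Suc[OF lim_1_over_n] s(1)] by (simp add: r_def[abs_def] comp_def)
  have qu: "qform V (u (s n)) \<le> infimum + r n + hart (u (s n))" for n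
    using u(3)[of "s n"] by (simp add: reduced_energy_def r_def)
  have hb: "hart (u n) \<le> M1 + A2 * gradient_bound" for n
    using hart_le[OF domainD(1)[OF ud[of n]]] mult_left_mono[OF ug[of n] A2_nonneg] us[of n] by simp
  have "qform V (u (s n)) \<le> (infimum + M1 + A2 * gradient_bound) + r n" for n
    using qu[of n] hb[of "s n"] by linarith
  then have vd: "v \<in> form_domain V"
    by (rule qform_lower_semicontinuous(1)[OF ud v lim _ r0])
  define K where "K = gradient_bound + sqn (weak_grad v) + 1"
  have K: "sqn (weak_grad (u n)) \<le> K" "sqn (weak_grad v) \<le> K" "0 < K" for n
    using ug[of n] gradient_bound_nonneg sqn_nonneg[of "weak_grad v"] unfolding K_def by linarith+
  have hl: "(\<lambda>n. hart (u (s n))) \<longlonglongrightarrow> hart v"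
    by (rule hart_tendsto[where K = K, OF domainD(10)[OF ud] u(2) domainD(10)[OF vd] vb]) (use us vs K lim in auto)
  have "(\<lambda>n. r n + (hart (u (s n)) - hart v)) \<longlonglongrightarrow> 0 + (hart v - hart v)"
    by (intro tendsto_add tendsto_diff r0 hl tendsto_const)
  then have e0: "(\<lambda>n. r n + (hart (u (s n)) - hart v)) \<longlonglongrightarrow> 0" by simp
  have "qform V (u (s n)) \<le> (infimum + hart v) + (r n + (hart (u (s n)) - hart v))" for n
    using qu[of n] by linarith
  then have "qform V v \<le> infimum + hart v"
    by (rule qform_lower_semicontinuous(2)[OF ud v lim _ e0])
  then show ?thesis using vd vs unfolding sphere_states_def reduced_energy_def by force
qed

end

theorem theorem1p2:
  shows "\<exists>C>0. \<exists>\<delta>>0. \<forall>V a b. hypothesis_A V a b \<longrightarrow>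
    (\<exists>C\<^sub>V>0. \<forall>\<omega> v g. field_data \<omega> v \<longrightarrow> hypothesis_C (field_W \<omega> v g) \<longrightarrow>
      (\<exists>V\<^sub>1 V\<^sub>2 W\<^sub>1 W\<^sub>2.
         decomposition_A V V\<^sub>1 V\<^sub>2 \<and> decomposition_C (field_W \<omega> v g) W\<^sub>1 W\<^sub>2 \<and>
         L1_norm W\<^sub>1 + C\<^sub>V * L3_weak_norm W\<^sub>2 \<le> \<delta> * (\<mu> V\<^sub>1 - \<mu> V) \<and>
         C * L3_weak_norm W\<^sub>2 \<le> 1/2 * (1 - a)) \<longrightarrow>
      (\<exists>u f. is_minimizer V \<omega> v g u f))"
proof (rule exI[of _ "2 * hartree_const"], rule conjI, goal_cases)
  case 1
  show ?case using hartree_const_pos by simp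
next
  case 2
  show ?case
  proof (rule exI[of _ "1 / 30"], intro conjI allI impI)
    fix V a b assume A: "hypothesis_A V a b"
    \<comment> \<open>Built from \<open>V\<close>, \<open>a\<close> and \<open>b\<close> alone, so
      that C_V is fixed before the decompositions in the smallness condition are given.\<close>
    define L where "L = \<mu> V + max b 0"
    define k where "k = 1 + 2 * (L + 1) / (1 - a) + 4 * L / (1 - a)"
    have V: "V \<in> borel_measurable lebesgue" "form_bounded V a b" "0 \<le> a" "a < 1"
      using A by (auto simp: hypothesis_A_def)
    \<comment> \<open>Some decomposition from the hypothesis. It supplies local integrability of
      V_+, hence a nontrivial form domain and L \<ge> 0, before the decomposition that meets the
      smallness condition is known.\<close>
    obtain U1 U2 where U: "decomposition_A V U1 U2" using A by (auto simp: hypothesis_A_def)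
    interpret particle: nontrivial_potential V a "max b 0" by (rule decomposition_potentials(1)[OF V U])
    have L: "0 \<le> L" using particle.ground_energy_ge by (simp add: L_def particle.mu_eq_ground_energy)
    have k: "0 < k" unfolding k_def using L V(4) by (intro add_pos_nonneg) auto
    show "\<exists>C\<^sub>V>0. \<forall>\<omega> v g. field_data \<omega> v \<longrightarrow> hypothesis_C (field_W \<omega> v g) \<longrightarrow>
      (\<exists>V\<^sub>1 V\<^sub>2 W\<^sub>1 W\<^sub>2.
         decomposition_A V V\<^sub>1 V\<^sub>2 \<and> decomposition_C (field_W \<omega> v g) W\<^sub>1 W\<^sub>2 \<and>
         L1_norm W\<^sub>1 + C\<^sub>V * L3_weak_norm W\<^sub>2 \<le> 1 / 30 * (\<mu> V\<^sub>1 - \<mu> V) \<and>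
         2 * hartree_const * L3_weak_norm W\<^sub>2 \<le> 1/2 * (1 - a)) \<longrightarrow>
      (\<exists>u f. is_minimizer V \<omega> v g u f)"
    \<comment> \<open>With this C_V the weak norm term of the first condition is \<open>A2\<close>
      times the bracket of \<open>small_gap\<close>.\<close>
    proof (rule exI[of _ "hartree_const * k"], intro conjI allI impI)
      show "0 < hartree_const * k" using hartree_const_pos k by simp
      fix \<omega> v g assume fd: "field_data \<omega> v"
      assume "\<exists>V\<^sub>1 V\<^sub>2 W\<^sub>1 W\<^sub>2.
         decomposition_A V V\<^sub>1 V\<^sub>2 \<and> decomposition_C (field_W \<omega> v g) W\<^sub>1 W\<^sub>2 \<and>
         L1_norm W\<^sub>1 + hartree_const * k * L3_weak_norm W\<^sub>2 \<le> 1 / 30 * (\<mu> V\<^sub>1 - \<mu> V) \<and>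
         2 * hartree_const * L3_weak_norm W\<^sub>2 \<le> 1/2 * (1 - a)"
      then obtain V1 V2 W1 W2 where d: "decomposition_A V V1 V2" "decomposition_C (field_W \<omega> v g) W1 W2"
        and s1: "L1_norm W1 + hartree_const * k * L3_weak_norm W2 \<le> 1 / 30 * (\<mu> V1 - \<mu> V)"
        and s2: "2 * hartree_const * L3_weak_norm W2 \<le> 1/2 * (1 - a)" by blast
      interpret outer: nontrivial_potential V1 0 0 by (rule decomposition_potentials(2)[OF V d(1)])
      have "field_W \<omega> v g \<in> borel_measurable lebesgue"
      proof -
        have [measurable]: "\<omega> \<in> borel_measurable lebesgue" "v \<in> borel_measurable lebesgue"
          using fd by (auto simp: field_data_def)
        show ?thesis unfolding field_W_def[abs_def] by measurable
      qed
      moreover have "0 \<le> field_W \<omega> v g x" for x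
        unfolding field_W_def using fd by (auto simp: field_data_def)
      ultimately interpret field_weight "field_W \<omega> v g" W1 W2 by unfold_locales (use d(2) in auto)
      interpret bound_state V V1 V2 a "max b 0" "field_W \<omega> v g" W1 W2
      proof
        show "decomposition_A V V1 V2" by (rule d(1))
        \<comment> \<open>The constant C is \<open>2 * hartree_const\<close> so that the second
          condition becomes this inequality.\<close>
        show "4 * A2 \<le> 1 - a" using s2 by simp
        show "M1 + A2 * (1 + 2 * (\<mu> V + max b 0 + 1) / (1 - a) + 4 * (\<mu> V + max b 0) / (1 - a)) \<le> (\<mu> V1 - \<mu> V) / 30"
          unfolding L_def[symmetric] k_def[symmetric] using s1 by (simp add: mult_ac)
      qed
      obtain u where u: "u \<in> sphere_states" "reduced_energy u \<le> infimum" using reduced_minimizer_exists by blast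
      have sphere: "w \<in> sphere_states \<longleftrightarrow> w \<in> particle_states V" for w
        unfolding sphere_states_def particle_states_def L2_norm_sqrt by simp
      have red: "reduced_energy w = qform V w - (\<integral>k. field_W \<omega> v g k * (norm (rho w k))\<^sup>2 \<partial>lebesgue)" for w
        by (simp add: reduced_energy_def hart_def)
      have H: "w \<in> L2" "integrable lebesgue (\<lambda>k. field_W \<omega> v g k * (norm (rho w k))\<^sup>2)" if "w \<in> sphere_states" for w
        using that particle.domainD(1,2) hart_integrable by (auto simp: sphere_states_def)
      obtain f where f: "f \<in> field_states \<omega>" "energy V \<omega> v g u f = reduced_energy u"
        using energy_minimal_field(2)[OF fd H[OF u(1)]] unfolding red by blast
      have "energy V \<omega> v g u f \<le> energy V \<omega> v g u' f'" if "u' \<in> sphere_states" "f' \<in> field_states \<omega>" for u' f'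
      proof -
        have "reduced_energy u' \<le> energy V \<omega> v g u' f'"
          unfolding red by (rule energy_minimal_field(1)[OF fd H[OF that(1)] that(2)])
        then show ?thesis using f(2) u(2) infimum_le[OF that(1)] by linarith
      qed
      then have "is_minimizer V \<omega> v g u f" using u(1) f(1) unfolding is_minimizer_def sphere by blast
      then show "\<exists>u f. is_minimizer V \<omega> v g u f" by blast
    qed
  qed simp
qed

end
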